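(* Let $G$ and $H$ be countable discrete sofic groups with respective sofic approximations $\Sigma=(\sigma_n:G\to\mathrm{Sym}(V_n))_{n\ge1}$ and $\mathrm T=(\tau_n:H\to\mathrm{Sym}(W_n))_{n\ge1}$, let $(X,\mu,T)$ be a $G$-system, and assume that $H$ is infinite. 1. If $(Y,\nu,S)$ is another $(G\times H)$-system such that $\mathrm h_{\Sigma\times\mathrm T}(\nu,S)=\underline{\mathrm h}_{\Sigma\times\mathrm T}(\nu,S)$, then $$\mathrm h_{\Sigma\times\mathrm T}\big(\mu^{\times H}\times\nu,\mathrm{CInd}_G^{G\times H}T\times S\big)=\mathrm h_{\Sigma\times\mathrm T}\big(\mu^{\times H},\mathrm{CInd}_G^{G\times H}T\big)+\mathrm h_{\Sigma\times\mathrm T}(\nu,S).$$ 2. If $(X,\mu,T)$ has a finite generating partition, then $$\mathrm h_{\Sigma\times\mathrm T}\big((\mu^{\times H})^{\times k},(\mathrm{CInd}_G^{G\times H}T)^{\times k}\big)=k\cdot\mathrm h_{\Sigma\times\mathrm T}\big(\mu^{\times H},\mathrm{CInd}_G^{G\times H}T\big)$$ for all $k\ge1$.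
   Context: A sofic approximation $\Sigma=(\sigma_n)_{n\ge1}$ to a countable discrete group $G$ is a sequence of nonempty finite sets $V_n$ and maps $\sigma_n:G\to\mathrm{Sym}(V_n)$, $g\mapsto\sigma_n^g$ (not necessarily homomorphisms), such that for all $g,h\in G$ the proportion of $v\in V_n$ with $\sigma_n^g(\sigma_n^h(v))=\sigma_n^{gh}(v)$ tends to $1$, and for all $g\ne e$ the proportion of $v\in V_n$ with $\sigma_n^g(v)\neq v$ tends to $1$. The product sofic approximation $\Sigma\times\mathrm T=(\sigma_n\times\tau_n)_{n\ge1}$ to $G\times H$ is given by $(\sigma_n\times\tau_n)^{(g,h)}=\sigma_n^g\times\tau_n^h\in\mathrm{Sym}(V_n\times W_n)$. A $G$-system $(X,\mu,T)$ is a standard probability space with a measurable $\mu$-preserving action $T$ of $G$. A finite generating partition is a finite measurable partition of $X$ whose translates under $T$ generate the $\sigma$-algebra modulo null sets. The co-induced $(G\times H)$-system is $(X^H,\mu^{\times H},\mathrm{CInd}_G^{G\times H}T)$, where $g\in G$ acts by $(T^g)^{\times H}$ (i.e. $T^g$ on every coordinate) and $h\in H$ acts by $(x_k)_{k\in H}\mapsto(x_{kh})_{k\in H}$. Superscript $\times k$ denotes a $k$-fold Cartesian power with the diagonal action. The following definitions are for a group $G$ with sofic approximation $\Sigma$, and are applied with $G\times H$ and $\Sigma\times\mathrm T$. A metric $G$-process $(\mathcal{X}^G,\mu,S,d)$ consists of a standard measurable space $\mathcal{X}$, a compact metric $d$ on $\mathcal X$ whose Borel $\sigma$-algebra is that of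 $\mathcal X$, the right-shift action $S^g((x_h)_{h})=(x_{hg})_{h}$, and an $S$-invariant probability measure $\mu$ on $\mathcal{X}^G$. $\mathcal{X}^G$ has the product topology from $d$, and $\mathrm{Prob}(\mathcal X^G)$ the resulting weak$^\ast$ topology. For a finite set $V$, a map $\sigma:G\to\mathrm{Sym}(V)$, $\mathbf{x}\in\mathcal{X}^V$, $v\in V$: $\Pi^\sigma_v(\mathbf{x})=(x_{\sigma^g(v)})_{g\in G}\in\mathcal{X}^G$; $P^\sigma_{\mathbf x}=\frac1{|V|}\sum_{v}\delta_{\Pi^\sigma_v(\mathbf x)}$; $\Omega(\mathcal O,\sigma)=\{\mathbf x\in\mathcal X^V: P^\sigma_{\mathbf x}\in\mathcal O\}$ for $\mathcal{O}\subseteq\mathrm{Prob}(\mathcal X^G)$; $d^{(V)}(\mathbf x,\mathbf x')=\frac1{|V|}\sum_v d(x_v,x'_v)$. $\mathrm{cov}_\delta(Z,d_Y)$ is the minimum cardinality of a $\delta$-dense subset of $Z$ (with $\log 0=-\infty$). Sofic entropy and lower sofic entropy of a metric $G$-process: $$\mathrm h_\Sigma(\mu)=\sup_{\delta>0}\inf_{\mathcal O}\limsup_{n\to\infty}\tfrac1{|V_n|}\log\mathrm{cov}_\delta(\Omega(\mathcal O,\sigma_n),d^{(V_n)}),$$ and $\underline{\mathrm h}_\Sigma(\mu)$ is defined identically with $\liminf$ in place of $\limsup$; $\mathcal O$ ranges over weak$^\ast$ neighbourhoods of $\mu$. These do not depend on $d$ and are isomorphism invariants of the underlying system. Every $G$-system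 is isomorphic to a $G$-process (via $x\mapsto(T^hx)_{h\in G}\in X^G$), and the quantities for a system are defined as those of any isomorphic metric $G$-process. A sum with a term equal to $-\infty$ is interpreted as $-\infty$. *)

theory Defs
  imports "HOL-Probability.Probability" "HOL-Algebra.Group"
begin

section \<open>Sofic approximations\<close>

text \<open>The finite sets are subsets of a type, and \<open>\<sigma> n g\<close> is only constrained on \<open>V n\<close>.\<close>

definition sofic_approximation ::
    "('g, 'm) monoid_scheme \<Rightarrow> (nat \<Rightarrow> 'v set) \<Rightarrow> (nat \<Rightarrow> 'g \<Rightarrow> 'v \<Rightarrow> 'v) \<Rightarrow> bool" where
  "sofic_approximation G V \<sigma> \<longleftrightarrow>
     (\<forall>n. finite (V n) \<and> V n \<noteq> {}) \<and>
     (\<forall>n. \<forall>g\<in>carrier G. bij_betw (\<sigma> n g) (V n) (V n)) \<and>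
     (\<forall>g\<in>carrier G. \<forall>h\<in>carrier G.
        (\<lambda>n. real (card {v \<in> V n. \<sigma> n g (\<sigma> n h v) = \<sigma> n (g \<otimes>\<^bsub>G\<^esub> h) v}) / real (card (V n)))
          \<longlonglongrightarrow> 1) \<and>
     (\<forall>g\<in>carrier G. g \<noteq> \<one>\<^bsub>G\<^esub> \<longrightarrow>
        (\<lambda>n. real (card {v \<in> V n. \<sigma> n g v \<noteq> v}) / real (card (V n))) \<longlonglongrightarrow> 1)"

definition prod_sets :: "(nat \<Rightarrow> 'v set) \<Rightarrow> (nat \<Rightarrow> 'w set) \<Rightarrow> nat \<Rightarrow> ('v \<times> 'w) set" where
  "prod_sets V W n = V n \<times> W n"

definition prod_approx ::
    "(nat \<Rightarrow> 'g \<Rightarrow> 'v \<Rightarrow> 'v) \<Rightarrow> (nat \<Rightarrow> 'h \<Rightarrow> 'w \<Rightarrow> 'w) \<Rightarrow> nat \<Rightarrow> 'g \<times> 'h \<Rightarrow> 'v \<times> 'w \<Rightarrow> 'v \<times> 'w" where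
  "prod_approx \<sigma> \<tau> n = (\<lambda>(g, h). map_prod (\<sigma> n g) (\<tau> n h))"

section \<open>Systems\<close>

definition standard_space :: "'x measure \<Rightarrow> bool" where
  "standard_space M \<longleftrightarrow>
     (\<exists>X. topspace X = space M \<and> completely_metrizable_space X \<and> separable_space X \<and>
          sets M = sigma_sets (space M) {U. openin X U})"

definition gsystem ::
    "('g, 'm) monoid_scheme \<Rightarrow> 'x measure \<Rightarrow> ('g \<Rightarrow> 'x \<Rightarrow> 'x) \<Rightarrow> bool" where
  "gsystem G M T \<longleftrightarrow>
     standard_space M \<and> prob_space M \<and>
     (\<forall>g\<in>carrier G. T g \<in> measurable M M \<and> distr M M (T g) = M) \<and>
     (\<forall>x\<in>space M. T \<one>\<^bsub>G\<^esub> x = x) \<and>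
     (\<forall>g\<in>carrier G. \<forall>h\<in>carrier G. \<forall>x\<in>space M. T (g \<otimes>\<^bsub>G\<^esub> h) x = T g (T h x))"

definition isomorphic_systems ::
    "('g, 'm) monoid_scheme \<Rightarrow> 'x measure \<Rightarrow> ('g \<Rightarrow> 'x \<Rightarrow> 'x) \<Rightarrow>
       'y measure \<Rightarrow> ('g \<Rightarrow> 'y \<Rightarrow> 'y) \<Rightarrow> bool" where
  "isomorphic_systems G M T N S \<longleftrightarrow>
     (\<exists>\<phi>\<in>measurable M N. \<exists>\<psi>\<in>measurable N M.
        distr M N \<phi> = N \<and> distr N M \<psi> = M \<and>
        (AE x in M. \<psi> (\<phi> x) = x) \<and> (AE y in N. \<phi> (\<psi> y) = y) \<and>
        (\<forall>g\<in>carrier G. AE x in M. \<phi> (T g x) = S g (\<phi> x)))"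

definition finite_generating_partition ::
    "('g, 'm) monoid_scheme \<Rightarrow> 'x measure \<Rightarrow> ('g \<Rightarrow> 'x \<Rightarrow> 'x) \<Rightarrow> 'x set set \<Rightarrow> bool" where
  "finite_generating_partition G M T \<P> \<longleftrightarrow>
     finite \<P> \<and> \<P> \<subseteq> sets M \<and> partition_on (space M) \<P> \<and>
     (\<forall>A\<in>sets M. \<exists>B\<in>sigma_sets (space M) {T g -` C \<inter> space M | g C. g \<in> carrier G \<and> C \<in> \<P>}.
        sym_diff A B \<in> null_sets M)"

definition prod_action :: "('g \<Rightarrow> 'x \<Rightarrow> 'x) \<Rightarrow> ('g \<Rightarrow> 'y \<Rightarrow> 'y) \<Rightarrow> 'g \<Rightarrow> 'x \<times> 'y \<Rightarrow> 'x \<times> 'y" where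
  "prod_action T S g = map_prod (T g) (S g)"

definition power_measure :: "'x measure \<Rightarrow> nat \<Rightarrow> (nat \<Rightarrow> 'x) measure" where
  "power_measure M k = (\<Pi>\<^sub>M i\<in>{..<k}. M)"

definition power_action :: "('g \<Rightarrow> 'x \<Rightarrow> 'x) \<Rightarrow> nat \<Rightarrow> 'g \<Rightarrow> (nat \<Rightarrow> 'x) \<Rightarrow> nat \<Rightarrow> 'x" where
  "power_action T k g x = (\<lambda>i\<in>{..<k}. T g (x i))"

definition coind_measure :: "('h, 'n) monoid_scheme \<Rightarrow> 'x measure \<Rightarrow> ('h \<Rightarrow> 'x) measure" where
  "coind_measure H M = (\<Pi>\<^sub>M k\<in>carrier H. M)"

text \<open>The actions of \<open>G\<close> and \<open>H\<close> on the power commute; \<open>(g, h)\<close> acts by their composition.\<close>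

definition coind_action ::
    "('h, 'n) monoid_scheme \<Rightarrow> ('g \<Rightarrow> 'x \<Rightarrow> 'x) \<Rightarrow> 'g \<times> 'h \<Rightarrow> ('h \<Rightarrow> 'x) \<Rightarrow> 'h \<Rightarrow> 'x" where
  "coind_action H T = (\<lambda>(g, h) x. \<lambda>k\<in>carrier H. T g (x (k \<otimes>\<^bsub>H\<^esub> h)))"

section \<open>Metric processes\<close>

text \<open>The alphabet is a measurable space \<open>A\<close>; the measure carried by \<open>A\<close> itself is irrelevant.\<close>

definition path_space :: "('g, 'm) monoid_scheme \<Rightarrow> 'x measure \<Rightarrow> ('g \<Rightarrow> 'x) measure" where
  "path_space G A = (\<Pi>\<^sub>M g\<in>carrier G. A)"

definition shift :: "('g, 'm) monoid_scheme \<Rightarrow> 'g \<Rightarrow> ('g \<Rightarrow> 'x) \<Rightarrow> 'g \<Rightarrow> 'x" where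
  "shift G g x = (\<lambda>h\<in>carrier G. x (h \<otimes>\<^bsub>G\<^esub> g))"

definition metric_process ::
    "('g, 'm) monoid_scheme \<Rightarrow> 'x measure \<Rightarrow> ('x \<Rightarrow> 'x \<Rightarrow> real) \<Rightarrow> ('g \<Rightarrow> 'x) measure \<Rightarrow> bool" where
  "metric_process G A d \<mu> \<longleftrightarrow>
     standard_space A \<and>
     Metric_space (space A) d \<and> compact_space (Metric_space.mtopology (space A) d) \<and>
     sets A = sigma_sets (space A) {U. openin (Metric_space.mtopology (space A) d) U} \<and>
     prob_space \<mu> \<and> sets \<mu> = sets (path_space G A) \<and>
     (\<forall>g\<in>carrier G. distr \<mu> \<mu> (shift G g) = \<mu>)"

definition path_topology ::
    "('g, 'm) monoid_scheme \<Rightarrow> 'x measure \<Rightarrow> ('x \<Rightarrow> 'x \<Rightarrow> real) \<Rightarrow> ('g \<Rightarrow> 'x) topology" where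
  "path_topology G A d = product_topology (\<lambda>_. Metric_space.mtopology (space A) d) (carrier G)"

definition Prob :: "('g, 'm) monoid_scheme \<Rightarrow> 'x measure \<Rightarrow> ('g \<Rightarrow> 'x) measure set" where
  "Prob G A = {\<nu>. prob_space \<nu> \<and> sets \<nu> = sets (path_space G A)}"

definition weak_star_topology ::
    "('g, 'm) monoid_scheme \<Rightarrow> 'x measure \<Rightarrow> ('x \<Rightarrow> 'x \<Rightarrow> real) \<Rightarrow> ('g \<Rightarrow> 'x) measure topology" where
  "weak_star_topology G A d = topology_generated_by
     {{\<nu> \<in> Prob G A. (\<integral>x. f x \<partial>\<nu>) \<in> U} | f U.
        continuous_map (path_topology G A d) euclideanreal f \<and> open U}"

definition weak_star_nbhds ::
    "('g, 'm) monoid_scheme \<Rightarrow> 'x measure \<Rightarrow> ('x \<Rightarrow> 'x \<Rightarrow> real) \<Rightarrow> ('g \<Rightarrow> 'x) measure \<Rightarrow>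
       ('g \<Rightarrow> 'x) measure set set" where
  "weak_star_nbhds G A d \<mu> =
     {N. N \<subseteq> Prob G A \<and> (\<exists>U. openin (weak_star_topology G A d) U \<and> \<mu> \<in> U \<and> U \<subseteq> N)}"

section \<open>Sofic entropy of metric processes\<close>

definition pullback_name ::
    "('g, 'm) monoid_scheme \<Rightarrow> ('g \<Rightarrow> 'v \<Rightarrow> 'v) \<Rightarrow> ('v \<Rightarrow> 'x) \<Rightarrow> 'v \<Rightarrow> 'g \<Rightarrow> 'x" where
  "pullback_name G s x v = (\<lambda>g\<in>carrier G. x (s g v))"

definition empirical_distr ::
    "('g, 'm) monoid_scheme \<Rightarrow> 'x measure \<Rightarrow> 'v set \<Rightarrow> ('g \<Rightarrow> 'v \<Rightarrow> 'v) \<Rightarrow> ('v \<Rightarrow> 'x) \<Rightarrow>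
       ('g \<Rightarrow> 'x) measure" where
  "empirical_distr G A V s x =
     distr (uniform_count_measure V) (path_space G A) (pullback_name G s x)"

definition good_models ::
    "('g, 'm) monoid_scheme \<Rightarrow> 'x measure \<Rightarrow> ('g \<Rightarrow> 'x) measure set \<Rightarrow> 'v set \<Rightarrow>
       ('g \<Rightarrow> 'v \<Rightarrow> 'v) \<Rightarrow> ('v \<Rightarrow> 'x) set" where
  "good_models G A N V s = {x \<in> V \<rightarrow>\<^sub>E space A. empirical_distr G A V s x \<in> N}"

definition hamming_metric ::
    "('x \<Rightarrow> 'x \<Rightarrow> real) \<Rightarrow> 'v set \<Rightarrow> ('v \<Rightarrow> 'x) \<Rightarrow> ('v \<Rightarrow> 'x) \<Rightarrow> real" where
  "hamming_metric d V x x' = (\<Sum>v\<in>V. d (x v) (x' v)) / real (card V)"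

text \<open>
  The minimum is only used for totally bounded \<open>Z\<close>, where a finite dense subset exists.
\<close>

definition cov :: "real \<Rightarrow> 'z set \<Rightarrow> ('z \<Rightarrow> 'z \<Rightarrow> real) \<Rightarrow> nat" where
  "cov \<delta> Z D = (LEAST m. \<exists>F\<subseteq>Z. finite F \<and> card F = m \<and> (\<forall>z\<in>Z. \<exists>y\<in>F. D z y < \<delta>))"

definition log_nat :: "nat \<Rightarrow> ereal" where
  "log_nat m = (if m = 0 then -\<infinity> else ereal (ln (real m)))"

definition process_entropy_wrt ::
    "((nat \<Rightarrow> ereal) \<Rightarrow> ereal) \<Rightarrow> ('g, 'm) monoid_scheme \<Rightarrow> (nat \<Rightarrow> 'v set) \<Rightarrow>
       (nat \<Rightarrow> 'g \<Rightarrow> 'v \<Rightarrow> 'v) \<Rightarrow> 'x measure \<Rightarrow> ('x \<Rightarrow> 'x \<Rightarrow> real) \<Rightarrow> ('g \<Rightarrow> 'x) measure \<Rightarrow> ereal" where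
  "process_entropy_wrt L G V \<sigma> A d \<mu> =
     (SUP \<delta>\<in>{0<..}. INF N\<in>weak_star_nbhds G A d \<mu>.
        L (\<lambda>n. log_nat (cov \<delta> (good_models G A N (V n) (\<sigma> n)) (hamming_metric d (V n)))
                  / ereal (real (card (V n)))))"

definition process_entropy ::
    "('g, 'm) monoid_scheme \<Rightarrow> (nat \<Rightarrow> 'v set) \<Rightarrow> (nat \<Rightarrow> 'g \<Rightarrow> 'v \<Rightarrow> 'v) \<Rightarrow>
       'x measure \<Rightarrow> ('x \<Rightarrow> 'x \<Rightarrow> real) \<Rightarrow> ('g \<Rightarrow> 'x) measure \<Rightarrow> ereal" where
  "process_entropy = process_entropy_wrt limsup"

definition lower_process_entropy ::
    "('g, 'm) monoid_scheme \<Rightarrow> (nat \<Rightarrow> 'v set) \<Rightarrow> (nat \<Rightarrow> 'g \<Rightarrow> 'v \<Rightarrow> 'v) \<Rightarrow>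
       'x measure \<Rightarrow> ('x \<Rightarrow> 'x \<Rightarrow> real) \<Rightarrow> ('g \<Rightarrow> 'x) measure \<Rightarrow> ereal" where
  "lower_process_entropy = process_entropy_wrt liminf"

section \<open>Sofic entropy of systems\<close>

text \<open>
  A definition cannot quantify over types, so the alphabet of a metric process isomorphic to a
  system on type \<open>'x\<close> is taken inside \<open>'x\<close>. This always suffices: the orbit map
  \<open>x \<mapsto> (T h x)\<^sub>h\<close> gives an isomorphic process whose alphabet is the underlying space itself.
  By isomorphism invariance the chosen process does not affect the entropies.
\<close>

definition is_metric_model ::
    "('g, 'm) monoid_scheme \<Rightarrow> 'x measure \<Rightarrow> ('g \<Rightarrow> 'x \<Rightarrow> 'x) \<Rightarrow>
       'x measure \<times> ('x \<Rightarrow> 'x \<Rightarrow> real) \<times> ('g \<Rightarrow> 'x) measure \<Rightarrow> bool" where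
  "is_metric_model G M T =
     (\<lambda>(A, d, \<mu>). metric_process G A d \<mu> \<and> isomorphic_systems G M T \<mu> (shift G))"

definition metric_model ::
    "('g, 'm) monoid_scheme \<Rightarrow> 'x measure \<Rightarrow> ('g \<Rightarrow> 'x \<Rightarrow> 'x) \<Rightarrow>
       'x measure \<times> ('x \<Rightarrow> 'x \<Rightarrow> real) \<times> ('g \<Rightarrow> 'x) measure" where
  "metric_model G M T = (SOME P. is_metric_model G M T P)"

definition sofic_entropy ::
    "('g, 'm) monoid_scheme \<Rightarrow> (nat \<Rightarrow> 'v set) \<Rightarrow> (nat \<Rightarrow> 'g \<Rightarrow> 'v \<Rightarrow> 'v) \<Rightarrow>
       'x measure \<Rightarrow> ('g \<Rightarrow> 'x \<Rightarrow> 'x) \<Rightarrow> ereal" where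
  "sofic_entropy G V \<sigma> M T = (case metric_model G M T of (A, d, \<mu>) \<Rightarrow> process_entropy G V \<sigma> A d \<mu>)"

definition lower_sofic_entropy ::
    "('g, 'm) monoid_scheme \<Rightarrow> (nat \<Rightarrow> 'v set) \<Rightarrow> (nat \<Rightarrow> 'g \<Rightarrow> 'v \<Rightarrow> 'v) \<Rightarrow>
       'x measure \<Rightarrow> ('g \<Rightarrow> 'x \<Rightarrow> 'x) \<Rightarrow> ereal" where
  "lower_sofic_entropy G V \<sigma> M T =
     (case metric_model G M T of (A, d, \<mu>) \<Rightarrow> lower_process_entropy G V \<sigma> A d \<mu>)"

text \<open>On \<open>ereal\<close> the library has \<open>\<infinity> + -\<infinity> = \<infinity>\<close>, whereas here \<open>-\<infinity>\<close> is absorbing.\<close>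

definition entropy_add :: "ereal \<Rightarrow> ereal \<Rightarrow> ereal" where
  "entropy_add a b = (if a = -\<infinity> \<or> b = -\<infinity> then -\<infinity> else a + b)"

end

theory Submission
  imports Defs "HOL-Combinatorics.Permutations"
begin

text \<open>
The entropy of a system is first freed from topology. A good model is a labelling of the finite set
whose empirical averages of finitely many Lipschitz functions of finitely many coordinates are close to
their integrals, so one may work with any measurable observable into a totally bounded metric space.
Any two observables that generate the same system give the same entropy (\<open>entropy_generating_eq\<close>),
and every system on a standard space has a metric model (\<open>metric_model_exists\<close>); hence the entropy
of a system is that of an arbitrary generating observable (\<open>system_entropy_observable\<close>). For
products, powers and co-induced systems the obvious observables built from coordinates generate.

The subadditivity of the entropy under products is a count of dense sets. The point is the converse.
Let \<open>x\<close> be a good model of the co-induced system and \<open>z\<close> a good model of a second system, both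
on \<open>V n \<times> W n\<close>. The pair \<open>(x, z)\<close> need not be a good model of the product. But the
co-induced system is, as a process over \<open>H\<close>, independent and identically distributed in its columns,
each column being a copy of the given system. So permute the columns of \<open>x\<close> by a permutation of
\<open>W n\<close>: after a uniformly random permutation the finitely many columns seen from a point are almost
independent samples from the columns of \<open>x\<close>, whatever \<open>z\<close> does, and the averages of a test function
over the pair concentrate near the averages over \<open>z\<close> of its conditional integral
(\<open>permuted_average_variance\<close>, \<open>permutation_almost_good\<close>). Since \<open>H\<close> is infinite,
\<open>W n\<close> grows, and distinct group elements move most points to distinct columns; this is what makes
both the sampling error and the variance small. Permuting columns is an isometry for the Hamming metric.
Hence for each \<open>z\<close> one permutation turns at least half of a separated set of models \<open>x\<close> into
models \<open>(x \<circ> permutation, z)\<close> of the product, and the product of the two separation numbers is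
at most twice that of the product system, at the same index \<open>n\<close> (\<open>product_lower\<close>).

For the product formula the factor 2 vanishes in the exponential rate, and agreement of the upper and
lower limits for the second system lets the limsup of the sum split. For powers all factors are counted
at the same \<open>n\<close>, so induction on the number of factors gives the formula for the limsup itself.
\<close>

abbreviation ext_funcset :: "'i set => 'a set => ('i => 'a) set" (infixr "~>" 60)
 where "D ~> S == D \<rightarrow>\<^sub>E S"

abbreviation hm :: "('x => 'x => real) => 'v set => ('v => 'x) => ('v => 'x) => real"
 where "hm == hamming_metric"

abbreviation eventually_seq :: "(nat => bool) => bool" (binder "EV " 10)
 where "eventually_seq P == eventually P sequentially"

section \<open>Lipschitz functions of finitely many coordinates\<close>

definition tbm :: "'a set => ('a => 'a => real) => bool" where
 "tbm S d \<longleftrightarrow> Metric_space S d &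
   (ALL r>0. \<exists>K\<subseteq>S. finite K & (ALL x:S. EX y:K. d x y < r))"

definition lip_on ::
  "'i set => 'a set => ('a => 'a => real) => 'i set => real => (('i => 'a) => real) => bool" where
 "lip_on D S d E C f \<longleftrightarrow> finite E & E <= D & 0 <= C &
   (ALL a:D ~> S. ALL b:D ~> S. \<bar>f a - f b\<bar> <= C * (SUM i:E. d (a i) (b i)))"

text \<open>Local functions: Lipschitz in finitely many coordinates. They replace continuous functions in the
weak-star topology because, unlike these, they make sense for labels in a totally bounded space.\<close>

definition loc :: "'i set => 'a set => ('a => 'a => real) => (('i => 'a) => real) set" where
 "loc D S d = {f. EX E C. lip_on D S d E C f}"

lemma tbm_metric: "tbm S d ==> Metric_space S d" by (simp add: tbm_def)

lemma tbm_nonneg: "tbm S d ==> 0 <= d x y" by (rule Metric_space.nonneg[OF tbm_metric])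

lemma tbm_sym: "tbm S d ==> d x y = d y x" by (rule Metric_space.commute[OF tbm_metric])

lemma tbm_zero: "tbm S d ==> x : S ==> d x x = 0" by (simp add: Metric_space.zero[OF tbm_metric])

lemma tbm_tri: "tbm S d ==> x : S ==> y : S ==> z : S ==> d x z <= d x y + d y z"
 by (rule Metric_space.triangle[OF tbm_metric])

lemma tbm_reverse_tri:
 assumes "tbm S d" "x : S" "y : S" "z : S"
 shows "\<bar>d x z - d y z\<bar> <= d x y"
 using tbm_tri[OF assms(1), of x y z] tbm_tri[OF assms(1), of y x z] tbm_sym[OF assms(1), of x y] assms by auto

lemma tbm_net:
 assumes "tbm S d" "0 < r"
 obtains K where "K <= S" "finite K" "!!x. x : S ==> EX y:K. d x y < r" using assms unfolding tbm_def by meson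

lemma tbm_bounded:
 assumes "tbm S d"
 obtains R where "0 < R" "!!x y. x : S ==> y : S ==> d x y <= R"
proof -
 obtain K where K: "K <= S" "finite K" "!!x. x : S ==> EX y:K. d x y < 1" using tbm_net[OF assms, of 1] by auto
 define R where "R = 2 + (SUM x:K. SUM y:K. d x y)"
 have "d x y <= R" if xy: "x : S" "y : S" for x y
 proof -
  obtain a where a: "a : K" "d x a < 1" using K xy by blast
  obtain b where b: "b : K" "d y b < 1" using K xy by blast
  have "d a b <= (SUM y:K. d a y)" using b K by (intro member_le_sum) (auto simp: tbm_nonneg[OF assms])
  also have "... <= (SUM x:K. SUM y:K. d x y)" using a K by (intro member_le_sum[of a K "%a. SUM y:K. d a y"])
     (auto intro!: sum_nonneg simp: tbm_nonneg[OF assms])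
  finally have "d a b <= R - 2" by (simp add: R_def)
  moreover have "d x y <= d x a + d a y" "d a y <= d a b + d b y" using a b K xy by (auto intro!: tbm_tri[OF assms])
  ultimately show ?thesis using a b tbm_sym[OF assms, of b y] by linarith
 qed
 moreover have "0 < R" unfolding R_def by (intro add_pos_nonneg sum_nonneg) (auto simp: tbm_nonneg[OF assms])
 ultimately show ?thesis using that by blast
qed

lemma path_net:
 assumes "tbm S d" "finite E" "E <= D" "0 < r"
 obtains Q where "finite Q" "Q <= D ~> S"
  "!!a. a : D ~> S ==> EX q:Q. ALL i:E. d (a i) (q i) < r"
proof (cases "D ~> S = {}")
 case True
 thus ?thesis using that[of "{}"] by auto
next
 case False
 then obtain z where z: "z : D ~> S" by blast
 obtain K where K: "K <= S" "finite K" "!!x. x : S ==> EX y:K. d x y < r" by (rule tbm_net[OF assms(1,4)]) auto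
 define Q where "Q = (%c i. if i : E then c i else z i) ` (E ~> K)"
 have "finite Q" unfolding Q_def using assms K by (intro finite_imageI finite_PiE) auto
 moreover have "Q <= D ~> S" using z K assms by (fastforce simp: Q_def PiE_iff extensional_def)
 moreover have "EX q:Q. ALL i:E. d (a i) (q i) < r" if a: "a : D ~> S" for a
 proof -
  have "ALL i:E. EX y:K. d (a i) y < r" using a K assms by (auto simp: PiE_iff)
  then obtain c where c: "!!i. i : E ==> c i : K & d (a i) (c i) < r" by metis
  hence "restrict c E : E ~> K" by auto
  hence "(%i. if i : E then restrict c E i else z i) : Q" unfolding Q_def by blast
  thus ?thesis using c by (intro bexI) auto
 qed
 ultimately show ?thesis using that by blast
qed

lemma lip_onD:
 "lip_on D S d E C f ==> a : D ~> S ==> b : D ~> S ==> \<bar>f a - f b\<bar> <= C * (SUM i:E. d (a i) (b i))"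
 by (simp add: lip_on_def)

lemma lip_on_mono:
 assumes "tbm S d" "lip_on D S d E C f" "E <= E'" "finite E'" "E' <= D" "C <= C'"
 shows "lip_on D S d E' C' f" unfolding lip_on_def
proof (intro conjI ballI)
 show "0 <= C'" using assms by (simp add: lip_on_def)
 fix a b assume ab: "a : D ~> S" "b : D ~> S"
 have "\<bar>f a - f b\<bar> <= C * (SUM i:E. d (a i) (b i))" using assms(2) ab by (rule lip_onD)
 also have "... <= C' * (SUM i:E'. d (a i) (b i))"
  using assms(2,6,4,3) by (intro mult_mono sum_mono2 sum_nonneg) (auto simp: lip_on_def tbm_nonneg[OF assms(1)])
 finally show "\<bar>f a - f b\<bar> <= C' * (SUM i:E'. d (a i) (b i))" .
qed (use assms in auto)

lemma loc_common:
 assumes "tbm S d" "finite F" "F <= loc D S d"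
 obtains E C where "finite E" "E <= D" "0 < C" "!!f. f : F ==> lip_on D S d E C f" using assms(2,3)
proof (induction F arbitrary: thesis rule: finite_induct)
 case empty
 show ?case by (rule empty(1)[of "{}" 1]) auto
next
 case (insert f F)
 obtain E C where EC: "finite E" "E <= D" "0 < C" "!!f. f : F ==> lip_on D S d E C f"
  by (rule insert.IH) (use insert.prems in auto)
 obtain E' C' where f: "lip_on D S d E' C' f" using insert.prems by (auto simp: loc_def)
 hence E': "finite E'" "E' <= D" by (auto simp: lip_on_def)
 have "lip_on D S d (E Un E') (max C C') g" if "g : insert f F" for g
 proof (cases "g = f")
  case True
  thus ?thesis using EC E' by (auto intro!: lip_on_mono[OF assms(1) f])
 next
  case False
  hence "lip_on D S d E C g" using EC that by auto
  from lip_on_mono[OF assms(1) this] show ?thesis using EC E' by auto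
 qed
 thus ?case using EC E' by (intro insert.prems(1)[of "E Un E'" "max C C'"]) auto
qed

lemma loc_pair:
 assumes "tbm S d" "f : loc D S d" "g : loc D S d"
 obtains E C where "lip_on D S d E C f" "lip_on D S d E C g"
proof -
 obtain E C where "!!h. h : {f, g} ==> lip_on D S d E C h"
  by (rule loc_common[OF assms(1), of "{f, g}" D]) (use assms in auto)
 thus ?thesis using that[of E C] by auto
qed

lemma locI: "lip_on D S d E C f ==> f : loc D S d" by (auto simp: loc_def)

lemma loc_bounded:
 assumes "tbm S d" "f : loc D S d"
 obtains B where "0 < B" "!!a. a : D ~> S ==> \<bar>f a\<bar> <= B"
proof (cases "D ~> S = {}")
 case True
 thus ?thesis using that[of 1] by auto
next
 case False
 then obtain z where z: "z : D ~> S" by blast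
 obtain E C where EC: "lip_on D S d E C f" using assms by (auto simp: loc_def)
 obtain R where R: "0 < R" "!!x y. x : S ==> y : S ==> d x y <= R" by (rule tbm_bounded[OF assms(1)]) auto
 have "\<bar>f a\<bar> <= \<bar>f z\<bar> + C * (SUM i:E. R) + 1" if a: "a : D ~> S" for a
 proof -
  have "\<bar>f a - f z\<bar> <= C * (SUM i:E. d (a i) (z i))" using EC a z by (rule lip_onD)
  also have "... <= C * (SUM i:E. R)"
   using EC a z R by (intro mult_left_mono sum_mono) (auto simp: lip_on_def PiE_iff subset_iff)
  finally show ?thesis by linarith
 qed
 moreover have "0 < \<bar>f z\<bar> + C * (SUM i:E. R) + 1"
  using EC R by (intro add_nonneg_pos add_nonneg_nonneg mult_nonneg_nonneg sum_nonneg) (auto simp: lip_on_def)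
 ultimately show ?thesis using that by blast
qed

lemma loc_const: "(%_. c) : loc D S d" by (rule locI[of D S d "{}" 0]) (auto simp: lip_on_def)

lemma loc_combine:
 assumes "tbm S d" "f : loc D S d" "g : loc D S d" "0 <= K"
  and "!!a b. a : D ~> S ==> b : D ~> S ==> \<bar>h a - h b\<bar> <= K * (\<bar>f a - f b\<bar> + \<bar>g a - g b\<bar>)"
 shows "h : loc D S d"
proof -
 obtain E C where f: "lip_on D S d E C f" and g: "lip_on D S d E C g" by (rule loc_pair[OF assms(1-3)])
 have "lip_on D S d E (K * (2 * C)) h" unfolding lip_on_def
 proof (intro conjI ballI)
  fix a b assume ab: "a : D ~> S" "b : D ~> S"
  have "\<bar>h a - h b\<bar> <= K * (\<bar>f a - f b\<bar> + \<bar>g a - g b\<bar>)" by (rule assms(5)[OF ab])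
  also have "... <= K * (C * (SUM i:E. d (a i) (b i)) + C * (SUM i:E. d (a i) (b i)))"
   by (intro mult_left_mono add_mono lip_onD[OF f ab] lip_onD[OF g ab] assms)
  finally show "\<bar>h a - h b\<bar> <= K * (2 * C) * (SUM i:E. d (a i) (b i))" by (simp add: algebra_simps)
 qed (use f assms in \<open>auto simp: lip_on_def\<close>)
 thus ?thesis by (rule locI)
qed

lemma loc_add: "tbm S d ==> f : loc D S d ==> g : loc D S d ==> (%a. f a + g a) : loc D S d"
 by (rule loc_combine[of S d f D g 1]) auto

lemma loc_diff: "tbm S d ==> f : loc D S d ==> g : loc D S d ==> (%a. f a - g a) : loc D S d"
 by (rule loc_combine[of S d f D g 1]) auto

lemma loc_max: "tbm S d ==> f : loc D S d ==> g : loc D S d ==> (%a. max (f a) (g a)) : loc D S d"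
 by (rule loc_combine[of S d f D g 1]) auto

lemma loc_abs: "tbm S d ==> f : loc D S d ==> (%a. \<bar>f a\<bar>) : loc D S d"
 by (rule loc_combine[of S d f D f 1]) (auto simp: abs_if)

lemma loc_scale: "tbm S d ==> f : loc D S d ==> (%a. c * f a) : loc D S d"
 by (rule loc_combine[of S d f D f "\<bar>c\<bar>"]) (auto simp: abs_mult simp flip: right_diff_distrib intro!: mult_left_mono)

lemma loc_sum:
 assumes "tbm S d" "!!j. j : J ==> f j : loc D S d"
 shows "(%a. SUM j:J. f j a) : loc D S d"
proof (cases "finite J")
 case True
 from this assms(2) show ?thesis by (induction J rule: finite_induct) (auto intro!: loc_const loc_add[OF assms(1)])
qed (auto intro: loc_const)

lemma loc_coord:
 assumes "i : D" "0 <= C" "!!x y. x : S ==> y : S ==> \<bar>u x - u y\<bar> <= C * d x y"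
 shows "(%a. u (a i)) : loc D S d"
 by (rule locI[of D S d "{i}" C]) (use assms in \<open>auto simp: lip_on_def PiE_iff\<close>)

lemma lip_on_cINF:
 assumes "I ~= {}" "!!i. i : I ==> lip_on D S d E C (F i)"
  and bdd: "!!a i. a : D ~> S ==> i : I ==> L <= F i a"
 shows "lip_on D S d E C (%a. INF i\<in>I. F i a)" unfolding lip_on_def
proof (intro conjI ballI)
 obtain i0 where i0: "i0 : I" using assms by blast
 hence l: "lip_on D S d E C (F i0)" using assms by blast
 thus "finite E" "E <= D" "0 <= C" by (auto simp: lip_on_def)
 have le: "(INF i\<in>I. F i a) <= (INF i\<in>I. F i b) + C * (SUM i:E. d (a i) (b i))"
  if ab: "a : D ~> S" "b : D ~> S" for a b
 proof -
  have "(INF i\<in>I. F i a) - C * (SUM i:E. d (a i) (b i)) <= (INF i\<in>I. F i b)"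
  proof (rule cINF_greatest[OF assms(1)])
   fix i assume i: "i : I"
   have "(INF i\<in>I. F i a) <= F i a" using bdd[OF ab(1)] i by (intro cINF_lower bdd_belowI2[of _ L]) auto
   thus "(INF i\<in>I. F i a) - C * (SUM i:E. d (a i) (b i)) <= F i b" using lip_onD[OF assms(2)[OF i] ab] by linarith
  qed
  thus ?thesis by linarith
 qed
 fix a b assume ab: "a : D ~> S" "b : D ~> S"


 have le': "(INF i\<in>I. F i b) <= (INF i\<in>I. F i a) + C * (SUM i:E. d (a i) (b i))"
 proof -
  have "(INF i\<in>I. F i b) - C * (SUM i:E. d (a i) (b i)) <= (INF i\<in>I. F i a)"
  proof (rule cINF_greatest[OF assms(1)])
   fix i assume i: "i : I"
   have "(INF i\<in>I. F i b) <= F i b" using bdd[OF ab(2)] i by (intro cINF_lower bdd_belowI2[of _ L]) auto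
   thus "(INF i\<in>I. F i b) - C * (SUM i:E. d (a i) (b i)) <= F i a" using lip_onD[OF assms(2)[OF i] ab] by linarith
  qed
  thus ?thesis by linarith
 qed
 show "\<bar>(INF i\<in>I. F i a) - (INF i\<in>I. F i b)\<bar> <= C * (SUM i:E. d (a i) (b i))"
  using le[OF ab] le' by linarith
qed

text \<open>A local function is an infimum of functions of distances to a countable dense set of labels, so
measurability of all distances to fixed labels suffices; no sigma-algebra on the labels is needed.\<close>

lemma loc_measurable:
 assumes tb: "tbm S d" and f: "f : loc D S d"
  and P: "!!x. x : space M ==> P x : D ~> S"
  and meas: "!!i c. i : D ==> c : S ==> (%x. d (P x i) c) : borel_measurable M"
 shows "(%x. f (P x)) : borel_measurable M"
proof (cases "space M = {}")
 case True
 thus ?thesis by (auto simp: measurable_def)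
next
 case False
 hence ne: "D ~> S ~= {}" using P by blast
 obtain E C where EC: "lip_on D S d E C f" using f by (auto simp: loc_def)
 hence E: "finite E" "E <= D" "0 <= C" by (auto simp: lip_on_def)
 have "ALL m. EX Q. finite Q & Q <= D ~> S & (ALL a:D ~> S. EX q:Q. ALL i:E. d (a i) (q i) < 1 / real (Suc m))"
 proof
  fix m :: nat
  have "0 < 1 / real (Suc m)" by simp
  then obtain Q where "finite Q" "Q <= D ~> S"
   "!!a. a : D ~> S ==> EX q:Q. ALL i:E. d (a i) (q i) < 1 / real (Suc m)" by (rule path_net[OF tb E(1,2)]) auto
  thus "EX Q. finite Q & Q <= D ~> S & (ALL a:D ~> S. EX q:Q. ALL i:E. d (a i) (q i) < 1 / real (Suc m))"
   by (intro exI[of _ Q]) auto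
 qed
 then obtain Q where Qa: "ALL m. finite (Q m) & Q m <= D ~> S & (ALL a:D ~> S. EX q:Q m. ALL i:E. d (a i) (q i) < 1 / real (Suc m))"
  by (rule choice[THEN exE])
 hence Q: "!!m. finite (Q m)" "!!m. Q m <= D ~> S"
  "!!m a. a : D ~> S ==> EX q:Q m. ALL i:E. d (a i) (q i) < 1 / real (Suc m)" by auto
 define U where "U = (UN m. Q m)"
 have U: "countable U" "U <= D ~> S" using Q by (auto simp: U_def intro: countable_finite)
 have Une: "U ~= {}" using ne Q(3)[of _ 0] by (auto simp: U_def)
 have lower: "f a <= f q + C * (SUM i:E. d (a i) (q i))" if "a : D ~> S" "q : U" for a q
  using lip_onD[OF EC, of a q] that U by (auto simp: abs_le_iff)
 have eq: "f a = (INF q\<in>U. f q + C * (SUM i:E. d (a i) (q i)))" if a: "a : D ~> S" for a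
 proof (rule antisym)
  show "f a <= (INF q\<in>U. f q + C * (SUM i:E. d (a i) (q i)))" using lower[OF a] Une by (intro cINF_greatest) auto
  show "(INF q\<in>U. f q + C * (SUM i:E. d (a i) (q i))) <= f a"
  proof (rule field_le_epsilon)
   fix e :: real assume e: "0 < e"
   define K where "K = 2 * C * real (card E) + 1"
   have K: "0 < K" using E by (simp add: K_def add_nonneg_pos)
   obtain m where m: "1 / real (Suc m) < e / K" using e K nat_approx_posE[of "e / K"] by (metis divide_pos_pos)
   obtain q where q: "q : Q m" "!!i. i : E ==> d (a i) (q i) < 1 / real (Suc m)" using Q(3)[OF a] by blast
   have qU: "q : U" using q by (auto simp: U_def)
   have s: "(SUM i:E. d (a i) (q i)) <= real (card E) * (e / K)"
    using q m sum_mono[of E "%i. d (a i) (q i)" "%i. e / K"] by fastforce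
   have "(INF q\<in>U. f q + C * (SUM i:E. d (a i) (q i))) <= f q + C * (SUM i:E. d (a i) (q i))"
    using lower[OF a] qU by (intro cINF_lower bdd_belowI2[of _ "f a"]) auto
   also have "f q <= f a + C * (SUM i:E. d (a i) (q i))" using lip_onD[OF EC, of a q] a qU U by (auto simp: abs_le_iff)
   finally have "(INF q\<in>U. f q + C * (SUM i:E. d (a i) (q i))) <= f a + 2 * C * (SUM i:E. d (a i) (q i))" by simp
   also have "... <= f a + 2 * C * (real (card E) * (e / K))" using s E by (intro add_left_mono mult_left_mono) auto
   also have "... = f a + (2 * C * real (card E) / K) * e" by simp
   also have "... <= f a + 1 * e" using e K by (intro add_left_mono mult_right_mono) (auto simp: K_def)
   finally show "(INF q\<in>U. f q + C * (SUM i:E. d (a i) (q i))) <= f a + e" by simp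
  qed
 qed
 have "(%x. INF q\<in>U. f q + C * (SUM i:E. d (P x i) (q i))) : borel_measurable M"
 proof (rule borel_measurable_cINF[OF U(1)])
  fix q assume "q : U"
  hence "!!i. i : E ==> (%x. d (P x i) (q i)) : borel_measurable M" using U E by (intro meas) (auto simp: PiE_iff subset_iff)
  thus "(%x. f q + C * (SUM i:E. d (P x i) (q i))) : borel_measurable M" by simp
 next
  fix x assume "x : space M"
  thus "bdd_below ((%q. f q + C * (SUM i:E. d (P x i) (q i))) ` U)" using lower P by (intro bdd_belowI2[of _ "f (P x)"]) auto
 qed
 thus ?thesis using eq P by (subst measurable_cong[of M _ "%x. INF q\<in>U. f q + C * (SUM i:E. d (P x i) (q i))"]) auto
qed

section \<open>Covering numbers and entropy by Lipschitz tests\<close>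

definition sep_set :: "real => ('z => 'z => real) => 'z set => bool" where
 "sep_set dl D F \<longleftrightarrow> (ALL x:F. ALL y:F. x ~= y --> dl <= D x y)"

lemma hamming_nonneg: "tbm S d ==> 0 <= hm d V x y" by (simp add: hamming_metric_def sum_nonneg tbm_nonneg[of S d])

lemma hamming_sym: "tbm S d ==> hm d V x y = hm d V y x" unfolding hamming_metric_def by (simp add: tbm_sym[of S d])

lemma hamming_zero: "tbm S d ==> x : V ~> S ==> hm d V x x = 0" unfolding hamming_metric_def by (simp add: tbm_zero PiE_iff)

lemma hamming_tri:
 assumes "tbm S d" "x : V ~> S" "y : V ~> S" "z : V ~> S"
 shows "hm d V x z <= hm d V x y + hm d V y z"
proof -
 have "(SUM v:V. d (x v) (z v)) <= (SUM v:V. d (x v) (y v) + d (y v) (z v))"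
  using assms(2-4) by (intro sum_mono tbm_tri[OF assms(1)]) (auto simp: PiE_iff)
 thus ?thesis unfolding hamming_metric_def by (simp add: sum.distrib divide_right_mono flip: add_divide_distrib)
qed

lemma sep_set_finite:
 assumes tb: "tbm S d" and V: "finite V" "V ~= {}" and "0 < dl"
 obtains B where "!!F. F <= V ~> S ==> sep_set dl (hm d V) F ==> finite F & card F <= B"
proof -
 have "0 < dl / 2" using assms by simp
 then obtain Q where Q: "finite Q" "Q <= V ~> S"
  "!!a. a : V ~> S ==> EX q:Q. ALL i:V. d (a i) (q i) < dl / 2" by (rule path_net[OF tb V(1) subset_refl]) auto
 have near: "EX q:Q. hm d V a q < dl / 2" if a: "a : V ~> S" for a
 proof -
  obtain q where q: "q : Q" "ALL i:V. d (a i) (q i) < dl / 2" using Q(3)[OF a] by auto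
  have "(SUM v:V. d (a v) (q v)) < (SUM v:V. dl / 2)" using q V by (intro sum_strict_mono) auto
  hence "hm d V a q < dl / 2" using V by (simp add: hamming_metric_def field_simps card_gt_0_iff)
  with q show ?thesis by blast
 qed
 have "finite F & card F <= card Q" if F: "F <= V ~> S" "sep_set dl (hm d V) F" for F
 proof -
  have "ALL a:F. EX q. q : Q & hm d V a q < dl / 2" using near F by blast
  then obtain h where h: "ALL a:F. h a : Q & hm d V a (h a) < dl / 2" by (rule bchoice[THEN exE])
  have "inj_on h F"
  proof (rule inj_onI, rule ccontr)
   fix a b assume ab: "a : F" "b : F" "h a = h b" "a ~= b"
   have "hm d V a b <= hm d V a (h a) + hm d V (h a) b"
     using subsetD[OF F(1) ab(1)] subsetD[OF F(1) ab(2)] subsetD[OF Q(2), of "h a"] h ab by (intro hamming_tri[OF tb]) auto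
   also have "... < dl" using h ab hamming_sym[OF tb, of V "h a" b] by (smt (verit) field_sum_of_halves)
   finally show False using F(2) ab unfolding sep_set_def by (meson not_less)
  qed
  thus ?thesis using h Q(1) by (auto intro!: card_inj_on_le[of h F Q] intro: inj_on_finite[of h F Q])
 qed
 thus ?thesis using that[of "card Q"] by auto
qed

lemma max_sep:
 assumes tb: "tbm S d" and V: "finite V" "V ~= {}" and "0 < dl" and Z: "Z <= V ~> S"
 obtains F where "F <= Z" "finite F" "sep_set dl (hm d V) F"
  "ALL z:Z. EX y:F. hm d V z y < dl"
proof -
 let ?D = "hm d V"
 let ?P = "%F. F <= Z & sep_set dl ?D F"
 obtain B where B: "!!F. F <= V ~> S ==> sep_set dl ?D F ==> finite F & card F <= B"
  by (rule sep_set_finite[OF tb V \<open>0 < dl\<close>]) auto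
 have "?P {}" by (auto simp: sep_set_def)
 moreover have "ALL F. ?P F --> card F < Suc B" using B Z by (auto simp: less_Suc_eq_le)
 ultimately obtain F where F: "?P F" "!!F'. ?P F' ==> card F' <= card F"
  using ex_has_greatest_nat[of ?P "{}" card "Suc B"] by auto
 have fin: "finite F" using F(1) B Z by auto
 have "EX y:F. ?D z y < dl" if z: "z : Z" for z
 proof (rule ccontr)
  assume *: "~ (EX y:F. ?D z y < dl)"
  hence "z ~: F" using hamming_zero[OF tb subsetD[OF Z z]] \<open>0 < dl\<close> by auto
  have far: "dl <= ?D z y" "dl <= ?D y z" if "y : F" for y using * that hamming_sym[OF tb, of V y z] by (auto simp: not_less)
  have "?P (insert z F)" using far F(1) z by (auto simp: sep_set_def)
  from F(2)[OF this] show False using fin \<open>z ~: F\<close> by simp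
 qed
 hence "ALL z:Z. EX y:F. ?D z y < dl" by (intro ballI)
 with F(1) fin show ?thesis by (intro that[of F]) simp_all
qed

lemma cov_le_card:
 assumes "F <= Z" "finite F" "ALL z:Z. EX y:F. D z y < dl"
 shows "cov dl Z D <= card F" unfolding cov_def using assms by (intro Least_le) blast

lemma sep_le_cov:
 assumes tb: "tbm S d" and V: "finite V" "V ~= {}" and "0 < dl" and Z: "Z <= V ~> S"
  and F: "F <= Z" "sep_set (2 * dl) (hm d V) F"
 shows "card F <= cov dl Z (hm d V)"
proof -
 let ?D = "hm d V"
 have "EX m. \<exists>F\<subseteq>Z. finite F & card F = m & (ALL z:Z. EX y:F. ?D z y < dl)"
  by (rule max_sep[OF tb V \<open>0 < dl\<close> Z]) auto
 from LeastI_ex[OF this] obtain Q where Q: "Q <= Z" "finite Q" "card Q = cov dl Z ?D"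
  "ALL z:Z. EX y:Q. ?D z y < dl" unfolding cov_def by auto
 have "ALL a:F. EX q. q : Q & ?D a q < dl" using Q F by blast
 then obtain h where h: "ALL a:F. h a : Q & ?D a (h a) < dl" by (rule bchoice[THEN exE])
 have "inj_on h F"
 proof (rule inj_onI, rule ccontr)
  fix a b assume ab: "a : F" "b : F" "h a = h b" "a ~= b"
  have "?D a b <= ?D a (h a) + ?D (h a) b"
   using subsetD[OF Z subsetD[OF F(1) ab(1)]] subsetD[OF Z subsetD[OF F(1) ab(2)]] subsetD[OF Z subsetD[OF Q(1), of "h a"]] h ab
   by (intro hamming_tri[OF tb]) auto
  also have "... < 2 * dl" using h ab hamming_sym[OF tb, of V "h a" b] by (smt (verit))
  finally show False using F(2) ab unfolding sep_set_def by (meson not_less)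
 qed
 hence "card F <= card Q" using h Q by (intro card_inj_on_le[of h F Q]) auto
 thus ?thesis using Q by simp
qed

lemma cov_le_sep:
 assumes tb: "tbm S d" and V: "finite V" "V ~= {}" and "0 < dl" and Z: "Z <= V ~> S"
 obtains F where "F <= Z" "finite F" "sep_set dl (hm d V) F"
  "cov dl Z (hm d V) <= card F" by (rule max_sep[OF assms]) (metis cov_le_card)

text \<open>Covering numbers by points of the set itself are monotone in the set only up to a factor 2 in the
radius, which is why separated sets are used to compare them.\<close>

lemma cov_subset:
 assumes tb: "tbm S d" and V: "finite V" "V ~= {}" and "0 < dl" and Z: "Z <= Z'" "Z' <= V ~> S"
 shows "cov (2 * dl) Z (hm d V) <= cov dl Z' (hm d V)"
proof -
 have "0 < 2 * dl" "Z <= V ~> S" using assms by auto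
 then obtain F where F: "F <= Z" "finite F" "sep_set (2 * dl) (hm d V) F"
  "cov (2 * dl) Z (hm d V) <= card F" by (rule cov_le_sep[OF tb V]) auto
 have "card F <= cov dl Z' (hm d V)" by (rule sep_le_cov[OF tb V]) (use F Z \<open>0 < dl\<close> in auto)
 with F show ?thesis by linarith
qed

definition emp_avg ::
  "('g, 'm) monoid_scheme => ('g => 'v => 'v) => 'v set => ('v => 'a) => (('g => 'a) => real) => real" where
 "emp_avg Gm s V x f = (SUM v:V. f (pullback_name Gm s x v)) / real (card V)"

definition loc_models ::
  "('g, 'm) monoid_scheme => ('g => 'v => 'v) => 'v set => 'a set => ((('g => 'a) => real) => real) =>
    (('g => 'a) => real) set => real => ('v => 'a) set" where
 "loc_models Gm s V S I F ep = {x : V ~> S. ALL f:F. \<bar>emp_avg Gm s V x f - I f\<bar> < ep}"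

definition loc_tests ::
  "'g set => 'a set => ('a => 'a => real) => ((('g => 'a) => real) set \<times> real) set" where
 "loc_tests D S d = {(F, ep). finite F & F <= loc D S d & 0 < ep}"

definition rate ::
  "('a => 'a => real) => (nat => 'v set) => real => (nat => ('v => 'a) set) => nat => ereal" where
 "rate d V dl Z n = log_nat (cov dl (Z n) (hm d (V n))) / ereal (real (card (V n)))"

text \<open>The integral enters only as a functional on local functions, so the same definition serves for path measures
and for observables of a system.\<close>

definition loc_entropy ::
  "((nat => ereal) => ereal) => ('g, 'm) monoid_scheme => (nat => 'v set) =>
    (nat => 'g => 'v => 'v) => 'a set => ('a => 'a => real) =>
    ((('g => 'a) => real) => real) => ereal" where
 "loc_entropy L Gm V sg S d I =
   (SUP dl\<in>{0<..}. INF (F, ep)\<in>loc_tests (carrier Gm) S d.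
    L (rate d V dl (%n. loc_models Gm (sg n) (V n) S I F ep)))"

text \<open>What limsup and liminf have in common; both entropies are treated at once.\<close>

definition tail_mono :: "((nat => ereal) => ereal) => bool" where
 "tail_mono L \<longleftrightarrow> (ALL a b. (EV n. a n <= b n) --> L a <= L b)"

lemma tail_mono_limsup: "tail_mono limsup" and tail_mono_liminf: "tail_mono liminf"
 by (auto simp: tail_mono_def intro: Limsup_mono Liminf_mono)

lemma log_nat_mono: "m <= n ==> log_nat m <= log_nat n" by (auto simp: log_nat_def)

lemma rate_mono:
 assumes "finite (V n)" "V n ~= {}"
  "cov dl (Z n) (hm d (V n)) <= cov dl' (Z' n) (hm d' (V n))"
 shows "rate d V dl Z n <= rate d' V dl' Z' n" unfolding rate_def using assms
 by (intro ereal_divide_right_mono log_nat_mono) (auto simp: card_gt_0_iff)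

section \<open>Continuous functions on a compact path space\<close>

definition alphabet :: "'x measure => ('x => 'x => real) => bool" where
 "alphabet A d \<longleftrightarrow> Metric_space (space A) d &
   compact_space (Metric_space.mtopology (space A) d) &
   sets A = sigma_sets (space A) {U. openin (Metric_space.mtopology (space A) d) U}"

lemma alphabet_tbm:
 assumes "alphabet A d"
 shows "tbm (space A) d"
proof -
 interpret Metric_space "space A" d using assms by (simp add: alphabet_def)
 have "mtotally_bounded (space A)" using assms compact_space_eq_mcomplete_mtotally_bounded by (simp add: alphabet_def)
 hence "\<exists>K\<subseteq>space A. finite K & (ALL x:space A. EX y:K. d x y < r)" if "0 < r" for r
 proof -
  obtain K where K: "finite K" "K <= space A" "space A <= (UN x:K. mball x r)"
   using \<open>mtotally_bounded (space A)\<close> \<open>0 < r\<close> unfolding mtotally_bounded_def by auto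
  have "EX y:K. d x y < r" if x: "x : space A" for x
  proof -
   obtain y where "y : K" "x : mball y r" using subsetD[OF K(3) x] by auto
   thus ?thesis using commute[of x y] by (intro bexI[of _ y]) simp_all
  qed
  thus ?thesis using K by auto
 qed
 thus ?thesis unfolding tbm_def using Metric_space_axioms by auto
qed

lemma alphabet_open:
 assumes "alphabet A d" "openin (Metric_space.mtopology (space A) d) U"
 shows "U : sets A" using assms by (auto simp: alphabet_def)

lemma alphabet_dist_measurable:
 assumes "alphabet A d" "c : space A"
 shows "(%x. d x c) : borel_measurable A" unfolding borel_measurable_iff_less
proof
 fix r
 interpret Metric_space "space A" d using assms by (simp add: alphabet_def)
 have "d x c = d c x" for x by (rule commute)
 hence "{x : space A. d x c < r} = mball c r" using assms(2) by auto
 thus "{x : space A. d x c < r} : sets A" using alphabet_open[OF assms(1)] by simp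
qed

lemma path_dist_measurable:
 assumes "alphabet A d" "i : D" "c : space A"
 shows "(%x. d (x i) c) : borel_measurable (PiM D (%_. A))"
 using measurable_compose[OF measurable_component_singleton alphabet_dist_measurable] assms by fast

lemma loc_measurable_PiM:
 assumes "alphabet A d" "f : loc D (space A) d"
 shows "f : borel_measurable (PiM D (%_. A))" by (rule loc_measurable[OF alphabet_tbm[OF assms(1)] assms(2), of _ "%x. x"])
   (auto simp: space_PiM intro: path_dist_measurable[OF assms(1)])

lemma lip_on_dist:
 assumes "tbm S d" "finite E" "E <= D" "0 <= C" "c : D ~> S"
 shows "lip_on D S d E C (%a. u + C * (SUM i:E. d (a i) (c i)))" unfolding lip_on_def
proof (intro conjI ballI assms)
 fix a b assume ab: "a : D ~> S" "b : D ~> S"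
 have "\<bar>(SUM i:E. d (a i) (c i)) - (SUM i:E. d (b i) (c i))\<bar> <= (SUM i:E. \<bar>d (a i) (c i) - d (b i) (c i)\<bar>)"
  unfolding sum_subtractf[symmetric] by (rule sum_abs)
 also have "... <= (SUM i:E. d (a i) (b i))"
  using ab assms by (intro sum_mono tbm_reverse_tri[OF assms(1)]) (auto simp: PiE_iff)
 finally have "C * \<bar>(SUM i:E. d (a i) (c i)) - (SUM i:E. d (b i) (c i))\<bar> <= C * (SUM i:E. d (a i) (b i))"
  using assms by (intro mult_left_mono)
 thus "\<bar>u + C * (SUM i:E. d (a i) (c i)) - (u + C * (SUM i:E. d (b i) (c i)))\<bar> <= C * (SUM i:E. d (a i) (b i))"
  using assms(4) by (simp add: right_diff_distrib[symmetric] abs_mult)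
qed

context
 fixes A :: "'x measure" and d :: "'x => 'x => real" and D :: "'g set"
 assumes al: "alphabet A d"
begin

interpretation Metric_space "space A" d using al by (simp add: alphabet_def)

lemma openin_box:
 assumes "finite E" "E <= D" "a : D ~> space A"
 shows "openin (product_topology (%_. mtopology) D) {b : D ~> space A. ALL i:E. d (a i) (b i) < r}"
proof -
 have "{b : D ~> space A. ALL i:E. d (a i) (b i) < r} = (\<Pi>\<^sub>E i\<in>D. if i : E then mball (a i) r else space A)"
  (is "?L = ?R")
 proof (intro equalityI subsetI)
  have aS: "a i : space A" if "i : E" for i using assms that by (auto simp: PiE_iff)
  fix b
  { assume "b : ?L"
   thus "b : ?R" using aS by (auto simp: PiE_iff) }
  { assume b: "b : ?R"
   have bi: "b i : (if i : E then mball (a i) r else space A)" if "i : D" for i using b that by (rule PiE_mem)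
   have "d (a i) (b i) < r" if "i : E" for i using bi[of i] that assms(2) by auto
   moreover have "b i : space A" if "i : D" for i using bi[OF that] by (cases "i : E") auto
   moreover have "b : extensional D" using b by (simp add: PiE_iff)
   ultimately show "b : ?L" by (simp add: PiE_iff) }
 qed
 moreover have "openin (product_topology (%_. mtopology) D) (\<Pi>\<^sub>E i\<in>D. if i : E then mball (a i) r else space A)"
  by (rule product_topology_basis) (use assms openin_topspace[of mtopology] in \<open>auto intro: finite_subset[of _ E]\<close>)
 ultimately show ?thesis by simp
qed

lemma open_contains_box:
 assumes U: "openin (product_topology (%_. mtopology) D) U" and a: "a : U"
 obtains E r where "finite E" "E <= D" "0 < r"
  "{b : D ~> space A. ALL i:E. d (a i) (b i) < r} <= U"
proof -
 obtain X where X: "a : (\<Pi>\<^sub>E i\<in>D. X i)" "!!i. openin mtopology (X i)" "finite {i. X i ~= topspace mtopology}"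
  "(\<Pi>\<^sub>E i\<in>D. X i) <= U" using product_topology_open_contains_basis[OF U a] by (elim exE conjE, intro that) auto
 define E where "E = {i : D. X i ~= space A}"
 have E: "finite E" "E <= D" using X(3) by (auto simp: E_def intro: finite_subset)
 have "EX r>0. mball (a i) r <= X i" if "i : E" for i
  using X(1,2) that E(2) unfolding openin_mtopology by (auto simp: PiE_iff)
 hence "ALL i:E. EX r. 0 < r & mball (a i) r <= X i" by blast
 then obtain r where r: "ALL i:E. 0 < r i & mball (a i) (r i) <= X i" by (rule bchoice[THEN exE])
 define rh where "rh = Min (insert 1 (r ` E))"
 have rh: "0 < rh" "!!i. i : E ==> rh <= r i" using r E by (auto simp: rh_def)
 have "{b : D ~> space A. ALL i:E. d (a i) (b i) < rh} <= (\<Pi>\<^sub>E i\<in>D. X i)"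
 proof
  fix b assume b: "b : {b : D ~> space A. ALL i:E. d (a i) (b i) < rh}"
  have "b i : X i" if i: "i : D" for i
  proof (cases "i : E")
   case True
   have "a i : X i" using X(1) i by auto
   hence "a i : space A" using openin_subset[OF X(2)] by auto
   hence "b i : mball (a i) (r i)" using b True i rh(2)[OF True] by (auto simp: PiE_iff)
   thus ?thesis using r True by blast
  next
   case False
   thus ?thesis using b i by (auto simp: E_def PiE_iff)
  qed
  thus "b : (\<Pi>\<^sub>E i\<in>D. X i)" using b by (auto simp: PiE_iff)
 qed
 with X(4) have "{b : D ~> space A. ALL i:E. d (a i) (b i) < rh} <= U" by blast
 with E rh(1) show ?thesis by (intro that) auto
qed

lemma loc_continuous:
 assumes f: "f : loc D (space A) d"
 shows "continuous_map (product_topology (%_. mtopology) D) euclideanreal f" unfolding continuous_map_def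
proof (intro conjI allI impI)
 obtain E C where EC: "lip_on D (space A) d E C f" using f by (auto simp: loc_def)
 fix U :: "real set" assume "openin euclidean U"
 hence U: "open U" by simp
 show "openin (product_topology (%_. mtopology) D) {x : topspace (product_topology (%_. mtopology) D). f x : U}"
 proof (subst openin_subopen, safe)
  fix a assume "a : topspace (product_topology (%_. mtopology) D)" and fa: "f a : U"
  hence a: "a : D ~> space A" by simp
  obtain e where e: "0 < e" "ball (f a) e <= U" using U fa by (auto simp: open_contains_ball)
  have E: "finite E" "E <= D" "0 <= C" using EC by (auto simp: lip_on_def)
  define r where "r = e / (C * real (card E) + 1)"
  have pos: "0 < C * real (card E) + 1" using E by (simp add: add_nonneg_pos)
  have r: "0 < r" using e pos by (simp add: r_def)
  have "f b : U" if b: "b : D ~> space A" "ALL i:E. d (a i) (b i) < r" for b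
  proof -
   have "\<bar>f a - f b\<bar> <= C * (SUM i:E. d (a i) (b i))" using EC a b(1) by (rule lip_onD)
   also have "... <= C * (SUM i:E. r)" using b E by (intro mult_left_mono sum_mono) auto
   also have "... = (C * real (card E)) * r" by simp
   also have "... < (C * real (card E) + 1) * r" using r by (intro mult_strict_right_mono) auto
   also have "... = e" using pos by (simp add: r_def)
   finally show ?thesis using e by (auto simp: ball_def dist_real_def)
  qed
  thus "EX T. openin (product_topology (%_. mtopology) D) T & a : T &
    T <= {x : topspace (product_topology (%_. mtopology) D). f x : U}" using a r openin_box[OF E(1,2) a, of r] E
   by (intro exI[of _ "{b : D ~> space A. ALL i:E. d (a i) (b i) < r}"])
     (auto simp: PiE_iff)
 qed
qed auto

text \<open>A continuous function on the compact path space is a uniform limit of local functions: the Lipschitz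
regularization, an infimum of functions plus a large multiple of the distance, over a finite box.\<close>

lemma continuous_loc_approx:
 assumes f: "continuous_map (product_topology (%_. mtopology) D) euclideanreal f" and "0 < et"
 obtains f' where "f' : loc D (space A) d" "!!a. a : D ~> space A ==> \<bar>f a - f' a\<bar> <= et"
proof (cases "D ~> space A = {}")
 case True
 thus ?thesis by (intro that[of "%_. 0"] loc_const) auto
next
 case False
 let ?X = "product_topology (%_. mtopology) D" and ?P = "D ~> space A"
 have tb: "tbm (space A) d" by (rule alphabet_tbm[OF al])
 have "EX E r. finite E & E <= D & 0 < r & (ALL b:?P. (ALL i:E. d (a i) (b i) < 2 * r) --> \<bar>f b - f a\<bar> < et / 2)"
  if a: "a : ?P" for a
 proof -
  have "openin ?X {b : topspace ?X. f b : ball (f a) (et / 2)}" by (rule openin_continuous_map_preimage[OF f]) simp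
  moreover have "a : {b : topspace ?X. f b : ball (f a) (et / 2)}" using a \<open>0 < et\<close> by simp
  ultimately obtain E r where "finite E" "E <= D" "0 < r"
   "{b : ?P. ALL i:E. d (a i) (b i) < r} <= {b : topspace ?X. f b : ball (f a) (et / 2)}" by (rule open_contains_box) auto
  thus ?thesis by (intro exI[of _ E] exI[of _ "r / 2"]) (auto simp: dist_real_def abs_minus_commute subset_iff)
 qed
 hence "ALL a:?P. EX p. finite (fst p) & fst p <= D & 0 < snd p & (ALL b:?P. (ALL i:fst p. d (a i) (b i) < 2 * snd p) --> \<bar>f b - f a\<bar> < et / 2)"
  by simp
 then obtain p where p: "ALL a:?P. finite (fst (p a)) & fst (p a) <= D & 0 < snd (p a) &
   (ALL b:?P. (ALL i:fst (p a). d (a i) (b i) < 2 * snd (p a)) --> \<bar>f b - f a\<bar> < et / 2)"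
  by (rule bchoice[THEN exE])
 have pE: "finite (fst (p a))" "fst (p a) <= D" "0 < snd (p a)" if "a : ?P" for a
  by (rule conjunct1[OF bspec[OF p that]] conjunct1[OF conjunct2[OF bspec[OF p that]]]
    conjunct1[OF conjunct2[OF conjunct2[OF bspec[OF p that]]]])+
 have pa: "\<bar>f c - f a\<bar> < et / 2"
  if "a : ?P" "c : ?P" "ALL i:fst (p a). d (a i) (c i) < 2 * snd (p a)" for a c
  using bspec[OF p that(1)] that(2,3) by (elim conjE) (drule (1) bspec, drule (1) mp)
 define B where "B a = {b : ?P. ALL i:fst (p a). d (a i) (b i) < snd (p a)}" for a
 have aB: "a : B a" if "a : ?P" for a using that pE[OF that] tbm_zero[OF tb] by (auto simp: B_def PiE_iff subset_iff)
 have "compact_space ?X" using al compact_space_product_topology by (auto simp: alphabet_def)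
 moreover have "!!U. U : B ` ?P ==> openin ?X U" using pE openin_box by (auto simp: B_def)
 moreover have "topspace ?X <= \<Union>(B ` ?P)" using aB by auto
 ultimately obtain \<F> where \<F>: "finite \<F>" "\<F> <= B ` ?P" "topspace ?X <= \<Union>\<F>"
  unfolding compact_space_alt by meson
 obtain K where K: "finite K" "K <= ?P" "\<F> = B ` K" using finite_subset_image[OF \<F>(1,2)] by auto
 have cover: "EX a:K. b : B a" if "b : ?P" for b using \<F>(3) K(3) that by auto
 have Kne: "K ~= {}" using cover False by auto
 define E where "E = (UN a:K. fst (p a))"
 define rh where "rh = Min ((%a. snd (p a)) ` K)"
 have E: "finite E" "E <= D" using K(1) pE(1)[OF subsetD[OF K(2)]] pE(2)[OF subsetD[OF K(2)]] by (auto simp: E_def)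
 have rh: "0 < rh" using K Kne pE by (auto simp: rh_def)
 have rh': "rh <= snd (p a)" if "a : K" for a using K that by (auto simp: rh_def)
 define R where "R = (SUM a:K. \<bar>f a\<bar>) + et"
 have R: "\<bar>f b\<bar> <= R" if b: "b : ?P" for b
 proof -
  obtain a where a: "a : K" "b : B a" using cover[OF b] by auto
  hence aP: "a : ?P" using K by auto
  have "ALL i:fst (p a). d (a i) (b i) < 2 * snd (p a)"
  proof
   fix i assume i: "i : fst (p a)"
   have "d (a i) (b i) < snd (p a)" "0 < snd (p a)" using a(2) i pE[OF aP] by (auto simp: B_def)
   thus "d (a i) (b i) < 2 * snd (p a)" by linarith
  qed
  hence "\<bar>f b - f a\<bar> < et / 2" by (rule pa[OF aP b])
  moreover have "\<bar>f a\<bar> <= (SUM a:K. \<bar>f a\<bar>)" using a K by (intro member_le_sum) auto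
  ultimately show ?thesis using \<open>0 < et\<close> unfolding R_def by linarith
 qed
 have unif: "\<bar>f b - f b'\<bar> <= et" if b: "b : ?P" "b' : ?P" and close: "!!i. i : E ==> d (b i) (b' i) < rh" for b b'
 proof -
  obtain a where a: "a : K" "b : B a" using cover[OF b(1)] by auto
  hence aP: "a : ?P" using K by auto
  have *: "d (a i) (b i) < 2 * snd (p a) & d (a i) (b' i) < 2 * snd (p a)" if i: "i : fst (p a)" for i
  proof -
   have iE: "i : E" using i a by (auto simp: E_def)
   hence "d (a i) (b' i) <= d (a i) (b i) + d (b i) (b' i)"
    using aP b E by (intro tbm_tri[OF tb]) (auto simp: PiE_iff subset_iff)
   moreover have "d (a i) (b i) < snd (p a)" "0 < snd (p a)" using a(2) i pE[OF aP] by (auto simp: B_def)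
   ultimately show ?thesis using close[OF iE] rh'[OF a(1)] by linarith
  qed
  have "\<bar>f b - f a\<bar> < et / 2" "\<bar>f b' - f a\<bar> < et / 2" by (rule pa[OF aP], rule b, use * in blast)+
  thus ?thesis by linarith
 qed
 define C where "C = 2 * R / rh"
 have R0: "0 <= R" using \<open>0 < et\<close> by (auto simp: R_def intro!: add_nonneg_nonneg sum_nonneg)
 have C: "0 <= C" using R0 rh by (simp add: C_def)
 have main: "f b <= f b' + C * (SUM i:E. d (b i) (b' i)) + et" if b: "b : ?P" "b' : ?P" for b b'
 proof (cases "ALL i:E. d (b i) (b' i) < rh")
  case True
  hence "\<bar>f b - f b'\<bar> <= et" using unif[OF b] by auto
  moreover have "0 <= C * (SUM i:E. d (b i) (b' i))" using C by (intro mult_nonneg_nonneg sum_nonneg) auto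
  ultimately show ?thesis by linarith
 next
  case False
  then obtain i where i: "i : E" "rh <= d (b i) (b' i)" by force
  have "rh <= (SUM i:E. d (b i) (b' i))" using i E member_le_sum[of i E "%i. d (b i) (b' i)"] by auto
  hence "C * rh <= C * (SUM i:E. d (b i) (b' i))" using C by (rule mult_left_mono)
  hence "2 * R <= C * (SUM i:E. d (b i) (b' i))" using rh by (simp add: C_def)
  thus ?thesis using R[OF b(1)] R[OF b(2)] \<open>0 < et\<close> by linarith
 qed
 define f' where "f' = (%a. INF c\<in>?P. f c + C * (SUM i:E. d (a i) (c i)))"
 have low: "f a - et <= f c + C * (SUM i:E. d (a i) (c i))" if "a : ?P" "c : ?P" for a c using main[OF that] by linarith
 have "- R - et <= f c + C * (SUM i:E. d (a i) (c i))" if "a : ?P" "c : ?P" for a c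
  using low[OF that] R[OF that(1)] by linarith
 hence "lip_on D (space A) d E C f'" unfolding f'_def using False by (intro lip_on_cINF lip_on_dist tb E C) auto
 hence "f' : loc D (space A) d" by (rule locI)
 moreover have "\<bar>f a - f' a\<bar> <= et" if a: "a : ?P" for a
 proof -
  have "f a - et <= f' a" unfolding f'_def using low[OF a] False by (intro cINF_greatest) auto
  moreover have "f' a <= f a + C * (SUM i:E. d (a i) (a i))"
   unfolding f'_def using low[OF a] a by (intro cINF_lower bdd_belowI2[of _ "f a - et"]) auto
  moreover have "(SUM i:E. d (a i) (a i)) = 0" using a E by (intro sum.neutral) (auto simp: PiE_iff subset_iff)
  ultimately show ?thesis using \<open>0 < et\<close> by simp
 qed
 ultimately show ?thesis by (rule that)
qed

end

lemma continuous_measurable_PiM: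
 assumes al: "alphabet A d"
  and f: "continuous_map (product_topology (%_. Metric_space.mtopology (space A) d) D) euclideanreal f"
 shows "f : borel_measurable (PiM D (%_. A))"
proof -
 have "EX g. g : loc D (space A) d & (ALL a:D ~> space A. \<bar>f a - g a\<bar> <= 1 / real (Suc n))" for n
  by (rule continuous_loc_approx[OF al f, of "1 / real (Suc n)"]) auto
 then obtain g where g: "ALL n. g n : loc D (space A) d & (ALL a:D ~> space A. \<bar>f a - g n a\<bar> <= 1 / real (Suc n))"
  using choice[of "%n g. g : loc D (space A) d & (ALL a:D ~> space A. \<bar>f a - g a\<bar> <= 1 / real (Suc n))"] by auto
 show ?thesis
 proof (rule borel_measurable_LIMSEQ_real)
  show "g n : borel_measurable (PiM D (%_. A))" for n using g loc_measurable_PiM[OF al] by auto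
  fix a assume "a : space (PiM D (%_. A))"
  hence a: "a : D ~> space A" by (simp add: space_PiM)
  show "(%n. g n a) \<longlonglongrightarrow> f a"
  proof (rule LIM_zero_cancel, rule Lim_null_comparison[OF _ LIMSEQ_inverse_real_of_nat])
   show "EV n. norm (g n a - f a) <= inverse (real (Suc n))"
    using g a by (intro always_eventually) (auto simp: abs_minus_commute inverse_eq_divide)
  qed
 qed
qed

section \<open>Entropy of a metric process by Lipschitz tests\<close>

lemma empirical_distr_Prob:
 assumes V: "finite V" "V ~= {}" and s: "!!g. g : carrier Gm ==> s g ` V <= V"
  and x: "x : V ~> space A"
 shows "empirical_distr Gm A V s x : Prob Gm A"
  and "f : borel_measurable (path_space Gm A) ==>
   (\<integral>p. f p \<partial>empirical_distr Gm A V s x) = emp_avg Gm s V x f"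
proof -
 have m: "pullback_name Gm s x : measurable (uniform_count_measure V) (path_space Gm A)" unfolding measurable_def
 proof (intro CollectI conjI ballI)
  show "pullback_name Gm s x : space (uniform_count_measure V) \<rightarrow> space (path_space Gm A)"
   using x s by (fastforce simp: pullback_name_def path_space_def space_PiM PiE_iff space_uniform_count_measure)
 qed (auto simp: sets_uniform_count_measure space_uniform_count_measure)
 interpret prob_space "uniform_count_measure V" using V by (rule prob_space_uniform_count_measure)
 show "empirical_distr Gm A V s x : Prob Gm A" using prob_space_distr[OF m] by (simp add: Prob_def empirical_distr_def)
 assume "f : borel_measurable (path_space Gm A)"
 thus "(\<integral>p. f p \<partial>empirical_distr Gm A V s x) = emp_avg Gm s V x f"
  unfolding empirical_distr_def emp_avg_def using V by (simp add: integral_distr[OF m] integral_uniform_count_measure)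
qed

lemma Prob_integrable:
 fixes f :: "('g => 'x) => real"
 assumes "\<nu> : Prob Gm A" "f : borel_measurable (path_space Gm A)"
  and "!!a. a : carrier Gm ~> space A ==> \<bar>f a\<bar> <= B"
 shows "integrable \<nu> f"
proof -
 interpret prob_space \<nu> using assms by (simp add: Prob_def)
 have s: "sets \<nu> = sets (path_space Gm A)" using assms by (simp add: Prob_def)
 have "space \<nu> = carrier Gm ~> space A" using sets_eq_imp_space_eq[OF s] by (simp add: path_space_def space_PiM)
 thus ?thesis using assms s by (intro integrable_const_bound[of _ B]) (auto cong: measurable_cong_sets)
qed

lemma loc_Prob_integrable:
 assumes "alphabet A d" "\<nu> : Prob Gm A" "f : loc (carrier Gm) (space A) d"
 shows "integrable \<nu> f"
proof -
 obtain B where "0 < B" "!!a. a : carrier Gm ~> space A ==> \<bar>f a\<bar> <= B"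
  by (rule loc_bounded[OF alphabet_tbm[OF assms(1)] assms(3)]) auto
 thus ?thesis using loc_measurable_PiM[OF assms(1,3)] by (intro Prob_integrable[OF assms(2)]) (auto simp: path_space_def)
qed

lemma weak_star_open_contains:
 assumes al: "alphabet A d" and mu: "mu : Prob Gm A"
  and U: "openin (weak_star_topology Gm A d) U" "mu : U"
 obtains F ep where "(F, ep) : loc_tests (carrier Gm) (space A) d"
  "!!\<nu>. \<nu> : Prob Gm A ==> (!!f. f : F ==> \<bar>(\<integral>p. f p \<partial>\<nu>) - (\<integral>p. f p \<partial>mu)\<bar> < ep) ==> \<nu> : U"
proof -
 let ?S = "{{\<nu> : Prob Gm A. (\<integral>x. f x \<partial>\<nu>) : U} | f U.
    continuous_map (path_topology Gm A d) euclideanreal f & open U}"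
 let ?G = "%F ep U. (F, ep) : loc_tests (carrier Gm) (space A) d &
   (ALL \<nu>:Prob Gm A. (ALL f:F. \<bar>(\<integral>p. f p \<partial>\<nu>) - (\<integral>p. f p \<partial>mu)\<bar> < ep) --> \<nu> : U)"
 have "generate_topology_on ?S U" using U(1) unfolding weak_star_topology_def by (rule openin_topology_generated_by)
 hence "mu : U --> (EX F ep. ?G F ep U)"
 proof induction
  case Empty
  thus ?case by simp
 next
  case (Int a b)
  show ?case
  proof
   assume "mu : a Int b"
   then obtain F ep F' ep' where F: "?G F ep a" "?G F' ep' b" using Int by auto
   have "?G (F Un F') (min ep ep') (a Int b)" using F by (auto simp: loc_tests_def)
   thus "EX F ep. ?G F ep (a Int b)" by blast
  qed
 next
  case (UN K)
  show ?case
  proof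
   assume "mu : \<Union>K"
   then obtain k F ep where "k : K" "?G F ep k" using UN by blast
   hence "?G F ep (\<Union>K)" by auto
   thus "EX F ep. ?G F ep (\<Union>K)" by blast
  qed
 next
  case (Basis s)
  then obtain f W where f: "s = {\<nu> : Prob Gm A. (\<integral>x. f x \<partial>\<nu>) : W}"
   "continuous_map (path_topology Gm A d) euclideanreal f" "open W" by auto
  show ?case
  proof
   assume "mu : s"
   then obtain e where e: "0 < e" "ball (\<integral>x. f x \<partial>mu) e <= W" using f by (auto simp: open_contains_ball)
   have cf: "continuous_map (product_topology (%_. Metric_space.mtopology (space A) d) (carrier Gm)) euclideanreal f"
    using f(2) by (simp add: path_topology_def)
   have "0 < e / 4" using e by simp
   then obtain g where g: "g : loc (carrier Gm) (space A) d" "!!a. a : carrier Gm ~> space A ==> \<bar>f a - g a\<bar> <= e / 4"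
    by (rule continuous_loc_approx[OF al cf]) auto
   have fm: "f : borel_measurable (path_space Gm A)" unfolding path_space_def by (rule continuous_measurable_PiM[OF al cf])
   obtain B where B: "0 < B" "!!a. a : carrier Gm ~> space A ==> \<bar>g a\<bar> <= B"
    by (rule loc_bounded[OF alphabet_tbm[OF al] g(1)]) auto
   have diff: "\<bar>(\<integral>x. f x \<partial>\<nu>) - (\<integral>x. g x \<partial>\<nu>)\<bar> <= e / 4" if \<nu>: "\<nu> : Prob Gm A" for \<nu>
   proof -
    interpret prob_space \<nu> using \<nu> by (simp add: Prob_def)
    have sp: "space \<nu> = carrier Gm ~> space A"
     using \<nu> sets_eq_imp_space_eq[of \<nu> "path_space Gm A"] by (simp add: Prob_def path_space_def space_PiM)
    have ig: "integrable \<nu> g" by (rule loc_Prob_integrable[OF al \<nu> g(1)])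
    have "\<bar>f a\<bar> <= B + e / 4" if "a : carrier Gm ~> space A" for a using B(2)[OF that] g(2)[OF that] by linarith
    hence "integrable \<nu> f" by (rule Prob_integrable[OF \<nu> fm])
    hence "(\<integral>x. f x \<partial>\<nu>) - (\<integral>x. g x \<partial>\<nu>) = (\<integral>x. f x - g x \<partial>\<nu>)" using ig by simp
    also have "\<bar>...\<bar> <= (\<integral>x. \<bar>f x - g x\<bar> \<partial>\<nu>)" by (rule integral_abs_bound)
    also have "... <= e / 4" using \<open>integrable \<nu> f\<close> ig g(2) by (intro integral_le_const) (auto simp: sp)
    finally show ?thesis .
   qed
   have "?G {g} (e / 4) s"
   proof (intro conjI ballI impI)
    show "({g}, e / 4) : loc_tests (carrier Gm) (space A) d" using g e by (simp add: loc_tests_def)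
    fix \<nu> assume \<nu>: "\<nu> : Prob Gm A" and "ALL f:{g}. \<bar>(\<integral>p. f p \<partial>\<nu>) - (\<integral>p. f p \<partial>mu)\<bar> < e / 4"
    hence "\<bar>(\<integral>p. g p \<partial>\<nu>) - (\<integral>p. g p \<partial>mu)\<bar> < e / 4" by simp
    hence "\<bar>(\<integral>x. f x \<partial>\<nu>) - (\<integral>x. f x \<partial>mu)\<bar> < e" using diff[OF \<nu>] diff[OF mu] by linarith
    hence "(\<integral>x. f x \<partial>\<nu>) : ball (\<integral>x. f x \<partial>mu) e" by (simp add: dist_real_def abs_minus_commute)
    thus "\<nu> : s" using e \<nu> f(1) by auto
   qed
   thus "EX F ep. ?G F ep s" by blast
  qed
 qed
 then obtain F ep where "?G F ep U" using U(2) by auto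
 thus ?thesis by (intro that[of F ep]) simp_all
qed

lemma weak_star_open_tests:
 assumes al: "alphabet A d" and F: "(F, ep) : loc_tests (carrier Gm) (space A) d"
 shows "openin (weak_star_topology Gm A d)
  {\<nu> : Prob Gm A. ALL f:F. \<bar>(\<integral>p. f p \<partial>\<nu>) - c f\<bar> < ep}"
proof -
 let ?B = "%f. {\<nu> : Prob Gm A. (\<integral>p. f p \<partial>\<nu>) : ball (c f) ep}"
 let ?T = "insert {\<nu> : Prob Gm A. (\<integral>p. (0::real) \<partial>\<nu>) : UNIV} (?B ` F)"
 have "{\<nu> : Prob Gm A. ALL f:F. \<bar>(\<integral>p. f p \<partial>\<nu>) - c f\<bar> < ep} = \<Inter>?T"
  by (auto simp: dist_real_def abs_minus_commute)
 moreover have "openin (weak_star_topology Gm A d) (\<Inter>?T)"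
 proof (rule openin_Inter)
  show "finite ?T" using F by (simp add: loc_tests_def)
  fix X assume "X : ?T"
  thus "openin (weak_star_topology Gm A d) X"
  proof (elim insertE imageE)
   assume X: "X = {\<nu> : Prob Gm A. (\<integral>p. (0::real) \<partial>\<nu>) : UNIV}"
   show ?thesis unfolding weak_star_topology_def X
    by (intro topology_generated_by_Basis CollectI exI[of _ "%_. 0"] exI[of _ UNIV]) auto
  next
   fix f assume f: "f : F" and X: "X = ?B f"
   have "continuous_map (path_topology Gm A d) euclideanreal f"
    using loc_continuous[OF al] F f by (auto simp: path_topology_def loc_tests_def)
   thus ?thesis unfolding weak_star_topology_def X
    by (intro topology_generated_by_Basis CollectI exI[of _ f] exI[of _ "ball (c f) ep"]) auto
  qed
 qed auto
 ultimately show ?thesis by simp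
qed

definition finite_action :: "('g, 'm) monoid_scheme => (nat => 'v set) => (nat => 'g => 'v => 'v) => bool" where
 "finite_action Gm V sg \<longleftrightarrow> (ALL n. finite (V n) & V n ~= {}) &
   (ALL n. ALL g:carrier Gm. bij_betw (sg n g) (V n) (V n))"

lemma finite_actionD:
 assumes "finite_action Gm V sg"
 shows "finite (V n)" "V n ~= {}" "g : carrier Gm ==> bij_betw (sg n g) (V n) (V n)"
  "g : carrier Gm ==> sg n g ` V n <= V n" "0 < card (V n)"
 using assms by (auto simp: finite_action_def bij_betw_def card_gt_0_iff)

text \<open>Local tests form a neighbourhood base of the weak-star topology at a measure, as continuous functions
are uniform limits of local ones and local ones are continuous.\<close>

lemma process_entropy_eq_loc:
 assumes al: "alphabet A d" and mu: "mu : Prob Gm A" and L: "tail_mono L"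
  and fa: "finite_action Gm V sg"
 shows "process_entropy_wrt L Gm V sg A d mu = loc_entropy L Gm V sg (space A) d (%f. \<integral>p. f p \<partial>mu)"
proof -
 let ?I = "%f. \<integral>p. f p \<partial>mu"
 let ?Z = "%F ep n. loc_models Gm (sg n) (V n) (space A) ?I F ep"
 let ?Y = "%N n. good_models Gm A N (V n) (sg n)"
 note tb = alphabet_tbm[OF al]
 have pe: "process_entropy_wrt L Gm V sg A d mu =
   (SUP dl\<in>{0<..}. INF N\<in>weak_star_nbhds Gm A d mu. L (rate d V dl (?Y N)))"
  unfolding process_entropy_wrt_def rate_def ..
 have 1: "(INF (F, ep)\<in>loc_tests (carrier Gm) (space A) d. L (rate d V (2 * dl) (?Z F ep)))
   <= (INF N\<in>weak_star_nbhds Gm A d mu. L (rate d V dl (?Y N)))" if "0 < dl" for dl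
 proof (rule INF_greatest)
  fix N assume "N : weak_star_nbhds Gm A d mu"
  then obtain U where U: "openin (weak_star_topology Gm A d) U" "mu : U" "U <= N" by (auto simp: weak_star_nbhds_def)
  obtain F ep where F: "(F, ep) : loc_tests (carrier Gm) (space A) d"
   "!!\<nu>. \<nu> : Prob Gm A ==> (!!f. f : F ==> \<bar>(\<integral>p. f p \<partial>\<nu>) - ?I f\<bar> < ep) ==> \<nu> : U"
   by (rule weak_star_open_contains[OF al mu U(1,2)]) auto
  have sub: "?Z F ep n <= ?Y N n" for n
  proof
   fix x assume x: "x : ?Z F ep n"
   hence xV: "x : V n ~> space A" by (simp add: loc_models_def)
   note em = empirical_distr_Prob[where Gm = Gm and s = "sg n", OF finite_actionD(1,2)[OF fa] finite_actionD(4)[OF fa] xV]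
   have "empirical_distr Gm A (V n) (sg n) x : U"
   proof (rule F(2))
    fix f assume f: "f : F"
    hence "f : borel_measurable (path_space Gm A)"
     using loc_measurable_PiM[OF al] F(1) by (auto simp: path_space_def loc_tests_def)
    thus "\<bar>(\<integral>p. f p \<partial>empirical_distr Gm A (V n) (sg n) x) - ?I f\<bar> < ep"
     using em(2) x f by (simp add: loc_models_def)
   qed (rule em(1))
   thus "x : ?Y N n" using U xV by (auto simp: good_models_def)
  qed
  have "L (rate d V (2 * dl) (?Z F ep)) <= L (rate d V dl (?Y N))"
  proof -
   have "rate d V (2 * dl) (?Z F ep) n <= rate d V dl (?Y N) n" for n
    by (intro rate_mono finite_actionD[OF fa] cov_subset[OF tb] sub that)
      (auto simp: good_models_def)
   thus ?thesis using L by (simp add: tail_mono_def)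
  qed
  thus "(INF (F, ep)\<in>loc_tests (carrier Gm) (space A) d. L (rate d V (2 * dl) (?Z F ep))) <= L (rate d V dl (?Y N))"
   using F(1) by (intro INF_lower2[of "(F, ep)"]) auto
 qed
 have 2: "(INF N\<in>weak_star_nbhds Gm A d mu. L (rate d V dl (?Y N)))
   <= (INF (F, ep)\<in>loc_tests (carrier Gm) (space A) d. L (rate d V dl (?Z F ep)))" for dl
 proof (rule INF_greatest, safe)
  fix F ep assume F: "(F, ep) : loc_tests (carrier Gm) (space A) d"
  define N where "N = {\<nu> : Prob Gm A. ALL f:F. \<bar>(\<integral>p. f p \<partial>\<nu>) - ?I f\<bar> < ep}"
  have "openin (weak_star_topology Gm A d) N" unfolding N_def by (rule weak_star_open_tests[OF al F])
  moreover have "mu : N" using mu F by (simp add: N_def loc_tests_def)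
  ultimately have N: "N : weak_star_nbhds Gm A d mu" by (auto simp: weak_star_nbhds_def N_def)
  have "?Y N n = ?Z F ep n" for n
  proof -
   have "empirical_distr Gm A (V n) (sg n) x : N \<longleftrightarrow> (ALL f:F. \<bar>emp_avg Gm (sg n) (V n) x f - ?I f\<bar> < ep)"
    if xV: "x : V n ~> space A" for x
   proof -
    note em = empirical_distr_Prob[where Gm = Gm and s = "sg n", OF finite_actionD(1,2)[OF fa] finite_actionD(4)[OF fa] xV]
    have "(\<integral>p. f p \<partial>empirical_distr Gm A (V n) (sg n) x) = emp_avg Gm (sg n) (V n) x f" if "f : F" for f
     using loc_measurable_PiM[OF al] F that by (intro em(2)) (auto simp: path_space_def loc_tests_def)
    thus ?thesis using em(1) by (simp add: N_def)
   qed
   thus ?thesis by (auto simp: good_models_def loc_models_def)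
  qed
  hence "?Y N = ?Z F ep" by auto
  thus "(INF N\<in>weak_star_nbhds Gm A d mu. L (rate d V dl (?Y N))) <= L (rate d V dl (?Z F ep))"
   using N by (intro INF_lower2[of N]) auto
 qed
 show ?thesis unfolding pe loc_entropy_def
 proof (rule antisym)
  show "(SUP dl\<in>{0<..}. INF N\<in>weak_star_nbhds Gm A d mu. L (rate d V dl (?Y N)))
   <= (SUP dl\<in>{0<..}. INF (F, ep)\<in>loc_tests (carrier Gm) (space A) d. L (rate d V dl (?Z F ep)))"
   using 2 by (intro SUP_mono) blast
  show "(SUP dl\<in>{0<..}. INF (F, ep)\<in>loc_tests (carrier Gm) (space A) d. L (rate d V dl (?Z F ep)))
   <= (SUP dl\<in>{0<..}. INF N\<in>weak_star_nbhds Gm A d mu. L (rate d V dl (?Y N)))"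
  proof (rule SUP_least)
   fix dl :: real assume "dl : {0<..}"
   hence "0 < dl / 2" by simp
   from 1[OF this] this show "(INF (F, ep)\<in>loc_tests (carrier Gm) (space A) d. L (rate d V dl (?Z F ep)))
    <= (SUP dl\<in>{0<..}. INF N\<in>weak_star_nbhds Gm A d mu. L (rate d V dl (?Y N)))"
    by (intro SUP_upper2[of "dl / 2"]) auto
  qed
 qed
qed

section \<open>Approximation of events by Lipschitz functions\<close>

definition pmp :: "('g, 'm) monoid_scheme => 'x measure => ('g => 'x => 'x) => bool" where
 "pmp Gm M T \<longleftrightarrow> prob_space M &
   (ALL g:carrier Gm. T g : measurable M M & distr M M (T g) = M) &
   (ALL x:space M. T \<one>\<^bsub>Gm\<^esub> x = x) &
   (ALL g:carrier Gm. ALL h:carrier Gm. ALL x:space M. T (g \<otimes>\<^bsub>Gm\<^esub> h) x = T g (T h x))"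

lemma gsystem_pmp: "gsystem Gm M T ==> pmp Gm M T" by (simp add: gsystem_def pmp_def)

lemma pmpD:
 assumes "pmp Gm M T"
 shows "prob_space M" "g : carrier Gm ==> T g : measurable M M" "g : carrier Gm ==> distr M M (T g) = M"
  "x : space M ==> T \<one>\<^bsub>Gm\<^esub> x = x"
  "g : carrier Gm ==> h : carrier Gm ==> x : space M ==> T (g \<otimes>\<^bsub>Gm\<^esub> h) x = T g (T h x)"
  "g : carrier Gm ==> x : space M ==> T g x : space M" using assms by (auto simp: pmp_def dest: measurable_space)

definition path_map :: "'x measure => 'i set => 'a set => ('a => 'a => real) => ('x => 'i => 'a) => bool" where
 "path_map M D S d P \<longleftrightarrow> (ALL x:space M. P x : D ~> S) &
   (ALL i:D. ALL c:S. (%x. d (P x i) c) : borel_measurable M)"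

lemma path_map_loc_measurable:
 assumes "tbm S d" "path_map M D S d P" "f : loc D S d"
 shows "(%x. f (P x)) : borel_measurable M"
 by (rule loc_measurable[OF assms(1,3)]) (use assms(2) in \<open>auto simp: path_map_def\<close>)

lemma path_map_loc_integrable:
 assumes "prob_space M" "tbm S d" "path_map M D S d P" "f : loc D S d"
 shows "integrable M (%x. f (P x))"
proof -
 interpret prob_space M by fact
 obtain B where "0 < B" "!!a. a : D ~> S ==> \<bar>f a\<bar> <= B" by (rule loc_bounded[OF assms(2,4)]) auto
 thus ?thesis using path_map_loc_measurable[OF assms(2-4)] assms(3)
  by (intro integrable_const_bound[of _ B]) (auto simp: path_map_def)
qed

text \<open>Approximability in mean by local functions of the path; for a generating observable it holds
for all integrable functions.\<close>

definition approximable ::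
  "'x measure => 'i set => 'a set => ('a => 'a => real) => ('x => 'i => 'a) => ('x => real) => bool" where
 "approximable M D S d P u \<longleftrightarrow>
   (ALL ep>0. EX f:loc D S d. (\<integral>x. \<bar>u x - f (P x)\<bar> \<partial>M) < ep)"

context
 fixes M :: "'x measure" and D :: "'i set" and S :: "'a set" and d and P
 assumes M: "prob_space M" and tb: "tbm S d" and P: "path_map M D S d P"
begin

interpretation prob_space M by (rule M)

lemma integrable_indicator_event: "B : sets M ==> integrable M (indicator B :: _ => real)"
 by (intro integrable_real_indicator) (auto simp: emeasure_eq_measure)

lemma approximableD:
 assumes "approximable M D S d P u" "0 < ep"
 obtains f where "f : loc D S d" "(\<integral>x. \<bar>u x - f (P x)\<bar> \<partial>M) < ep"
 using assms unfolding approximable_def by auto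

lemma approximable_combine:
 assumes u: "approximable M D S d P u" "integrable M u" and v: "approximable M D S d P v" "integrable M v"
  and w: "integrable M w" and "0 <= K"
  and h: "!!f g. f : loc D S d ==> g : loc D S d ==> (%a. h (f a) (g a)) : loc D S d"
  and le: "!!x s t. x : space M ==> \<bar>w x - h s t\<bar> <= K * (\<bar>u x - s\<bar> + \<bar>v x - t\<bar>)"
 shows "approximable M D S d P w" unfolding approximable_def
proof (intro allI impI)
 fix ep :: real assume "0 < ep"
 define e where "e = ep / (2 * (K + 1))"
 have e: "0 < e" using \<open>0 < ep\<close> \<open>0 <= K\<close> by (simp add: e_def)
 obtain f where f: "f : loc D S d" "(\<integral>x. \<bar>u x - f (P x)\<bar> \<partial>M) < e" by (rule approximableD[OF u(1) e]) auto
 obtain g where g: "g : loc D S d" "(\<integral>x. \<bar>v x - g (P x)\<bar> \<partial>M) < e" by (rule approximableD[OF v(1) e]) auto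
 note int = path_map_loc_integrable[OF M tb P]
 have "(\<integral>x. \<bar>w x - h (f (P x)) (g (P x))\<bar> \<partial>M) <= (\<integral>x. K * (\<bar>u x - f (P x)\<bar> + \<bar>v x - g (P x)\<bar>) \<partial>M)"
  using u v w int[OF f(1)] int[OF g(1)] int[OF h[OF f(1) g(1)]] le by (intro integral_mono) auto
 also have "... = K * ((\<integral>x. \<bar>u x - f (P x)\<bar> \<partial>M) + (\<integral>x. \<bar>v x - g (P x)\<bar> \<partial>M))"
  using u v int[OF f(1)] int[OF g(1)] by simp
 also have "... <= K * (e + e)" using f g \<open>0 <= K\<close> by (intro mult_left_mono) auto
 also have "... < (K + 1) * (e + e)" using e by (intro mult_strict_right_mono) auto
 also have "e + e = ep / (K + 1)" using \<open>0 <= K\<close> by (simp add: e_def divide_simps)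
 also have "(K + 1) * (ep / (K + 1)) = ep" using \<open>0 <= K\<close> by simp
 finally show "EX f:loc D S d. (\<integral>x. \<bar>w x - f (P x)\<bar> \<partial>M) < ep"
  using h[OF f(1) g(1)] by (intro bexI[of _ "%a. h (f a) (g a)"]) auto
qed

lemma approximable_limit:
 assumes w: "integrable M w"
  and lim: "!!ep. 0 < ep ==> EX v. integrable M v & approximable M D S d P v & (\<integral>x. \<bar>w x - v x\<bar> \<partial>M) < ep"
 shows "approximable M D S d P w" unfolding approximable_def
proof (intro allI impI)
 fix ep :: real assume "0 < ep"
 hence e: "0 < ep / 2" by simp
 obtain v where v: "integrable M v" "approximable M D S d P v" "(\<integral>x. \<bar>w x - v x\<bar> \<partial>M) < ep / 2" using lim[OF e] by auto
 obtain f where f: "f : loc D S d" "(\<integral>x. \<bar>v x - f (P x)\<bar> \<partial>M) < ep / 2" by (rule approximableD[OF v(2) e]) auto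
 note int = path_map_loc_integrable[OF M tb P f(1)]
 have "(\<integral>x. \<bar>w x - f (P x)\<bar> \<partial>M) <= (\<integral>x. \<bar>w x - v x\<bar> + \<bar>v x - f (P x)\<bar> \<partial>M)"
  using v w int by (intro integral_mono) auto
 also have "... = (\<integral>x. \<bar>w x - v x\<bar> \<partial>M) + (\<integral>x. \<bar>v x - f (P x)\<bar> \<partial>M)"
  using v w int by simp
 also have "... < ep" using v f by simp
 finally show "EX f:loc D S d. (\<integral>x. \<bar>w x - f (P x)\<bar> \<partial>M) < ep" using f by blast
qed

lemma approximable_const: "approximable M D S d P (%_. c)" unfolding approximable_def
 by (intro allI impI bexI[of _ "%_. c"] loc_const) auto

lemma approximable_cong_AE:
 assumes "approximable M D S d P u" "integrable M u" "integrable M v" "AE x in M. u x = v x"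
 shows "approximable M D S d P v" unfolding approximable_def
proof (intro allI impI)
 fix ep :: real assume "0 < ep"
 obtain f where f: "f : loc D S d" "(\<integral>x. \<bar>u x - f (P x)\<bar> \<partial>M) < ep" by (rule approximableD[OF assms(1) \<open>0 < ep\<close>]) auto
 note int = path_map_loc_integrable[OF M tb P f(1)]
 have "(\<integral>x. \<bar>u x - f (P x)\<bar> \<partial>M) = (\<integral>x. \<bar>v x - f (P x)\<bar> \<partial>M)"
  using assms int by (intro integral_cong_AE) auto
 with f show "EX f:loc D S d. (\<integral>x. \<bar>v x - f (P x)\<bar> \<partial>M) < ep" by auto
qed

text \<open>Approximable events form a sigma-algebra, since minima, complements and monotone limits can be
taken on the side of the local functions.\<close>

lemma approximable_sigma_sets:
 assumes G: "!!B. B : G ==> B : sets M & approximable M D S d P (indicator B)"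
  and B: "B : sigma_sets (space M) G"
 shows "B : sets M & approximable M D S d P (indicator B)" using B
proof induction
 case (Basic a)
 thus ?case by (rule G)
next
 case Empty
 show ?case using approximable_const[of 0] by (auto simp: indicator_def)
next
 case (Compl a)
 hence a: "a : sets M" "approximable M D S d P (indicator a)" by auto
 moreover have "approximable M D S d P (indicator (space M - a))"
  by (rule approximable_combine[OF a(2) _ a(2), where h = "%s t. 1 - s" and K = 1])
    (use a in \<open>auto intro!: loc_diff[OF tb] loc_const integrable_indicator_event simp: indicator_def\<close>)
 ultimately show ?case by auto
next
 case (Union B)
 hence B: "B i : sets M" "approximable M D S d P (indicator (B i))" for i by auto
 have fin: "approximable M D S d P (indicator (UN i<n. B i))" for n :: nat
 proof (induction n)
  case 0
  show ?case using approximable_const[of 0] by (auto simp: indicator_def)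
 next
  case (Suc n)
  have int: "integrable M (indicator (UN i<m. B i) :: _ => real)" for m :: nat
   using B by (intro integrable_indicator_event) auto
  show ?case
  proof (rule approximable_combine[OF Suc int B(2)[of n] integrable_indicator_event[OF B(1)] int, where h = max and K = 1])
   show "\<bar>indicator (UN i<Suc n. B i) x - max s t\<bar>
    <= 1 * (\<bar>indicator (UN i<n. B i) x - s\<bar> + \<bar>indicator (B n) x - t\<bar>)" for x and s t :: real
    by (auto simp: indicator_def lessThan_Suc)
  qed (auto intro: loc_max[OF tb])
 qed
 have U: "(UN i. B i) : sets M" using B by auto
 moreover have "approximable M D S d P (indicator (UN i. B i))"
 proof (rule approximable_limit)
  show "integrable M (indicator (UN i. B i) :: _ => real)" using U by (rule integrable_indicator_event)
  fix ep :: real assume "0 < ep"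
  have "(%n. prob (UN i<n. B i)) \<longlonglongrightarrow> prob (UN n. UN i<n. B i)"
   by (rule finite_Lim_measure_incseq) (use B in \<open>auto simp: incseq_def intro: less_le_trans\<close>)
  moreover have eq: "(UN n. UN i<n. B i) = (UN i. B i)" by auto
  ultimately have "(%n. prob (UN i<n. B i)) \<longlonglongrightarrow> prob (UN i. B i)" by simp
  from LIMSEQ_D[OF this \<open>0 < ep\<close>] obtain n where n: "\<bar>prob (UN i<n. B i) - prob (UN i. B i)\<bar> < ep" by auto
  have "(\<integral>x. \<bar>indicat_real (UN i. B i) x - indicator (UN i<n. B i) x\<bar> \<partial>M)
    = (\<integral>x. indicator (UN i. B i) x - indicator (UN i<n. B i) x \<partial>M)"
   by (intro Bochner_Integration.integral_cong) (auto simp: indicator_def)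
  also have "... = prob (UN i. B i) - prob (UN i<n. B i)"
   using B U by (subst Bochner_Integration.integral_diff) (auto intro!: integrable_indicator_event)
  also have "... < ep" using n by linarith
  finally show "EX v. integrable M v & approximable M D S d P v &
    (\<integral>x. \<bar>indicator (UN i. B i) x - v x\<bar> \<partial>M) < ep"
   using fin B by (intro exI[of _ "indicator (UN i<n. B i)"]) (auto intro!: integrable_indicator_event)
 qed
 ultimately show ?case by auto
qed

lemma approximable_integrable:
 assumes ind: "!!B. B : sets M ==> approximable M D S d P (indicator B)" and u: "integrable M u"
 shows "approximable M D S d P u" using u
proof (induct rule: integrable_induct)
 case (base A c)
 show ?case
  by (rule approximable_combine[OF ind[OF base(1)] _ ind[OF base(1)], where h = "%s t. c * s" and K = "\<bar>c\<bar>"])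
    (use base in \<open>auto intro!: loc_scale[OF tb] integrable_indicator_event simp: abs_mult[symmetric] algebra_simps\<close>)
next
 case (add f g)
 show ?case by (rule approximable_combine[OF add(2,1) add(4,3), where h = "%s t. s + t" and K = 1])
    (use add in \<open>auto intro!: loc_add[OF tb]\<close>)
next
 case (lim f s)
 show ?case
 proof (rule approximable_limit[OF lim(5)])
  fix ep :: real assume "0 < ep"
  have "(%i. \<integral>x. \<bar>f x - s i x\<bar> \<partial>M) \<longlonglongrightarrow> (\<integral>x. \<bar>f x - f x\<bar> \<partial>M)"
  proof (rule integral_dominated_convergence[where w = "%x. 3 * \<bar>f x\<bar>"])
   show "AE x in M. (%i. \<bar>f x - s i x\<bar>) \<longlonglongrightarrow> \<bar>f x - f x\<bar>"
    using lim(3) by (intro AE_I2 tendsto_intros) auto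
   show "AE x in M. norm \<bar>f x - s i x\<bar> <= 3 * \<bar>f x\<bar>" for i
   proof (rule AE_I2)
    fix x assume "x : space M"
    from lim(4)[OF this, of i] show "norm \<bar>f x - s i x\<bar> <= 3 * \<bar>f x\<bar>" by (simp add: abs_if split: if_splits)
   qed
  qed (use lim in auto)
  hence "(%i. \<integral>x. \<bar>f x - s i x\<bar> \<partial>M) \<longlonglongrightarrow> 0" by simp
  from LIMSEQ_D[OF this \<open>0 < ep\<close>] obtain n where "\<bar>\<integral>x. \<bar>f x - s n x\<bar> \<partial>M\<bar> < ep" by auto
  thus "EX v. integrable M v & approximable M D S d P v & (\<integral>x. \<bar>f x - v x\<bar> \<partial>M) < ep"
   using lim(1,2) by (intro exI[of _ "s n"]) auto
 qed
qed

end

text \<open>The indicator of an open set is the increasing limit of truncated multiples of the distance to the complement.\<close>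

lemma approximable_open:
 assumes M: "prob_space M" and al: "alphabet A d" and P: "path_map M D (space A) d P" and i: "i : D"
  and U: "openin (Metric_space.mtopology (space A) d) U"
  and meas: "{x : space M. P x i : U} : sets M"
 shows "approximable M D (space A) d P (indicator {x : space M. P x i : U})"
proof (cases "U = space A")
 case True
 interpret prob_space M by (rule M)
 have "approximable M D (space A) d P (indicator (space M))"
  by (rule approximable_cong_AE[OF M alphabet_tbm[OF al] P approximable_const[OF M alphabet_tbm[OF al] P, of 1]])
    (auto intro!: integrable_real_indicator simp: emeasure_eq_measure)
 moreover have "{x : space M. P x i : U} = space M" using P i True by (auto simp: path_map_def)
 ultimately show ?thesis by simp
next
 case False
 interpret prob_space M by (rule M)
 interpret Metric_space "space A" d using al by (simp add: alphabet_def)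
 note tb = alphabet_tbm[OF al]
 have Us: "U <= space A" using openin_subset[OF U] by simp
 hence ne: "space A - U ~= {}" using False by auto
 define g where "g n a = (INF c\<in>space A - U. real n * d (a i) c)" for n and a :: "'c => 'b"
 have lip: "lip_on D (space A) d {i} (real n) (%a. real n * d (a i) c)" if "c : space A" for n c unfolding lip_on_def
 proof (intro conjI ballI)
  fix a b assume ab: "a : D ~> space A" "b : D ~> space A"
  have "\<bar>d (a i) c - d (b i) c\<bar> <= d (a i) (b i)"
   by (rule tbm_reverse_tri[OF tb]) (use ab i that in \<open>auto simp: PiE_iff\<close>)
  hence "real n * \<bar>d (a i) c - d (b i) c\<bar> <= real n * d (a i) (b i)" by (rule mult_left_mono) simp
  thus "\<bar>real n * d (a i) c - real n * d (b i) c\<bar> <= real n * (SUM i:{i}. d (a i) (b i))"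
   by (simp add: right_diff_distrib[symmetric] abs_mult)
 qed (use i in auto)
 have g: "g n : loc D (space A) d" for n unfolding g_def by (rule locI, rule lip_on_cINF[where L = 0]) (use ne lip in auto)
 have f: "(%a. 1 - max 0 (1 - g n a)) : loc D (space A) d" for n by (intro loc_diff[OF tb] loc_max[OF tb] loc_const g)
 define f where "f n a = 1 - max 0 (1 - g n a)" for n a
 have floc: "f n : loc D (space A) d" for n using f[of n] unfolding f_def .
 have g0: "0 <= g n a" for n a unfolding g_def using ne by (intro cINF_greatest) auto
 hence f01: "0 <= f n a" "f n a <= 1" for n a by (auto simp: f_def max_def)
 have conv: "(%n. \<bar>indicator {x : space M. P x i : U} x - f n (P x)\<bar>) \<longlonglongrightarrow> (0::real)" if x: "x : space M" for x
 proof (cases "P x i : U")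
  case True
  then obtain r where r: "0 < r" "mball (P x i) r <= U" using U unfolding openin_mtopology by auto
  obtain N :: nat where N: "1 / r < real N" using reals_Archimedean2 by blast
  have "f n (P x) = 1" if "N <= n" for n
  proof -
   have "1 <= real N * r" using N r by (simp add: field_simps)
   also have "... <= real n * r" using that r by (intro mult_right_mono) auto
   also have "real n * r <= g n (P x)" unfolding g_def
   proof (rule cINF_greatest[OF ne])
    fix c assume c: "c : space A - U"
    have "c ~: mball (P x i) r" using r(2) c by auto
    hence "r <= d (P x i) c" using c subsetD[OF Us True] by (simp add: not_less)
    thus "real n * r <= real n * d (P x i) c" by (intro mult_left_mono) auto
   qed
   finally show ?thesis by (simp add: f_def)
  qed
  hence "EV n. \<bar>indicator {x : space M. P x i : U} x - f n (P x)\<bar> = (0::real)"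
   using True x unfolding eventually_sequentially by auto
  thus ?thesis by (rule tendsto_eventually)
 next
  case False
  have "g n (P x) <= real n * d (P x i) (P x i)" for n
   unfolding g_def using False P x i by (intro cINF_lower bdd_belowI2[of _ 0]) (auto simp: path_map_def)
  moreover have "d (P x i) (P x i) = 0" using P x i by (auto simp: path_map_def PiE_iff)
  ultimately have "g n (P x) = 0" for n using g0[of n "P x"] by (simp add: antisym)
  hence "f n (P x) = 0" for n by (simp add: f_def)
  thus ?thesis using False by simp
 qed
 have "(%n. \<integral>x. \<bar>indicator {x : space M. P x i : U} x - f n (P x)\<bar> \<partial>M) \<longlonglongrightarrow> (\<integral>x. 0 \<partial>M)"
 proof (rule integral_dominated_convergence[where w = "%_. 1"])
  show "AE x in M. norm \<bar>indicator {x : space M. P x i : U} x - f n (P x)\<bar> <= 1" for n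
  proof (rule AE_I2)
   fix x
   from f01[of n "P x"] show "norm \<bar>indicator {x : space M. P x i : U} x - f n (P x)\<bar> <= 1"
    by (auto simp: indicator_def)
  qed
  show "(%x. \<bar>indicator {x : space M. P x i : U} x - f n (P x)\<bar>) : borel_measurable M" for n
   using path_map_loc_measurable[OF tb P floc[of n]] meas by auto
 qed (use conv in auto)
 hence lim0: "(%n. \<integral>x. \<bar>indicator {x : space M. P x i : U} x - f n (P x)\<bar> \<partial>M) \<longlonglongrightarrow> 0" by simp
 show ?thesis unfolding approximable_def
 proof (intro allI impI)
  fix ep :: real assume "0 < ep"
  from LIMSEQ_D[OF lim0 this] obtain n where
   "\<bar>\<integral>x. \<bar>indicator {x : space M. P x i : U} x - f n (P x)\<bar> \<partial>M\<bar> < ep" by auto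
  thus "EX f:loc D (space A) d. (\<integral>x. \<bar>indicator {x : space M. P x i : U} x - f (P x)\<bar> \<partial>M) < ep"
   using floc by (intro bexI[of _ "f n"]) auto
 qed
qed

lemma approximable_coordinate:
 assumes M: "prob_space M" and al: "alphabet A d" and P: "path_map M D (space A) d P" and i: "i : D"
  and meas: "(%x. P x i) : measurable M A" and U: "U : sets A"
 shows "approximable M D (space A) d P (indicator {x : space M. P x i : U})"
proof -
 note tb = alphabet_tbm[OF al]
 let ?G = "{{x : space M. P x i : U} | U. openin (Metric_space.mtopology (space A) d) U}"
 have ms: "{x : space M. P x i : U} : sets M" if "U : sets A" for U
  using measurable_sets[OF meas that] by (simp add: vimage_def Int_def conj_commute)
 have G: "B : sets M & approximable M D (space A) d P (indicator B)" if "B : ?G" for B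
  using that ms[OF alphabet_open[OF al]] approximable_open[OF M al P i] by auto
 have "U : sigma_sets (space A) {U. openin (Metric_space.mtopology (space A) d) U}" using U al by (simp add: alphabet_def)
 hence "{x : space M. P x i : U} : sigma_sets (space M) ?G"
 proof induction
  case (Basic a)
  thus ?case by (intro sigma_sets.Basic) auto
 next
  case Empty
  thus ?case by (simp add: sigma_sets.Empty)
 next
  case (Compl a)
  have "{x : space M. P x i : space A - a} = space M - {x : space M. P x i : a}" using P i by (auto simp: path_map_def)
  thus ?case using Compl by (simp add: sigma_sets.Compl)
 next
  case (Union a)
  have "{x : space M. P x i : (UN j. a j)} = (UN j. {x : space M. P x i : a j})" by auto
  thus ?case using Union by (simp add: sigma_sets.Union)
 qed
 thus ?thesis using approximable_sigma_sets[OF M tb P G] by blast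
qed

lemma approximable_PiM:
 assumes M: "prob_space M" and al: "alphabet A d" and P: "P : measurable M (PiM D (%_. A))"
  and C: "C : sets (PiM D (%_. A))"
 shows "approximable M D (space A) d P (indicator (P -` C Int space M))"
proof -
 note tb = alphabet_tbm[OF al]
 have ci: "(%x. P x i) : measurable M A" if "i : D" for i
  using measurable_compose[OF P measurable_component_singleton[OF that]] .
 have PE: "x : space M ==> P x : D ~> space A" for x using measurable_space[OF P] by (simp add: space_PiM)
 have pm: "path_map M D (space A) d P" unfolding path_map_def
  using PE measurable_compose[OF ci alphabet_dist_measurable[OF al]] by blast
 let ?G = "{{x : space M. P x i : U} | i U. i : D & U : sets A}"
 have G: "B : sets M & approximable M D (space A) d P (indicator B)" if BG: "B : ?G" for B
 proof -
  obtain i U where B: "B = {x : space M. P x i : U}" "i : D" "U : sets A" using BG by blast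
  have "B : sets M" using measurable_sets[OF ci[OF B(2)] B(3)] B(1) by (simp add: vimage_def Int_def conj_commute)
  thus ?thesis using approximable_coordinate[OF M al pm B(2) ci[OF B(2)] B(3)] B(1) by simp
 qed
 have "C : sigma_sets (\<Pi>\<^sub>E i\<in>D. space A) {{f:\<Pi>\<^sub>E i\<in>D. space A. f i : U} | i U. i : D & U : sets A}"
  using C by (simp add: sets_PiM_single)
 hence "P -` C Int space M : sigma_sets (space M) ?G"
 proof induction
  case (Basic a)
  then obtain i U where a: "a = {f:\<Pi>\<^sub>E i\<in>D. space A. f i : U}" "i : D" "U : sets A" by blast
  have "P -` a Int space M = {x : space M. P x i : U}" using PE a(1) by auto
  thus ?case using a by (intro sigma_sets.Basic) auto
 next
  case Empty
  thus ?case by (simp add: sigma_sets.Empty)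
 next
  case (Compl a)
  have "P -` ((\<Pi>\<^sub>E i\<in>D. space A) - a) Int space M = space M - (P -` a Int space M)" using PE by auto
  thus ?case using Compl by (simp add: sigma_sets.Compl)
 next
  case (Union a)
  have eq: "P -` (UN j. a j) Int space M = (UN j. P -` a j Int space M)" by auto
  show ?case unfolding eq by (rule sigma_sets.Union) (rule Union)
 qed
 thus ?thesis using approximable_sigma_sets[OF M tb pm G] by blast
qed

section \<open>Observables of measure-preserving systems\<close>

definition observable :: "'x measure => 'a set => ('a => 'a => real) => ('x => 'a) => bool" where
 "observable M S d af \<longleftrightarrow> (ALL x:space M. af x : S) &
   (ALL c:S. (%x. d (af x) c) : borel_measurable M)"

definition orb ::
  "('g, 'm) monoid_scheme => ('g => 'x => 'x) => ('x => 'a) => 'x => 'g => 'a" where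
 "orb Gm T af x = (\<lambda>g\<in>carrier Gm. af (T g x))"

definition obs_int ::
  "('g, 'm) monoid_scheme => 'x measure => ('g => 'x => 'x) => ('x => 'a) =>
    (('g => 'a) => real) => real" where
 "obs_int Gm M T af f = (\<integral>x. f (orb Gm T af x) \<partial>M)"

definition generating ::
  "('g, 'm) monoid_scheme => 'x measure => ('g => 'x => 'x) => 'a set =>
    ('a => 'a => real) => ('x => 'a) => bool" where
 "generating Gm M T S d af \<longleftrightarrow>
   (ALL B:sets M. approximable M (carrier Gm) S d (orb Gm T af) (indicator B))"

lemma orb_path_map:
 assumes "pmp Gm M T" "observable M S d af"
 shows "path_map M (carrier Gm) S d (orb Gm T af)" unfolding path_map_def
proof (intro conjI ballI)
 fix x assume "x : space M"
 thus "orb Gm T af x : carrier Gm ~> S" using assms pmpD(6)[OF assms(1)] by (auto simp: orb_def observable_def)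
next
 fix i c assume i: "i : carrier Gm" and c: "c : S"
 hence "(%x. d (af (T i x)) c) : borel_measurable M"
  using measurable_compose[OF pmpD(2)[OF assms(1) i], of "%x. d (af x) c"] assms(2) by (auto simp: observable_def)
 thus "(%x. d (orb Gm T af x i) c) : borel_measurable M" using i by (simp add: orb_def)
qed

lemma orb_in: "pmp Gm M T ==> observable M S d af ==> x : space M ==> orb Gm T af x : carrier Gm ~> S"
 using orb_path_map[of Gm M T S d af] by (simp add: path_map_def)

lemma obs_int_loc_integrable:
 assumes "tbm S d" "pmp Gm M T" "observable M S d af" "f : loc (carrier Gm) S d"
 shows "integrable M (%x. f (orb Gm T af x))"
 by (rule path_map_loc_integrable[OF pmpD(1)[OF assms(2)] assms(1) orb_path_map[OF assms(2,3)] assms(4)])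

lemma generating_approx:
 assumes "tbm S d" "pmp Gm M T" "observable M S d af" "generating Gm M T S d af" "integrable M u" "0 < ep"
 obtains f where "f : loc (carrier Gm) S d" "(\<integral>x. \<bar>u x - f (orb Gm T af x)\<bar> \<partial>M) < ep"
proof -
 have "approximable M (carrier Gm) S d (orb Gm T af) u"
  by (rule approximable_integrable[OF pmpD(1)[OF assms(2)] assms(1) orb_path_map[OF assms(2,3)] _ assms(5)])
    (use assms(4) in \<open>simp add: generating_def\<close>)
 thus ?thesis using that \<open>0 < ep\<close> unfolding approximable_def by auto
qed

lemma loc_entropy_cong:
 assumes "!!f. f : loc (carrier Gm) S d ==> I f = I' f"
 shows "loc_entropy L Gm V sg S d I = loc_entropy L Gm V sg S d I'"
proof -
 have *: "loc_models Gm s W S I F ep = loc_models Gm s W S I' F ep" if "(F, ep) : loc_tests (carrier Gm) S d" for F ep s and W :: "'v set"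
  using that assms by (auto simp: loc_models_def loc_tests_def subset_iff)
 show ?thesis unfolding loc_entropy_def by (intro SUP_cong INF_cong refl) (auto simp: * case_prod_beta)
qed

lemma metric_process_alphabet:
 assumes "metric_process Gm A d mu"
 shows "alphabet A d" "mu : Prob Gm A" using assms by (auto simp: metric_process_def alphabet_def Prob_def)

text \<open>The label at the unit in the isomorphic process is an observable; the isomorphism and countability
of the group identify its orbit with the process almost everywhere.\<close>

lemma metric_model_observable:
 assumes grp: "group Gm" and cnt: "countable (carrier Gm)" and pm: "pmp Gm M T"
  and mm: "is_metric_model Gm M T (A, d, mu)"
 obtains af where "observable M (space A) d af" "generating Gm M T (space A) d af"
  "!!f. f : loc (carrier Gm) (space A) d ==> (\<integral>p. f p \<partial>mu) = obs_int Gm M T af f"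
proof -
 interpret group Gm by (rule grp)
 interpret prob_space M by (rule pmpD(1)[OF pm])
 have mp: "metric_process Gm A d mu" and iso: "isomorphic_systems Gm M T mu (shift Gm)"
  using mm by (auto simp: is_metric_model_def)
 note al = metric_process_alphabet[OF mp]
 note tb = alphabet_tbm[OF al(1)]
 have smu: "sets mu = sets (PiM (carrier Gm) (%_. A))" using al(2) by (simp add: Prob_def path_space_def)
 obtain ph ps where ph: "ph : measurable M mu" and ps: "ps : measurable mu M" and dph: "distr M mu ph = mu"
  and inv: "AE x in M. ps (ph x) = x" and eqv: "!!g. g : carrier Gm ==> AE x in M. ph (T g x) = shift Gm g (ph x)"
  using iso unfolding isomorphic_systems_def by blast
 have ph': "ph : measurable M (PiM (carrier Gm) (%_. A))" using ph smu by (simp cong: measurable_cong_sets)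
 define af where "af x = ph x \<one>\<^bsub>Gm\<^esub>" for x
 have afm: "af : measurable M A" unfolding af_def using measurable_compose[OF ph' measurable_component_singleton] by simp
 have obs: "observable M (space A) d af" unfolding observable_def
  using measurable_space[OF afm] measurable_compose[OF afm alphabet_dist_measurable[OF al(1)]] by blast
 have "AE x in M. ALL g:carrier Gm. ph (T g x) = shift Gm g (ph x)" using eqv cnt by (simp add: AE_ball_countable)
 hence orb: "AE x in M. ph x = orb Gm T af x"
 proof (rule AE_mp, intro AE_I2 impI)
  fix x assume x: "x : space M" and eq: "ALL g:carrier Gm. ph (T g x) = shift Gm g (ph x)"
  have "ph x : carrier Gm ~> space A" using measurable_space[OF ph' x] by (simp add: space_PiM)
  thus "ph x = orb Gm T af x" using eq by (intro ext) (auto simp: orb_def af_def shift_def PiE_iff extensional_def)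
 qed
 have pmph: "path_map M (carrier Gm) (space A) d ph" unfolding path_map_def
  using measurable_space[OF ph'] measurable_compose[OF ph' path_dist_measurable[OF al(1)]] by (auto simp: space_PiM)
 have gen: "generating Gm M T (space A) d af" unfolding generating_def
 proof
  fix B assume B: "B : sets M"
  define C where "C = ps -` B Int space mu"
  have "C : sets (PiM (carrier Gm) (%_. A))" using measurable_sets[OF ps B] smu by (simp add: C_def)
  hence ap: "approximable M (carrier Gm) (space A) d ph (indicator (ph -` C Int space M))"
   by (rule approximable_PiM[OF pmpD(1)[OF pm] al(1) ph'])
  have ev: "ph -` C Int space M : sets M" using measurable_sets[OF ph measurable_sets[OF ps B]] by (simp add: C_def)
  have ae: "AE x in M. indicat_real (ph -` C Int space M) x = indicator B x" using inv
  proof (rule AE_mp, intro AE_I2 impI)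
   fix x assume x: "x : space M" "ps (ph x) = x"
   thus "indicat_real (ph -` C Int space M) x = indicator B x"
    using measurable_space[OF ph x(1)] by (auto simp: C_def indicator_def)
  qed
  have "approximable M (carrier Gm) (space A) d ph (indicator B)"
   by (rule approximable_cong_AE[OF pmpD(1)[OF pm] tb pmph ap _ _ ae])
     (use ev B in \<open>auto intro!: integrable_real_indicator simp: emeasure_eq_measure\<close>)
  moreover have "(\<integral>x. \<bar>indicator B x - f (ph x)\<bar> \<partial>M) = (\<integral>x. \<bar>indicator B x - f (orb Gm T af x)\<bar> \<partial>M)"
   if "f : loc (carrier Gm) (space A) d" for f
   using orb B path_map_loc_measurable[OF tb pmph that] path_map_loc_measurable[OF tb orb_path_map[OF pm obs] that]
   by (intro integral_cong_AE) (auto elim: AE_mp)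
  ultimately show "approximable M (carrier Gm) (space A) d (orb Gm T af) (indicator B)" unfolding approximable_def by metis
 qed
 have "(\<integral>p. f p \<partial>mu) = obs_int Gm M T af f" if f: "f : loc (carrier Gm) (space A) d" for f
 proof -
  have fm: "f : borel_measurable mu" using loc_measurable_PiM[OF al(1) f] smu by (simp cong: measurable_cong_sets)
  have "(\<integral>p. f p \<partial>mu) = (\<integral>x. f (ph x) \<partial>M)" by (subst dph[symmetric]) (rule integral_distr[OF ph fm])
  also have "... = (\<integral>x. f (orb Gm T af x) \<partial>M)"
   using orb path_map_loc_measurable[OF tb pmph f] path_map_loc_measurable[OF tb orb_path_map[OF pm obs] f]
   by (intro integral_cong_AE) (auto elim: AE_mp)
  finally show ?thesis by (simp add: obs_int_def)
 qed
 with obs gen show ?thesis by (rule that)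
qed

definition almost_action :: "('g, 'm) monoid_scheme => (nat => 'v set) => (nat => 'g => 'v => 'v) => bool" where
 "almost_action Gm V sg \<longleftrightarrow> finite_action Gm V sg &
   (ALL g:carrier Gm. ALL h:carrier Gm.
    (%n. real (card {v : V n. sg n g (sg n h v) = sg n (g \<otimes>\<^bsub>Gm\<^esub> h) v}) / real (card (V n)))
     \<longlonglongrightarrow> 1)"

lemma almost_action_bad:
 assumes "almost_action Gm V sg" "g : carrier Gm" "h : carrier Gm" "0 < \<theta>"
 shows "EV n. real (card {v : V n. sg n g (sg n h v) ~= sg n (g \<otimes>\<^bsub>Gm\<^esub> h) v}) < \<theta> * real (card (V n))"
proof -
 have "(%n. real (card {v : V n. sg n g (sg n h v) = sg n (g \<otimes>\<^bsub>Gm\<^esub> h) v}) / real (card (V n))) \<longlonglongrightarrow> 1"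
  using assms by (simp add: almost_action_def)
 hence "EV n. 1 - \<theta> < real (card {v : V n. sg n g (sg n h v) = sg n (g \<otimes>\<^bsub>Gm\<^esub> h) v}) / real (card (V n))"
  by (rule order_tendstoD) (use assms in simp)
 thus ?thesis
 proof (rule eventually_mono)
  fix n
  let ?A = "{v : V n. sg n g (sg n h v) = sg n (g \<otimes>\<^bsub>Gm\<^esub> h) v}" and ?B = "{v : V n. sg n g (sg n h v) ~= sg n (g \<otimes>\<^bsub>Gm\<^esub> h) v}"
  assume *: "1 - \<theta> < real (card ?A) / real (card (V n))"
  have fa: "finite_action Gm V sg" using assms by (simp add: almost_action_def)
  have "card (?A Un ?B) = card ?A + card ?B" using finite_actionD(1)[OF fa] by (intro card_Un_disjoint) auto
  moreover have "?A Un ?B = V n" by auto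
  ultimately have "real (card (V n)) = real (card ?A) + real (card ?B)" by simp
  moreover have "(1 - \<theta>) * real (card (V n)) < real (card ?A)"
   using * finite_actionD(5)[OF fa, of n] by (simp add: field_simps)
  ultimately show "real (card ?B) < \<theta> * real (card (V n))" by (simp add: algebra_simps)
 qed
qed

section \<open>Pairs of observables and shifted labellings\<close>

definition pair_dist :: "('a => 'a => real) => ('b => 'b => real) => 'a \<times> 'b => 'a \<times> 'b => real" where
 "pair_dist d e p q = d (fst p) (fst q) + e (snd p) (snd q)"

definition pair_path :: "'i set => ('i => 'a) => ('i => 'b) => 'i => 'a \<times> 'b" where
 "pair_path D a b = (\<lambda>i\<in>D. (a i, b i))"

lemma pair_path_in: "a : D ~> S ==> b : D ~> S' ==> pair_path D a b : D ~> S \<times> S'" by (auto simp: pair_path_def)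

lemma pair_path_apply [simp]: "i : D ==> pair_path D a b i = (a i, b i)" by (simp add: pair_path_def)

lemma tbm_pair:
 assumes "tbm S d" "tbm S' e"
 shows "tbm (S \<times> S') (pair_dist d e)" unfolding tbm_def
proof (intro conjI allI impI)
 show "Metric_space (S \<times> S') (pair_dist d e)"
 proof
  fix p q r
  show "0 <= pair_dist d e p q" by (simp add: pair_dist_def tbm_nonneg[OF assms(1)] tbm_nonneg[OF assms(2)])
  show "pair_dist d e p q = pair_dist d e q p" unfolding pair_dist_def by (metis tbm_sym[OF assms(1)] tbm_sym[OF assms(2)])
  assume p: "p : S \<times> S'" and q: "q : S \<times> S'"
  have "d (fst p) (fst q) = 0 \<longleftrightarrow> fst p = fst q" "e (snd p) (snd q) = 0 \<longleftrightarrow> snd p = snd q"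
   using p q Metric_space.zero[OF tbm_metric[OF assms(1)]] Metric_space.zero[OF tbm_metric[OF assms(2)]] by auto
  thus "(pair_dist d e p q = 0) = (p = q)"
   by (simp add: pair_dist_def prod_eq_iff add_nonneg_eq_0_iff tbm_nonneg[OF assms(1)] tbm_nonneg[OF assms(2)])
  assume r: "r : S \<times> S'"
  show "pair_dist d e p r <= pair_dist d e p q + pair_dist d e q r"
   using tbm_tri[OF assms(1), of "fst p" "fst q" "fst r"] tbm_tri[OF assms(2), of "snd p" "snd q" "snd r"] p q r
   by (auto simp: pair_dist_def)
 qed
next
 fix r :: real assume "0 < r"
 hence r: "0 < r / 2" by simp
 obtain K where K: "K <= S" "finite K" "!!x. x : S ==> EX y:K. d x y < r / 2" by (rule tbm_net[OF assms(1) r]) auto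
 obtain K' where K': "K' <= S'" "finite K'" "!!x. x : S' ==> EX y:K'. e x y < r / 2" by (rule tbm_net[OF assms(2) r]) auto
 have "EX q:K \<times> K'. pair_dist d e p q < r" if p: "p : S \<times> S'" for p
 proof -
  obtain y y' where "y : K" "d (fst p) y < r / 2" "y' : K'" "e (snd p) y' < r / 2"
   using K(3)[of "fst p"] K'(3)[of "snd p"] p by (auto simp: mem_Times_iff)
  thus ?thesis by (intro bexI[of _ "(y, y')"]) (auto simp: pair_dist_def)
 qed
 thus "\<exists>K\<subseteq>S \<times> S'. finite K & (ALL p:S \<times> S'. EX q:K. pair_dist d e p q < r)"
  using K K' by (intro exI[of _ "K \<times> K'"]) auto
qed

lemma observable_pair:
 assumes "observable M S d af" "observable M S' e bt"
 shows "observable M (S \<times> S') (pair_dist d e) (%x. (af x, bt x))"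
 using assms unfolding observable_def pair_dist_def by (auto intro!: borel_measurable_add)

lemma lip_on_add:
 assumes "lip_on D S d E C f" "lip_on D S d E C' g"
 shows "lip_on D S d E (C + C') (%a. f a + g a)" unfolding lip_on_def
proof (intro conjI ballI)
 fix a b assume ab: "a : D ~> S" "b : D ~> S"
 show "\<bar>f a + g a - (f b + g b)\<bar> <= (C + C') * (SUM i:E. d (a i) (b i))"
  using lip_onD[OF assms(1) ab] lip_onD[OF assms(2) ab] unfolding distrib_right by linarith
qed (use assms in \<open>auto simp: lip_on_def\<close>)

lemma lip_on_scale:
 assumes "lip_on D S d E C f" "0 <= k"
 shows "lip_on D S d E (k * C) (%a. k * f a)" unfolding lip_on_def
proof (intro conjI ballI)
 fix a b assume ab: "a : D ~> S" "b : D ~> S"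
 have "k * \<bar>f a - f b\<bar> <= k * (C * (SUM i:E. d (a i) (b i)))"
  by (rule mult_left_mono[OF lip_onD[OF assms(1) ab] assms(2)])
 thus "\<bar>k * f a - k * f b\<bar> <= k * C * (SUM i:E. d (a i) (b i))"
  using assms(2) by (simp add: right_diff_distrib[symmetric] abs_mult mult.assoc)
qed (use assms in \<open>auto simp: lip_on_def\<close>)

lemma lip_on_const: "finite E ==> E <= D ==> lip_on D S d E 0 (%_. c)" by (simp add: lip_on_def)

lemma lip_on_sum:
 assumes "finite E" "E <= D" "finite J" "!!j. j : J ==> lip_on D S d E C (f j)"
 shows "lip_on D S d E (real (card J) * C) (%a. SUM j:J. f j a)" using assms(3,4)
proof (induction J rule: finite_induct)
 case empty
 show ?case using lip_on_const[OF assms(1,2)] by simp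
next
 case (insert j J)
 hence "lip_on D S d E (C + real (card J) * C) (%a. f j a + (SUM j:J. f j a))" by (intro lip_on_add) auto
 thus ?case using insert by (simp add: algebra_simps)
qed

lemma shift_path_in:
 assumes "group Gm" "g : carrier Gm" "a : carrier Gm ~> S"
 shows "shift Gm g a : carrier Gm ~> S"
proof -
 interpret group Gm by fact
 show ?thesis using assms(2,3) by (auto simp: shift_def PiE_iff)
qed

lemma lip_on_shift:
 assumes "group Gm" "g : carrier Gm" "lip_on (carrier Gm) S d E C f"
 shows "lip_on (carrier Gm) S d ((%i. i \<otimes>\<^bsub>Gm\<^esub> g) ` E) C (%a. f (shift Gm g a))" unfolding lip_on_def
proof (intro conjI ballI)
 interpret group Gm by fact
 have E: "finite E" "E <= carrier Gm" "0 <= C" using assms(3) by (auto simp: lip_on_def)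
 thus "finite ((%i. i \<otimes>\<^bsub>Gm\<^esub> g) ` E)" "(%i. i \<otimes>\<^bsub>Gm\<^esub> g) ` E <= carrier Gm" "0 <= C"
  using assms(2) by auto
 fix a b assume ab: "a : carrier Gm ~> S" "b : carrier Gm ~> S"
 have "\<bar>f (shift Gm g a) - f (shift Gm g b)\<bar> <= C * (SUM i:E. d (shift Gm g a i) (shift Gm g b i))"
  by (intro lip_onD[OF assms(3)] shift_path_in assms ab)
 also have "(SUM i:E. d (shift Gm g a i) (shift Gm g b i)) = (SUM i:E. d (a (i \<otimes>\<^bsub>Gm\<^esub> g)) (b (i \<otimes>\<^bsub>Gm\<^esub> g)))"
  using E by (intro sum.cong) (auto simp: shift_def)
 also have "... = (SUM i:(%i. i \<otimes>\<^bsub>Gm\<^esub> g) ` E. d (a i) (b i))"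
  using E assms(2) by (subst sum.reindex) (auto intro!: inj_onI simp: subset_iff)
 finally show "\<bar>f (shift Gm g a) - f (shift Gm g b)\<bar> <= C * (SUM i:(%i. i \<otimes>\<^bsub>Gm\<^esub> g) ` E. d (a i) (b i))" .
qed

lemma shift_orb:
 assumes "group Gm" "pmp Gm M T" "g : carrier Gm" "x : space M"
 shows "shift Gm g (orb Gm T af x) = orb Gm T af (T g x)"
proof -
 interpret group Gm by fact
 show ?thesis unfolding shift_def orb_def using pmpD(5)[OF assms(2)] assms(3,4) by (intro restrict_ext) auto
qed

lemma pullback_in:
 assumes "finite_action Gm V sg" "x : V n ~> S" "v : V n"
 shows "pullback_name Gm (sg n) x v : carrier Gm ~> S"
 using assms finite_actionD(4)[OF assms(1)] by (fastforce simp: pullback_name_def PiE_iff)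

lemma pullback_pair:
 "pullback_name Gm s (%v. (x v, y v)) v = pair_path (carrier Gm) (pullback_name Gm s x v) (pullback_name Gm s y v)"
 by (auto simp: pullback_name_def pair_path_def)

lemma emp_avg_reindex:
 assumes "finite_action Gm V sg" "g : carrier Gm"
 shows "(SUM v:V n. u (sg n g v)) = (SUM v:V n. u v :: real)"
 using finite_actionD(3)[OF assms] by (rule sum.reindex_bij_betw)

lemma shifted_pullback_sum:
 assumes grp: "group Gm" and fa: "finite_action Gm V sg" and tb: "tbm S d"
  and lip: "!!y. y : S' ==> lip_on (carrier Gm) S d E C (%a. c a y)"
  and bnd: "!!a y. a : carrier Gm ~> S ==> y : S' ==> 0 <= c a y & c a y <= K"
  and x: "x : V n ~> S" and y: "!!v. v : V n ==> y v : S'" and g: "g : carrier Gm"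
  and E: "finite E" "E <= carrier Gm"
  and bad: "!!i. i : E ==> real (card {v : V n. sg n i (sg n g v) ~= sg n (i \<otimes>\<^bsub>Gm\<^esub> g) v}) <= \<theta>"
 shows "(SUM v:V n. c (shift Gm g (pullback_name Gm (sg n) x v)) (y (sg n g v)))
  <= (SUM v:V n. c (pullback_name Gm (sg n) x v) (y v)) + K * (real (card E) * \<theta>)"
proof -
 let ?p = "pullback_name Gm (sg n) x"
 let ?B = "%i. {v : V n. sg n i (sg n g v) ~= sg n (i \<otimes>\<^bsub>Gm\<^esub> g) v}"
 note V = finite_actionD[OF fa]
 have sgV: "sg n g v : V n" if "v : V n" for v using V(4)[OF g, of n] that by auto
 have K0: "0 <= K" if "v : V n" for v using bnd[OF pullback_in[OF fa x that] y[OF that]] by linarith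
 have pt: "c (shift Gm g (?p v)) (y (sg n g v)) <= c (?p (sg n g v)) (y (sg n g v)) + K * (SUM i:E. indicator (?B i) v)"
  if v: "v : V n" for v
 proof (cases "ALL i:E. v ~: ?B i")
  case True
  have 1: "shift Gm g (?p v) : carrier Gm ~> S" by (intro shift_path_in grp g pullback_in[OF fa x] v)
  have 2: "?p (sg n g v) : carrier Gm ~> S" by (intro pullback_in[OF fa x] sgV v)
  have "d (shift Gm g (?p v) i) (?p (sg n g v) i) = 0" if i: "i : E" for i
  proof -
   interpret group Gm by (rule grp)
   have "shift Gm g (?p v) i = ?p (sg n g v) i" using True i v g E by (auto simp: shift_def pullback_name_def)
   thus ?thesis using 2 i E by (auto intro!: tbm_zero[OF tb] simp: PiE_iff)
  qed
  hence "(SUM i:E. d (shift Gm g (?p v) i) (?p (sg n g v) i)) = 0" by simp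
  hence "\<bar>c (shift Gm g (?p v)) (y (sg n g v)) - c (?p (sg n g v)) (y (sg n g v))\<bar> <= 0"
   using lip_onD[OF lip[OF y[OF sgV[OF v]]] 1 2] by simp
  moreover have "0 <= K * (SUM i:E. indicator (?B i) v)" using K0[OF v] by (intro mult_nonneg_nonneg sum_nonneg) auto
  ultimately show ?thesis by linarith
 next
  case False
  then obtain i where i: "i : E" "v : ?B i" by blast
  have "(1::real) = indicator (?B i) v" using i by simp
  also have "... <= (SUM i:E. indicator (?B i) v)" using i E by (intro member_le_sum) auto
  finally have "K * 1 <= K * (SUM i:E. indicator (?B i) v)" using K0[OF v] by (rule mult_left_mono)
  moreover have "c (shift Gm g (?p v)) (y (sg n g v)) <= K"
   using bnd[OF shift_path_in[OF grp g pullback_in[OF fa x v]] y[OF sgV[OF v]]] by simp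
  moreover have "0 <= c (?p (sg n g v)) (y (sg n g v))" using bnd[OF pullback_in[OF fa x sgV[OF v]] y[OF sgV[OF v]]] by simp
  ultimately show ?thesis by linarith
 qed
 have "(SUM v:V n. c (shift Gm g (?p v)) (y (sg n g v)))
   <= (SUM v:V n. c (?p (sg n g v)) (y (sg n g v)) + K * (SUM i:E. indicator (?B i) v))" by (intro sum_mono pt)
 also have "... = (SUM v:V n. c (?p (sg n g v)) (y (sg n g v))) + K * (SUM v:V n. SUM i:E. indicator (?B i) v)"
  by (simp add: sum.distrib sum_distrib_left)
 also have "(SUM v:V n. c (?p (sg n g v)) (y (sg n g v))) = (SUM v:V n. c (?p v) (y v))"
  by (rule emp_avg_reindex[OF fa g, of "%v. c (?p v) (y v)"])
 also have "(SUM v:V n. SUM i:E. indicator (?B i) v) = (SUM i:E. real (card (?B i)))"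
  using V(1) by (subst sum.swap) (auto intro!: sum.cong simp: indicator_def sum.If_cases Int_def conj_commute)
 also have "K * (SUM i:E. real (card (?B i))) <= K * (SUM i:E. \<theta>)"
  using K0 V(2)[of n] bad by (intro mult_left_mono sum_mono) auto
 finally show ?thesis by simp
qed

section \<open>Extending a good model to a second observable\<close>

text \<open>The labels of the second observable are approximately given by a local function of the first. Reading this
function off a good model, and choosing a nearest label, extends the model to a good model of the pair.
The almost action is used to compare the shifted labellings with translates of the path.\<close>

lemma joint_extension:
 assumes grp: "group Gm" and pm: "pmp Gm M T" and aa: "almost_action Gm V sg"
  and tb: "tbm S d" and tb': "tbm S' e" and af: "observable M S d af" and bt: "observable M S' e bt"
  and gen: "generating Gm M T S d af"
  and F: "finite F" "F <= loc (carrier Gm) (S \<times> S') (pair_dist d e)" and "0 < ep"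
 obtains H et where "(H, et) : loc_tests (carrier Gm) S d"
  "EV n. ALL x:loc_models Gm (sg n) (V n) S (obs_int Gm M T af) H et.
   EX y:V n ~> S'. ALL f:F. \<bar>emp_avg Gm (sg n) (V n) (%v. (x v, y v)) f
    - obs_int Gm M T (%x. (af x, bt x)) f\<bar> < ep"
proof -
 let ?D = "carrier Gm"
 let ?P = "?D ~> S" and ?P' = "?D ~> S'"
 let ?o = "orb Gm T af" and ?o' = "orb Gm T bt"
 interpret group Gm by (rule grp)
 interpret prob_space M by (rule pmpD(1)[OF pm])
 have fa: "finite_action Gm V sg" using aa by (simp add: almost_action_def)
 note V = finite_actionD[OF fa]
 note tbp = tbm_pair[OF tb tb']
 note afbt = observable_pair[OF af bt]
 have orb_pair: "orb Gm T (%x. (af x, bt x)) x = pair_path ?D (?o x) (?o' x)" for x by (auto simp: orb_def pair_path_def)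
 obtain x0 where x0: "x0 : space M" using not_empty by blast
 hence S'ne: "S' ~= {}" and Sne: "S ~= {}" using af bt by (auto simp: observable_def)
 have o_in: "?o x : ?P" "?o' x : ?P'" if "x : space M" for x using orb_in[OF pm af that] orb_in[OF pm bt that] by auto
 have P'ne: "?P' ~= {}" using o_in(2)[OF x0] by blast

 obtain E C where EC: "finite E" "E <= ?D" "0 < C"
  "!!f. f : F ==> lip_on ?D (S \<times> S') (pair_dist d e) E C f" by (rule loc_common[OF tbp F]) auto
 define et where "et = ep / 10"
 have et: "0 < et" using \<open>0 < ep\<close> by (simp add: et_def)
 define q where "q = C * (real (card E) + 1)"
 have q: "0 < q" "C * real (card E) <= q" using EC by (auto simp: q_def)
 define rh where "rh = et / (2 * q)"
 have rh: "0 < rh" using et q by (simp add: rh_def)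
 have rhq: "C * real (card E) * (2 * rh) <= et"
 proof -
  have "C * real (card E) * (2 * rh) <= q * (2 * rh)" using q rh by (intro mult_right_mono) auto
  also have "... = et" using q by (simp add: rh_def)
  finally show ?thesis .
 qed
 define ep0 where "ep0 = et / q"
 have ep0: "0 < ep0" using et q by (simp add: ep0_def)
 have ep0q: "C * real (card E) * ep0 <= et"
 proof -
  have "C * real (card E) * ep0 <= q * ep0" using q ep0 by (intro mult_right_mono) auto
  also have "... = et" using q by (simp add: ep0_def)
  finally show ?thesis .
 qed

 obtain N where N: "N <= S'" "finite N" "!!y. y : S' ==> EX b:N. e y b < rh" by (rule tbm_net[OF tb' rh]) auto
 obtain R' where R': "0 < R'" "!!x y. x : S' ==> y : S' ==> e x y <= R'" by (rule tbm_bounded[OF tb']) auto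
 have int_e: "integrable M (%x. e (bt x) b)" if "b : S'" for b
  using bt that R' by (intro integrable_const_bound[of _ R']) (auto simp: observable_def tbm_nonneg[OF tb'])
 have "ALL b:N. EX f. f : loc ?D S d & (\<integral>x. \<bar>e (bt x) b - f (?o x)\<bar> \<partial>M) < ep0 / (real (card N) + 1)"
 proof
  fix b assume "b : N"
  hence "integrable M (%x. e (bt x) b)" using int_e N by auto
  moreover have "0 < ep0 / (real (card N) + 1)" using ep0 by (simp add: add_nonneg_pos)
  ultimately obtain f where "f : loc ?D S d" "(\<integral>x. \<bar>e (bt x) b - f (?o x)\<bar> \<partial>M) < ep0 / (real (card N) + 1)"
   by (rule generating_approx[OF tb pm af gen]) auto
  thus "EX f. f : loc ?D S d & (\<integral>x. \<bar>e (bt x) b - f (?o x)\<bar> \<partial>M) < ep0 / (real (card N) + 1)" by blast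
 qed
 then obtain Ph where Ph: "ALL b:N. Ph b : loc ?D S d & (\<integral>x. \<bar>e (bt x) b - Ph b (?o x)\<bar> \<partial>M) < ep0 / (real (card N) + 1)"
  by (rule bchoice[THEN exE])
 have "Ph ` N <= loc ?D S d" using Ph by auto
 then obtain Ec Cc where Ec: "finite Ec" "Ec <= ?D" "0 < Cc" "!!f. f : Ph ` N ==> lip_on ?D S d Ec Cc f"
  by (rule loc_common[OF tb finite_imageI[OF N(2)]]) auto
 define c where "c a y = (SUM b:N. \<bar>e y b - Ph b a\<bar>)" for a y
 define C1 where "C1 = real (card N) * Cc"
 have c0: "0 <= c a y" for a y by (auto simp: c_def intro!: sum_nonneg)
 have c_lip: "lip_on ?D S d Ec C1 (%a. c a y)" for y unfolding c_def C1_def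
 proof (rule lip_on_sum[OF Ec(1,2) N(2)])
  fix b assume "b : N"
  hence l: "lip_on ?D S d Ec Cc (Ph b)" using Ec by auto
  show "lip_on ?D S d Ec Cc (%a. \<bar>e y b - Ph b a\<bar>)" unfolding lip_on_def
  proof (intro conjI ballI)
   fix a a' assume "a : ?P" "a' : ?P"
   from lip_onD[OF l this] show "\<bar>\<bar>e y b - Ph b a\<bar> - \<bar>e y b - Ph b a'\<bar>\<bar> <= Cc * (SUM i:Ec. d (a i) (a' i))"
    by linarith
  qed (use Ec in auto)
 qed
 have c_tri: "e y y' <= c a y + c a y' + 2 * rh" if y: "y : S'" "y' : S'" for a y y'
 proof -
  obtain b where b: "b : N" "e y' b < rh" using N(3)[OF y(2)] by blast
  have "\<bar>e z b - Ph b a\<bar> <= c a z" for z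
   unfolding c_def using b N by (intro member_le_sum[of b N "%b. \<bar>e z b - Ph b a\<bar>"]) auto
  from this[of y] this[of y'] have "e y b <= c a y + c a y' + rh" using b by linarith
  moreover have "e y y' <= e y b + e b y'" using y b N by (intro tbm_tri[OF tb']) auto
  moreover have "e b y' = e y' b" by (rule tbm_sym[OF tb'])
  ultimately show ?thesis using b by linarith
 qed
 obtain Kc where Kc: "0 < Kc" "!!a y. a : ?P ==> y : S' ==> c a y <= Kc"
 proof -
  have "(%a. SUM b:N. \<bar>Ph b a\<bar>) : loc ?D S d" using Ph by (intro loc_sum[OF tb] loc_abs[OF tb]) auto
  then obtain B where B: "0 < B" "!!a. a : ?P ==> \<bar>SUM b:N. \<bar>Ph b a\<bar>\<bar> <= B" by (rule loc_bounded[OF tb]) auto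
  have "c a y <= real (card N) * R' + B" if ay: "a : ?P" "y : S'" for a y
  proof -
   have "c a y <= (SUM b:N. R' + \<bar>Ph b a\<bar>)" unfolding c_def
   proof (rule sum_mono)
    fix b assume "b : N"
    hence "e y b <= R'" "0 <= e y b" using R' N ay tbm_nonneg[OF tb'] by auto
    thus "\<bar>e y b - Ph b a\<bar> <= R' + \<bar>Ph b a\<bar>" by linarith
   qed
   also have "... = real (card N) * R' + (SUM b:N. \<bar>Ph b a\<bar>)" by (simp add: sum.distrib)
   also have "... <= real (card N) * R' + B" using B(2)[OF ay(1)] by linarith
   finally show ?thesis .
  qed
  moreover have "0 < real (card N) * R' + B" using B R' by (intro add_nonneg_pos) auto
  ultimately show ?thesis by (intro that) auto
 qed
 have int_c: "integrable M (%x. c (?o x) (bt x))" unfolding c_def using Ph N int_e obs_int_loc_integrable[OF tb pm af]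
  by (intro Bochner_Integration.integrable_sum integrable_abs Bochner_Integration.integrable_diff) auto
 have I_c: "(\<integral>x. c (?o x) (bt x) \<partial>M) <= ep0"
 proof -
  have "(\<integral>x. c (?o x) (bt x) \<partial>M) = (SUM b:N. \<integral>x. \<bar>e (bt x) b - Ph b (?o x)\<bar> \<partial>M)"
   unfolding c_def using Ph N int_e obs_int_loc_integrable[OF tb pm af]
   by (intro Bochner_Integration.integral_sum integrable_abs Bochner_Integration.integrable_diff) auto
  also have "... <= (SUM b:N. ep0 / (real (card N) + 1))" using Ph by (intro sum_mono) auto
  also have "... = (real (card N) / (real (card N) + 1)) * ep0" by simp
  also have "... <= 1 * ep0" using ep0 by (intro mult_right_mono) auto
  finally show ?thesis by simp
 qed

 define H0 where "H0 a = (INF y\<in>S'. c a y)" for a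
 have H0: "H0 : loc ?D S d" unfolding H0_def by (rule locI, rule lip_on_cINF[where L = 0]) (use S'ne c_lip c0 in auto)
 have H0_le: "H0 a <= c a y" if "y : S'" for a y
  unfolding H0_def using c0 that by (intro cINF_lower bdd_belowI2[of _ 0]) auto
 have I_H0: "obs_int Gm M T af H0 <= ep0"
 proof -
  have "obs_int Gm M T af H0 <= (\<integral>x. c (?o x) (bt x) \<partial>M)"
   unfolding obs_int_def using H0_le bt obs_int_loc_integrable[OF tb pm af H0] int_c
   by (intro integral_mono) (auto simp: observable_def)
  thus ?thesis using I_c by linarith
 qed

 define sc where "sc a b = (SUM g:E. c (shift Gm g a) (b g))" for a b
 have sc0: "0 <= sc a b" for a b unfolding sc_def by (intro sum_nonneg c0)
 define Rf where "Rf f a = (INF b\<in>?P'. f (pair_path ?D a b) + C * sc a b)" for f a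
 define Et where "Et = E Un (UN g:E. (%i. i \<otimes>\<^bsub>Gm\<^esub> g) ` Ec)"
 have Et: "finite Et" "Et <= ?D" using EC Ec by (auto simp: Et_def)
 have sc_lip: "lip_on ?D S d Et (real (card E) * C1) (%a. sc a b)" for b unfolding sc_def
 proof (rule lip_on_sum[OF Et EC(1)])
  fix g assume g: "g : E"
  have "lip_on ?D S d ((%i. i \<otimes>\<^bsub>Gm\<^esub> g) ` Ec) C1 (%a. c (shift Gm g a) (b g))"
   using g EC by (intro lip_on_shift[OF grp _ c_lip]) auto
  thus "lip_on ?D S d Et C1 (%a. c (shift Gm g a) (b g))"
   by (rule lip_on_mono[OF tb]) (use g Et in \<open>auto simp: Et_def\<close>)
 qed
 have f_lip: "lip_on ?D S d Et C (%a. f (pair_path ?D a b))" if f: "f : F" and b: "b : ?P'" for f b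
 proof (rule lip_on_mono[OF tb, where E = E and C = C])
  show "lip_on ?D S d E C (%a. f (pair_path ?D a b))" unfolding lip_on_def
  proof (intro conjI ballI)
   fix a a' assume a: "a : ?P" "a' : ?P"
   have "\<bar>f (pair_path ?D a b) - f (pair_path ?D a' b)\<bar>
     <= C * (SUM i:E. pair_dist d e (pair_path ?D a b i) (pair_path ?D a' b i))"
    by (intro lip_onD[OF EC(4)[OF f]] pair_path_in a b)
   also have "(SUM i:E. pair_dist d e (pair_path ?D a b i) (pair_path ?D a' b i)) = (SUM i:E. d (a i) (a' i))"
    using EC b by (intro sum.cong refl) (auto simp: pair_dist_def PiE_iff subset_iff tbm_zero[OF tb'])
   finally show "\<bar>f (pair_path ?D a b) - f (pair_path ?D a' b)\<bar> <= C * (SUM i:E. d (a i) (a' i))" .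
  qed (use EC in auto)
 qed (use Et in \<open>auto simp: Et_def\<close>)
 have Rf: "Rf f : loc ?D S d" if f: "f : F" for f
 proof -
  obtain B where B: "0 < B" "!!a. a : ?D ~> S \<times> S' ==> \<bar>f a\<bar> <= B"
   by (rule loc_bounded[OF tbp subsetD[OF F(2) f]]) auto
  have "lip_on ?D S d Et (C + C * (real (card E) * C1)) (Rf f)" unfolding Rf_def
  proof (rule lip_on_cINF[where L = "- B"])
   show "lip_on ?D S d Et (C + C * (real (card E) * C1)) (%a. f (pair_path ?D a b) + C * sc a b)" if "b : ?P'" for b
    using EC by (intro lip_on_add lip_on_scale f_lip f that sc_lip) auto
   fix a b assume "a : ?P" "b : ?P'"
   hence "\<bar>f (pair_path ?D a b)\<bar> <= B" by (intro B pair_path_in)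
   moreover have "0 <= C * sc a b" using EC sc0 by simp
   ultimately show "- B <= f (pair_path ?D a b) + C * sc a b" by linarith
  qed (rule P'ne)
  thus ?thesis by (rule locI)
 qed
 have Rf_close: "\<bar>f (pair_path ?D a b) - Rf f a\<bar> <= C * sc a b + et"
  if f: "f : F" and a: "a : ?P" and b: "b : ?P'" for f a b
 proof -
  have lower: "f (pair_path ?D a b) - C * sc a b - et <= f (pair_path ?D a b') + C * sc a b'" if b': "b' : ?P'" for b'
  proof -
   have "\<bar>f (pair_path ?D a b) - f (pair_path ?D a b')\<bar>
     <= C * (SUM i:E. pair_dist d e (pair_path ?D a b i) (pair_path ?D a b' i))"
    by (intro lip_onD[OF EC(4)[OF f]] pair_path_in a b b')
   also have "(SUM i:E. pair_dist d e (pair_path ?D a b i) (pair_path ?D a b' i)) = (SUM i:E. e (b i) (b' i))"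
    using EC a by (intro sum.cong refl) (auto simp: pair_dist_def PiE_iff subset_iff tbm_zero[OF tb])
   also have "... <= (SUM i:E. c (shift Gm i a) (b i) + c (shift Gm i a) (b' i) + 2 * rh)"
    using EC b b' by (intro sum_mono c_tri) (auto simp: PiE_iff)
   also have "... = sc a b + sc a b' + real (card E) * (2 * rh)" by (simp add: sc_def sum.distrib)
   finally have "\<bar>f (pair_path ?D a b) - f (pair_path ?D a b')\<bar> <= C * (sc a b + sc a b' + real (card E) * (2 * rh))"
    using EC by simp
   also have "... = C * sc a b + C * sc a b' + C * real (card E) * (2 * rh)" by (simp add: algebra_simps)
   finally show ?thesis using rhq by linarith
  qed
  have "f (pair_path ?D a b) - C * sc a b - et <= Rf f a" unfolding Rf_def using lower P'ne by (intro cINF_greatest) auto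
  moreover have "Rf f a <= f (pair_path ?D a b) + C * sc a b"
   unfolding Rf_def using lower b by (intro cINF_lower bdd_belowI2[of _ "f (pair_path ?D a b) - C * sc a b - et"]) auto
  ultimately show ?thesis using et by linarith
 qed
 have sc_orb: "integrable M (%x. sc (?o x) (?o' x))" "C * (\<integral>x. sc (?o x) (?o' x) \<partial>M) <= et"
 proof -
  have eq: "c (shift Gm g (?o x)) (?o' x g) = c (?o (T g x)) (bt (T g x))" if "g : E" "x : space M" for g x
   using shift_orb[OF grp pm, of g x af] that EC by (auto simp: orb_def)
  have int: "integrable M (%x. c (shift Gm g (?o x)) (?o' x g))"
   and val: "(\<integral>x. c (shift Gm g (?o x)) (?o' x g) \<partial>M) = (\<integral>x. c (?o x) (bt x) \<partial>M)" if g: "g : E" for g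
  proof -
   have gD: "g : ?D" using g EC by auto
   note Tm = pmpD(2)[OF pm gD] and Td = pmpD(3)[OF pm gD]
   have "integrable (distr M M (T g)) (%x. c (?o x) (bt x))" using int_c Td by simp
   hence "integrable M (%x. c (?o (T g x)) (bt (T g x)))" by (rule integrable_distr[OF Tm])
   thus "integrable M (%x. c (shift Gm g (?o x)) (?o' x g))"
    by (subst Bochner_Integration.integrable_cong[OF refl eq[OF g]]) auto
   have "(\<integral>x. c (?o x) (bt x) \<partial>M) = (\<integral>x. c (?o x) (bt x) \<partial>distr M M (T g))" using Td by simp
   also have "... = (\<integral>x. c (?o (T g x)) (bt (T g x)) \<partial>M)"
    using int_c by (intro integral_distr[OF Tm]) auto
   also have "... = (\<integral>x. c (shift Gm g (?o x)) (?o' x g) \<partial>M)"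
    using eq[OF g] by (intro Bochner_Integration.integral_cong) auto
   finally show "(\<integral>x. c (shift Gm g (?o x)) (?o' x g) \<partial>M) = (\<integral>x. c (?o x) (bt x) \<partial>M)" ..
  qed
  show "integrable M (%x. sc (?o x) (?o' x))" unfolding sc_def using int by simp
  have "(\<integral>x. sc (?o x) (?o' x) \<partial>M) = (SUM g:E. \<integral>x. c (shift Gm g (?o x)) (?o' x g) \<partial>M)"
   unfolding sc_def using int by simp
  also have "... = real (card E) * (\<integral>x. c (?o x) (bt x) \<partial>M)" using val by simp
  also have "... <= real (card E) * ep0" using I_c by (intro mult_left_mono) auto
  finally have "C * (\<integral>x. sc (?o x) (?o' x) \<partial>M) <= C * (real (card E) * ep0)" using EC by (intro mult_left_mono) auto
  thus "C * (\<integral>x. sc (?o x) (?o' x) \<partial>M) <= et" using ep0q by (simp add: mult.assoc)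
 qed
 have I_Rf: "\<bar>obs_int Gm M T af (Rf f) - obs_int Gm M T (%x. (af x, bt x)) f\<bar> <= 2 * et" if f: "f : F" for f
 proof -
  have floc: "f : loc ?D (S \<times> S') (pair_dist d e)" using f F by auto
  have i1: "integrable M (%x. Rf f (?o x))" by (rule obs_int_loc_integrable[OF tb pm af Rf[OF f]])
  have i2: "integrable M (%x. f (pair_path ?D (?o x) (?o' x)))"
   using obs_int_loc_integrable[OF tbp pm afbt floc] by (simp add: orb_pair)
  have "\<bar>(\<integral>x. f (pair_path ?D (?o x) (?o' x)) \<partial>M) - (\<integral>x. Rf f (?o x) \<partial>M)\<bar>
    = \<bar>\<integral>x. f (pair_path ?D (?o x) (?o' x)) - Rf f (?o x) \<partial>M\<bar>" using i1 i2 by simp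
  also have "... <= (\<integral>x. \<bar>f (pair_path ?D (?o x) (?o' x)) - Rf f (?o x)\<bar> \<partial>M)" by (rule integral_abs_bound)
  also have "... <= (\<integral>x. C * sc (?o x) (?o' x) + et \<partial>M)"
   using i1 i2 sc_orb(1) Rf_close[OF f] o_in by (intro integral_mono) auto
  also have "... = C * (\<integral>x. sc (?o x) (?o' x) \<partial>M) + et" using sc_orb(1) by (simp add: prob_space)
  also have "... <= 2 * et" using sc_orb(2) by linarith
  finally show ?thesis by (simp add: obs_int_def orb_pair abs_minus_commute)
 qed

 define HH where "HH = insert H0 (Rf ` F)"
 define et' where "et' = min ep0 et"
 have tests: "(HH, et') : loc_tests ?D S d" using H0 Rf F ep0 et by (auto simp: HH_def et'_def loc_tests_def)
 define \<theta> where "\<theta> = ep0 / (Kc * (real (card Ec) + 1))"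
 have \<theta>: "0 < \<theta>" using ep0 Kc by (simp add: \<theta>_def add_nonneg_pos)
 have \<theta>K: "Kc * (real (card Ec) * \<theta>) <= ep0"
 proof -
  have "Kc * (real (card Ec) * \<theta>) <= Kc * ((real (card Ec) + 1) * \<theta>)"
   using Kc \<theta> by (intro mult_left_mono mult_right_mono) auto
  also have "... = ep0" using Kc by (simp add: \<theta>_def add_nonneg_eq_0_iff)
  finally show ?thesis .
 qed
 have "EV n. ALL (g, i):E \<times> Ec. real (card {v : V n. sg n i (sg n g v) ~= sg n (i \<otimes>\<^bsub>Gm\<^esub> g) v}) < \<theta> * real (card (V n))"
  using EC Ec \<theta> by (intro eventually_ball_finite ballI) (auto intro!: almost_action_bad[OF aa])
 hence "EV n. ALL x:loc_models Gm (sg n) (V n) S (obs_int Gm M T af) HH et'.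
   EX y:V n ~> S'. ALL f:F. \<bar>emp_avg Gm (sg n) (V n) (%v. (x v, y v)) f
    - obs_int Gm M T (%x. (af x, bt x)) f\<bar> < ep"
 proof (rule eventually_mono, intro ballI)
  fix n x
  assume bad: "ALL (g, i):E \<times> Ec. real (card {v : V n. sg n i (sg n g v) ~= sg n (i \<otimes>\<^bsub>Gm\<^esub> g) v}) < \<theta> * real (card (V n))"
   and xm: "x : loc_models Gm (sg n) (V n) S (obs_int Gm M T af) HH et'"
  have x: "x : V n ~> S" and xt: "!!f. f : HH ==> \<bar>emp_avg Gm (sg n) (V n) x f - obs_int Gm M T af f\<bar> < et'"
   using xm by (auto simp: loc_models_def)
  let ?p = "pullback_name Gm (sg n) x"
  define m where "m = real (card (V n))"
  have m: "0 < m" using V(5) by (simp add: m_def)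
  note pin = pullback_in[OF fa x]
  have "ALL v:V n. EX y. y : S' & c (?p v) y < H0 (?p v) + ep0"
  proof
   fix v
   have "(INF y\<in>S'. c (?p v) y) < H0 (?p v) + ep0" using ep0 by (simp add: H0_def)
   from cInf_lessD[OF _ this] S'ne show "EX y. y : S' & c (?p v) y < H0 (?p v) + ep0" by auto
  qed
  then obtain y0 where y0: "ALL v:V n. y0 v : S' & c (?p v) (y0 v) < H0 (?p v) + ep0" by (rule bchoice[THEN exE])
  define y where "y = restrict y0 (V n)"
  have yV: "y : V n ~> S'" using y0 by (auto simp: y_def)
  have csum: "(SUM v:V n. c (?p v) (y v)) <= 3 * ep0 * m"
  proof -
   have "(SUM v:V n. c (?p v) (y v)) <= (SUM v:V n. H0 (?p v) + ep0)"
    using y0 by (intro sum_mono) (auto simp: y_def less_imp_le)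
   also have "... = (emp_avg Gm (sg n) (V n) x H0 + ep0) * m"
    using m by (simp add: emp_avg_def sum.distrib m_def algebra_simps)
   also have "... <= (3 * ep0) * m" using xt[of H0] I_H0 m by (intro mult_right_mono) (auto simp: HH_def et'_def)
   finally show ?thesis .
  qed
  have scsum: "(SUM v:V n. C * sc (?p v) (pullback_name Gm (sg n) y v)) <= 4 * et * m"
  proof -
   have one: "(SUM v:V n. c (shift Gm g (?p v)) (pullback_name Gm (sg n) y v g)) <= 4 * ep0 * m" if g: "g : E" for g
   proof -
    have gD: "g : ?D" using g EC by auto
    have "(SUM v:V n. c (shift Gm g (?p v)) (pullback_name Gm (sg n) y v g)) = (SUM v:V n. c (shift Gm g (?p v)) (y (sg n g v)))"
     using gD by (simp add: pullback_name_def)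
    also have "... <= (SUM v:V n. c (?p v) (y v)) + Kc * (real (card Ec) * (\<theta> * m))"
    proof (rule shifted_pullback_sum[OF grp fa tb, where S' = S'])
     show "lip_on ?D S d Ec C1 (%a. c a y)" for y by (rule c_lip)
     show "0 <= c a y & c a y <= Kc" if "a : ?P" "y : S'" for a y using c0 Kc that by auto
     show "real (card {v : V n. sg n i (sg n g v) ~= sg n (i \<otimes>\<^bsub>Gm\<^esub> g) v}) <= \<theta> * m" if "i : Ec" for i
      using bad g that by (auto simp: m_def intro: less_imp_le)
    qed (use x yV gD Ec in auto)
    also have "Kc * (real (card Ec) * (\<theta> * m)) = Kc * (real (card Ec) * \<theta>) * m" by simp
    also have "... <= ep0 * m" using \<theta>K m by (intro mult_right_mono) auto
    finally show ?thesis using csum by linarith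
   qed
   have "(SUM v:V n. C * sc (?p v) (pullback_name Gm (sg n) y v)) = C * (SUM v:V n. SUM g:E. c (shift Gm g (?p v)) (pullback_name Gm (sg n) y v g))"
    by (simp add: sc_def sum_distrib_left)
   also have "... = C * (SUM g:E. SUM v:V n. c (shift Gm g (?p v)) (pullback_name Gm (sg n) y v g))" by (subst sum.swap) simp
   also have "... <= C * (SUM g:E. 4 * ep0 * m)" using EC one by (intro mult_left_mono sum_mono) auto
   also have "... = 4 * (C * real (card E) * ep0) * m" by simp
   also have "... <= 4 * et * m" using ep0q m by (intro mult_right_mono mult_left_mono) auto
   finally show ?thesis .
  qed
  have "\<bar>emp_avg Gm (sg n) (V n) (%v. (x v, y v)) f - obs_int Gm M T (%x. (af x, bt x)) f\<bar> < ep" if f: "f : F" for f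
  proof -
   let ?py = "pullback_name Gm (sg n) y"
   have "\<bar>(SUM v:V n. f (pair_path ?D (?p v) (?py v))) - (SUM v:V n. Rf f (?p v))\<bar>
     <= (SUM v:V n. \<bar>f (pair_path ?D (?p v) (?py v)) - Rf f (?p v)\<bar>)"
    unfolding sum_subtractf[symmetric] by (rule sum_abs)
   also have "... <= (SUM v:V n. C * sc (?p v) (?py v) + et)" by (intro sum_mono Rf_close[OF f] pin pullback_in[OF fa yV])
   also have "... = (SUM v:V n. C * sc (?p v) (?py v)) + et * m" by (simp add: sum.distrib m_def)
   also have "... <= 4 * et * m + et * m" using scsum by (rule add_right_mono)
   also have "... = 5 * et * m" by simp
   finally have "\<bar>(SUM v:V n. f (pair_path ?D (?p v) (?py v))) / m - (SUM v:V n. Rf f (?p v)) / m\<bar> <= 5 * et"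
    using m by (simp add: diff_divide_distrib[symmetric] divide_le_eq)
   hence "\<bar>emp_avg Gm (sg n) (V n) (%v. (x v, y v)) f - emp_avg Gm (sg n) (V n) x (Rf f)\<bar> <= 5 * et"
    by (simp add: emp_avg_def pullback_pair m_def)
   moreover have "\<bar>emp_avg Gm (sg n) (V n) x (Rf f) - obs_int Gm M T af (Rf f)\<bar> < et"
    using xt[of "Rf f"] f by (auto simp: HH_def et'_def)
   moreover note I_Rf[OF f]
   moreover have "ep = 10 * et" by (simp add: et_def)
   ultimately show ?thesis using et by linarith
  qed
  thus "EX y:V n ~> S'. ALL f:F. \<bar>emp_avg Gm (sg n) (V n) (%v. (x v, y v)) f
    - obs_int Gm M T (%x. (af x, bt x)) f\<bar> < ep" using yV by blast
 qed
 with tests show ?thesis by (rule that)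
qed

section \<open>Independence of the generating observable\<close>

lemma loc_compose:
 assumes f: "f : loc D S d"
  and h: "!!p. p : S' ==> h p : S" "!!p q. p : S' ==> q : S' ==> d (h p) (h q) <= d' p q"
 shows "(%a. f (\<lambda>i\<in>D. h (a i))) : loc D S' d'"
proof -
 obtain E C where l: "lip_on D S d E C f" using f by (auto simp: loc_def)
 have "lip_on D S' d' E C (%a. f (\<lambda>i\<in>D. h (a i)))" unfolding lip_on_def
 proof (intro conjI ballI)
  show E: "finite E" "E <= D" "0 <= C" using l by (auto simp: lip_on_def)
  fix a b assume ab: "a : D ~> S'" "b : D ~> S'"
  have "\<bar>f (\<lambda>i\<in>D. h (a i)) - f (\<lambda>i\<in>D. h (b i))\<bar> <= C * (SUM i:E. d ((\<lambda>i\<in>D. h (a i)) i) ((\<lambda>i\<in>D. h (b i)) i))"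
   by (rule lip_onD[OF l]) (use ab h in \<open>auto simp: PiE_iff\<close>)
  also have "... <= C * (SUM i:E. d' (a i) (b i))"
   using E ab h by (intro mult_left_mono sum_mono) (auto simp: PiE_iff subset_iff)
  finally show "\<bar>f (\<lambda>i\<in>D. h (a i)) - f (\<lambda>i\<in>D. h (b i))\<bar> <= C * (SUM i:E. d' (a i) (b i))" .
 qed
 thus ?thesis by (rule locI)
qed

lemma sum_distance_bound:
 assumes tb: "tbm S d" and p: "p : S" "p' : S" and N: "finite N" "N <= S" and b: "b0 : N" "d p' b0 < rh"
 shows "d p p' <= (SUM b:N. \<bar>d p b - d p' b\<bar>) + 2 * rh"
proof -
 have "d p p' <= d p b0 + d b0 p'" using p N b by (intro tbm_tri[OF tb]) auto
 moreover have "d b0 p' = d p' b0" by (rule tbm_sym[OF tb])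
 moreover have "\<bar>d p b0 - d p' b0\<bar> <= (SUM b:N. \<bar>d p b - d p' b\<bar>)"
  using N b by (intro member_le_sum[of b0 N "%b. \<bar>d p b - d p' b\<bar>"]) auto
 ultimately show ?thesis using b by linarith
qed

text \<open>Both observables approximate each other in mean. Two models whose extensions have close second labels
have close first labels, because these are local functions of the second up to a small average error;
so a separated set of models extends to a set still separated in the second metric.\<close>

lemma entropy_le_of_generating:
 fixes Gm :: "('g, 'm) monoid_scheme" and M :: "'x measure" and V :: "nat => 'v set"
  and S :: "'a set" and S' :: "'b set"
 assumes grp: "group Gm" and pm: "pmp Gm M T" and aa: "almost_action Gm V sg"
  and tb: "tbm S d" and tb': "tbm S' e" and af: "observable M S d af" and bt: "observable M S' e bt"
  and gen: "generating Gm M T S d af" and gen': "generating Gm M T S' e bt" and L: "tail_mono L"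
 shows "loc_entropy L Gm V sg S d (obs_int Gm M T af) <= loc_entropy L Gm V sg S' e (obs_int Gm M T bt)"
proof -
 let ?D = "carrier Gm"
 let ?A = "%F ep n. loc_models Gm (sg n) (V n) S (obs_int Gm M T af) F ep"
 let ?B = "%F ep n. loc_models Gm (sg n) (V n) S' (obs_int Gm M T bt) F ep"
 interpret group Gm by (rule grp)
 interpret prob_space M by (rule pmpD(1)[OF pm])
 have fa: "finite_action Gm V sg" using aa by (simp add: almost_action_def)
 note V = finite_actionD[OF fa]
 note tbp = tbm_pair[OF tb tb']
 note afbt = observable_pair[OF af bt]
 let ?o' = "orb Gm T bt"
 have orb_pair: "orb Gm T (%x. (af x, bt x)) x = pair_path ?D (orb Gm T af x) (?o' x)" for x
  by (auto simp: orb_def pair_path_def)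
 have "EX dl'>0. ALL (F', ep'):loc_tests ?D S' e. EX (F, ep):loc_tests ?D S d.
   L (rate d V dl (?A F ep)) <= L (rate e V dl' (?B F' ep'))" if dl: "0 < dl" for dl :: real
 proof -
  define rh where "rh = dl / 8"
  have rh: "0 < rh" using dl by (simp add: rh_def)
  obtain N where N: "N <= S" "finite N" "!!y. y : S ==> EX b:N. d y b < rh" by (rule tbm_net[OF tb rh]) auto
  obtain R where R: "0 < R" "!!x y. x : S ==> y : S ==> d x y <= R" by (rule tbm_bounded[OF tb]) auto
  define kq where "kq = dl / (32 * (real (card N) + 1))"
  have kq: "0 < kq" using dl by (simp add: kq_def add_nonneg_pos)
  have kqN: "4 * kq * real (card N) <= dl / 8"
  proof -
   have "4 * kq * real (card N) <= 4 * kq * (real (card N) + 1)" using kq by (intro mult_left_mono) auto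
   also have "... = dl / 8" by (simp add: kq_def add_nonneg_eq_0_iff divide_simps)
   finally show ?thesis .
  qed
  have "ALL b:N. EX f. f : loc ?D S' e & (\<integral>x. \<bar>d (af x) b - f (?o' x)\<bar> \<partial>M) < kq"
  proof
   fix b assume "b : N"
   hence "integrable M (%x. d (af x) b)"
    using af N R by (intro integrable_const_bound[of _ R]) (auto simp: observable_def tbm_nonneg[OF tb])
   then obtain f where "f : loc ?D S' e" "(\<integral>x. \<bar>d (af x) b - f (?o' x)\<bar> \<partial>M) < kq"
    using kq by (rule generating_approx[OF tb' pm bt gen']) auto
   thus "EX f. f : loc ?D S' e & (\<integral>x. \<bar>d (af x) b - f (?o' x)\<bar> \<partial>M) < kq" by blast
  qed
  then obtain Ps where Ps: "ALL b:N. Ps b : loc ?D S' e & (\<integral>x. \<bar>d (af x) b - Ps b (?o' x)\<bar> \<partial>M) < kq"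
   by (rule bchoice[THEN exE])
  have "Ps ` N <= loc ?D S' e" using Ps by auto
  then obtain E C where EC: "finite E" "E <= ?D" "0 < C" "!!f. f : Ps ` N ==> lip_on ?D S' e E C f"
   by (rule loc_common[OF tb' finite_imageI[OF N(2)]]) auto
  define K where "K = real (card N) * C * real (card E)"
  have K: "0 <= K" using EC by (simp add: K_def)
  define dl' where "dl' = dl / (8 * (K + 1))"
  have dl': "0 < dl'" using dl K by (simp add: dl'_def)
  have Kdl: "K * (2 * dl') <= dl / 4"
  proof -
   have "K * (2 * dl') <= (K + 1) * (2 * dl')" using dl' by (intro mult_right_mono) auto
   also have "... = dl / 4" using K by (simp add: dl'_def divide_simps)
   finally show ?thesis .
  qed
  define t where "t b p = \<bar>d (fst (p \<one>\<^bsub>Gm\<^esub>)) b - Ps b (\<lambda>i\<in>?D. snd (p i))\<bar>" for b and p :: "'g => 'a \<times> 'b"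
  have snd_loc: "(%p. f (\<lambda>i\<in>?D. snd (p i))) : loc ?D (S \<times> S') (pair_dist d e)" if "f : loc ?D S' e" for f
   by (rule loc_compose[OF that]) (auto simp: pair_dist_def tbm_nonneg[OF tb])
  have t_loc: "t b : loc ?D (S \<times> S') (pair_dist d e)" if b: "b : N" for b unfolding t_def
  proof (intro loc_abs[OF tbp] loc_diff[OF tbp] snd_loc)
   show "(%p. d (fst (p \<one>\<^bsub>Gm\<^esub>)) b) : loc ?D (S \<times> S') (pair_dist d e)"
   proof (rule loc_coord[where u = "%q. d (fst q) b" and C = 1])
    fix x y assume "x : S \<times> S'" "y : S \<times> S'"
    hence "\<bar>d (fst x) b - d (fst y) b\<bar> <= d (fst x) (fst y)" using b N by (intro tbm_reverse_tri[OF tb]) auto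
    also have "... <= 1 * pair_dist d e x y" by (simp add: pair_dist_def tbm_nonneg[OF tb'])
    finally show "\<bar>d (fst x) b - d (fst y) b\<bar> <= 1 * pair_dist d e x y" .
   qed auto
   show "Ps b : loc ?D S' e" using Ps b by auto
  qed
  have snd_pair: "(\<lambda>i\<in>?D. snd (pair_path ?D a b i)) = b" if "b : ?D ~> S'" for a :: "'g => 'a" and b :: "'g => 'b"
   using that by (auto simp: PiE_iff extensional_def)
  have orb_one: "orb Gm T af x \<one>\<^bsub>Gm\<^esub> = af x" if "x : space M" for x
   using pmpD(4)[OF pm that] by (simp add: orb_def)
  have t_int: "obs_int Gm M T (%x. (af x, bt x)) (t b) < kq" if b: "b : N" for b
  proof -
   have "obs_int Gm M T (%x. (af x, bt x)) (t b) = (\<integral>x. \<bar>d (af x) b - Ps b (?o' x)\<bar> \<partial>M)"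
    unfolding obs_int_def orb_pair t_def using snd_pair[OF orb_in[OF pm bt]] orb_one
    by (intro Bochner_Integration.integral_cong) auto
   thus ?thesis using Ps b by simp
  qed
  have "EX (F, ep):loc_tests ?D S d. L (rate d V dl (?A F ep)) <= L (rate e V dl' (?B F' ep'))"
   if F': "(F', ep') : loc_tests ?D S' e" for F' ep'
  proof -
   define G where "G = t ` N Un (%f p. f (\<lambda>i\<in>?D. snd (p i))) ` F'"
   have G: "finite G" "G <= loc ?D (S \<times> S') (pair_dist d e)"
    using N F' t_loc snd_loc by (auto simp: G_def loc_tests_def)
   have "0 < min ep' kq" using kq F' by (simp add: loc_tests_def)
   then obtain H et where H: "(H, et) : loc_tests ?D S d"
    "EV n. ALL x:?A H et n. EX y:V n ~> S'. ALL f:G. \<bar>emp_avg Gm (sg n) (V n) (%v. (x v, y v)) f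
    - obs_int Gm M T (%x. (af x, bt x)) f\<bar> < min ep' kq" by (rule joint_extension[OF grp pm aa tb tb' af bt gen G])
   have "EV n. rate d V dl (?A H et) n <= rate e V dl' (?B F' ep') n" using H(2)
   proof (rule eventually_mono)
    fix n
    assume "ALL x:?A H et n. EX y:V n ~> S'. ALL f:G. \<bar>emp_avg Gm (sg n) (V n) (%v. (x v, y v)) f
    - obs_int Gm M T (%x. (af x, bt x)) f\<bar> < min ep' kq"
    hence "ALL x:?A H et n. EX y. y : V n ~> S' & (ALL f:G. \<bar>emp_avg Gm (sg n) (V n) (%v. (x v, y v)) f
    - obs_int Gm M T (%x. (af x, bt x)) f\<bar> < min ep' kq)" by blast
    then obtain Y where Y: "ALL x:?A H et n. Y x : V n ~> S' & (ALL f:G. \<bar>emp_avg Gm (sg n) (V n) (%v. (x v, Y x v)) f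
    - obs_int Gm M T (%x. (af x, bt x)) f\<bar> < min ep' kq)" by (rule bchoice[THEN exE])
    have YV: "Y x : V n ~> S'" if "x : ?A H et n" for x using Y that by blast
    have YG: "\<bar>emp_avg Gm (sg n) (V n) (%v. (x v, Y x v)) f - obs_int Gm M T (%x. (af x, bt x)) f\<bar> < min ep' kq"
     if "x : ?A H et n" "f : G" for x f using Y that by blast
    have AV: "?A H et n <= V n ~> S" by (auto simp: loc_models_def)
    let ?pb = "pullback_name Gm (sg n)"
    define m where "m = real (card (V n))"
    have m: "0 < m" using V(5) by (simp add: m_def)
    have YB: "Y x : ?B F' ep' n" if x: "x : ?A H et n" for x unfolding loc_models_def
    proof (intro CollectI conjI ballI YV[OF x])
     fix f assume f: "f : F'"
     let ?f = "%p. f (\<lambda>i\<in>?D. snd (p i))"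
     have "?f : G" using f by (auto simp: G_def)
     from YG[OF x this] have "\<bar>emp_avg Gm (sg n) (V n) (%v. (x v, Y x v)) ?f - obs_int Gm M T (%x. (af x, bt x)) ?f\<bar> < ep'" by simp
     moreover have "emp_avg Gm (sg n) (V n) (%v. (x v, Y x v)) ?f = emp_avg Gm (sg n) (V n) (Y x) f"
      unfolding emp_avg_def pullback_pair
      using snd_pair[OF pullback_in[OF fa YV[OF x]]] by (intro arg_cong2[where f = "(/)"] sum.cong) auto
     moreover have "obs_int Gm M T (%x. (af x, bt x)) ?f = obs_int Gm M T bt f" unfolding obs_int_def orb_pair
      using snd_pair[OF orb_in[OF pm bt]] by (intro Bochner_Integration.integral_cong) auto
     ultimately show "\<bar>emp_avg Gm (sg n) (V n) (Y x) f - obs_int Gm M T bt f\<bar> < ep'" by simp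
    qed
    have t_avg: "(SUM v:V n. \<bar>d (?pb x v \<one>\<^bsub>Gm\<^esub>) b - Ps b (?pb (Y x) v)\<bar>) <= 2 * kq * m" if x: "x : ?A H et n" and b: "b : N" for x b
    proof -
     have "t b : G" using b by (auto simp: G_def)
     from YG[OF x this] t_int[OF b] have "emp_avg Gm (sg n) (V n) (%v. (x v, Y x v)) (t b) <= 2 * kq" by linarith
     moreover have "(SUM v:V n. t b (pair_path ?D (?pb x v) (?pb (Y x) v))) = (SUM v:V n. \<bar>d (?pb x v \<one>\<^bsub>Gm\<^esub>) b - Ps b (?pb (Y x) v)\<bar>)"
      unfolding t_def using snd_pair[OF pullback_in[OF fa YV[OF x]]] by (intro sum.cong) auto
     ultimately show ?thesis using m by (simp add: emp_avg_def pullback_pair m_def[symmetric] divide_le_eq)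
    qed
    have close: "hm d (V n) x x' < dl"
     if x: "x : ?A H et n" and x': "x' : ?A H et n" and h: "hm e (V n) (Y x) (Y x') < 2 * dl'" for x x'
    proof -
     have xV: "x : V n ~> S" "x' : V n ~> S" using x x' AV by auto
     have "(SUM v:V n. d (x v) (x' v)) = (SUM v:V n. d (x (sg n \<one>\<^bsub>Gm\<^esub> v)) (x' (sg n \<one>\<^bsub>Gm\<^esub> v)))"
      by (rule emp_avg_reindex[OF fa one_closed, of "%v. d (x v) (x' v)" n, symmetric])
     also have "... <= (SUM v:V n. (SUM b:N. \<bar>d (?pb x v \<one>\<^bsub>Gm\<^esub>) b - Ps b (?pb (Y x) v)\<bar> +
       \<bar>d (?pb x' v \<one>\<^bsub>Gm\<^esub>) b - Ps b (?pb (Y x') v)\<bar> + C * (SUM i:E. e (Y x (sg n i v)) (Y x' (sg n i v)))) + 2 * rh)"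
     proof (rule sum_mono)
      fix v assume v: "v : V n"
      let ?p = "?pb x v \<one>\<^bsub>Gm\<^esub>" and ?p' = "?pb x' v \<one>\<^bsub>Gm\<^esub>"
      have pS: "?p : S" "?p' : S" using pullback_in[OF fa xV(1) v] pullback_in[OF fa xV(2) v] by auto
      obtain b0 where "b0 : N" "d ?p' b0 < rh" using N(3)[OF pS(2)] by blast
      hence "d ?p ?p' <= (SUM b:N. \<bar>d ?p b - d ?p' b\<bar>) + 2 * rh" by (rule sum_distance_bound[OF tb pS N(2,1)])
      also have "(SUM b:N. \<bar>d ?p b - d ?p' b\<bar>) <= (SUM b:N. \<bar>d ?p b - Ps b (?pb (Y x) v)\<bar> +
       \<bar>d ?p' b - Ps b (?pb (Y x') v)\<bar> + C * (SUM i:E. e (Y x (sg n i v)) (Y x' (sg n i v))))"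
      proof (rule sum_mono)
       fix b assume b: "b : N"
       hence l: "lip_on ?D S' e E C (Ps b)" using EC by auto
       have "\<bar>Ps b (?pb (Y x) v) - Ps b (?pb (Y x') v)\<bar> <= C * (SUM i:E. e (?pb (Y x) v i) (?pb (Y x') v i))"
        by (intro lip_onD[OF l] pullback_in[OF fa] YV x x' v)
       also have "(SUM i:E. e (?pb (Y x) v i) (?pb (Y x') v i)) = (SUM i:E. e (Y x (sg n i v)) (Y x' (sg n i v)))"
        using EC by (intro sum.cong) (auto simp: pullback_name_def)
       finally show "\<bar>d ?p b - d ?p' b\<bar> <= \<bar>d ?p b - Ps b (?pb (Y x) v)\<bar> +
        \<bar>d ?p' b - Ps b (?pb (Y x') v)\<bar> + C * (SUM i:E. e (Y x (sg n i v)) (Y x' (sg n i v)))" by linarith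
      qed
      finally show "d (x (sg n \<one>\<^bsub>Gm\<^esub> v)) (x' (sg n \<one>\<^bsub>Gm\<^esub> v)) <= (SUM b:N. \<bar>d ?p b - Ps b (?pb (Y x) v)\<bar> +
       \<bar>d ?p' b - Ps b (?pb (Y x') v)\<bar> + C * (SUM i:E. e (Y x (sg n i v)) (Y x' (sg n i v)))) + 2 * rh"
       by (simp add: pullback_name_def)
     qed
     also have "... = (SUM b:N. (SUM v:V n. \<bar>d (?pb x v \<one>\<^bsub>Gm\<^esub>) b - Ps b (?pb (Y x) v)\<bar>) +
       (SUM v:V n. \<bar>d (?pb x' v \<one>\<^bsub>Gm\<^esub>) b - Ps b (?pb (Y x') v)\<bar>) +
       C * (SUM i:E. SUM v:V n. e (Y x (sg n i v)) (Y x' (sg n i v)))) + 2 * rh * m"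
     proof -
      have sw1: "(SUM v:V n. SUM b:N. u b v) = (SUM b:N. SUM v:V n. u b v)" for u :: "'a => 'v => real" by (rule sum.swap)
      have sw2: "(SUM v:V n. SUM i:E. u i v) = (SUM i:E. SUM v:V n. u i v)" for u :: "'g => 'v => real" by (rule sum.swap)
      show ?thesis by (simp add: sum.distrib sw1 sum_distrib_left[symmetric] sw2 m_def mult.commute)
     qed
     also have "(SUM i:E. SUM v:V n. e (Y x (sg n i v)) (Y x' (sg n i v))) = (SUM i:E. SUM v:V n. e (Y x v) (Y x' v))"
      using EC by (intro sum.cong refl emp_avg_reindex[OF fa, of _ "%v. e (Y x v) (Y x' v)"]) auto
     also have "(SUM v:V n. e (Y x v) (Y x' v)) = hm e (V n) (Y x) (Y x') * m"
      using m by (simp add: hamming_metric_def m_def)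
     also have "(SUM b:N. (SUM v:V n. \<bar>d (?pb x v \<one>\<^bsub>Gm\<^esub>) b - Ps b (?pb (Y x) v)\<bar>) +
       (SUM v:V n. \<bar>d (?pb x' v \<one>\<^bsub>Gm\<^esub>) b - Ps b (?pb (Y x') v)\<bar>) +
       C * (SUM i:E. hm e (V n) (Y x) (Y x') * m)) + 2 * rh * m
      <= (SUM b:N. 2 * kq * m + 2 * kq * m + C * (SUM i:E. (2 * dl') * m)) + 2 * rh * m"
      using h m EC x x' by (intro add_right_mono sum_mono add_mono t_avg mult_left_mono mult_right_mono) auto
     also have "... = (4 * kq * real (card N) + K * (2 * dl') + 2 * rh) * m" by (simp add: K_def algebra_simps)
     also have "... <= (dl / 8 + dl / 4 + dl / 4) * m"
      using kqN Kdl m by (intro mult_right_mono add_mono) (auto simp: rh_def)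
     also have "... < dl * m" using dl m by simp
     finally show ?thesis using m by (simp add: hamming_metric_def m_def divide_less_eq)
    qed
    obtain X where X: "X <= ?A H et n" "finite X" "sep_set dl (hm d (V n)) X"
     "cov dl (?A H et n) (hm d (V n)) <= card X" by (rule cov_le_sep[OF tb V(1,2) dl AV]) auto
    have far: "2 * dl' <= hm e (V n) (Y x) (Y x')" if "x : X" "x' : X" "x ~= x'" for x x'
    proof (rule ccontr)
     assume "~ ?thesis"
     hence "hm d (V n) x x' < dl" using close[of x x'] that X by auto
     moreover have "dl <= hm d (V n) x x'" using X(3) that unfolding sep_set_def by blast
     ultimately show False by simp
    qed
    have "inj_on Y X"
    proof (rule inj_onI, rule ccontr)
     fix x x' assume xx: "x : X" "x' : X" "Y x = Y x'" "x ~= x'"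
     have "hm e (V n) (Y x') (Y x') = 0" using YV X xx by (intro hamming_zero[OF tb']) auto
     thus False using far[OF xx(1,2,4)] xx(3) dl' by simp
    qed
    hence "card X = card (Y ` X)" by (simp add: card_image)
    also have "... <= cov dl' (?B F' ep' n) (hm e (V n))"
    proof (rule sep_le_cov[OF tb' V(1,2) dl'])
     show "?B F' ep' n <= V n ~> S'" unfolding loc_models_def by blast
     show "Y ` X <= ?B F' ep' n" using YB X(1) by blast
     show "sep_set (2 * dl') (hm e (V n)) (Y ` X)" unfolding sep_set_def using far by blast
    qed
    finally show "rate d V dl (?A H et) n <= rate e V dl' (?B F' ep') n" using X(4) by (intro rate_mono V) auto
   qed
   hence "L (rate d V dl (?A H et)) <= L (rate e V dl' (?B F' ep'))" using L by (simp add: tail_mono_def)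
   thus ?thesis using H(1) by blast
  qed
  thus ?thesis using dl' by blast
 qed
 note key = this
 show ?thesis unfolding loc_entropy_def
 proof (rule SUP_least)
  fix dl :: real assume "dl : {0<..}"
  hence "0 < dl" by simp
  from key[OF this] obtain dl' where dl': "0 < dl'" "ALL (F', ep'):loc_tests ?D S' e. EX (F, ep):loc_tests ?D S d.
   L (rate d V dl (?A F ep)) <= L (rate e V dl' (?B F' ep'))" by blast
  have "(INF (F, ep)\<in>loc_tests ?D S d. L (rate d V dl (?A F ep))) <= (INF (F, ep)\<in>loc_tests ?D S' e. L (rate e V dl' (?B F ep)))"
  proof (rule INF_mono)
   fix p assume "p : loc_tests ?D S' e"
   then obtain F' ep' where p: "p = (F', ep')" "(F', ep') : loc_tests ?D S' e" by (cases p) auto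
   then obtain F ep where "(F, ep) : loc_tests ?D S d" "L (rate d V dl (?A F ep)) <= L (rate e V dl' (?B F' ep'))"
    using dl'(2) by fast
   thus "EX q:loc_tests ?D S d. (case q of (F, ep) => L (rate d V dl (?A F ep))) <= (case p of (F, ep) => L (rate e V dl' (?B F ep)))"
    unfolding p(1) by (intro bexI[of _ "(F, ep)"]) auto
  qed
  thus "(INF (F, ep)\<in>loc_tests ?D S d. L (rate d V dl (?A F ep)))
   <= (SUP dl\<in>{0<..}. INF (F, ep)\<in>loc_tests ?D S' e. L (rate e V dl (?B F ep)))"
   using dl'(1) by (intro SUP_upper2[of dl']) auto
 qed
qed

lemma entropy_generating_eq:
 assumes "group Gm" "pmp Gm M T" "almost_action Gm V sg" "tbm S d" "tbm S' e" "observable M S d af"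
  "observable M S' e bt" "generating Gm M T S d af" "generating Gm M T S' e bt" "tail_mono L"
 shows "loc_entropy L Gm V sg S d (obs_int Gm M T af) = loc_entropy L Gm V sg S' e (obs_int Gm M T bt)"
 using assms by (intro antisym entropy_le_of_generating)

section \<open>Resampling independent columns by a random permutation\<close>

text \<open>One coordinate of an independent family may be replaced by a fresh copy under the integral.\<close>

lemma integral_PiM_resample:
 fixes q :: "('h => 'x) => real"
 assumes M: "prob_space M" and k: "k : I"
  and q: "q : borel_measurable (PiM I (%_. M))" "!!y. y : space (PiM I (%_. M)) ==> \<bar>q y\<bar> <= B"
 shows "integrable (PiM I (%_. M)) (%y. \<integral>x. q (y(k := x)) \<partial>M)"
  and "(\<integral>y. q y \<partial>PiM I (%_. M)) = (\<integral>y. \<integral>x. q (y(k := x)) \<partial>M \<partial>PiM I (%_. M))"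
proof -
 let ?P = "PiM I (%_. M)"
 interpret M: prob_space M by fact
 interpret P: prob_space ?P by (rule prob_space_PiM) (rule M)
 interpret pair_sigma_finite M ?P ..
 interpret MP: prob_space "M \<Otimes>\<^sub>M ?P" by (rule prob_space_pair) unfold_locales
 have ins: "insert k I = I" using k by auto
 have d: "distr (M \<Otimes>\<^sub>M ?P) ?P (%(x, y). y(k := x)) = ?P"
  using distr_pair_PiM_eq_PiM[of I "%_. M" k] M ins by simp
 have m: "(%(x, y). y(k := x)) : measurable (M \<Otimes>\<^sub>M ?P) ?P"
  unfolding case_prod_beta by (rule measurable_fun_upd[where J = I]) (use ins in auto)
 have "integrable ?P q" using q by (intro P.integrable_const_bound[of _ B]) auto
 hence "integrable (distr (M \<Otimes>\<^sub>M ?P) ?P (%(x, y). y(k := x))) q" using d by simp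
 hence int: "integrable (M \<Otimes>\<^sub>M ?P) (%(x, y). q (y(k := x)))"
  by (subst (asm) integrable_distr_eq[OF m q(1)]) (simp add: split_beta')
 show "integrable ?P (%y. \<integral>x. q (y(k := x)) \<partial>M)"
  using integrable_snd[of "%x y. q (y(k := x))"] int by simp
 have "(\<integral>y. q y \<partial>?P) = (\<integral>y. q y \<partial>distr (M \<Otimes>\<^sub>M ?P) ?P (%(x, y). y(k := x)))" using d by simp
 also have "... = (\<integral>p. (%(x, y). q (y(k := x))) p \<partial>(M \<Otimes>\<^sub>M ?P))"
  by (subst integral_distr[OF m q(1)]) (simp add: split_beta')
 also have "... = (\<integral>y. \<integral>x. q (y(k := x)) \<partial>M \<partial>?P)"
  using integral_snd[of "%x y. q (y(k := x))"] int by simp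
 finally show "(\<integral>y. q y \<partial>?P) = (\<integral>y. \<integral>x. q (y(k := x)) \<partial>M \<partial>?P)" .
qed

text \<open>A bounded function of the columns indexed by a finite set whose integral over independent columns vanishes.\<close>

definition column_kernel ::
  "'x measure => 'h set => 'h set => 'c set => ('x => 'c) => real => (('h => 'c) => real) => bool" where
 "column_kernel M I J A Q B ph \<longleftrightarrow>
   (ALL c. (ALL k:J. c k : A) --> \<bar>ph c\<bar> <= B) &
   (ALL c c'. (ALL k:J. c k = c' k) --> ph c = ph c') &
   (ALL D c. D <= J --> (ALL k:J. c k : A) -->
    (%y. ph (%k. if k : D then Q (y k) else c k)) : borel_measurable (PiM I (%_. M))) &
   (\<integral>y. ph (%k. Q (y k)) \<partial>PiM I (%_. M)) = 0"

definition column_error ::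
  "'x measure => 'h set => 'c set => ('x => 'c) => 'w set => ('w => 'c) => real => (('h => 'c) => real) => bool" where
 "column_error M J A Q W X err ph \<longleftrightarrow>
   (ALL c k. (ALL k:J. c k : A) --> k : J -->
    \<bar>(SUM u:W. ph (c(k := X u))) / real (card W) - (\<integral>x. ph (c(k := Q x)) \<partial>M)\<bar> <= err)"

text \<open>Replacing one column at a time by an independent sample: the column at a further place of a uniformly
random permutation is uniform on the unused places, hence nearly uniform on all of them.\<close>

lemma permuted_columns_step:
 fixes ph :: "('h => 'c) => real"
 assumes M: "prob_space M" and J: "finite J" "J <= I"
  and ker: "column_kernel M I J A Q B ph" and Q: "!!x. x : space M ==> Q x : A"
  and W: "finite W" "W ~= {}" and X: "!!u. u : W ==> X u : A"
  and err: "column_error M J A Q W X err ph"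
  and t: "inj_on t J" "t ` J <= W"
  and Y: "!!pv. pv permutes W ==> \<bar>Y pv\<bar> <= B"
  and R: "finite R" "R Int t ` J = {}"
  and YR: "!!pv pv'. (!!r. r : R ==> pv r = pv' r) ==> Y pv = Y pv'"
  and D: "D <= J" "k : J" "k ~: D" and B: "0 <= B"
 defines "Ph \<equiv> %D pv. \<integral>y. ph (%j. if j : D then Q (y j) else X (pv (t j))) \<partial>PiM I (%_. M)"
 shows "\<bar>\<Sum>pv | pv permutes W. (Ph D pv - Ph (insert k D) pv) * Y pv\<bar>
  <= real (card {pv. pv permutes W}) * (err * B + 2 * B\<^sup>2 * real (card J + card R) / real (card W))"
proof -
 let ?P = "PiM I (%_. M)" and ?S = "{pv. pv permutes W}"
 define N where "N = real (card W)"
 have N: "0 < N" using W by (simp add: N_def card_gt_0_iff)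
 interpret M: prob_space M by fact
 interpret P: prob_space ?P by (rule prob_space_PiM) (rule M)
 have fS: "finite ?S" using W(1) by (rule finite_permutations)
 have bnd: "\<bar>ph c\<bar> <= B" if "!!j. j : J ==> c j : A" for c using ker that by (simp add: column_kernel_def)
 have dep: "ph c = ph c'" if "!!j. j : J ==> c j = c' j" for c c'
 proof -
  have "ALL c c'. (ALL k:J. c k = c' k) --> ph c = ph c'" using ker by (simp add: column_kernel_def)
  thus ?thesis using that by blast
 qed
 have meas: "(%y. ph (%k. if k : D then Q (y k) else c k)) : borel_measurable ?P"
  if "D <= J" "!!j. j : J ==> c j : A" for D c using ker that by (simp add: column_kernel_def)
 have QP: "Q (y j) : A" if "y : space ?P" "j : J" for y j using that J by (intro Q) (auto simp: space_PiM)
 have XA: "X (pv (t j)) : A" if "pv permutes W" "j : J" for pv j using that t by (intro X) (auto simp: permutes_in_image)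
 define cc where "cc D pv y = (%j. if j : D then Q (y j) else X (pv (t j)))" for D pv and y :: "'h => 'a"
 have ccA: "cc D pv y j : A" if "pv permutes W" "y : space ?P" "j : J" for D pv y j using that QP XA by (auto simp: cc_def)
 have Ph_alt: "Ph D pv = (\<integral>y. ph (cc D pv y) \<partial>?P)" for D pv by (simp add: Ph_def cc_def)
 have bound_int: "\<bar>\<integral>y. f y \<partial>?P\<bar> <= B" if "f : borel_measurable ?P" "!!y. y : space ?P ==> \<bar>f y\<bar> <= B" for f
 proof -
  have "integrable ?P f" using that by (intro P.integrable_const_bound[of _ B]) auto
  hence "(\<integral>y. \<bar>f y\<bar> \<partial>?P) <= B" using that by (intro P.integral_le_const) auto
  thus ?thesis using integral_abs_bound[of ?P f] by linarith
 qed
 define Ps where "Ps pv u = (\<integral>y. ph ((cc D pv y)(k := X u)) \<partial>?P)" for pv u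
 have Psm: "(%y. ph ((cc D pv y)(k := X u))) : borel_measurable ?P" if "pv permutes W" "u : W" for pv u
 proof -
  have "(%y. ph (%j. if j : D then Q (y j) else (if j = k then X u else X (pv (t j))))) : borel_measurable ?P"
   using that by (intro meas D(1)) (auto intro: X XA)
  moreover have "(%j. if j : D then Q (y j) else (if j = k then X u else X (pv (t j)))) = (cc D pv y)(k := X u)" for y
   using D(3) by (auto simp: cc_def)
  ultimately show ?thesis by simp
 qed
 have PsA: "\<bar>ph ((cc D pv y)(k := X u))\<bar> <= B" if "pv permutes W" "u : W" "y : space ?P" for pv u y
  using that ccA X by (intro bnd) auto
 have Psb: "\<bar>Ps pv u\<bar> <= B" if "pv permutes W" "u : W" for pv u unfolding Ps_def by (intro bound_int Psm PsA that)
 have Phm: "(%y. ph (cc D pv y)) : borel_measurable ?P" if "D <= J" "pv permutes W" for D pv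
  unfolding cc_def using that by (intro meas XA)
 have Phb: "\<bar>Ph D pv\<bar> <= B" if "D <= J" "pv permutes W" for D pv
  unfolding Ph_alt using that by (intro bound_int Phm bnd ccA)
 have prod_bound: "\<bar>s * z\<bar> <= B\<^sup>2" if "\<bar>s\<bar> <= B" "\<bar>z\<bar> <= B" for s z
  using mult_mono[OF that B] by (simp add: abs_mult power2_eq_square)

 \<comment> \<open>resampling one position of a uniformly random permutation\<close>
 have swap: "(SUM pv:?S. Ph D pv * Y pv) = (SUM pv:?S. Ph D (pv \<circ> Transposition.transpose (t k) u) * Y (pv \<circ> Transposition.transpose (t k) u))" if "u : W" for u
 proof -
  have "Transposition.transpose (t k) u permutes W" using that t D by (intro permutes_swap_id) auto
  from sum_permutations_compose_right[OF this, of "%pv. Ph D pv * Y pv"] show ?thesis by simp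
 qed
 have good: "Ph D (pv \<circ> Transposition.transpose (t k) u) * Y (pv \<circ> Transposition.transpose (t k) u) = Ps pv (pv u) * Y pv"
  if u: "u ~: R Un t ` J" for u pv
 proof -
  have "Y (pv \<circ> Transposition.transpose (t k) u) = Y pv"
   using u R D by (intro YR) (auto simp: Transposition.transpose_def)
  moreover have "ph (cc D (pv \<circ> Transposition.transpose (t k) u) y) = ph ((cc D pv y)(k := X (pv u)))" for y
  proof (rule dep)
   fix j assume j: "j : J"
   have "t j ~= u" using u j by auto
   moreover have "t j ~= t k" if "j ~= k" using that t(1) j D(2) by (auto dest: inj_onD)
   ultimately show "cc D (pv \<circ> Transposition.transpose (t k) u) y j = ((cc D pv y)(k := X (pv u))) j"
    using D(3) by (auto simp: cc_def Transposition.transpose_def)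
  qed
  ultimately show ?thesis by (simp add: Ph_alt Ps_def)
 qed
 define b where "b u = (if u : R Un t ` J then 2 * B\<^sup>2 else 0)" for u
 have close: "\<bar>Ph D (pv \<circ> Transposition.transpose (t k) u) * Y (pv \<circ> Transposition.transpose (t k) u) - Ps pv (pv u) * Y pv\<bar> <= b u"
  if "pv permutes W" "u : W" for u pv
 proof (cases "u : R Un t ` J")
  case True
  have p: "pv \<circ> Transposition.transpose (t k) u permutes W"
   using that t D by (intro permutes_compose[OF _ that(1)] permutes_swap_id) auto
  have "pv u : W" using that by (simp add: permutes_in_image)
  hence "\<bar>Ph D (pv \<circ> Transposition.transpose (t k) u) * Y (pv \<circ> Transposition.transpose (t k) u)\<bar> <= B\<^sup>2" "\<bar>Ps pv (pv u) * Y pv\<bar> <= B\<^sup>2"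
   by (intro prod_bound Phb Psb Y D p that(1); assumption)+
  thus ?thesis using True by (simp add: b_def)
 qed (simp add: good b_def)
 have sum_b: "(SUM u:W. b u) <= 2 * B\<^sup>2 * real (card J + card R)"
 proof -
  have "(SUM u:W. b u) = (SUM u:W Int (R Un t ` J). 2 * B\<^sup>2)"
   unfolding b_def using W by (subst sum.inter_restrict[symmetric]) auto
  also have "... = real (card (W Int (R Un t ` J))) * (2 * B\<^sup>2)" by simp
  also have "... <= real (card J + card R) * (2 * B\<^sup>2)"
  proof (intro mult_right_mono, unfold of_nat_le_iff)
   have "card (W Int (R Un t ` J)) <= card (R Un t ` J)" using R J by (intro card_mono) auto
   also have "... <= card R + card (t ` J)" by (rule card_Un_le)
   also have "... <= card R + card J" using card_image_le[OF J(1)] by simp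
   finally show "card (W Int (R Un t ` J)) <= card J + card R" by simp
  qed simp
  finally show ?thesis by (simp add: mult.commute)
 qed
 have part1: "\<bar>N * (SUM pv:?S. Ph D pv * Y pv) - (SUM pv:?S. (SUM u:W. Ps pv u) * Y pv)\<bar>
   <= real (card ?S) * (2 * B\<^sup>2 * real (card J + card R))"
 proof -
  have "N * (SUM pv:?S. Ph D pv * Y pv) = (SUM u:W. SUM pv:?S. Ph D pv * Y pv)" by (simp add: N_def)
  also have "... = (SUM u:W. SUM pv:?S. Ph D (pv \<circ> Transposition.transpose (t k) u) * Y (pv \<circ> Transposition.transpose (t k) u))"
   by (intro sum.cong refl swap)
  also have "... = (SUM pv:?S. SUM u:W. Ph D (pv \<circ> Transposition.transpose (t k) u) * Y (pv \<circ> Transposition.transpose (t k) u))"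
   by (rule sum.swap)
  finally have 1: "N * (SUM pv:?S. Ph D pv * Y pv) = (SUM pv:?S. SUM u:W. Ph D (pv \<circ> Transposition.transpose (t k) u) * Y (pv \<circ> Transposition.transpose (t k) u))" .
  have 2: "(SUM pv:?S. (SUM u:W. Ps pv u) * Y pv) = (SUM pv:?S. SUM u:W. Ps pv (pv u) * Y pv)"
  proof (rule sum.cong[OF refl])
   fix pv assume "pv : ?S"
   hence "bij_betw pv W W" by (simp add: permutes_imp_bij)
   from sum.reindex_bij_betw[OF this, of "Ps pv"]
   show "(SUM u:W. Ps pv u) * Y pv = (SUM u:W. Ps pv (pv u) * Y pv)" by (simp only: sum_distrib_right[symmetric])
  qed
  have "\<bar>N * (SUM pv:?S. Ph D pv * Y pv) - (SUM pv:?S. (SUM u:W. Ps pv u) * Y pv)\<bar>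
   = \<bar>SUM pv:?S. SUM u:W. Ph D (pv \<circ> Transposition.transpose (t k) u) * Y (pv \<circ> Transposition.transpose (t k) u) - Ps pv (pv u) * Y pv\<bar>"
   unfolding 1 2 by (simp add: sum_subtractf)
  also have "... <= (SUM pv:?S. SUM u:W. \<bar>Ph D (pv \<circ> Transposition.transpose (t k) u) * Y (pv \<circ> Transposition.transpose (t k) u) - Ps pv (pv u) * Y pv\<bar>)"
   by (rule order_trans[OF sum_abs sum_mono[OF sum_abs]])
  also have "... <= (SUM pv:?S. SUM u:W. b u)" by (intro sum_mono close) auto
  also have "... <= real (card ?S) * (2 * B\<^sup>2 * real (card J + card R))" using sum_b by (simp add: mult_left_mono)
  finally show ?thesis .
 qed
 have part2: "\<bar>(SUM u:W. Ps pv u) / N - Ph (insert k D) pv\<bar> <= err" if pv: "pv permutes W" for pv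
 proof -
  define q where "q y = ph (cc (insert k D) pv y)" for y
  have qm: "q : borel_measurable ?P" unfolding q_def using D pv by (intro Phm) auto
  have qb: "\<bar>q y\<bar> <= B" if "y : space ?P" for y unfolding q_def by (intro bnd ccA pv that)
  have kI: "k : I" using D J by auto
  have qk: "q (y(k := x)) = ph ((cc D pv y)(k := Q x))" for y x
  proof -
   have "cc (insert k D) pv (y(k := x)) = (cc D pv y)(k := Q x)" using D(3) by (auto simp: cc_def)
   thus ?thesis by (simp add: q_def)
  qed
  note rs = integral_PiM_resample[OF M kI qm qb, simplified]
  have i1: "integrable ?P (%y. (SUM u:W. ph ((cc D pv y)(k := X u))) / N)" using Psm[OF pv] PsA[OF pv]
   by (intro integrable_divide Bochner_Integration.integrable_sum P.integrable_const_bound[of _ B] AE_I2) auto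
  have i2: "integrable ?P (%y. \<integral>x. ph ((cc D pv y)(k := Q x)) \<partial>M)" using rs(1) by (simp add: qk)
  have "(SUM u:W. Ps pv u) / N = (\<integral>y. (SUM u:W. ph ((cc D pv y)(k := X u))) / N \<partial>?P)"
   unfolding Ps_def using Psm[OF pv] PsA[OF pv] by (subst integral_divide_zero, subst Bochner_Integration.integral_sum)
     (auto intro!: P.integrable_const_bound[of _ B])
  moreover have "Ph (insert k D) pv = (\<integral>y. \<integral>x. ph ((cc D pv y)(k := Q x)) \<partial>M \<partial>?P)"
   using rs(2) by (simp add: Ph_alt q_def[symmetric] qk)
  ultimately have "\<bar>(SUM u:W. Ps pv u) / N - Ph (insert k D) pv\<bar>
   = \<bar>\<integral>y. (SUM u:W. ph ((cc D pv y)(k := X u))) / N - (\<integral>x. ph ((cc D pv y)(k := Q x)) \<partial>M) \<partial>?P\<bar>"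
   by (simp only: Bochner_Integration.integral_diff[OF i1 i2])
  also have "... <= (\<integral>y. \<bar>(SUM u:W. ph ((cc D pv y)(k := X u))) / N - (\<integral>x. ph ((cc D pv y)(k := Q x)) \<partial>M)\<bar> \<partial>?P)"
   by (rule integral_abs_bound)
  also have "... <= err"
  proof (rule P.integral_le_const)
   show "integrable ?P (%y. \<bar>(SUM u:W. ph ((cc D pv y)(k := X u))) / N - (\<integral>x. ph ((cc D pv y)(k := Q x)) \<partial>M)\<bar>)"
    using i1 i2 by simp
   show "AE y in ?P. \<bar>(SUM u:W. ph ((cc D pv y)(k := X u))) / N - (\<integral>x. ph ((cc D pv y)(k := Q x)) \<partial>M)\<bar> <= err"
   proof (rule AE_I2)
    fix y assume "y : space ?P"
    hence "ALL j:J. cc D pv y j : A" using ccA[OF pv] by blast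
    thus "\<bar>(SUM u:W. ph ((cc D pv y)(k := X u))) / N - (\<integral>x. ph ((cc D pv y)(k := Q x)) \<partial>M)\<bar> <= err"
     using err D(2) unfolding column_error_def N_def by blast
   qed
  qed
  finally show ?thesis .
 qed
 have part2': "\<bar>(SUM pv:?S. (SUM u:W. Ps pv u) * Y pv) / N - (SUM pv:?S. Ph (insert k D) pv * Y pv)\<bar> <= real (card ?S) * (err * B)"
 proof -
  have "(SUM pv:?S. (SUM u:W. Ps pv u) * Y pv) / N - (SUM pv:?S. Ph (insert k D) pv * Y pv)
    = (SUM pv:?S. ((SUM u:W. Ps pv u) / N - Ph (insert k D) pv) * Y pv)"
   by (simp only: sum_divide_distrib left_diff_distrib sum_subtractf times_divide_eq_left[symmetric])
  also have "\<bar>...\<bar> <= (SUM pv:?S. \<bar>((SUM u:W. Ps pv u) / N - Ph (insert k D) pv) * Y pv\<bar>)" by (rule sum_abs)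
  also have "... <= (SUM pv:?S. err * B)"
  proof (rule sum_mono)
   fix pv assume "pv : ?S"
   hence pv: "pv permutes W" by simp
   have "0 <= err" using part2[OF pv] by linarith
   thus "\<bar>((SUM u:W. Ps pv u) / N - Ph (insert k D) pv) * Y pv\<bar> <= err * B"
    unfolding abs_mult using part2[OF pv] Y[OF pv] by (intro mult_mono) auto
  qed
  finally show ?thesis by simp
 qed
 have "\<bar>(SUM pv:?S. Ph D pv * Y pv) - (SUM pv:?S. (SUM u:W. Ps pv u) * Y pv) / N\<bar>
   = \<bar>N * (SUM pv:?S. Ph D pv * Y pv) - (SUM pv:?S. (SUM u:W. Ps pv u) * Y pv)\<bar> / N"
 proof -
  have "p - q / N = (N * p - q) / N" for p q using N by (simp add: diff_divide_distrib)
  thus ?thesis using N by (simp only: abs_divide abs_of_pos)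
 qed
 also have "... <= real (card ?S) * (2 * B\<^sup>2 * real (card J + card R)) / N"
  using part1 N by (intro divide_right_mono) auto
 finally have part1': "\<bar>(SUM pv:?S. Ph D pv * Y pv) - (SUM pv:?S. (SUM u:W. Ps pv u) * Y pv) / N\<bar>
  <= real (card ?S) * (2 * B\<^sup>2 * real (card J + card R) / N)" by simp
 have "(SUM pv:?S. (Ph D pv - Ph (insert k D) pv) * Y pv) = (SUM pv:?S. Ph D pv * Y pv) - (SUM pv:?S. Ph (insert k D) pv * Y pv)"
  by (simp add: left_diff_distrib sum_subtractf)
 thus ?thesis using part1' part2' by (simp add: N_def[symmetric] distrib_left)
qed

text \<open>Two kernels reading disjoint sets of columns are almost uncorrelated under a random permutation, since
the second one can be integrated out column by column, and its integral is zero.\<close>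

lemma permuted_columns_decorrelate:
 fixes ph :: "('h => 'c) => real"
 assumes M: "prob_space M" and J: "finite J" "J <= I"
  and ker: "column_kernel M I J A Q B ph" and Q: "!!x. x : space M ==> Q x : A"
  and W: "finite W" "W ~= {}" and X: "!!u. u : W ==> X u : A"
  and err: "column_error M J A Q W X err ph"
  and t: "inj_on t J" "t ` J <= W"
  and Y: "!!pv. pv permutes W ==> \<bar>Y pv\<bar> <= B"
  and R: "finite R" "R Int t ` J = {}"
  and YR: "!!pv pv'. (!!r. r : R ==> pv r = pv' r) ==> Y pv = Y pv'"
  and B: "0 <= B"
 shows "\<bar>\<Sum>pv | pv permutes W. ph (%j. X (pv (t j))) * Y pv\<bar>
  <= real (card J) * (real (card {pv. pv permutes W}) * (err * B + 2 * B\<^sup>2 * real (card J + card R) / real (card W)))"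
proof -
 let ?P = "PiM I (%_. M)"
 define Ph where "Ph = (%D pv. \<integral>y. ph (%j. if j : D then Q (y j) else X (pv (t j))) \<partial>?P)"
 define e where "e = real (card {pv. pv permutes W}) * (err * B + 2 * B\<^sup>2 * real (card J + card R) / real (card W))"
 interpret P: prob_space ?P by (rule prob_space_PiM) (rule M)
 have "\<bar>\<Sum>pv | pv permutes W. (Ph {} pv - Ph D pv) * Y pv\<bar> <= real (card D) * e" if "D <= J" for D
  using finite_subset[OF that J(1)] that
 proof (induction D rule: finite_induct)
  case empty
  thus ?case by simp
 next
  case (insert k D)
  have "\<bar>\<Sum>pv | pv permutes W. (Ph D pv - Ph (insert k D) pv) * Y pv\<bar> <= e" unfolding e_def Ph_def
   by (rule permuted_columns_step[OF M J ker Q W X err t Y R YR _ _ _ B]) (use insert in auto)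
  moreover have "(\<Sum>pv | pv permutes W. (Ph {} pv - Ph (insert k D) pv) * Y pv) =
    (\<Sum>pv | pv permutes W. (Ph {} pv - Ph D pv) * Y pv) + (\<Sum>pv | pv permutes W. (Ph D pv - Ph (insert k D) pv) * Y pv)"
   by (simp add: sum.distrib[symmetric] algebra_simps)
  moreover have "real (card (insert k D)) * e = real (card D) * e + e" using insert by (simp add: algebra_simps)
  moreover have "\<bar>\<Sum>pv | pv permutes W. (Ph {} pv - Ph D pv) * Y pv\<bar> <= real (card D) * e"
   using insert.prems by (intro insert.IH) auto
  ultimately show ?case by linarith
 qed
 from this[of J] have "\<bar>\<Sum>pv | pv permutes W. (Ph {} pv - Ph J pv) * Y pv\<bar> <= real (card J) * e" by simp
 moreover have "Ph {} pv = ph (%j. X (pv (t j)))" for pv by (simp add: Ph_def P.prob_space)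
 moreover have "Ph J pv = 0" for pv
 proof -
  have dep: "ALL c c'. (ALL k:J. c k = c' k) --> ph c = ph c'" using ker by (simp add: column_kernel_def)
  have eq: "ph (%j. if j : J then Q (y j) else X (pv (t j))) = ph (%j. Q (y j))" for y
   using dep[rule_format, of "%j. if j : J then Q (y j) else X (pv (t j))" "%j. Q (y j)"] by simp
  show ?thesis unfolding Ph_def eq using ker unfolding column_kernel_def by blast
 qed
 ultimately show ?thesis by (simp add: e_def)
qed

section \<open>Variance over random permutations\<close>

lemma column_kernel_bound:
 "column_kernel M I J A Q B ph ==> (!!k. k : J ==> c k : A) ==> \<bar>ph c\<bar> <= B" by (simp add: column_kernel_def)

text \<open>Expanding the square, pairs of points reading disjoint columns contribute little by decorrelation
and the remaining pairs are few.\<close>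

lemma permuted_average_variance:
 fixes ph :: "'v => 'w => ('h => 'c) => real" and t :: "'h => 'w => 'w"
 assumes M: "prob_space M" and J: "finite J" "J <= I" and Q: "!!x. x : space M ==> Q x : A"
  and V: "finite V" and W: "finite W" "W ~= {}"
  and ker: "!!v w. v : V ==> w : W ==> column_kernel M I J A Q B (ph v w)"
  and X: "!!v u. v : V ==> u : W ==> X v u : A"
  and err: "!!v w. v : V ==> w : W ==> column_error M J A Q W (X v) (err v) (ph v w)"
  and err0: "!!v. v : V ==> 0 <= err v"
  and t: "!!k. k : J ==> bij_betw (t k) W W" and B: "0 <= B"
  and bad: "real (card {w : W. ~ inj_on (%k. t k w) J}) <= bt * real (card W)"
 shows "(\<Sum>pv | pv permutes W. (SUM (v, w):V \<times> W. ph v w (%k. X v (pv (t k w))))\<^sup>2)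
  <= real (card {pv. pv permutes W}) * ((real (card V) * real (card W))\<^sup>2 *
    (B\<^sup>2 * bt + 5 * B\<^sup>2 * (real (card J))\<^sup>2 / real (card W))
   + real (card V) * (real (card W))\<^sup>2 * (B * real (card J) * (SUM v:V. err v)))"
proof -
 let ?S = "{pv. pv permutes W}"
 define N where "N = real (card W)"
 define m where "m = real (card V)"
 define r where "r = real (card J)"
 define s where "s = real (card ?S)"
 have N: "0 < N" using W by (simp add: N_def card_gt_0_iff)
 define ps where "ps = (%p pv. ph (fst p) (snd p) (%k. X (fst p) (pv (t k (snd p)))))"
 have tW: "t k w : W" if "k : J" "w : W" for k w using t[OF that(1)] that(2) by (auto simp: bij_betw_def)
 have psb: "\<bar>ps p pv\<bar> <= B" if "p : V \<times> W" "pv permutes W" for p pv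
 proof -
  have "column_kernel M I J A Q B (ph (fst p) (snd p))" using that ker by auto
  thus ?thesis unfolding ps_def by (rule column_kernel_bound) (use that tW X in \<open>auto simp: permutes_in_image\<close>)
 qed
 define coll where "coll w w' = (if (%k. t k w') ` J Int (%k. t k w) ` J = {} then 0 else B\<^sup>2)" for w w'
 define bd where "bd w = (if inj_on (%k. t k w) J then 0 else B\<^sup>2)" for w
 have pairs: "(SUM pv:?S. ps p pv * ps p' pv) <= s * (r * B * err (fst p) + 4 * B\<^sup>2 * r\<^sup>2 / N + bd (snd p) + coll (snd p) (snd p'))"
  if p: "p : V \<times> W" and p': "p' : V \<times> W" for p p'
 proof -
  obtain v w v' w' where [simp]: "p = (v, w)" "p' = (v', w')" by (cases p, cases p') auto
  have vw: "v : V" "w : W" "v' : V" "w' : W" using p p' by auto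
  have nonneg: "0 <= r * B * err v" "0 <= 4 * B\<^sup>2 * r\<^sup>2 / N" "0 <= bd w" "0 <= coll w w'"
   using err0[OF vw(1)] B N by (auto simp: r_def bd_def coll_def)
  show ?thesis
  proof (cases "inj_on (%k. t k w) J & (%k. t k w') ` J Int (%k. t k w) ` J = {}")
   case True
   let ?R = "(%k. t k w') ` J"
   have "\<bar>SUM pv:?S. ph v w (%j. X v (pv (t j w))) * ps p' pv\<bar>
    <= real (card J) * (real (card ?S) * (err v * B + 2 * B\<^sup>2 * real (card J + card ?R) / real (card W)))"
   proof (rule permuted_columns_decorrelate[OF M J ker[OF vw(1,2)] Q W X[OF vw(1)] err[OF vw(1,2)], where R = ?R and t = "%k. t k w"])
    show "inj_on (%k. t k w) J" "(%k. t k w) ` J <= W" "finite ?R" "?R Int (%k. t k w) ` J = {}" "0 <= B"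
     using True tW vw J B by auto
    show "\<bar>ps p' pv\<bar> <= B" if "pv permutes W" for pv by (rule psb[OF p' that])
    show "ps p' pv = ps p' pv'" if "!!r. r : ?R ==> pv r = pv' r" for pv pv'
    proof -
     have "ALL c c'. (ALL k:J. c k = c' k) --> ph v' w' c = ph v' w' c'"
      using ker[OF vw(3,4)] by (simp add: column_kernel_def)
     moreover have "ALL k:J. X v' (pv (t k w')) = X v' (pv' (t k w'))" using that by auto
     ultimately show ?thesis unfolding ps_def by simp
    qed
   qed
   also have "... = s * (r * B * err v + r * (2 * B\<^sup>2 * (r + real (card ?R)) / N))"
    by (simp add: s_def r_def N_def algebra_simps)
   also have "... <= s * (r * B * err v + r * (2 * B\<^sup>2 * (r + r) / N))"
   proof -
    have "real (card ?R) <= r" using card_image_le[OF J(1)] by (simp add: r_def)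
    thus ?thesis using N by (intro mult_left_mono add_left_mono divide_right_mono) (auto simp: s_def r_def)
   qed
   also have "r * (2 * B\<^sup>2 * (r + r) / N) = 4 * B\<^sup>2 * r\<^sup>2 / N" by (simp add: power2_eq_square)
   finally have "(SUM pv:?S. ps p pv * ps p' pv) <= s * (r * B * err v + 4 * B\<^sup>2 * r\<^sup>2 / N)" by (simp add: ps_def)
   also have "... <= s * (r * B * err v + 4 * B\<^sup>2 * r\<^sup>2 / N + bd w + coll w w')"
    using nonneg by (intro mult_left_mono) (auto simp: s_def)
   finally show ?thesis by simp
  next
   case False
   have "(SUM pv:?S. ps p pv * ps p' pv) <= (SUM pv:?S. B\<^sup>2)"
   proof (rule sum_mono)
    fix pv assume "pv : ?S"
    hence "\<bar>ps p pv\<bar> * \<bar>ps p' pv\<bar> <= B * B" using psb p p' B by (intro mult_mono) auto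
    thus "ps p pv * ps p' pv <= B\<^sup>2" by (simp add: abs_mult[symmetric] power2_eq_square)
   qed
   also have "... = s * B\<^sup>2" by (simp add: s_def)
   also have "... <= s * (r * B * err v + 4 * B\<^sup>2 * r\<^sup>2 / N + bd w + coll w w')"
   proof (rule mult_left_mono)
    have "B\<^sup>2 <= bd w + coll w w'" using False by (auto simp: bd_def coll_def)
    thus "B\<^sup>2 <= r * B * err v + 4 * B\<^sup>2 * r\<^sup>2 / N + bd w + coll w w'" using nonneg by linarith
   qed (simp add: s_def)
   finally show ?thesis by simp
  qed
 qed
 have sum_bd: "(SUM w:W. bd w) <= B\<^sup>2 * bt * N"
 proof -
  have "(SUM w:W. bd w) = (\<Sum>w | w : W & ~ inj_on (%k. t k w) J. B\<^sup>2)"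
   unfolding bd_def using W(1) by (subst sum.inter_filter) (auto intro!: sum.cong)
  also have "... = B\<^sup>2 * real (card {w : W. ~ inj_on (%k. t k w) J})" by simp
  also have "... <= B\<^sup>2 * (bt * N)" using bad by (intro mult_left_mono) (auto simp: N_def)
  finally show ?thesis by (simp add: mult.assoc)
 qed
 have sum_coll: "(SUM w':W. coll w w') <= B\<^sup>2 * r\<^sup>2" if w: "w : W" for w
 proof -
  let ?C = "{w' : W. ~ (%k. t k w') ` J Int (%k. t k w) ` J = {}}"
  have "?C <= (%(k, k'). inv_into W (t k') (t k w)) ` (J \<times> J)"
  proof
   fix w' assume "w' : ?C"
   then obtain k k' where k: "k : J" "k' : J" "w' : W" "t k' w' = t k w" by force
   hence "w' = inv_into W (t k') (t k w)" using t[OF k(2)] by (metis bij_betw_inv_into_left)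
   thus "w' : (%(k, k'). inv_into W (t k') (t k w)) ` (J \<times> J)" using k by force
  qed
  hence "card ?C <= card ((%(k, k'). inv_into W (t k') (t k w)) ` (J \<times> J))" using J by (intro card_mono) auto
  also have "... <= card (J \<times> J)" using J by (intro card_image_le) auto
  finally have "real (card ?C) <= r\<^sup>2" by (simp add: r_def card_cartesian_product power2_eq_square flip: of_nat_mult)
  hence "B\<^sup>2 * real (card ?C) <= B\<^sup>2 * r\<^sup>2" by (rule mult_left_mono) simp
  moreover have "(SUM w':W. coll w w') = (SUM w':?C. B\<^sup>2)"
   unfolding coll_def using W(1) by (subst sum.inter_filter) (auto intro!: sum.cong)
  ultimately show ?thesis by (simp add: mult.commute)
 qed
 have "(SUM pv:?S. (SUM (v, w):V \<times> W. ph v w (%k. X v (pv (t k w))))\<^sup>2)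
   = (SUM pv:?S. SUM p:V \<times> W. SUM p':V \<times> W. ps p pv * ps p' pv)"
  by (intro sum.cong refl) (simp add: power2_eq_square sum_product ps_def case_prod_beta)
 also have "... = (SUM p:V \<times> W. SUM pv:?S. SUM p':V \<times> W. ps p pv * ps p' pv)" by (rule sum.swap)
 also have "... = (SUM p:V \<times> W. SUM p':V \<times> W. SUM pv:?S. ps p pv * ps p' pv)" by (intro sum.cong refl sum.swap)
 also have "... <= (SUM p:V \<times> W. SUM p':V \<times> W. s * (r * B * err (fst p) + 4 * B\<^sup>2 * r\<^sup>2 / N + bd (snd p) + coll (snd p) (snd p')))"
  by (intro sum_mono pairs)
 also have "... = s * (SUM v:V. SUM w:W. SUM v':V. SUM w':W. r * B * err v + 4 * B\<^sup>2 * r\<^sup>2 / N + bd w + coll w w')"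
 proof -
  have cart: "(SUM p:V \<times> W. h p) = (SUM v:V. SUM w:W. h (v, w))" for h :: "'v \<times> 'w => real"
   by (simp add: sum.cartesian_product)
  show ?thesis by (simp only: cart fst_conv snd_conv sum_distrib_left)
 qed
 also have "(SUM v:V. SUM w:W. SUM v':V. SUM w':W. r * B * err v + 4 * B\<^sup>2 * r\<^sup>2 / N + bd w + coll w w')
   = m * N\<^sup>2 * (B * r * (SUM v:V. err v)) + (m * N)\<^sup>2 * (4 * B\<^sup>2 * r\<^sup>2 / N) + m\<^sup>2 * N * (SUM w:W. bd w) + m\<^sup>2 * (SUM w:W. SUM w':W. coll w w')"
  by (simp add: sum.distrib m_def[symmetric] N_def[symmetric] sum_distrib_left[symmetric] power2_eq_square algebra_simps)
 also have "... <= m * N\<^sup>2 * (B * r * (SUM v:V. err v)) + (m * N)\<^sup>2 * (4 * B\<^sup>2 * r\<^sup>2 / N) + m\<^sup>2 * N * (B\<^sup>2 * bt * N) + m\<^sup>2 * (SUM w:W. B\<^sup>2 * r\<^sup>2)"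
  using N by (intro add_mono mult_left_mono sum_bd sum_mono sum_coll order_refl) (auto simp: m_def)
 also have "... = (m * N)\<^sup>2 * (B\<^sup>2 * bt + 5 * B\<^sup>2 * r\<^sup>2 / N) + m * N\<^sup>2 * (B * r * (SUM v:V. err v))"
  using N by (simp add: N_def[symmetric] power2_eq_square field_simps)
 finally show ?thesis by (simp add: s_def m_def N_def r_def mult_left_mono)
qed

lemma markov_permutations:
 fixes q :: "('w => 'w) => real"
 assumes W: "finite W" and c: "0 < c" and le: "(\<Sum>pv | pv permutes W. (q pv)\<^sup>2) <= real (card {pv. pv permutes W}) * (et * c\<^sup>2)"
 shows "real (card {pv. pv permutes W & c <= \<bar>q pv\<bar>}) <= et * real (card {pv. pv permutes W})"
proof -
 let ?S = "{pv. pv permutes W}" and ?T = "{pv. pv permutes W & c <= \<bar>q pv\<bar>}"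
 have fS: "finite ?S" using W by (rule finite_permutations)
 have "real (card ?T) * c\<^sup>2 = (SUM pv:?T. c\<^sup>2)" by simp
 also have "... <= (SUM pv:?T. (q pv)\<^sup>2)"
  using c by (intro sum_mono) (metis (mono_tags, lifting) abs_le_square_iff abs_of_pos mem_Collect_eq)
 also have "... <= (SUM pv:?S. (q pv)\<^sup>2)" using fS by (intro sum_mono2) auto
 also note le
 finally have "real (card ?T) * c\<^sup>2 <= (et * real (card ?S)) * c\<^sup>2" by (simp add: algebra_simps)
 thus ?thesis using c by (simp add: mult_le_cancel_right)
qed

section \<open>Co-induced paths merged with a second labelling\<close>

text \<open>An identification of \<open>SC\<close> with the product of two label spaces carrying the sum metric; pairs and
finite tuples are the two instances.\<close>

definition merging ::
  "('a => 'b => 'c) => ('c => 'a) => ('c => 'b) => 'a set => ('a => 'a => real) =>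
    'b set => ('b => 'b => real) => 'c set => ('c => 'c => real) => bool" where
 "merging j p1 p2 S d S' e SC dC \<longleftrightarrow>
   (ALL a:S. ALL b:S'. j a b : SC & p1 (j a b) = a & p2 (j a b) = b) &
   (ALL c:SC. p1 c : S & p2 c : S' & j (p1 c) (p2 c) = c) &
   (ALL c:SC. ALL c':SC. dC c c' = d (p1 c) (p1 c') + e (p2 c) (p2 c'))"

lemma mergingD:
 assumes "merging j p1 p2 S d S' e SC dC"
 shows "a : S ==> b : S' ==> j a b : SC" "a : S ==> b : S' ==> p1 (j a b) = a"
  "a : S ==> b : S' ==> p2 (j a b) = b"
  "c : SC ==> p1 c : S" "c : SC ==> p2 c : S'" "c : SC ==> j (p1 c) (p2 c) = c"
  "c : SC ==> c' : SC ==> dC c c' = d (p1 c) (p1 c') + e (p2 c) (p2 c')" using assms unfolding merging_def by auto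

lemma merging_dist:
 assumes "merging j p1 p2 S d S' e SC dC" "a : S" "a' : S" "b : S'" "b' : S'"
 shows "dC (j a b) (j a' b') = d a a' + e b b'" using mergingD[OF assms(1)] assms(2-5) by simp

text \<open>The orbit of the observable \<open>y \<mapsto> label of y at 1\<close> under the co-induced action: the
column over \<open>h\<close> is the \<open>G\<close>-orbit of the \<open>h\<close>-th coordinate.\<close>

definition coind_path ::
  "('g, 'm) monoid_scheme => ('h, 'n) monoid_scheme => ('g => 'x => 'x) => ('x => 'a) =>
    ('h => 'x) => 'g \<times> 'h => 'a" where
 "coind_path G H T af y = (\<lambda>i\<in>carrier G \<times> carrier H. af (T (fst i) (y (snd i))))"

definition merge_path :: "'i set => ('a => 'b => 'c) => ('i => 'a) => ('i => 'b) => 'i => 'c" where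
 "merge_path D j a b = (\<lambda>i\<in>D. j (a i) (b i))"

lemma lip_on_eq:
 assumes "tbm S d" "lip_on D S d E C f" "a : D ~> S" "b : D ~> S" "!!i. i : E ==> a i = b i"
 shows "f a = f b"
proof -
 have "(SUM i:E. d (a i) (b i)) = 0"
  using assms(2-5) by (intro sum.neutral) (auto simp: lip_on_def PiE_iff subset_iff tbm_zero[OF assms(1)])
 thus ?thesis using lip_onD[OF assms(2-4)] by simp
qed

locale coind_merge =
 fixes G :: "('g, 'm) monoid_scheme" and H :: "('h, 'n) monoid_scheme"
  and M :: "'x measure" and T :: "'g => 'x => 'x" and af :: "'x => 'a"
  and S :: "'a set" and d and S' :: "'b set" and e and SC :: "'c set" and dC
  and j :: "'a => 'b => 'c" and p1 and p2
 assumes grpG: "group G" and grpH: "group H" and pm: "pmp G M T"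
  and tb: "tbm S d" and tb': "tbm S' e" and tbC: "tbm SC dC"
  and obs: "observable M S d af" and mg: "merging j p1 p2 S d S' e SC dC"
begin

sublocale G: group G by (rule grpG)
sublocale H: group H by (rule grpH)
sublocale M: prob_space M by (rule pmpD(1)[OF pm])

abbreviation "D \<equiv> carrier G \<times> carrier H"
abbreviation "MH \<equiv> coind_measure H M"
abbreviation "cp \<equiv> coind_path G H T af"
abbreviation "mp \<equiv> merge_path D j"
abbreviation "col \<equiv> orb G T af"
abbreviation "cols \<equiv> carrier G ~> S"

sublocale MH: prob_space MH unfolding coind_measure_def by (rule prob_space_PiM) unfold_locales

lemma S_ne: "S ~= {}" using obs M.not_empty unfolding observable_def by blast

definition "s0 = (SOME s. s : S)"

lemma s0: "s0 : S" unfolding s0_def using S_ne by (simp add: some_in_eq)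

lemma col_in: "x : space M ==> col x : cols" by (rule orb_in[OF pm obs])

lemma space_MH: "space MH = carrier H ~> space M" by (simp add: coind_measure_def space_PiM)

lemma col_y_in: "y : space MH ==> k : carrier H ==> col (y k) : cols" by (rule col_in) (auto simp: space_MH)

lemma cp_in: "y : space MH ==> cp y : D ~> S"
 using obs pmpD(6)[OF pm] by (auto simp: coind_path_def space_MH observable_def PiE_iff)

lemma mp_in: "a : D ~> S ==> b : D ~> S' ==> mp a b : D ~> SC"
 using mergingD(1)[OF mg] by (auto simp: merge_path_def PiE_iff)

definition "cpath J c = (\<lambda>i\<in>D. if snd i : J then c (snd i) (fst i) else s0)"

lemma cpath_in: "(!!k. k : J ==> c k : cols) ==> cpath J c : D ~> S" using s0 by (auto simp: cpath_def PiE_iff)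

lemma dist_measurable:
 assumes "i : D" "z : S"
 shows "(%y. d (af (T (fst i) (y (snd i)))) z) : borel_measurable MH"
proof -
 have "(%x. d (af x) z) : borel_measurable M" using obs assms by (simp add: observable_def)
 from measurable_compose[OF pmpD(2)[OF pm] this, of "fst i"]
 have "(%x. d (af (T (fst i) x)) z) : borel_measurable M" using assms by auto
 from measurable_compose[OF measurable_component_singleton[of "snd i" "carrier H" "%_. M"] this]
 show ?thesis using assms by (auto simp: coind_measure_def)
qed

lemma path_map_cp: "path_map MH D S d cp" unfolding path_map_def using cp_in dist_measurable by (auto simp: coind_path_def)

lemma path_map_mixed:
 assumes c: "!!k. k : J ==> c k : cols" and b: "b : D ~> S'" and "J <= carrier H" "K <= J"
 shows "path_map MH D SC dC (%y. mp (cpath J (%k. if k : K then col (y k) else c k)) b)" unfolding path_map_def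
proof (intro conjI ballI)
 fix y assume y: "y : space MH"
 show "mp (cpath J (%k. if k : K then col (y k) else c k)) b : D ~> SC"
 proof (intro mp_in cpath_in b)
  fix k assume k: "k : J"
  hence "col (y k) : cols" "c k : cols" by (rule col_y_in[OF y subsetD[OF assms(3)]], rule c)
  thus "(if k : K then col (y k) else c k) : cols" by presburger
 qed
next
 fix i z assume i: "i : D" and z: "z : SC"
 let ?a = "%y. if snd i : J then (if snd i : K then af (T (fst i) (y (snd i))) else c (snd i) (fst i)) else s0"
 have aS: "?a y : S" if "y : space MH" for y
  using that i c s0 obs pmpD(6)[OF pm] by (auto simp: space_MH PiE_iff observable_def)
 have "dC (mp (cpath J (%k. if k : K then col (y k) else c k)) b i) z = d (?a y) (p1 z) + e (b i) (p2 z)"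
  if y: "y : space MH" for y
 proof -
  have "mp (cpath J (%k. if k : K then col (y k) else c k)) b i = j (?a y) (b i)"
   using i by (auto simp: merge_path_def cpath_def orb_def)
  moreover have "b i : S'" using b i by auto
  ultimately show ?thesis using aS[OF y] mergingD[OF mg] z by simp
 qed
 moreover have "(%y. d (?a y) (p1 z) + e (b i) (p2 z)) : borel_measurable MH"
  using dist_measurable[OF i mergingD(4)[OF mg z]]
  by (intro borel_measurable_add; cases "snd i : J"; cases "snd i : K") simp_all
 ultimately show "(%y. dC (mp (cpath J (%k. if k : K then col (y k) else c k)) b i) z) : borel_measurable MH"
  by (subst measurable_cong) auto
qed

definition "Th f b = (\<integral>y. f (mp (cp y) b) \<partial>MH)"

definition "ker f J b c = f (mp (cpath J c) b) - Th f b"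

context
 fixes f E C
 assumes lf: "lip_on D SC dC E C f"
begin

lemma E: "finite E" "E <= D" "0 <= C" using lf by (auto simp: lip_on_def)

lemma J: "finite (snd ` E)" "snd ` E <= carrier H" using E by auto

lemma f_cp_eq:
 assumes y: "y : space MH" and b: "b : D ~> S'"
 shows "f (mp (cpath (snd ` E) (%k. col (y k))) b) = f (mp (cp y) b)"
proof (rule lip_on_eq[OF tbC lf])
 show "mp (cpath (snd ` E) (%k. col (y k))) b : D ~> SC" by (intro mp_in cpath_in b col_y_in[OF y]) (rule subsetD[OF J(2)])
 show "mp (cp y) b : D ~> SC" by (intro mp_in cp_in y b)
 fix i assume "i : E"
 thus "mp (cpath (snd ` E) (%k. col (y k))) b i = mp (cp y) b i"
  using E by (auto simp: merge_path_def cpath_def orb_def coind_path_def subset_iff)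
qed

lemma f_mixed_measurable:
 assumes "!!k. k : snd ` E ==> c k : cols" "b : D ~> S'" "K <= snd ` E"
 shows "(%y. f (mp (cpath (snd ` E) (%k. if k : K then col (y k) else c k)) b)) : borel_measurable MH"
 by (rule path_map_loc_measurable[OF tbC path_map_mixed[OF assms(1,2) J(2) assms(3)] locI[OF lf]]) auto

lemma f_cp_measurable:
 assumes b: "b : D ~> S'"
 shows "(%y. f (mp (cp y) b)) : borel_measurable MH"
proof -
 have dep: "cpath (snd ` E) (%k. if k : snd ` E then col (y k) else restrict (%_. s0) (carrier G)) = cpath (snd ` E) (%k. col (y k))" for y
  by (auto simp: cpath_def)
 have "(%y. f (mp (cpath (snd ` E) (%k. if k : snd ` E then col (y k) else restrict (%_. s0) (carrier G))) b)) : borel_measurable MH"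
  using s0 by (intro f_mixed_measurable b) auto
 hence "(%y. f (mp (cpath (snd ` E) (%k. col (y k))) b)) : borel_measurable MH" by (simp add: dep)
 thus ?thesis using f_cp_eq b by (subst measurable_cong[of MH _ "%y. f (mp (cpath (snd ` E) (%k. col (y k))) b)"]) auto
qed

context
 fixes B
 assumes B: "0 < B" "!!z. z : D ~> SC ==> \<bar>f z\<bar> <= B"
begin

lemma f_cp_integrable: "b : D ~> S' ==> integrable MH (%y. f (mp (cp y) b))"
 using f_cp_measurable B(2) mp_in cp_in by (intro MH.integrable_const_bound[of _ B]) auto

lemma Th_bound:
 assumes "b : D ~> S'" shows "\<bar>Th f b\<bar> <= B"
proof -
 have "(\<integral>y. \<bar>f (mp (cp y) b)\<bar> \<partial>MH) <= B"
  using f_cp_integrable[OF assms] B(2) mp_in cp_in assms by (intro MH.integral_le_const) auto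
 with integral_abs_bound[of MH "%y. f (mp (cp y) b)"] show ?thesis unfolding Th_def by (rule order_trans)
qed

lemma ker_column_kernel:
 assumes b: "b : D ~> S'"
 shows "column_kernel M (carrier H) (snd ` E) cols col (2 * B) (ker f (snd ` E) b)" unfolding column_kernel_def
proof (intro conjI allI impI)
 fix c assume "ALL k:snd ` E. c k : cols"
 hence "mp (cpath (snd ` E) c) b : D ~> SC" by (intro mp_in cpath_in b) auto
 thus "\<bar>ker f (snd ` E) b c\<bar> <= 2 * B" unfolding ker_def using B(2) Th_bound[OF b] by fastforce
next
 fix c c' :: "'h => 'g => 'a" assume eq: "ALL k:snd ` E. c k = c' k"
 have "cpath (snd ` E) c = cpath (snd ` E) c'"
  unfolding cpath_def by (intro restrict_ext if_cong refl fun_cong[OF bspec[OF eq]])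
 thus "ker f (snd ` E) b c = ker f (snd ` E) b c'" by (simp add: ker_def)
next
 fix K c assume "K <= snd ` E" "ALL k:snd ` E. c k : cols"
 hence "(%y. f (mp (cpath (snd ` E) (%k. if k : K then col (y k) else c k)) b)) : borel_measurable MH"
  by (intro f_mixed_measurable b) auto
 thus "(%y. ker f (snd ` E) b (%k. if k : K then col (y k) else c k)) : borel_measurable (Pi\<^sub>M (carrier H) (%_. M))"
  unfolding ker_def coind_measure_def by simp
next
 have "(\<integral>y. ker f (snd ` E) b (%k. col (y k)) \<partial>MH) = (\<integral>y. f (mp (cp y) b) - Th f b \<partial>MH)"
  using f_cp_eq b by (intro Bochner_Integration.integral_cong) (auto simp: ker_def)
 also have "... = 0" using f_cp_integrable[OF b] by (simp add: Th_def MH.prob_space)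
 finally show "(\<integral>y. ker f (snd ` E) b (%k. col (y k)) \<partial>Pi\<^sub>M (carrier H) (%_. M)) = 0"
  by (simp add: coind_measure_def)
qed

end

definition "colfun q k p = f (\<lambda>i\<in>D. if snd i = k then j (p (fst i)) (p2 (q i)) else q i)"

lemma colfun_path_in:
 assumes q: "q : D ~> SC" and p: "p : cols"
 shows "(\<lambda>i\<in>D. if snd i = k then j (p (fst i)) (p2 (q i)) else q i) : D ~> SC"
 using q p mergingD(1,5)[OF mg] by (auto simp: PiE_iff)

lemma colfun_loc:
 assumes q: "q : D ~> SC"
 shows "colfun q k : loc (carrier G) S d"
proof (rule locI)
 show "lip_on (carrier G) S d (fst ` E) (C * real (card E)) (colfun q k)" unfolding lip_on_def
 proof (intro conjI ballI)
  show "finite (fst ` E)" "fst ` E <= carrier G" "0 <= C * real (card E)" using E by auto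
  fix p p' assume p: "p : cols" "p' : cols"
  let ?z = "%p. \<lambda>i\<in>D. if snd i = k then j (p (fst i)) (p2 (q i)) else q i"
  have "\<bar>colfun q k p - colfun q k p'\<bar> <= C * (SUM i:E. dC (?z p i) (?z p' i))"
   unfolding colfun_def by (rule lip_onD[OF lf colfun_path_in[OF q p(1)] colfun_path_in[OF q p(2)]])
  also have "... <= C * (SUM i:E. SUM g:fst ` E. d (p g) (p' g))"
  proof (intro mult_left_mono sum_mono E(3))
   fix i assume i: "i : E"
   hence iD: "i : D" using E by auto
   have qi: "q i : SC" using q iD by auto
   have pi: "p (fst i) : S" "p' (fst i) : S" using p iD by auto
   have "dC (?z p i) (?z p' i) <= d (p (fst i)) (p' (fst i))"
   proof (cases "snd i = k")
    case True
    have "p2 (q i) : S'" using mergingD(5)[OF mg qi] .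
    thus ?thesis using iD True merging_dist[OF mg pi] tbm_zero[OF tb'] by auto
   next
    case False
    thus ?thesis using iD tbm_zero[OF tbC qi] tbm_nonneg[OF tb] by auto
   qed
   also have "... <= (SUM g:fst ` E. d (p g) (p' g))" using i E tbm_nonneg[OF tb] by (intro member_le_sum) auto
   finally show "dC (?z p i) (?z p' i) <= (SUM g:fst ` E. d (p g) (p' g))" .
  qed
  finally show "\<bar>colfun q k p - colfun q k p'\<bar> <= C * real (card E) * (SUM i:fst ` E. d (p i) (p' i))" by simp
 qed
qed

lemma ker_column_error:
 assumes b: "b : D ~> S'" and Qn: "finite Qn" "Qn <= D ~> SC"
  and net: "!!z. z : D ~> SC ==> EX q:Qn. ALL i:E. dC (z i) (q i) < rh" and rh: "0 < rh"
  and W: "finite W" "W ~= {}" and X: "!!u. u : W ==> X u : cols"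
 shows "column_error M (snd ` E) cols col W X
  ((SUM (q, k):Qn \<times> snd ` E. \<bar>(SUM u:W. colfun q k (X u)) / real (card W) - (\<integral>x. colfun q k (col x) \<partial>M)\<bar>)
   + 2 * (C * real (card E) * rh)) (ker f (snd ` E) b)" unfolding column_error_def
proof (intro allI impI)
 fix c k assume c: "ALL k:snd ` E. c k : cols" and k: "k : snd ` E"
 define N where "N = real (card W)"
 have N: "0 < N" using W by (simp add: N_def card_gt_0_iff)
 define z where "z = mp (cpath (snd ` E) c) b"
 have zin: "z : D ~> SC" unfolding z_def using c by (intro mp_in cpath_in b) auto
 obtain q where q: "q : Qn" "ALL i:E. dC (z i) (q i) < rh" using net[OF zin] by blast
 hence qin: "q : D ~> SC" using Qn by auto
 define F where "F p = f (mp (cpath (snd ` E) (c(k := p))) b)" for p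
 have near: "\<bar>F p - colfun q k p\<bar> <= C * real (card E) * rh" if p: "p : cols" for p
 proof -
  have in1: "mp (cpath (snd ` E) (c(k := p))) b : D ~> SC" using c p by (intro mp_in cpath_in b) auto
  let ?z = "\<lambda>i\<in>D. if snd i = k then j (p (fst i)) (p2 (q i)) else q i"
  have "\<bar>F p - colfun q k p\<bar> <= C * (SUM i:E. dC (mp (cpath (snd ` E) (c(k := p))) b i) (?z i))"
   unfolding F_def colfun_def by (rule lip_onD[OF lf in1 colfun_path_in[OF qin p]])
  also have "... <= C * (SUM i:E. rh)"
  proof (intro mult_left_mono sum_mono E(3))
   fix i assume i: "i : E"
   hence iD: "i : D" using E by auto
   have qi: "q i : SC" and zi: "z i : SC" and bi: "b i : S'" using qin zin b iD by auto
   show "dC (mp (cpath (snd ` E) (c(k := p))) b i) (?z i) <= rh"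
   proof (cases "snd i = k")
    case True
    have pi: "p (fst i) : S" using p iD by auto
    have "mp (cpath (snd ` E) (c(k := p))) b i = j (p (fst i)) (b i)" using True k iD by (simp add: merge_path_def cpath_def)
    moreover have "?z i = j (p (fst i)) (p2 (q i))" using True iD by simp
    ultimately have "dC (mp (cpath (snd ` E) (c(k := p))) b i) (?z i) = e (b i) (p2 (q i))"
     using merging_dist[OF mg pi pi bi mergingD(5)[OF mg qi]] tbm_zero[OF tb pi] by simp
    moreover have "p2 (z i) = b i"
    proof -
     have "cpath (snd ` E) c i : S" using cpath_in[of "snd ` E" c] c iD by (auto simp: PiE_iff)
     thus ?thesis using mergingD(3)[OF mg _ bi] iD by (simp add: z_def merge_path_def)
    qed
    moreover have "e (p2 (z i)) (p2 (q i)) <= dC (z i) (q i)" using mergingD(7)[OF mg zi qi] tbm_nonneg[OF tb] by simp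
    ultimately show ?thesis using q(2) i by force
   next
    case False
    have "mp (cpath (snd ` E) (c(k := p))) b i = z i" using False iD by (simp add: z_def merge_path_def cpath_def)
    thus ?thesis using False iD q(2) i by (auto intro: less_imp_le)
   qed
  qed
  finally show ?thesis by (simp add: mult.assoc)
 qed
 have intq: "integrable M (%x. colfun q k (col x))" by (rule obs_int_loc_integrable[OF tb pm obs colfun_loc[OF qin]])
 have F_eq: "F p = colfun (\<lambda>i\<in>D. j (cpath (snd ` E) c i) (b i)) k p" if p: "p : cols" for p
 proof -
  have "mp (cpath (snd ` E) (c(k := p))) b = (\<lambda>i\<in>D. if snd i = k then j (p (fst i)) (p2 ((\<lambda>i\<in>D. j (cpath (snd ` E) c i) (b i)) i)) else (\<lambda>i\<in>D. j (cpath (snd ` E) c i) (b i)) i)"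
  proof
   fix i
   show "mp (cpath (snd ` E) (c(k := p))) b i = (\<lambda>i\<in>D. if snd i = k then j (p (fst i)) (p2 ((\<lambda>i\<in>D. j (cpath (snd ` E) c i) (b i)) i)) else (\<lambda>i\<in>D. j (cpath (snd ` E) c i) (b i)) i) i"
   proof (cases "i : D")
    case True
    have aS: "cpath (snd ` E) c i : S" using cpath_in[of "snd ` E" c] c True by (auto simp: PiE_iff)
    have bS: "b i : S'" using b True by auto
    have "cpath (snd ` E) (c(k := p)) i = (if snd i = k then p (fst i) else cpath (snd ` E) c i)"
     using True k by (simp add: cpath_def)
    thus ?thesis using True mergingD(3)[OF mg aS bS] by (simp add: merge_path_def)
   qed (simp add: merge_path_def)
  qed
  thus ?thesis by (simp add: F_def colfun_def)
 qed
 have intF: "integrable M (%x. F (col x))"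
 proof -
  have "(\<lambda>i\<in>D. j (cpath (snd ` E) c i) (b i)) : D ~> SC" using zin by (simp add: z_def merge_path_def)
  from obs_int_loc_integrable[OF tb pm obs colfun_loc[OF this], of k]
  show ?thesis using F_eq col_in by (subst Bochner_Integration.integrable_cong[OF refl]) auto
 qed
 have a1: "\<bar>(SUM u:W. F (X u)) / N - (SUM u:W. colfun q k (X u)) / N\<bar> <= C * real (card E) * rh"
 proof -
  have "\<bar>(SUM u:W. F (X u)) - (SUM u:W. colfun q k (X u))\<bar> <= (SUM u:W. \<bar>F (X u) - colfun q k (X u)\<bar>)"
   unfolding sum_subtractf[symmetric] by (rule sum_abs)
  also have "... <= (SUM u:W. C * real (card E) * rh)" by (intro sum_mono near X)
  also have "... = (C * real (card E) * rh) * N" by (simp add: N_def)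
  finally have "\<bar>(SUM u:W. F (X u)) - (SUM u:W. colfun q k (X u))\<bar> / N <= C * real (card E) * rh"
   using N by (simp add: divide_le_eq)
  thus ?thesis using N by (simp add: diff_divide_distrib[symmetric])
 qed
 have a2: "\<bar>(\<integral>x. F (col x) \<partial>M) - (\<integral>x. colfun q k (col x) \<partial>M)\<bar> <= C * real (card E) * rh"
 proof -
  have "\<bar>(\<integral>x. F (col x) \<partial>M) - (\<integral>x. colfun q k (col x) \<partial>M)\<bar> = \<bar>\<integral>x. F (col x) - colfun q k (col x) \<partial>M\<bar>"
   using intF intq by simp
  also have "... <= (\<integral>x. \<bar>F (col x) - colfun q k (col x)\<bar> \<partial>M)" by (rule integral_abs_bound)
  also have "... <= C * real (card E) * rh" using intF intq near col_in by (intro M.integral_le_const) auto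
  finally show ?thesis .
 qed
 have a3: "\<bar>(SUM u:W. colfun q k (X u)) / N - (\<integral>x. colfun q k (col x) \<partial>M)\<bar>
   <= (SUM (q, k):Qn \<times> snd ` E. \<bar>(SUM u:W. colfun q k (X u)) / N - (\<integral>x. colfun q k (col x) \<partial>M)\<bar>)"
  using member_le_sum[of "(q, k)" "Qn \<times> snd ` E" "%(q, k). \<bar>(SUM u:W. colfun q k (X u)) / N - (\<integral>x. colfun q k (col x) \<partial>M)\<bar>"]
   q k Qn E by (auto simp: case_prod_beta)
 have k1: "(SUM u:W. ker f (snd ` E) b (c(k := X u))) / N = (SUM u:W. F (X u)) / N - Th f b"
  using N by (simp add: ker_def F_def sum_subtractf diff_divide_distrib N_def[symmetric])
 have k2: "(\<integral>x. ker f (snd ` E) b (c(k := col x)) \<partial>M) = (\<integral>x. F (col x) \<partial>M) - Th f b"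
  using intF by (simp add: ker_def F_def[symmetric] M.prob_space)
 show "\<bar>(SUM u:W. ker f (snd ` E) b (c(k := X u))) / real (card W) - (\<integral>x. ker f (snd ` E) b (c(k := col x)) \<partial>M)\<bar>
  <= (SUM (q, k):Qn \<times> snd ` E. \<bar>(SUM u:W. colfun q k (X u)) / real (card W) - (\<integral>x. colfun q k (col x) \<partial>M)\<bar>)
   + 2 * (C * real (card E) * rh)" unfolding N_def[symmetric] k1 k2 using a1 a2 a3 by linarith
qed

end

end

section \<open>A law of large numbers for the columns of a good model\<close>

context coind_merge
begin

lemma slice_in: "a : D ~> S ==> k : carrier H ==> (\<lambda>g\<in>carrier G. a (g, k)) : cols" by auto

lemma slice_loc:
 assumes "u : loc (carrier G) S d" "k : carrier H"
 shows "(%a. u (\<lambda>g\<in>carrier G. a (g, k))) : loc D S d"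
proof -
 obtain E C where l: "lip_on (carrier G) S d E C u" using assms by (auto simp: loc_def)
 have "lip_on D S d ((%g. (g, k)) ` E) C (%a. u (\<lambda>g\<in>carrier G. a (g, k)))" unfolding lip_on_def
 proof (intro conjI ballI)
  show E: "finite ((%g. (g, k)) ` E)" "(%g. (g, k)) ` E <= D" "0 <= C" using l assms by (auto simp: lip_on_def)
  fix a b assume ab: "a : D ~> S" "b : D ~> S"
  have "\<bar>u (\<lambda>g\<in>carrier G. a (g, k)) - u (\<lambda>g\<in>carrier G. b (g, k))\<bar>
    <= C * (SUM g:E. d ((\<lambda>g\<in>carrier G. a (g, k)) g) ((\<lambda>g\<in>carrier G. b (g, k)) g))"
   by (rule lip_onD[OF l slice_in[OF ab(1) assms(2)] slice_in[OF ab(2) assms(2)]])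
  also have "(SUM g:E. d ((\<lambda>g\<in>carrier G. a (g, k)) g) ((\<lambda>g\<in>carrier G. b (g, k)) g)) = (SUM g:E. d (a (g, k)) (b (g, k)))"
   using l by (intro sum.cong) (auto simp: lip_on_def)
  also have "... = (SUM i:(%g. (g, k)) ` E. d (a i) (b i))" by (subst sum.reindex) (auto intro!: inj_onI)
  finally show "\<bar>u (\<lambda>g\<in>carrier G. a (g, k)) - u (\<lambda>g\<in>carrier G. b (g, k))\<bar> <= C * (SUM i:(%g. (g, k)) ` E. d (a i) (b i))" .
 qed
 thus ?thesis by (rule locI)
qed

lemma slice_cp: "k : carrier H ==> (\<lambda>g\<in>carrier G. cp y (g, k)) = col (y k)"
 by (auto simp: coind_path_def orb_def)

text \<open>In a good model of the co-induced system the columns over a typical point sample the \<open>G\<close>-system, because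
finite families of columns are tested as well.\<close>

lemma column_lln:
 assumes u: "u : loc (carrier G) S d" and K: "finite K" "K <= carrier H" "K ~= {}"
  and B: "0 < B" "!!p. p : cols ==> \<bar>u p\<bar> <= B" and "0 < \<xi>" and big: "4 * B\<^sup>2 / \<xi>\<^sup>2 <= real (card K)"
 shows "(\<integral>y. \<bar>(SUM k:K. u (col (y k))) / real (card K) - (\<integral>x. u (col x) \<partial>M)\<bar> \<partial>MH) <= \<xi>"
proof -
 define I where "I = (\<integral>x. u (col x) \<partial>M)"
 define w where "w x = u (col x) - I" for x
 define m where "m = real (card K)"
 have m: "0 < m" using K by (simp add: m_def card_gt_0_iff)
 have ui: "integrable M (%x. u (col x))" by (rule obs_int_loc_integrable[OF tb pm obs u])
 have I: "\<bar>I\<bar> <= B"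
 proof -
  have "(\<integral>x. \<bar>u (col x)\<bar> \<partial>M) <= B" using ui B col_in by (intro M.integral_le_const) auto
  with integral_abs_bound[of M "%x. u (col x)"] show ?thesis unfolding I_def by (rule order_trans)
 qed
 have wm: "w : borel_measurable M"
 proof -
  have "w = (%x. u (col x) - I)" by (auto simp: w_def)
  thus ?thesis using ui by auto
 qed
 have wb: "\<bar>w x\<bar> <= 2 * B" if "x : space M" for x using B(2)[OF col_in[OF that]] I by (simp add: w_def)
 have w0: "(\<integral>x. w x \<partial>M) = 0" using ui by (simp add: w_def I_def M.prob_space)
 have wkm: "(%y. w (y k)) : borel_measurable MH" if "k : K" for k
  using measurable_compose[OF measurable_component_singleton[of k "carrier H" "%_. M"] wm] that K by (auto simp: coind_measure_def)
 have wkb: "\<bar>w (y k)\<bar> <= 2 * B" if "k : K" "y : space MH" for k y using that K by (intro wb) (auto simp: space_MH)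
 have prod_b: "\<bar>w (y k) * w (y l)\<bar> <= 4 * B\<^sup>2" if "k : K" "l : K" "y : space MH" for k l y
  using mult_mono[OF wkb[OF that(1,3)] wkb[OF that(2,3)]] B by (simp add: abs_mult power2_eq_square)
 have int: "integrable MH (%y. w (y k) * w (y l))" if "k : K" "l : K" for k l
  using prod_b[OF that] wkm[OF that(1)] wkm[OF that(2)] by (intro MH.integrable_const_bound[of _ "4 * B\<^sup>2"]) auto
 have cov: "(\<integral>y. w (y k) * w (y l) \<partial>MH) <= (if k = l then 4 * B\<^sup>2 else 0)" if kl: "k : K" "l : K" for k l
 proof (cases "k = l")
  case True
  thus ?thesis using prod_b[OF kl] int[OF kl] by (intro order_trans[OF MH.integral_le_const[of _ "4 * B\<^sup>2"]]) (auto simp: abs_le_iff)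
 next
  case False
  have "(\<integral>y. w (y k) * w (y l) \<partial>PiM (carrier H) (%_. M)) =
    (\<integral>y. \<integral>x. w ((y(k := x)) k) * w ((y(k := x)) l) \<partial>M \<partial>PiM (carrier H) (%_. M))"
   by (rule integral_PiM_resample(2)[where B = "4 * B\<^sup>2"])
     (use kl K prod_b wkm[OF kl(1)] wkm[OF kl(2)] M.prob_space_axioms in \<open>auto simp: coind_measure_def\<close>)
  also have "... = 0" using False w0 by simp
  finally show ?thesis using False by (simp add: coind_measure_def)
 qed
 have sq: "(\<integral>y. (SUM k:K. w (y k))\<^sup>2 \<partial>MH) <= m * (4 * B\<^sup>2)"
 proof -
  have "(\<integral>y. (SUM k:K. w (y k))\<^sup>2 \<partial>MH) = (\<integral>y. (SUM k:K. SUM l:K. w (y k) * w (y l)) \<partial>MH)"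
   by (simp add: power2_eq_square sum_product)
  also have "... = (SUM k:K. SUM l:K. \<integral>y. w (y k) * w (y l) \<partial>MH)"
   using int by (subst Bochner_Integration.integral_sum; (intro sum.cong refl Bochner_Integration.integral_sum Bochner_Integration.integrable_sum)?) auto
  also have "... <= (SUM k:K. SUM l:K. if k = l then 4 * B\<^sup>2 else 0)" by (intro sum_mono cov)
  also have "... = m * (4 * B\<^sup>2)" using K by (simp add: m_def)
  finally show ?thesis .
 qed
 have sqi: "integrable MH (%y. (SUM k:K. w (y k))\<^sup>2)"
  unfolding power2_eq_square sum_product using int by (intro Bochner_Integration.integrable_sum)
 have si: "integrable MH (%y. SUM k:K. w (y k))"
  using wkm wkb by (intro Bochner_Integration.integrable_sum MH.integrable_const_bound[of _ "2 * B"]) auto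
 have eq: "(SUM k:K. u (col (y k))) / real (card K) - I = (SUM k:K. w (y k)) / m" for y
  using m by (simp add: w_def sum_subtractf m_def[symmetric] diff_divide_distrib)
 have amgm: "\<bar>z\<bar> <= \<xi> / 2 + z\<^sup>2 / (2 * \<xi>)" for z
 proof -
  have "0 <= (\<bar>z\<bar> - \<xi>)\<^sup>2" by simp
  hence "2 * \<xi> * \<bar>z\<bar> <= \<xi>\<^sup>2 + z\<^sup>2" by (simp add: power2_eq_square algebra_simps)
  thus ?thesis using \<open>0 < \<xi>\<close> by (simp add: field_simps power2_eq_square)
 qed
 have "(\<integral>y. \<bar>(SUM k:K. w (y k)) / m\<bar> \<partial>MH) <= (\<integral>y. \<xi> / 2 + (SUM k:K. w (y k))\<^sup>2 / (m\<^sup>2 * (2 * \<xi>)) \<partial>MH)"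
 proof (rule integral_mono)
  show "\<bar>(SUM k:K. w (y k)) / m\<bar> <= \<xi> / 2 + (SUM k:K. w (y k))\<^sup>2 / (m\<^sup>2 * (2 * \<xi>))" for y
   using amgm[of "(SUM k:K. w (y k)) / m"] by (simp add: power_divide)
 qed (use si sqi in auto)
 also have "... = \<xi> / 2 + (\<integral>y. (SUM k:K. w (y k))\<^sup>2 \<partial>MH) / (m\<^sup>2 * (2 * \<xi>))"
  using sqi by (simp add: MH.prob_space)
 also have "... <= \<xi> / 2 + (m * (4 * B\<^sup>2)) / (m\<^sup>2 * (2 * \<xi>))"
  using sq m \<open>0 < \<xi>\<close> by (intro add_left_mono divide_right_mono) auto
 also have "... <= \<xi> / 2 + \<xi> / 2"
 proof (rule add_left_mono)
  have "4 * B\<^sup>2 <= m * \<xi>\<^sup>2" using big \<open>0 < \<xi>\<close> by (simp add: m_def divide_le_eq)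
  hence "(m * (4 * B\<^sup>2)) / (m\<^sup>2 * (2 * \<xi>)) <= (m * (m * \<xi>\<^sup>2)) / (m\<^sup>2 * (2 * \<xi>))"
   using m \<open>0 < \<xi>\<close> by (intro divide_right_mono mult_left_mono) auto
  also have "... = \<xi> / 2" using m \<open>0 < \<xi>\<close> by (simp add: power2_eq_square)
  finally show "(m * (4 * B\<^sup>2)) / (m\<^sup>2 * (2 * \<xi>)) <= \<xi> / 2" .
 qed
 finally show ?thesis using eq by (simp add: I_def)
qed

definition "column_test K u a = \<bar>(1 / real (card K)) * (SUM k:K. u (\<lambda>g\<in>carrier G. a (g, k))) - (\<integral>x. u (col x) \<partial>M)\<bar>"

lemma column_test_loc:
 assumes "u : loc (carrier G) S d" "K <= carrier H"
 shows "column_test K u : loc D S d" unfolding column_test_def using assms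
 by (intro loc_abs[OF tb] loc_diff[OF tb] loc_scale[OF tb] loc_sum[OF tb] loc_const slice_loc) auto

lemma column_test_integral:
 assumes inf: "infinite (carrier H)" and u: "u : loc (carrier G) S d" and "0 < \<xi>"
 shows "EX K. finite K & K ~= {} & K <= carrier H & (\<integral>y. column_test K u (cp y) \<partial>MH) <= \<xi>"
proof -
 obtain B where B: "0 < B" "!!p. p : cols ==> \<bar>u p\<bar> <= B" by (rule loc_bounded[OF tb u]) auto
 obtain n :: nat where n: "4 * B\<^sup>2 / \<xi>\<^sup>2 <= real n" using real_arch_simple by blast
 obtain K where K: "finite K" "card K = Suc n" "K <= carrier H" using infinite_arbitrarily_large[OF inf] by blast
 have Kne: "K ~= {}" using K by auto
 have "column_test K u (cp y) = \<bar>(SUM k:K. u (col (y k))) / real (card K) - (\<integral>x. u (col x) \<partial>M)\<bar>" for y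
 proof -
  have "(SUM k:K. u (\<lambda>g\<in>carrier G. cp y (g, k))) = (SUM k:K. u (col (y k)))"
   using K slice_cp by (intro sum.cong refl arg_cong[where f = u]) auto
  thus ?thesis by (simp add: column_test_def)
 qed
 hence "(\<integral>y. column_test K u (cp y) \<partial>MH) <= \<xi>"
  using column_lln[OF u K(1,3) Kne B \<open>0 < \<xi>\<close>] n K(2) by simp
 thus ?thesis using K Kne by blast
qed

lemma column_test_sum:
 fixes V :: "'v set" and W :: "'w set"
 assumes V: "finite V" and W: "finite W" "W ~= {}" and t: "!!k. k : carrier H ==> bij_betw (t k) W W"
  and K: "finite K" "K ~= {}" "K <= carrier H"
 shows "(SUM v:V. \<bar>(SUM w:W. u (\<lambda>g\<in>carrier G. x (s g v, w))) / real (card W) - (\<integral>y. u (col y) \<partial>M)\<bar>)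
   <= (SUM p:V \<times> W. column_test K u (\<lambda>i\<in>D. x (s (fst i) (fst p), t (snd i) (snd p)))) / real (card W)"
proof -
  define I where "I = (\<integral>y. u (col y) \<partial>M)"
  let ?ps = "column_test K u"
  define N where "N = real (card W)"
  have N: "0 < N" using W by (simp add: N_def card_gt_0_iff)
  define m where "m = real (card K)"
  have m: "0 < m" using K by (simp add: m_def card_gt_0_iff)
  have "\<bar>(SUM w:W. u (\<lambda>g\<in>carrier G. x (s g v, w))) / N - I\<bar>
    <= (SUM w:W. ?ps (\<lambda>i\<in>D. x (s (fst i) v, t (snd i) w))) / N" for v
  proof -
   have re: "(SUM w:W. u (\<lambda>g\<in>carrier G. x (s g v, t k w))) = (SUM w:W. u (\<lambda>g\<in>carrier G. x (s g v, w)))" if "k : K" for k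
    using sum.reindex_bij_betw[OF t, of k "%w. u (\<lambda>g\<in>carrier G. x (s g v, w))"] that K by auto
   have psi: "?ps (\<lambda>i\<in>D. x (s (fst i) v, t (snd i) w)) = \<bar>(1 / m) * (SUM k:K. u (\<lambda>g\<in>carrier G. x (s g v, t k w))) - I\<bar>" for w
   proof -
    have "(\<lambda>g\<in>carrier G. (\<lambda>i\<in>D. x (s (fst i) v, t (snd i) w)) (g, k)) = (\<lambda>g\<in>carrier G. x (s g v, t k w))" if "k : K" for k
     using that K by (intro restrict_ext) auto
    thus ?thesis unfolding column_test_def m_def I_def by (simp cong: sum.cong)
   qed
   define Uf where "Uf k w = u (\<lambda>g\<in>carrier G. x (s g v, t k w))" for k w
   have "(SUM w:W. (1 / m) * (SUM k:K. Uf k w) - I) = (1 / m) * (SUM w:W. SUM k:K. Uf k w) - N * I"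
    by (simp add: sum_subtractf sum_divide_distrib[symmetric] N_def)
   also have "(SUM w:W. SUM k:K. Uf k w) = (SUM k:K. SUM w:W. Uf k w)" by (rule sum.swap)
   also have "... = (SUM k:K. SUM w:W. u (\<lambda>g\<in>carrier G. x (s g v, w)))"
    unfolding Uf_def by (intro sum.cong[OF refl, of K] re)
   also have "... = m * (SUM w:W. u (\<lambda>g\<in>carrier G. x (s g v, w)))" by (simp add: m_def)
   finally have "(SUM w:W. u (\<lambda>g\<in>carrier G. x (s g v, w))) - N * I = (SUM w:W. (1 / m) * (SUM k:K. Uf k w) - I)"
    using m by simp
   hence "(SUM w:W. u (\<lambda>g\<in>carrier G. x (s g v, w))) - N * I = (SUM w:W. (1 / m) * (SUM k:K. u (\<lambda>g\<in>carrier G. x (s g v, t k w))) - I)"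
    by (simp only: Uf_def)
   hence "\<bar>(SUM w:W. u (\<lambda>g\<in>carrier G. x (s g v, w))) - N * I\<bar> <= (SUM w:W. ?ps (\<lambda>i\<in>D. x (s (fst i) v, t (snd i) w)))"
    unfolding psi by (simp only: sum_abs)
   hence "\<bar>(SUM w:W. u (\<lambda>g\<in>carrier G. x (s g v, w))) - N * I\<bar> / N <= (SUM w:W. ?ps (\<lambda>i\<in>D. x (s (fst i) v, t (snd i) w))) / N"
    using N by (intro divide_right_mono) auto
   moreover have "(SUM w:W. u (\<lambda>g\<in>carrier G. x (s g v, w))) / N - I = ((SUM w:W. u (\<lambda>g\<in>carrier G. x (s g v, w))) - N * I) / N"
    using N by (simp add: diff_divide_distrib)
   ultimately show ?thesis using N by (simp add: abs_divide)
  qed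
  hence "(SUM v:V. \<bar>(SUM w:W. u (\<lambda>g\<in>carrier G. x (s g v, w))) / N - I\<bar>)
   <= (SUM v:V. (SUM w:W. ?ps (\<lambda>i\<in>D. x (s (fst i) v, t (snd i) w))) / N)" by (rule sum_mono)
  also have "... = (SUM p:V \<times> W. ?ps (\<lambda>i\<in>D. x (s (fst i) (fst p), t (snd i) (snd p)))) / N"
   by (simp add: sum_divide_distrib[symmetric] sum.cartesian_product case_prod_beta)
  finally show ?thesis by (simp add: N_def I_def)
 qed

end

section \<open>Most column permutations give good models\<close>

lemma half_cancel:
 fixes a c :: real
 assumes "0 < a"
 shows "a * (c / (2 * a)) = c / 2" "2 * (a * (c / (4 * a))) = c / 2" "a * (2 * (c / (4 * a))) = c / 2"
 using assms by (auto simp: field_simps)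

lemma sofic_almost_action: "sofic_approximation Gm V sg ==> almost_action Gm V sg"
 by (simp add: sofic_approximation_def almost_action_def finite_action_def)

lemma sofic_distinct:
 assumes grp: "group H" and so: "sofic_approximation H W ta" and h: "h : carrier H" "h' : carrier H" "h ~= h'"
  and "0 < \<theta>"
 shows "EV n. real (card {w : W n. ta n h w = ta n h' w}) <= \<theta> * real (card (W n))"
proof -
 interpret group H by fact
 note aa = sofic_almost_action[OF so]
 hence fa: "finite_action H W ta" by (simp add: almost_action_def)
 define k where "k = inv\<^bsub>H\<^esub> h' \<otimes>\<^bsub>H\<^esub> h"
 have k: "k : carrier H" using h by (simp add: k_def)
 have k1: "k ~= \<one>\<^bsub>H\<^esub>"
 proof
  assume "k = \<one>\<^bsub>H\<^esub>"
  hence "h' \<otimes>\<^bsub>H\<^esub> (inv\<^bsub>H\<^esub> h' \<otimes>\<^bsub>H\<^esub> h) = h'" using h by (simp add: k_def)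
  thus False using h by (simp add: m_assoc[symmetric])
 qed
 have th: "0 < \<theta> / 4" using \<open>0 < \<theta>\<close> by simp
 have "(%n. real (card {w : W n. ta n k w ~= w}) / real (card (W n))) \<longlonglongrightarrow> 1"
  using so k k1 by (simp add: sofic_approximation_def)
 hence e4: "EV n. 1 - \<theta> / 4 < real (card {w : W n. ta n k w ~= w}) / real (card (W n))"
  by (rule order_tendstoD) (use th in simp)
 note e1 = almost_action_bad[OF aa inv_closed[OF h(2)] h(1) th]
 note e2 = almost_action_bad[OF aa inv_closed[OF h(2)] h(2) th]
 note e3 = almost_action_bad[OF aa one_closed one_closed th]
 show ?thesis using e1 e2 e3 e4
 proof eventually_elim
  case (elim n)
  note W = finite_actionD[OF fa]
  let ?B1 = "{v : W n. ta n (inv\<^bsub>H\<^esub> h') (ta n h v) ~= ta n (inv\<^bsub>H\<^esub> h' \<otimes>\<^bsub>H\<^esub> h) v}"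
  let ?B2 = "{v : W n. ta n (inv\<^bsub>H\<^esub> h') (ta n h' v) ~= ta n (inv\<^bsub>H\<^esub> h' \<otimes>\<^bsub>H\<^esub> h') v}"
  let ?B3 = "{v : W n. ta n \<one>\<^bsub>H\<^esub> (ta n \<one>\<^bsub>H\<^esub> v) ~= ta n (\<one>\<^bsub>H\<^esub> \<otimes>\<^bsub>H\<^esub> \<one>\<^bsub>H\<^esub>) v}"
  let ?B4 = "{w : W n. ta n k w = w}"
  have N: "0 < real (card (W n))" using W(5) by simp
  have "card (?B4 Un {w : W n. ta n k w ~= w}) = card ?B4 + card {w : W n. ta n k w ~= w}"
   using W(1) by (intro card_Un_disjoint) auto
  moreover have "?B4 Un {w : W n. ta n k w ~= w} = W n" by auto
  ultimately have "real (card (W n)) = real (card ?B4) + real (card {w : W n. ta n k w ~= w})" by simp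
  moreover have "(1 - \<theta> / 4) * real (card (W n)) < real (card {w : W n. ta n k w ~= w})"
   using elim(4) N by (simp add: field_simps)
  ultimately have b4: "real (card ?B4) < \<theta> / 4 * real (card (W n))" by (simp add: algebra_simps)
  have "{w : W n. ta n h w = ta n h' w} <= ?B1 Un ?B2 Un ?B3 Un ?B4"
  proof
   fix w assume w: "w : {w : W n. ta n h w = ta n h' w}"
   show "w : ?B1 Un ?B2 Un ?B3 Un ?B4"
   proof (rule ccontr)
    assume no: "w ~: ?B1 Un ?B2 Un ?B3 Un ?B4"
    have A: "ta n (inv\<^bsub>H\<^esub> h') (ta n h w) = ta n (inv\<^bsub>H\<^esub> h' \<otimes>\<^bsub>H\<^esub> h) w" using no w by blast
    have A': "ta n (inv\<^bsub>H\<^esub> h') (ta n h' w) = ta n (inv\<^bsub>H\<^esub> h' \<otimes>\<^bsub>H\<^esub> h') w" using no w by blast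
    have "ta n k w = ta n (inv\<^bsub>H\<^esub> h') (ta n h w)" by (simp only: A k_def)
    also have "... = ta n (inv\<^bsub>H\<^esub> h') (ta n h' w)" using w by simp
    also have "... = ta n \<one>\<^bsub>H\<^esub> w" using h by (simp only: A' l_inv)
    also have "ta n \<one>\<^bsub>H\<^esub> w = w"
    proof -
     have "inj_on (ta n \<one>\<^bsub>H\<^esub>) (W n)" using W(3)[OF one_closed] by (simp add: bij_betw_def)
     moreover have "ta n \<one>\<^bsub>H\<^esub> (ta n \<one>\<^bsub>H\<^esub> w) = ta n \<one>\<^bsub>H\<^esub> w" using no w by simp
     moreover have "ta n \<one>\<^bsub>H\<^esub> w : W n" using W(4)[OF one_closed] w by auto
     ultimately show ?thesis using w by (auto dest: inj_onD)
    qed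
    finally show False using no w by simp
   qed
  qed
  hence "card {w : W n. ta n h w = ta n h' w} <= card (?B1 Un ?B2 Un ?B3 Un ?B4)" using W(1) by (intro card_mono) auto
  also have "... <= card ?B1 + card ?B2 + card ?B3 + card ?B4"
   using card_Un_le[of "?B1 Un ?B2 Un ?B3" ?B4] card_Un_le[of "?B1 Un ?B2" ?B3] card_Un_le[of ?B1 ?B2] by linarith
  finally have "real (card {w : W n. ta n h w = ta n h' w}) <= real (card ?B1) + real (card ?B2) + real (card ?B3) + real (card ?B4)"
   by linarith
  thus ?case using elim b4 by linarith
 qed
qed

lemma sofic_injective:
 assumes grp: "group H" and so: "sofic_approximation H W ta" and J: "finite J" "J <= carrier H" and "0 < bt"
 shows "EV n. real (card {w : W n. ~ inj_on (%k. ta n k w) J}) <= bt * real (card (W n))"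
proof -
 have fa: "finite_action H W ta" using sofic_almost_action[OF so] by (simp add: almost_action_def)
 let ?P = "{p : J \<times> J. fst p ~= snd p}"
 define \<theta> where "\<theta> = bt / (real (card ?P) + 1)"
 have \<theta>: "0 < \<theta>" using \<open>0 < bt\<close> by (simp add: \<theta>_def add_nonneg_pos)
 have fP: "finite ?P" using J by simp
 have "EV n. ALL p:?P. real (card {w : W n. ta n (fst p) w = ta n (snd p) w}) <= \<theta> * real (card (W n))"
  using J \<theta> by (intro eventually_ball_finite[OF fP] ballI sofic_distinct[OF grp so]) auto
 thus ?thesis
 proof (rule eventually_mono)
  fix n assume *: "ALL p:?P. real (card {w : W n. ta n (fst p) w = ta n (snd p) w}) <= \<theta> * real (card (W n))"
  have "{w : W n. ~ inj_on (%k. ta n k w) J} <= (UN p:?P. {w : W n. ta n (fst p) w = ta n (snd p) w})"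
   by (fastforce simp: inj_on_def)
  hence "card {w : W n. ~ inj_on (%k. ta n k w) J} <= card (UN p:?P. {w : W n. ta n (fst p) w = ta n (snd p) w})"
   using finite_actionD(1)[OF fa] fP by (intro card_mono) auto
  also have "... <= (SUM p:?P. card {w : W n. ta n (fst p) w = ta n (snd p) w})" by (rule card_UN_le[OF fP])
  finally have "real (card {w : W n. ~ inj_on (%k. ta n k w) J}) <= (SUM p:?P. real (card {w : W n. ta n (fst p) w = ta n (snd p) w}))"
   by (simp flip: of_nat_sum)
  also have "... <= (SUM p:?P. \<theta> * real (card (W n)))" using * by (intro sum_mono) auto
  also have "... = (real (card ?P) * \<theta>) * real (card (W n))" by simp
  also have "... <= ((real (card ?P) + 1) * \<theta>) * real (card (W n))" using \<theta> by (intro mult_right_mono) auto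
  also have "(real (card ?P) + 1) * \<theta> = bt" unfolding \<theta>_def by (simp add: add_nonneg_eq_0_iff)
  finally show "real (card {w : W n. ~ inj_on (%k. ta n k w) J}) <= bt * real (card (W n))" .
 qed
qed

text \<open>Arbitrarily many elements of an infinite group move a common point to distinct places.\<close>

lemma sofic_card_unbounded:
 assumes grp: "group H" and so: "sofic_approximation H W ta" and inf: "infinite (carrier H)"
 shows "EV n. R <= real (card (W n))"
proof -
 have fa: "finite_action H W ta" using sofic_almost_action[OF so] by (simp add: almost_action_def)
 obtain m :: nat where m: "R <= real m" using real_arch_simple by blast
 obtain J where J: "finite J" "card J = m" "J <= carrier H" using infinite_arbitrarily_large[OF inf] by blast
 have "EV n. real (card {w : W n. ~ inj_on (%k. ta n k w) J}) <= 1 / 2 * real (card (W n))"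
  by (rule sofic_injective[OF grp so J(1,3)]) simp
 thus ?thesis
 proof (rule eventually_mono)
  fix n assume *: "real (card {w : W n. ~ inj_on (%k. ta n k w) J}) <= 1 / 2 * real (card (W n))"
  have "EX w:W n. inj_on (%k. ta n k w) J"
  proof (rule ccontr)
   assume "~ ?thesis"
   hence "{w : W n. ~ inj_on (%k. ta n k w) J} = W n" by auto
   thus False using * finite_actionD(5)[OF fa, of n] by simp
  qed
  then obtain w where w: "w : W n" "inj_on (%k. ta n k w) J" by blast
  have "(%k. ta n k w) ` J <= W n" using finite_actionD(4)[OF fa] w J by blast
  hence "card J <= card (W n)" using w(2) finite_actionD(1)[OF fa] by (intro card_inj_on_le) auto
  thus "R <= real (card (W n))" using m J by simp
 qed
qed

lemma prod_pullback:
 "pullback_name (G \<times>\<times> H) (prod_approx sg ta n) x p =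
  (\<lambda>i\<in>carrier G \<times> carrier H. x (sg n (fst i) (fst p), ta n (snd i) (snd p)))"
 by (auto simp: pullback_name_def prod_approx_def DirProd_def map_prod_def case_prod_beta)

context coind_merge
begin

text \<open>The second moment bound and Markov's inequality, uniformly in the model \<open>z\<close> of the second system,
which enters the kernels only as a parameter.\<close>

lemma permutation_almost_good:
 fixes V :: "nat => 'v set" and W :: "nat => 'w set"
 assumes inf: "infinite (carrier H)" and fa: "finite_action G V sg" and so: "sofic_approximation H W ta"
  and f: "f : loc D SC dC" and kq: "0 < kq" and et: "0 < et"
 obtains F1 ep1 where "(F1, ep1) : loc_tests D S d"
  "EV n.
    ALL x:loc_models (G \<times>\<times> H) (prod_approx sg ta n) (prod_sets V W n) S (%f. \<integral>y. f (cp y) \<partial>MH) F1 ep1.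
    ALL z:prod_sets V W n ~> S'.
     real (card {pv. pv permutes W n & kq <=
      \<bar>emp_avg (G \<times>\<times> H) (prod_approx sg ta n) (prod_sets V W n)
        (\<lambda>p\<in>prod_sets V W n. j (x (fst p, pv (snd p))) (z p)) f
       - emp_avg (G \<times>\<times> H) (prod_approx sg ta n) (prod_sets V W n) z (Th f)\<bar>})
     <= et * real (card {pv. pv permutes W n})"
proof -
 have faH: "finite_action H W ta" using sofic_almost_action[OF so] by (simp add: almost_action_def)
 note V = finite_actionD[OF fa] and W = finite_actionD[OF faH]
 obtain E C where lf: "lip_on D SC dC E C f" using f by (auto simp: loc_def)
 note E = E[OF lf] and J = J[OF lf]
 let ?J = "snd ` E"
 obtain B where B: "0 < B" "!!z. z : D ~> SC ==> \<bar>f z\<bar> <= B" by (rule loc_bounded[OF tbC f]) auto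
 define r where "r = real (card ?J)"
 define c where "c = et * kq\<^sup>2"
 have c: "0 < c" using kq et by (simp add: c_def)
 define \<zeta> where "\<zeta> = c / (2 * (2 * B * r + 1))"
 have pos1: "0 < 2 * B * r + 1" using B by (simp add: r_def add_nonneg_pos)
 have \<zeta>: "0 < \<zeta>" using c pos1 by (simp add: \<zeta>_def)
 have \<zeta>c: "2 * B * r * \<zeta> <= c / 2"
 proof -
  have "2 * B * r * \<zeta> <= (2 * B * r + 1) * \<zeta>" using \<zeta> by (intro mult_right_mono) auto
  also have "... = c / 2" unfolding \<zeta>_def by (rule half_cancel[OF pos1])
  finally show ?thesis .
 qed
 define rh where "rh = \<zeta> / (4 * (C * real (card E) + 1))"
 have pos2: "0 < C * real (card E) + 1" using E by (simp add: add_nonneg_pos)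
 have rh: "0 < rh" using \<zeta> pos2 by (simp add: rh_def)
 have rh\<zeta>: "2 * (C * real (card E) * rh) <= \<zeta> / 2"
 proof -
  have "2 * (C * real (card E) * rh) <= 2 * ((C * real (card E) + 1) * rh)" using rh by (intro mult_left_mono mult_right_mono) auto
  also have "... = \<zeta> / 2" unfolding rh_def by (rule half_cancel[OF pos2])
  finally show ?thesis .
 qed
 obtain Qn where Qn: "finite Qn" "Qn <= D ~> SC"
  "!!a. a : D ~> SC ==> EX q:Qn. ALL i:E. dC (a i) (q i) < rh" by (rule path_net[OF tbC E(1,2) rh]) auto
 let ?U = "Qn \<times> ?J"
 have fU: "finite ?U" using Qn J by simp
 define \<xi> where "\<xi> = \<zeta> / (4 * (real (card ?U) + 1))"
 have \<xi>: "0 < \<xi>" using \<zeta> by (simp add: \<xi>_def add_nonneg_pos)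
 have \<xi>U: "real (card ?U) * (2 * \<xi>) <= \<zeta> / 2"
 proof -
  have "real (card ?U) * (2 * \<xi>) <= (real (card ?U) + 1) * (2 * \<xi>)" using \<xi> by (intro mult_right_mono) auto
  also have "... = \<zeta> / 2" unfolding \<xi>_def by (rule half_cancel) (simp add: add_nonneg_pos)
  finally show ?thesis .
 qed
 let ?cf = "%p. colfun f (fst p) (snd p)"
 have cf: "?cf p : loc (carrier G) S d" if "p : ?U" for p
  by (rule colfun_loc[OF lf], rule subsetD[OF Qn(2)], rule mem_Times_iff[THEN iffD1, THEN conjunct1, OF that])
 have "ALL p:?U. EX K. finite K & K ~= {} & K <= carrier H & (\<integral>y. column_test K (?cf p) (cp y) \<partial>MH) <= \<xi>"
  by (intro ballI column_test_integral[OF inf cf \<xi>])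
 then obtain K where K: "ALL p:?U. finite (K p) & K p ~= {} & K p <= carrier H & (\<integral>y. column_test (K p) (?cf p) (cp y) \<partial>MH) <= \<xi>"
  by (rule bchoice[THEN exE])
 define Ps where "Ps p = column_test (K p) (?cf p)" for p
 have Ps1: "Ps p : loc D S d" "(\<integral>y. Ps p (cp y) \<partial>MH) <= \<xi>" if "p : ?U" for p
  using bspec[OF K that] column_test_loc[OF cf[OF that]] unfolding Ps_def by simp_all
 have Ps2: "(SUM v:V. \<bar>(SUM w:W. ?cf p (\<lambda>g\<in>carrier G. x (s g v, w))) / real (card W) - (\<integral>y. ?cf p (col y) \<partial>M)\<bar>)
   <= (SUM q:V \<times> W. Ps p (\<lambda>i\<in>D. x (s (fst i) (fst q), t (snd i) (snd q)))) / real (card W)"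
  if p: "p : ?U" and "finite V" "finite W" "W ~= {}" "!!k. k : carrier H ==> bij_betw (t k) W W"
  for p and V :: "'v set" and W :: "'w set" and s t x
 proof -
  have "finite (K p)" "K p ~= {}" "K p <= carrier H" using bspec[OF K p] by simp_all
  from column_test_sum[OF that(2-5) this] show ?thesis unfolding Ps_def .
 qed
 have tests: "(Ps ` ?U, \<xi>) : loc_tests D S d" using fU Ps1 \<xi> by (auto simp: loc_tests_def)
 define bt where "bt = c / (4 * (2 * B)\<^sup>2)"
 have bt: "0 < bt" using c B by (simp add: bt_def)
 have ev: "EV n. real (card {w : W n. ~ inj_on (%k. ta n k w) ?J}) <= bt * real (card (W n))
   & 20 * (2 * B)\<^sup>2 * r\<^sup>2 / c <= real (card (W n))"
  by (intro eventually_conj sofic_injective[OF grpH so J bt] sofic_card_unbounded[OF grpH so inf])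
 hence "EV n.
    ALL x:loc_models (G \<times>\<times> H) (prod_approx sg ta n) (prod_sets V W n) S (%f. \<integral>y. f (cp y) \<partial>MH) (Ps ` ?U) \<xi>.
    ALL z:prod_sets V W n ~> S'.
     real (card {pv. pv permutes W n & kq <=
      \<bar>emp_avg (G \<times>\<times> H) (prod_approx sg ta n) (prod_sets V W n)
        (\<lambda>p\<in>prod_sets V W n. j (x (fst p, pv (snd p))) (z p)) f
       - emp_avg (G \<times>\<times> H) (prod_approx sg ta n) (prod_sets V W n) z (Th f)\<bar>})
     <= et * real (card {pv. pv permutes W n})"
 proof (rule eventually_mono, intro ballI)
  fix n x z
  assume evn: "real (card {w : W n. ~ inj_on (%k. ta n k w) ?J}) <= bt * real (card (W n))
   & 20 * (2 * B)\<^sup>2 * r\<^sup>2 / c <= real (card (W n))"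
   and xm: "x : loc_models (G \<times>\<times> H) (prod_approx sg ta n) (prod_sets V W n) S (%f. \<integral>y. f (cp y) \<partial>MH) (Ps ` ?U) \<xi>"
   and z: "z : prod_sets V W n ~> S'"
  let ?VW = "V n \<times> W n" and ?em = "emp_avg (G \<times>\<times> H) (prod_approx sg ta n) (prod_sets V W n)"
  let ?S = "{pv. pv permutes W n}"
  define N where "N = real (card (W n))"
  define m where "m = real (card (V n))"
  have N: "0 < N" and m: "0 < m" using W(5) V(5) by (auto simp: N_def m_def)
  have x: "x : ?VW ~> S" and xt: "!!p. p : ?U ==> \<bar>?em x (Ps p) - (\<integral>y. Ps p (cp y) \<partial>MH)\<bar> < \<xi>"
   using xm by (auto simp: loc_models_def prod_sets_def)
  have z: "z : ?VW ~> S'" using z by (simp add: prod_sets_def)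
  have sgV: "sg n g v : V n" if "g : carrier G" "v : V n" for g v using V(4)[OF that(1)] that(2) by auto
  have taW: "ta n k w : W n" if "k : carrier H" "w : W n" for k w using W(4)[OF that(1)] that(2) by auto
  define X where "X v u = (\<lambda>g\<in>carrier G. x (sg n g v, u))" for v u
  have X: "X v u : cols" if "v : V n" "u : W n" for v u using that x sgV by (auto simp: X_def PiE_iff)
  define b where "b v w = (\<lambda>i\<in>D. z (sg n (fst i) v, ta n (snd i) w))" for v w
  have b: "b v w : D ~> S'" if "v : V n" "w : W n" for v w using that z sgV taW by (auto simp: b_def PiE_iff)
  define ph where "ph v w = ker f ?J (b v w)" for v w
  define err where "err v = (SUM (q, k):?U. \<bar>(SUM u:W n. colfun f q k (X v u)) / real (card (W n)) - (\<integral>x. colfun f q k (col x) \<partial>M)\<bar>)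
   + 2 * (C * real (card E) * rh)" for v
  have err0: "0 <= err v" for v
   unfolding err_def using E rh by (intro add_nonneg_nonneg sum_nonneg) (auto simp: case_prod_beta)
  have err_sum: "(SUM v:V n. err v) <= m * \<zeta>"
  proof -
   have "(SUM v:V n. err v) = (SUM p:?U. SUM v:V n. \<bar>(SUM u:W n. ?cf p (X v u)) / real (card (W n)) - (\<integral>x. ?cf p (col x) \<partial>M)\<bar>)
     + m * (2 * (C * real (card E) * rh))" unfolding err_def sum.distrib case_prod_beta by (subst sum.swap) (simp add: m_def)
   also have "(SUM p:?U. SUM v:V n. \<bar>(SUM u:W n. ?cf p (X v u)) / real (card (W n)) - (\<integral>x. ?cf p (col x) \<partial>M)\<bar>) <= (SUM p:?U. m * (2 * \<xi>))"
   proof (rule sum_mono)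
    fix p assume p: "p : ?U"
    have "(SUM v:V n. \<bar>(SUM u:W n. ?cf p (X v u)) / real (card (W n)) - (\<integral>x. ?cf p (col x) \<partial>M)\<bar>)
     <= (SUM q:?VW. Ps p (\<lambda>i\<in>D. x (sg n (fst i) (fst q), ta n (snd i) (snd q)))) / real (card (W n))"
     unfolding X_def by (rule Ps2[OF p V(1) W(1,2)]) (use W(3) in auto)
    also have "... = m * ?em x (Ps p)"
     using m N by (simp add: emp_avg_def prod_pullback prod_sets_def card_cartesian_product m_def N_def)
    also have "... <= m * (2 * \<xi>)"
    proof (rule mult_left_mono)
     show "?em x (Ps p) <= 2 * \<xi>" using xt[OF p] Ps1(2)[OF p] by linarith
    qed (use m in simp)
    finally show "(SUM v:V n. \<bar>(SUM u:W n. ?cf p (X v u)) / real (card (W n)) - (\<integral>x. ?cf p (col x) \<partial>M)\<bar>) <= m * (2 * \<xi>)" .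
   qed
   also have "(SUM p:?U. m * (2 * \<xi>)) + m * (2 * (C * real (card E) * rh)) = m * (real (card ?U) * (2 * \<xi>) + 2 * (C * real (card E) * rh))"
    by (simp add: distrib_left del: card_cartesian_product)
   also have "... <= m * (\<zeta> / 2 + \<zeta> / 2)" using \<xi>U rh\<zeta> m by (intro mult_left_mono add_mono) auto
   finally show ?thesis by simp
  qed
  have var: "(SUM pv:?S. (SUM (v, w):?VW. ph v w (%k. X v (pv (ta n k w))))\<^sup>2)
   <= real (card ?S) * ((m * N)\<^sup>2 * ((2 * B)\<^sup>2 * bt + 5 * (2 * B)\<^sup>2 * r\<^sup>2 / N)
    + m * N\<^sup>2 * (2 * B * r * (SUM v:V n. err v)))" unfolding m_def N_def r_def
  proof (rule permuted_average_variance[OF M.prob_space_axioms J col_in V(1) W(1,2)])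
   fix v w assume vw: "v : V n" "w : W n"
   show "column_kernel M (carrier H) ?J cols col (2 * B) (ph v w)"
    unfolding ph_def by (rule ker_column_kernel[OF lf B b[OF vw]]) auto
   show "column_error M ?J cols col (W n) (X v) (err v) (ph v w)"
    unfolding ph_def err_def by (rule ker_column_error[OF lf b[OF vw] Qn rh W(1,2) X[OF vw(1)]])
  next
   show "bij_betw (ta n k) (W n) (W n)" if "k : ?J" for k using that J W(3) by blast
  qed (use X err0 B evn in auto)
  define q where "q pv = ?em (\<lambda>p\<in>prod_sets V W n. j (x (fst p, pv (snd p))) (z p)) f - ?em z (Th f)" for pv
  have qeq: "q pv = (SUM (v, w):?VW. ph v w (%k. X v (pv (ta n k w)))) / (m * N)" if pv: "pv permutes W n" for pv
  proof -
   have key: "f (\<lambda>i\<in>D. (\<lambda>p\<in>?VW. j (x (fst p, pv (snd p))) (z p)) (sg n (fst i) v, ta n (snd i) w))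
     - Th f (b v w) = ph v w (%k. X v (pv (ta n k w)))" if vw: "v : V n" "w : W n" for v w
   proof -
    let ?l = "\<lambda>i\<in>D. (\<lambda>p\<in>?VW. j (x (fst p, pv (snd p))) (z p)) (sg n (fst i) v, ta n (snd i) w)"
    have pvW: "pv u : W n" if "u : W n" for u using that pv by (simp add: permutes_in_image)
    have colsin: "X v (pv (ta n k w)) : cols" if "k : carrier H" for k using vw that by (intro X pvW taW)
    have "f ?l = f (mp (cpath ?J (%k. X v (pv (ta n k w)))) (b v w))"
    proof (rule lip_on_eq[OF tbC lf])
     show "?l : D ~> SC" using vw x z sgV taW pvW mergingD(1)[OF mg] by (auto simp: PiE_iff)
     show "mp (cpath ?J (%k. X v (pv (ta n k w)))) (b v w) : D ~> SC" using J by (intro mp_in cpath_in b vw colsin) auto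
     fix i assume i: "i : E"
     hence iD: "i : D" using E by auto
     thus "?l i = mp (cpath ?J (%k. X v (pv (ta n k w)))) (b v w) i"
      using i vw sgV taW by (auto simp: merge_path_def cpath_def b_def X_def)
    qed
    thus ?thesis by (simp add: ph_def ker_def)
   qed
   have "(SUM (v, w):?VW. ph v w (%k. X v (pv (ta n k w)))) =
     (SUM p:?VW. f (\<lambda>i\<in>D. (\<lambda>p\<in>?VW. j (x (fst p, pv (snd p))) (z p)) (sg n (fst i) (fst p), ta n (snd i) (snd p))) - Th f (b (fst p) (snd p)))"
   proof (rule sum.cong[OF refl])
    fix p assume "p : ?VW"
    then obtain v w where p: "p = (v, w)" "v : V n" "w : W n" by blast
    show "(case p of (v, w) => ph v w (%k. X v (pv (ta n k w)))) =
     f (\<lambda>i\<in>D. (\<lambda>p\<in>?VW. j (x (fst p, pv (snd p))) (z p)) (sg n (fst i) (fst p), ta n (snd i) (snd p))) - Th f (b (fst p) (snd p))"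
     unfolding p(1) prod.case fst_conv snd_conv by (rule key[OF p(2,3), symmetric])
   qed
   thus ?thesis
    by (simp add: q_def emp_avg_def prod_pullback prod_sets_def b_def sum_subtractf diff_divide_distrib card_cartesian_product m_def N_def)
  qed
  have "(SUM pv:?S. (q pv)\<^sup>2) = (SUM pv:?S. (SUM (v, w):?VW. ph v w (%k. X v (pv (ta n k w))))\<^sup>2) / (m * N)\<^sup>2"
   unfolding sum_divide_distrib using qeq by (intro sum.cong refl) (simp add: power_divide)
  also have "... <= (real (card ?S) * ((m * N)\<^sup>2 * ((2 * B)\<^sup>2 * bt + 5 * (2 * B)\<^sup>2 * r\<^sup>2 / N)
    + m * N\<^sup>2 * (2 * B * r * (m * \<zeta>)))) / (m * N)\<^sup>2"
  proof (rule divide_right_mono[OF order_trans[OF var]])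
   show "real (card ?S) * ((m * N)\<^sup>2 * ((2 * B)\<^sup>2 * bt + 5 * (2 * B)\<^sup>2 * r\<^sup>2 / N) + m * N\<^sup>2 * (2 * B * r * (SUM v:V n. err v)))
    <= real (card ?S) * ((m * N)\<^sup>2 * ((2 * B)\<^sup>2 * bt + 5 * (2 * B)\<^sup>2 * r\<^sup>2 / N) + m * N\<^sup>2 * (2 * B * r * (m * \<zeta>)))"
    using err_sum m N B by (intro mult_left_mono add_left_mono) (auto simp: r_def)
  qed simp
  also have "... = real (card ?S) * ((2 * B)\<^sup>2 * bt + 5 * (2 * B)\<^sup>2 * r\<^sup>2 / N + 2 * B * r * \<zeta>)"
  proof -
   have "(m * N)\<^sup>2 * ((2 * B)\<^sup>2 * bt + 5 * (2 * B)\<^sup>2 * r\<^sup>2 / N) + m * N\<^sup>2 * (2 * B * r * (m * \<zeta>))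
     = ((2 * B)\<^sup>2 * bt + 5 * (2 * B)\<^sup>2 * r\<^sup>2 / N + 2 * B * r * \<zeta>) * (m * N)\<^sup>2"
    by (simp add: power2_eq_square algebra_simps)
   thus ?thesis using m N by simp
  qed
  also have "... <= real (card ?S) * (c / 4 + c / 4 + c / 2)"
  proof (intro mult_left_mono add_mono \<zeta>c)
   show "(2 * B)\<^sup>2 * bt <= c / 4" using B by (simp add: bt_def)
   have "20 * (2 * B)\<^sup>2 * r\<^sup>2 <= N * c" using evn c by (simp add: N_def divide_le_eq)
   thus "5 * (2 * B)\<^sup>2 * r\<^sup>2 / N <= c / 4" using N by (simp add: divide_le_eq mult_ac)
  qed simp
  also have "... = real (card ?S) * (et * kq\<^sup>2)" by (simp add: c_def)
  finally have "real (card {pv. pv permutes W n & kq <= \<bar>q pv\<bar>}) <= et * real (card ?S)"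
   by (rule markov_permutations[OF W(1) kq])
  thus "real (card {pv. pv permutes W n & kq <=
      \<bar>?em (\<lambda>p\<in>prod_sets V W n. j (x (fst p, pv (snd p))) (z p)) f - ?em z (Th f)\<bar>})
     <= et * real (card ?S)" by (simp add: q_def)
 qed
 with tests show ?thesis by (rule that)
qed

end

section \<open>Counting models of a product\<close>

lemma cov_attained:
 assumes tb: "tbm S d" and V: "finite V" "V ~= {}" and "0 < dl" and Z: "Z <= V ~> S"
 obtains Q where "Q <= Z" "finite Q" "card Q = cov dl Z (hm d V)"
  "ALL z:Z. EX y:Q. hm d V z y < dl"
proof -
 have "EX m. \<exists>F\<subseteq>Z. finite F & card F = m & (ALL z:Z. EX y:F. hm d V z y < dl)"
  by (rule max_sep[OF tb V \<open>0 < dl\<close> Z]) auto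
 from LeastI_ex[OF this] show ?thesis using that unfolding cov_def by auto
qed

lemma cov_antimono:
 assumes tb: "tbm S d" and V: "finite V" "V ~= {}" and "0 < dl" "dl <= dl'" and Z: "Z <= V ~> S"
 shows "cov dl' Z (hm d V) <= cov dl Z (hm d V)"
proof -
 obtain Q where Q: "Q <= Z" "finite Q" "card Q = cov dl Z (hm d V)"
  "ALL z:Z. EX y:Q. hm d V z y < dl" by (rule cov_attained[OF tb V \<open>0 < dl\<close> Z]) auto
 have "ALL z:Z. EX y:Q. hm d V z y < dl'" using Q(4) \<open>dl <= dl'\<close> by (meson order_less_le_trans)
 from cov_le_card[OF Q(1,2) this] show ?thesis using Q(3) by simp
qed

text \<open>If each element is good for half of the permutations, some permutation is good for half of the elements.\<close>

lemma exists_good_permutation: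
 assumes W: "finite W" and X: "finite X"
  and good: "!!x. x : X ==> real (card {pv. pv permutes W}) <= 2 * real (card {pv. pv permutes W & P pv x})"
 shows "EX pv. pv permutes W & real (card X) <= 2 * real (card {x : X. P pv x})"
proof (rule ccontr)
 assume no: "~ ?thesis"
 let ?S = "{pv. pv permutes W}"
 have fS: "finite ?S" using W by (rule finite_permutations)
 have ne: "?S ~= {}" using permutes_id by blast
 have ind: "real (card {a : A. R a}) = (SUM a:A. if R a then 1 else 0)" if "finite A" for A :: "'z set" and R
  using that by (simp add: sum.If_cases Int_def)
 have ind': "real (card {a : A. R a}) = (SUM a:A. if R a then 1 else 0)" if "finite A" for A :: "('a => 'a) set" and R
  using that by (simp add: sum.If_cases Int_def)
 have ind'': "real (card {a : A. R a}) = (SUM a:A. if R a then 1 else 0)" if "finite A" for A :: "'b set" and R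
  using that by (simp add: sum.If_cases Int_def)
 have "(SUM x:X. real (card ?S)) <= (SUM x:X. 2 * real (card {pv : ?S. P pv x}))" using good by (intro sum_mono) simp
 also have "... = 2 * (SUM x:X. SUM pv:?S. if P pv x then 1 else 0)" using fS by (simp only: ind' sum_distrib_left)
 also have "(SUM x:X. SUM pv:?S. if P pv x then 1 else 0) = (SUM pv:?S. SUM x:X. if P pv x then 1 else (0::real))"
  by (rule sum.swap)
 also have "... = (SUM pv:?S. real (card {x : X. P pv x}))" using X by (simp only: ind'')
 also have "2 * ... = (SUM pv:?S. 2 * real (card {x : X. P pv x}))" by (rule sum_distrib_left)
 also have "... < (SUM pv:?S. real (card X))" using no by (intro sum_strict_mono fS ne) (auto simp: not_le)
 also have "... = (SUM x:X. real (card ?S))" by simp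
 finally show False by simp
qed

context coind_merge
begin

lemma Th_loc:
 assumes f: "f : loc D SC dC"
 shows "Th f : loc D S' e"
proof -
 obtain E C where lf: "lip_on D SC dC E C f" using f by (auto simp: loc_def)
 note E = E[OF lf]
 obtain B where B: "0 < B" "!!z. z : D ~> SC ==> \<bar>f z\<bar> <= B" by (rule loc_bounded[OF tbC f]) auto
 have "lip_on D S' e E C (Th f)" unfolding lip_on_def
 proof (intro conjI ballI E)
  fix b b' assume b: "b : D ~> S'" "b' : D ~> S'"
  note int = f_cp_integrable[OF lf B b(1)] f_cp_integrable[OF lf B b(2)]
  have "\<bar>Th f b - Th f b'\<bar> = \<bar>\<integral>y. f (mp (cp y) b) - f (mp (cp y) b') \<partial>MH\<bar>"
   unfolding Th_def using int by simp
  also have "... <= (\<integral>y. \<bar>f (mp (cp y) b) - f (mp (cp y) b')\<bar> \<partial>MH)" by (rule integral_abs_bound)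
  also have "... <= C * (SUM i:E. e (b i) (b' i))"
  proof (rule MH.integral_le_const)
   show "AE y in MH. \<bar>f (mp (cp y) b) - f (mp (cp y) b')\<bar> <= C * (SUM i:E. e (b i) (b' i))"
   proof (rule AE_I2)
    fix y assume y: "y : space MH"
    have "\<bar>f (mp (cp y) b) - f (mp (cp y) b')\<bar> <= C * (SUM i:E. dC (mp (cp y) b i) (mp (cp y) b' i))"
     by (intro lip_onD[OF lf] mp_in cp_in y b)
    also have "(SUM i:E. dC (mp (cp y) b i) (mp (cp y) b' i)) = (SUM i:E. e (b i) (b' i))"
    proof (rule sum.cong[OF refl])
     fix i assume "i : E"
     hence i: "i : D" using E by auto
     have "cp y i : S" "b i : S'" "b' i : S'" using cp_in[OF y] b i by auto
     thus "dC (mp (cp y) b i) (mp (cp y) b' i) = e (b i) (b' i)"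
      using i merging_dist[OF mg, of "cp y i" "cp y i" "b i" "b' i"] tbm_zero[OF tb, of "cp y i"] by (simp add: merge_path_def)
    qed
    finally show "\<bar>f (mp (cp y) b) - f (mp (cp y) b')\<bar> <= C * (SUM i:E. e (b i) (b' i))" .
   qed
  qed (use int in auto)
  finally show "\<bar>Th f b - Th f b'\<bar> <= C * (SUM i:E. e (b i) (b' i))" .
 qed
 thus ?thesis by (rule locI)
qed

lemma hamming_permute:
 assumes "pv permutes W"
 shows "hm d (V \<times> W) (%p. x (fst p, pv (snd p))) (%p. x' (fst p, pv (snd p))) = hm d (V \<times> W) x x'"
proof -
 have "bij_betw (map_prod id pv) (V \<times> W) (V \<times> W)"
  using permutes_imp_bij[OF assms] by (intro bij_betw_map_prod) auto
 from sum.reindex_bij_betw[OF this, of "%p. d (x p) (x' p)"]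
 show ?thesis unfolding hamming_metric_def by (simp add: map_prod_def case_prod_beta)
qed

end

locale coind_product = coind_merge G H M T af S d S' e SC dC j p1 p2
 for G :: "('g, 'm) monoid_scheme" and H :: "('h, 'n) monoid_scheme"
  and M :: "'x measure" and T :: "'g => 'x => 'x" and af :: "'x => 'a"
  and S :: "'a set" and d and S' :: "'b set" and e and SC :: "'c set" and dC
  and j :: "'a => 'b => 'c" and p1 and p2 +
 fixes V :: "nat => 'v set" and W :: "nat => 'w set" and sg :: "nat => 'g => 'v => 'v"
  and ta :: "nat => 'h => 'w => 'w"
  and I2 :: "(('g \<times> 'h => 'b) => real) => real" and I12 :: "(('g \<times> 'h => 'c) => real) => real"
 assumes inf: "infinite (carrier H)" and fa: "finite_action G V sg" and so: "sofic_approximation H W ta"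
  and I12_Th: "!!f. f : loc D SC dC ==> I12 f = I2 (Th f)"
  and I12_1: "!!f. f : loc D S d ==> I12 (%c. f (\<lambda>i\<in>D. p1 (c i))) = (\<integral>y. f (cp y) \<partial>MH)"
  and I12_2: "!!f. f : loc D S' e ==> I12 (%c. f (\<lambda>i\<in>D. p2 (c i))) = I2 f"
begin

abbreviation "Gam \<equiv> G \<times>\<times> H"
abbreviation "VW \<equiv> prod_sets V W"
abbreviation "st \<equiv> prod_approx sg ta"
abbreviation "I1 \<equiv> (%f. \<integral>y. f (cp y) \<partial>MH)"
abbreviation "Z1 F ep n \<equiv> loc_models Gam (st n) (VW n) S I1 F ep"
abbreviation "Z2 F ep n \<equiv> loc_models Gam (st n) (VW n) S' I2 F ep"
abbreviation "Z12 F ep n \<equiv> loc_models Gam (st n) (VW n) SC I12 F ep"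

lemma faH: "finite_action H W ta" using sofic_almost_action[OF so] by (simp add: almost_action_def)

lemma VW: "finite (VW n)" "VW n ~= {}" using finite_actionD[OF fa] finite_actionD[OF faH] by (auto simp: prod_sets_def)

lemma carrier_Gam: "carrier Gam = D" by (simp add: DirProd_def)

text \<open>For each \<open>z\<close> in a separated set, permute a separated set of models \<open>x\<close> by a permutation that is
good for at least half of them. The resulting pairs stay separated: for different \<open>z\<close> by the second
coordinate, for equal \<open>z\<close> because the same permutation was applied.\<close>

lemma product_lower:
 assumes dl: "0 < dl" and F: "(F, ep) : loc_tests D SC dC"
 obtains F1 ep1 F2 ep2 where "(F1, ep1) : loc_tests D S d" "(F2, ep2) : loc_tests D S' e"
  "EV n. cov dl (Z1 F1 ep1 n) (hm d (VW n)) * cov dl (Z2 F2 ep2 n) (hm e (VW n))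
    <= 2 * cov (dl / 2) (Z12 F ep n) (hm dC (VW n))"
proof -
 have F': "finite F" "F <= loc D SC dC" "0 < ep" using F by (auto simp: loc_tests_def)
 define et where "et = 1 / (2 * (real (card F) + 1))"
 have et: "0 < et" by (simp add: et_def add_nonneg_pos)
 have etF: "real (card F) * et <= 1 / 2" by (simp add: et_def divide_simps)
 have kq: "0 < ep / 2" using F' by simp
 let ?bad = "%f n x z. {pv. pv permutes W n & ep / 2 <=
      \<bar>emp_avg Gam (st n) (VW n) (\<lambda>p\<in>VW n. j (x (fst p, pv (snd p))) (z p)) f
       - emp_avg Gam (st n) (VW n) z (Th f)\<bar>}"
 have "ALL f:F. EX q. q : loc_tests D S d & (EV n. ALL x:Z1 (fst q) (snd q) n. ALL z:VW n ~> S'.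
     real (card (?bad f n x z)) <= et * real (card {pv. pv permutes W n}))"
 proof
  fix f assume "f : F"
  hence "f : loc D SC dC" using F' by auto
  then obtain F1 ep1 where "(F1, ep1) : loc_tests D S d" "EV n. ALL x:Z1 F1 ep1 n. ALL z:VW n ~> S'.
     real (card (?bad f n x z)) <= et * real (card {pv. pv permutes W n})"
   by (rule permutation_almost_good[OF inf fa so _ kq et])
  thus "EX q. q : loc_tests D S d & (EV n. ALL x:Z1 (fst q) (snd q) n. ALL z:VW n ~> S'.
     real (card (?bad f n x z)) <= et * real (card {pv. pv permutes W n}))" by (intro exI[of _ "(F1, ep1)"]) simp
 qed
 then obtain q where q: "ALL f:F. q f : loc_tests D S d & (EV n. ALL x:Z1 (fst (q f)) (snd (q f)) n. ALL z:VW n ~> S'.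
     real (card (?bad f n x z)) <= et * real (card {pv. pv permutes W n}))" by (rule bchoice[THEN exE])
 define F1 where "F1 = (UN f:F. fst (q f))"
 define ep1 where "ep1 = Min (insert 1 ((%f. snd (q f)) ` F))"
 have q1: "finite (fst (q f))" "fst (q f) <= loc D S d" "0 < snd (q f)" if "f : F" for f
  using bspec[OF q that] by (auto simp: loc_tests_def case_prod_beta)
 have t1: "(F1, ep1) : loc_tests D S d" using F'(1) q1 by (auto simp: loc_tests_def F1_def ep1_def)
 have t2: "(Th ` F, ep / 2) : loc_tests D S' e" using F' Th_loc by (auto simp: loc_tests_def)
 have sub: "Z1 F1 ep1 n <= Z1 (fst (q f)) (snd (q f)) n" if "f : F" for f n
 proof -
  have "ep1 <= snd (q f)" unfolding ep1_def using F'(1) that by (intro Min_le) auto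
  thus ?thesis using that by (fastforce simp: loc_models_def F1_def)
 qed
 have "EV n. ALL f:F. ALL x:Z1 (fst (q f)) (snd (q f)) n. ALL z:VW n ~> S'.
     real (card (?bad f n x z)) <= et * real (card {pv. pv permutes W n})"
  using q by (intro eventually_ball_finite[OF F'(1)]) blast
 hence "EV n. cov dl (Z1 F1 ep1 n) (hm d (VW n)) * cov dl (Z2 (Th ` F) (ep / 2) n) (hm e (VW n))
    <= 2 * cov (dl / 2) (Z12 F ep n) (hm dC (VW n))"
 proof (rule eventually_mono)
  fix n assume few: "ALL f:F. ALL x:Z1 (fst (q f)) (snd (q f)) n. ALL z:VW n ~> S'.
     real (card (?bad f n x z)) <= et * real (card {pv. pv permutes W n})"
  have W: "finite (W n)" using finite_actionD[OF faH] by auto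
  let ?S = "{pv. pv permutes W n}"
  have fS: "finite ?S" using W by (rule finite_permutations)
  define mr where "mr pv x z = (\<lambda>p\<in>VW n. j (x (fst p, pv (snd p))) (z p))" for pv and x :: "'v \<times> 'w => 'a" and z :: "'v \<times> 'w => 'b"
  have Z1V: "Z1 F1 ep1 n <= VW n ~> S" and Z2V: "Z2 (Th ` F) (ep / 2) n <= VW n ~> S'" by (auto simp: loc_models_def)
  have mrV: "mr pv x z : VW n ~> SC" if "pv permutes W n" "x : VW n ~> S" "z : VW n ~> S'" for pv x z
   using that mergingD(1)[OF mg] by (auto simp: mr_def prod_sets_def PiE_iff permutes_in_image)
  obtain X where X: "X <= Z1 F1 ep1 n" "finite X" "sep_set dl (hm d (VW n)) X"
   "cov dl (Z1 F1 ep1 n) (hm d (VW n)) <= card X" by (rule cov_le_sep[OF tb VW dl Z1V]) auto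
  obtain Y where Y: "Y <= Z2 (Th ` F) (ep / 2) n" "finite Y" "sep_set dl (hm e (VW n)) Y"
   "cov dl (Z2 (Th ` F) (ep / 2) n) (hm e (VW n)) <= card Y" by (rule cov_le_sep[OF tb' VW dl Z2V]) auto
  have XV: "x : VW n ~> S" if "x : X" for x using that X(1) Z1V by blast
  have YV: "z : VW n ~> S'" if "z : Y" for z using that Y(1) Z2V by blast
  let ?good = "%z pv x. mr pv x z : Z12 F ep n"
  have most: "real (card ?S) <= 2 * real (card {pv. pv permutes W n & ?good z pv x})" if x: "x : X" and z: "z : Y" for x z
  proof -
   have "?S - (UN f:F. ?bad f n x z) <= {pv. pv permutes W n & ?good z pv x}"
   proof
    fix pv assume a: "pv : ?S - (UN f:F. ?bad f n x z)"
    hence pv: "pv permutes W n" by simp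
    have "\<bar>emp_avg Gam (st n) (VW n) (mr pv x z) f - I12 f\<bar> < ep" if f: "f : F" for f
    proof -
     have "\<bar>emp_avg Gam (st n) (VW n) (mr pv x z) f - emp_avg Gam (st n) (VW n) z (Th f)\<bar> < ep / 2"
      using a f pv unfolding mr_def by (auto simp: not_le)
     moreover have "\<bar>emp_avg Gam (st n) (VW n) z (Th f) - I2 (Th f)\<bar> < ep / 2"
      using z Y(1) f by (auto simp: loc_models_def)
     moreover have "I12 f = I2 (Th f)" using f F' by (intro I12_Th) auto
     ultimately show ?thesis by linarith
    qed
    thus "pv : {pv. pv permutes W n & ?good z pv x}" using pv mrV[OF pv XV[OF x] YV[OF z]] by (simp add: loc_models_def)
   qed
   hence "card (?S - (UN f:F. ?bad f n x z)) <= card {pv. pv permutes W n & ?good z pv x}"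
    using fS by (intro card_mono) (auto intro: finite_subset[of _ ?S])
   moreover have "card ?S - card (UN f:F. ?bad f n x z) <= card (?S - (UN f:F. ?bad f n x z))"
    by (rule diff_card_le_card_Diff) (use fS F'(1) in \<open>auto intro: finite_subset[of _ ?S]\<close>)
   moreover have "real (card (UN f:F. ?bad f n x z)) <= real (card ?S) / 2"
   proof -
    have "real (card (UN f:F. ?bad f n x z)) <= (SUM f:F. real (card (?bad f n x z)))"
     using card_UN_le[OF F'(1), of "%f. ?bad f n x z"] by (simp flip: of_nat_sum)
    also have "... <= (SUM f:F. et * real (card ?S))" using few sub X(1) x YV[OF z] by (intro sum_mono) blast
    also have "... = (real (card F) * et) * real (card ?S)" by simp
    also have "... <= 1 / 2 * real (card ?S)" using etF by (intro mult_right_mono) auto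
    finally show ?thesis by simp
   qed
   ultimately show ?thesis by linarith
  qed
  have "ALL z:Y. EX pv. pv permutes W n & real (card X) <= 2 * real (card {x : X. ?good z pv x})"
   using most by (intro ballI exists_good_permutation[OF W X(2)]) auto
  then obtain pv where pv: "ALL z:Y. pv z permutes W n & real (card X) <= 2 * real (card {x : X. ?good z (pv z) x})"
   by (rule bchoice[THEN exE])
  have pvp: "pv z permutes W n" and pvc: "real (card X) <= 2 * real (card {x : X. ?good z (pv z) x})" if "z : Y" for z
   using bspec[OF pv that] by auto
  define P where "P = (SIGMA z:Y. {x : X. ?good z (pv z) x})"
  define mk where "mk = (%(z, x). mr (pv z) x z)"
  have fP: "finite P" using X Y by (auto simp: P_def)
  have far: "dl <= hm dC (VW n) (mk p) (mk p')" if p: "p : P" "p' : P" "p ~= p'" for p p'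
  proof -
   obtain z x z' x' where [simp]: "p = (z, x)" "p' = (z', x')" by (cases p, cases p') auto
   have zx: "z : Y" "x : X" "z' : Y" "x' : X" using p by (auto simp: P_def)
   have "hm dC (VW n) (mk p) (mk p') =
    hm d (VW n) (%p. x (fst p, pv z (snd p))) (%p. x' (fst p, pv z' (snd p))) + hm e (VW n) z z'"
   proof -
    have "dC (mk p v) (mk p' v) = d (x (fst v, pv z (snd v))) (x' (fst v, pv z' (snd v))) + e (z v) (z' v)"
     if v: "v : VW n" for v
    proof -
     have "(fst v, pv z (snd v)) : VW n" "(fst v, pv z' (snd v)) : VW n"
      using v pvp[OF zx(1)] pvp[OF zx(3)] by (auto simp: prod_sets_def permutes_in_image)
     hence "x (fst v, pv z (snd v)) : S" "x' (fst v, pv z' (snd v)) : S" "z v : S'" "z' v : S'"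
      using XV[OF zx(2)] XV[OF zx(4)] YV[OF zx(1)] YV[OF zx(3)] v by auto
     from merging_dist[OF mg this] show ?thesis using v by (simp add: mk_def mr_def)
    qed
    thus ?thesis by (simp add: hamming_metric_def sum.distrib add_divide_distrib)
   qed
   moreover have "dl <= hm d (VW n) (%p. x (fst p, pv z (snd p))) (%p. x' (fst p, pv z' (snd p))) + hm e (VW n) z z'"
   proof (cases "z = z'")
    case True
    hence "x ~= x'" using p by simp
    hence "dl <= hm d (VW n) x x'" using X(3) zx unfolding sep_set_def by blast
    also have "... = hm d (VW n) (%p. x (fst p, pv z (snd p))) (%p. x' (fst p, pv z' (snd p)))"
     using hamming_permute[OF pvp[OF zx(1)], where V = "V n"] True by (simp add: prod_sets_def)
    finally show ?thesis using hamming_nonneg[OF tb', of "VW n" z z'] by linarith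
   next
    case False
    hence "dl <= hm e (VW n) z z'" using Y(3) zx unfolding sep_set_def by blast
    thus ?thesis using hamming_nonneg[OF tb, of "VW n" "%p. x (fst p, pv z (snd p))" "%p. x' (fst p, pv z' (snd p))"] by linarith
   qed
   ultimately show ?thesis by simp
  qed
  have mkZ: "mk p : Z12 F ep n" if "p : P" for p using that by (auto simp: P_def mk_def)
  have Z12V: "Z12 F ep n <= VW n ~> SC" unfolding loc_models_def by blast
  have inj: "inj_on mk P"
  proof (rule inj_onI, rule ccontr)
   fix p p' assume pp: "p : P" "p' : P" "mk p = mk p'" "p ~= p'"
   have "hm dC (VW n) (mk p') (mk p') = 0" by (rule hamming_zero[OF tbC subsetD[OF Z12V mkZ[OF pp(2)]]])
   thus False using far[OF pp(1,2,4)] pp(3) dl by simp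
  qed
  have dl2: "0 < dl / 2" using dl by simp
  have "card P = card (mk ` P)" using inj by (simp add: card_image)
  also have "... <= cov (dl / 2) (Z12 F ep n) (hm dC (VW n))"
  proof (rule sep_le_cov[OF tbC VW dl2 Z12V])
   show "mk ` P <= Z12 F ep n" using mkZ by blast
   show "sep_set (2 * (dl / 2)) (hm dC (VW n)) (mk ` P)" unfolding sep_set_def using far by auto
  qed
  finally have cP: "card P <= cov (dl / 2) (Z12 F ep n) (hm dC (VW n))" .
  have "real (card Y) * real (card X) = (SUM z:Y. real (card X))" by simp
  also have "... <= (SUM z:Y. 2 * real (card {x : X. ?good z (pv z) x}))" by (intro sum_mono pvc)
  also have "... = 2 * real (card P)" unfolding P_def using X(2) Y(2) by (subst card_SigmaI) (auto simp: sum_distrib_left)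
  finally have "card X * card Y <= 2 * card P" by (simp add: mult.commute flip: of_nat_mult of_nat_le_iff)
  moreover have "cov dl (Z1 F1 ep1 n) (hm d (VW n)) * cov dl (Z2 (Th ` F) (ep / 2) n) (hm e (VW n)) <= card X * card Y"
   by (intro mult_mono X Y) auto
  ultimately show "cov dl (Z1 F1 ep1 n) (hm d (VW n)) * cov dl (Z2 (Th ` F) (ep / 2) n) (hm e (VW n))
    <= 2 * cov (dl / 2) (Z12 F ep n) (hm dC (VW n))" using cP by linarith
 qed
 with t1 t2 show ?thesis by (rule that)
qed

text \<open>A model of the product projects to models of both factors, and a pair of nearest points in dense
sets determines it up to a small distance.\<close>

lemma product_upper:
 assumes dl: "0 < dl" and F1: "(F1, ep1) : loc_tests D S d" and F2: "(F2, ep2) : loc_tests D S' e"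
 obtains F ep where "(F, ep) : loc_tests D SC dC"
  "ALL n. cov (4 * dl) (Z12 F ep n) (hm dC (VW n))
    <= cov dl (Z1 F1 ep1 n) (hm d (VW n)) * cov dl (Z2 F2 ep2 n) (hm e (VW n))"
proof -
 let ?l1 = "%f c. f (\<lambda>i\<in>D. p1 (c i))" and ?l2 = "%f c. f (\<lambda>i\<in>D. p2 (c i))"
 have dC_ge: "d (p1 c) (p1 c') <= dC c c'" "e (p2 c) (p2 c') <= dC c c'" if "c : SC" "c' : SC" for c c'
  using mergingD(7)[OF mg that] tbm_nonneg[OF tb] tbm_nonneg[OF tb'] by auto
 have l1: "?l1 f : loc D SC dC" if "f : loc D S d" for f
  by (rule loc_compose[OF that]) (use mergingD(4)[OF mg] dC_ge in auto)
 have l2: "?l2 f : loc D SC dC" if "f : loc D S' e" for f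
  by (rule loc_compose[OF that]) (use mergingD(5)[OF mg] dC_ge in auto)
 define F where "F = ?l1 ` F1 Un ?l2 ` F2"
 define ep where "ep = min ep1 ep2"
 have t: "(F, ep) : loc_tests D SC dC" using F1 F2 l1 l2 by (auto simp: F_def ep_def loc_tests_def)
 have "cov (4 * dl) (Z12 F ep n) (hm dC (VW n))
    <= cov dl (Z1 F1 ep1 n) (hm d (VW n)) * cov dl (Z2 F2 ep2 n) (hm e (VW n))" for n
 proof -
  have Z1V: "Z1 F1 ep1 n <= VW n ~> S" and Z2V: "Z2 F2 ep2 n <= VW n ~> S'" and Z12V: "Z12 F ep n <= VW n ~> SC"
   by (auto simp: loc_models_def)
  obtain Q where Q: "Q <= Z1 F1 ep1 n" "finite Q" "card Q = cov dl (Z1 F1 ep1 n) (hm d (VW n))"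
   "ALL z:Z1 F1 ep1 n. EX y:Q. hm d (VW n) z y < dl" by (rule cov_attained[OF tb VW dl Z1V]) auto
  obtain R where R: "R <= Z2 F2 ep2 n" "finite R" "card R = cov dl (Z2 F2 ep2 n) (hm e (VW n))"
   "ALL z:Z2 F2 ep2 n. EX y:R. hm e (VW n) z y < dl" by (rule cov_attained[OF tb' VW dl Z2V]) auto
  have dl4: "0 < 4 * dl" using dl by simp
  obtain X where X: "X <= Z12 F ep n" "finite X" "sep_set (4 * dl) (hm dC (VW n)) X"
   "cov (4 * dl) (Z12 F ep n) (hm dC (VW n)) <= card X" by (rule cov_le_sep[OF tbC VW dl4 Z12V]) auto
  define a where "a c = (\<lambda>v\<in>VW n. p1 (c v))" for c
  define b where "b c = (\<lambda>v\<in>VW n. p2 (c v))" for c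
  have sV: "(sg n (fst i) (fst v), ta n (snd i) (snd v)) : VW n" if "i : D" "v : VW n" for i v
  proof -
   have "fst i : carrier G" "snd i : carrier H" "fst v : V n" "snd v : W n" using that by (auto simp: prod_sets_def)
   hence "sg n (fst i) (fst v) : V n" "ta n (snd i) (snd v) : W n"
    using finite_actionD(4)[OF fa, of "fst i" n] finite_actionD(4)[OF faH, of "snd i" n] by auto
   thus ?thesis by (simp add: prod_sets_def)
  qed
  have aZ: "a c : Z1 F1 ep1 n" and bZ: "b c : Z2 F2 ep2 n" if c: "c : Z12 F ep n" for c
  proof -
   have cV: "c : VW n ~> SC" using c Z12V by blast
   have aV: "a c : VW n ~> S" using cV mergingD(4)[OF mg] by (auto simp: a_def)
   have bV: "b c : VW n ~> S'" using cV mergingD(5)[OF mg] by (auto simp: b_def)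
   have ea: "emp_avg Gam (st n) (VW n) (a c) f = emp_avg Gam (st n) (VW n) c (?l1 f)" for f
    unfolding emp_avg_def prod_pullback a_def using sV
    by (intro arg_cong2[where f = "(/)"] sum.cong arg_cong[where f = f] restrict_ext refl) auto
   have eb: "emp_avg Gam (st n) (VW n) (b c) f = emp_avg Gam (st n) (VW n) c (?l2 f)" for f
    unfolding emp_avg_def prod_pullback b_def using sV
    by (intro arg_cong2[where f = "(/)"] sum.cong arg_cong[where f = f] restrict_ext refl) auto
   have ct: "\<bar>emp_avg Gam (st n) (VW n) c f - I12 f\<bar> < ep" if "f : F" for f using c that by (simp add: loc_models_def)
   have "\<bar>emp_avg Gam (st n) (VW n) (a c) f - I1 f\<bar> < ep1" if f: "f : F1" for f
   proof -
    have "f : loc D S d" using f F1 by (auto simp: loc_tests_def)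
    hence "I12 (?l1 f) = I1 f" by (rule I12_1)
    moreover have "?l1 f : F" using f by (auto simp: F_def)
    ultimately show ?thesis using ct[of "?l1 f"] ea[of f] by (simp add: ep_def)
   qed
   thus "a c : Z1 F1 ep1 n" using aV by (simp add: loc_models_def)
   have "\<bar>emp_avg Gam (st n) (VW n) (b c) f - I2 f\<bar> < ep2" if f: "f : F2" for f
   proof -
    have "f : loc D S' e" using f F2 by (auto simp: loc_tests_def)
    hence "I12 (?l2 f) = I2 f" by (rule I12_2)
    moreover have "?l2 f : F" using f by (auto simp: F_def)
    ultimately show ?thesis using ct[of "?l2 f"] eb[of f] by (simp add: ep_def)
   qed
   thus "b c : Z2 F2 ep2 n" using bV by (simp add: loc_models_def)
  qed
  have "ALL c:X. EX p. p : Q \<times> R & hm d (VW n) (a c) (fst p) < dl & hm e (VW n) (b c) (snd p) < dl"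
  proof
   fix c assume "c : X"
   hence c: "c : Z12 F ep n" using X by blast
   obtain y where "y : Q" "hm d (VW n) (a c) y < dl" using Q(4) aZ[OF c] by blast
   moreover obtain y' where "y' : R" "hm e (VW n) (b c) y' < dl" using R(4) bZ[OF c] by blast
   ultimately show "EX p. p : Q \<times> R & hm d (VW n) (a c) (fst p) < dl & hm e (VW n) (b c) (snd p) < dl"
    by (intro exI[of _ "(y, y')"]) auto
  qed
  then obtain h where h: "ALL c:X. h c : Q \<times> R & hm d (VW n) (a c) (fst (h c)) < dl & hm e (VW n) (b c) (snd (h c)) < dl"
   by (rule bchoice[THEN exE])
  have h1: "h c : Q \<times> R" and h2: "hm d (VW n) (a c) (fst (h c)) < dl" and h3: "hm e (VW n) (b c) (snd (h c)) < dl"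
   if "c : X" for c using bspec[OF h that] by auto
  have "inj_on h X"
  proof (rule inj_onI, rule ccontr)
   fix c c' assume cc: "c : X" "c' : X" "h c = h c'" "c ~= c'"
   have cZ: "c : Z12 F ep n" "c' : Z12 F ep n" using cc X by auto
   hence cV: "c : VW n ~> SC" "c' : VW n ~> SC" using Z12V by auto
   have aV: "a c : VW n ~> S" "a c' : VW n ~> S" "fst (h c) : VW n ~> S"
    using subsetD[OF Z1V aZ[OF cZ(1)]] subsetD[OF Z1V aZ[OF cZ(2)]] subsetD[OF Z1V subsetD[OF Q(1)]] h1[OF cc(1)]
    by (simp_all add: mem_Times_iff)
   have bV: "b c : VW n ~> S'" "b c' : VW n ~> S'" "snd (h c) : VW n ~> S'"
    using subsetD[OF Z2V bZ[OF cZ(1)]] subsetD[OF Z2V bZ[OF cZ(2)]] subsetD[OF Z2V subsetD[OF R(1)]] h1[OF cc(1)]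
    by (simp_all add: mem_Times_iff)
   have "hm dC (VW n) c c' = hm d (VW n) (a c) (a c') + hm e (VW n) (b c) (b c')"
   proof -
    have "dC (c v) (c' v) = d (a c v) (a c' v) + e (b c v) (b c' v)" if "v : VW n" for v
    proof -
     have "c v : SC" "c' v : SC" using cV that by auto
     from mergingD(7)[OF mg this] show ?thesis using that by (simp add: a_def b_def)
    qed
    thus ?thesis by (simp add: hamming_metric_def sum.distrib add_divide_distrib)
   qed
   also have "hm d (VW n) (a c) (a c') < 2 * dl"
    using hamming_tri[OF tb aV(1,3,2)] h2[OF cc(1)] h2[OF cc(2)] cc(3) hamming_sym[OF tb, of "VW n" "a c'" "fst (h c)"] by simp
   also have "hm e (VW n) (b c) (b c') < 2 * dl"
    using hamming_tri[OF tb' bV(1,3,2)] h3[OF cc(1)] h3[OF cc(2)] cc(3) hamming_sym[OF tb', of "VW n" "b c'" "snd (h c)"] by simp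
   finally have "hm dC (VW n) c c' < 4 * dl" by simp
   moreover have "4 * dl <= hm dC (VW n) c c'" using X(3) cc unfolding sep_set_def by blast
   ultimately show False by simp
  qed
  moreover have "h ` X <= Q \<times> R" using h1 by blast
  ultimately have "card X <= card (Q \<times> R)" by (rule card_inj_on_le[OF _ _ finite_cartesian_product[OF Q(2) R(2)]])
  thus ?thesis using X(4) Q(3) R(3) by (simp add: card_cartesian_product)
 qed
 with t show ?thesis by (intro that allI)
qed

end

section \<open>Entropy of a product\<close>

text \<open>The excluded infinite values are those for which the sum of limits would not be a limit of sums.\<close>

lemma limsup_liminf_le:
 fixes a b c :: "nat => ereal" and z :: "nat => real"
 assumes le: "EV n. a n + b n <= c n + ereal (z n)" and z: "z \<longlonglongrightarrow> 0"
  and a: "limsup a ~= -\<infinity>" and b: "liminf b ~= -\<infinity>"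
 shows "limsup a + liminf b <= limsup c"
proof -
 have step: "limsup a + ereal y <= limsup c" if y: "ereal y < liminf b" for y
 proof (rule ereal_le_epsilon2)
  fix ep :: real assume ep: "0 < ep"
  have "EV n. ereal y < b n" using y by (rule less_LiminfD)
  moreover have "EV n. z n < ep" using z ep by (rule order_tendstoD)
  ultimately have "EV n. a n + ereal y <= c n + ereal ep" using le
  proof eventually_elim
   case (elim n)
   have "a n + ereal y <= a n + b n" using elim by (intro add_left_mono) auto
   also note elim(3)
   also have "c n + ereal (z n) <= c n + ereal ep" using elim by (intro add_left_mono) auto
   finally show ?case .
  qed
  hence "limsup (%n. a n + ereal y) <= limsup (%n. c n + ereal ep)" by (rule Limsup_mono)
  thus "limsup a + ereal y <= limsup c + ereal ep" by (simp add: Limsup_add_ereal_right)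
 qed
 show ?thesis
 proof (cases "liminf b")
  case (real r)
  have "limsup a + ereal r <= limsup c + ereal ep" if "0 < ep" for ep :: real
  proof -
   have "limsup a + ereal (r - ep) <= limsup c" using that real by (intro step) auto
   hence "limsup a + ereal (r - ep) + ereal ep <= limsup c + ereal ep" by (rule add_right_mono)
   thus ?thesis by (simp add: add.assoc)
  qed
  thus ?thesis using real ereal_le_epsilon2 by auto
 next
  case PInf
  have "limsup c = \<infinity>"
  proof (rule ereal_top)
   fix B :: real
   show "ereal B <= limsup c"
   proof (cases "limsup a")
    case (real r)
    have "limsup a + ereal (B - r) <= limsup c" using PInf by (intro step) auto
    thus ?thesis using real by simp
   next
    case PInf
    have "limsup a + ereal 0 <= limsup c" using \<open>liminf b = \<infinity>\<close> by (intro step) auto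
    thus ?thesis using PInf by simp
   qed (use a in simp)
  qed
  thus ?thesis by simp
 qed (use b in simp)
qed

text \<open>Covering numbers are natural numbers, so a rate that is negative is that of an empty set of models.\<close>

lemma rate_cases: "finite (V n) ==> V n ~= {} ==> rate d V dl Z n = -\<infinity> | 0 <= rate d V dl Z n"
 by (auto simp: rate_def log_nat_def card_gt_0_iff intro!: divide_nonneg_pos)

lemma rate_minf:
 assumes "finite (V n)" "V n ~= {}"
 shows "rate d V dl Z n = -\<infinity> \<longleftrightarrow> cov dl (Z n) (hm d (V n)) = 0"
 using assms by (auto simp: rate_def log_nat_def card_gt_0_iff)

lemma limsup_rate_minf:
 assumes V: "!!n. finite (V n) & V n ~= {}"
  and neg: "limsup (rate d V dl Z) < 0"
 shows "EV n. cov dl (Z n) (hm d (V n)) = 0"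
proof -
 have "EV n. rate d V dl Z n < 0" using neg by (rule Limsup_lessD)
 thus ?thesis
 proof (rule eventually_mono)
  fix n assume "rate d V dl Z n < 0"
  hence "rate d V dl Z n = -\<infinity>" using rate_cases[of V n d dl Z] V by auto
  thus "cov dl (Z n) (hm d (V n)) = 0" using rate_minf[of V n] V by auto
 qed
qed

lemma entropy_add_mono: "a <= a' ==> b <= b' ==> entropy_add a b <= entropy_add a' b'"
 by (auto simp: entropy_add_def intro: add_mono)

definition test_inf ::
  "((nat => ereal) => ereal) => ('g, 'm) monoid_scheme => (nat => 'v set) =>
    (nat => 'g => 'v => 'v) => 'a set => ('a => 'a => real) =>
    ((('g => 'a) => real) => real) => real => ereal" where
 "test_inf L Gm V sg S d I dl = (INF (F, ep)\<in>loc_tests (carrier Gm) S d.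
    L (rate d V dl (%n. loc_models Gm (sg n) (V n) S I F ep)))"

lemma loc_entropy_alt: "loc_entropy L Gm V sg S d I = (SUP dl\<in>{0<..}. test_inf L Gm V sg S d I dl)"
 by (simp add: loc_entropy_def test_inf_def)

lemma test_inf_le: "(F, ep) : loc_tests (carrier Gm) S d ==>
 test_inf L Gm V sg S d I dl <= L (rate d V dl (%n. loc_models Gm (sg n) (V n) S I F ep))"
 unfolding test_inf_def by (rule INF_lower2[of "(F, ep)"]) auto

lemma test_inf_greatest:
 "(!!F ep. (F, ep) : loc_tests (carrier Gm) S d ==> y <= L (rate d V dl (%n. loc_models Gm (sg n) (V n) S I F ep)))
  ==> y <= test_inf L Gm V sg S d I dl" unfolding test_inf_def by (rule INF_greatest) auto

lemma test_inf_less: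
 assumes "test_inf L Gm V sg S d I dl < y"
 obtains F ep where "(F, ep) : loc_tests (carrier Gm) S d"
  "L (rate d V dl (%n. loc_models Gm (sg n) (V n) S I F ep)) < y" using assms unfolding test_inf_def INF_less_iff by auto

lemma test_inf_antimono:
 assumes tb: "tbm S d" and fa: "finite_action Gm V sg" and L: "tail_mono L" and "0 < dl" "dl <= dl'"
 shows "test_inf L Gm V sg S d I dl' <= test_inf L Gm V sg S d I dl"
proof (rule test_inf_greatest)
 fix F ep assume t: "(F, ep) : loc_tests (carrier Gm) S d"
 let ?Z = "%n. loc_models Gm (sg n) (V n) S I F ep"
 have "rate d V dl' ?Z n <= rate d V dl ?Z n" for n
  by (intro rate_mono finite_actionD[OF fa] cov_antimono[OF tb] assms) (auto simp: loc_models_def)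
 hence "L (rate d V dl' ?Z) <= L (rate d V dl ?Z)" using L by (simp add: tail_mono_def)
 thus "test_inf L Gm V sg S d I dl' <= L (rate d V dl ?Z)" using test_inf_le[OF t] by (rule order_trans[rotated])
qed

lemma SUP_add_restrict:
 fixes A B :: "real => ereal"
 assumes AB: "!!s t. 0 < s ==> 0 < t ==> A s ~= -\<infinity> ==> B t ~= -\<infinity> ==> A s + B t <= c"
 shows "entropy_add (SUP s\<in>{0<..}. A s) (SUP t\<in>{0<..}. B t) <= c"
proof (cases "(SUP s\<in>{0<..}. A s) = -\<infinity> | (SUP t\<in>{0<..}. B t) = -\<infinity>")
 case False
 define I where "I = {s. 0 < s & A s ~= -\<infinity>}"
 define J where "J = {t. 0 < t & B t ~= -\<infinity>}"
 have restrict: "(SUP s\<in>{0<..}. f s) = (SUP s\<in>{s. 0 < s & f s ~= -\<infinity>}. f s) & {s. 0 < s & f s ~= -\<infinity>} ~= {}"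
  if "(SUP s\<in>{0<..}. f s) ~= -\<infinity>" for f :: "real => ereal"
 proof
  show "(SUP s\<in>{0<..}. f s) = (SUP s\<in>{s. 0 < s & f s ~= -\<infinity>}. f s)"
  proof (rule antisym)
   show "(SUP s\<in>{0<..}. f s) <= (SUP s\<in>{s. 0 < s & f s ~= -\<infinity>}. f s)"
   proof (rule SUP_least)
    fix s :: real assume "s : {0<..}"
    thus "f s <= (SUP s\<in>{s. 0 < s & f s ~= -\<infinity>}. f s)" by (cases "f s = -\<infinity>") (auto intro: SUP_upper)
   qed
  qed (auto intro!: SUP_subset_mono)
  show "{s. 0 < s & f s ~= -\<infinity>} ~= {}"
  proof
   assume "{s. 0 < s & f s ~= -\<infinity>} = {}"
   hence "f s <= -\<infinity>" if "s : {0<..}" for s using that by auto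
   hence "(SUP s\<in>{0<..}. f s) <= -\<infinity>" by (rule SUP_least)
   thus False using that by simp
  qed
 qed
 have A: "(SUP s\<in>{0<..}. A s) = (SUP s\<in>I. A s)" "I ~= {}" using restrict[of A] False by (auto simp: I_def)
 have B: "(SUP s\<in>{0<..}. B s) = (SUP s\<in>J. B s)" "J ~= {}" using restrict[of B] False by (auto simp: J_def)
 have "(SUP s\<in>I. A s) + (SUP t\<in>J. B t) = (SUP s\<in>I. A s + (SUP t\<in>J. B t))"
  using False A B by (intro SUP_ereal_add_left[symmetric]) auto
 also have "... <= c"
 proof (rule SUP_least)
  fix s assume s: "s : I"
  have "A s + (SUP t\<in>J. B t) = (SUP t\<in>J. A s + B t)"
   using s B(2) by (intro SUP_ereal_add_right[symmetric]) (auto simp: I_def)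
  also have "... <= c" using s AB by (intro SUP_least) (auto simp: I_def J_def)
  finally show "A s + (SUP t\<in>J. B t) <= c" .
 qed
 finally show ?thesis using False A B by (simp add: entropy_add_def)
qed (auto simp: entropy_add_def)

lemma rate_add_le:
 assumes V: "finite V'" "V' ~= {}" and le: "c1 * c2 <= 2 * c3"
 shows "log_nat c1 / ereal (real (card V')) + log_nat c2 / ereal (real (card V'))
   <= log_nat c3 / ereal (real (card V')) + ereal (ln 2 / real (card V'))"
proof -
 define m where "m = real (card V')"
 have m: "0 < m" using V by (simp add: m_def card_gt_0_iff)
 show ?thesis
 proof (cases "c1 = 0 | c2 = 0")
  case True
  thus ?thesis using m by (auto simp: log_nat_def m_def[symmetric])
 next
  case False
  hence "c1 * c2 ~= 0" by simp
  hence c3: "c3 ~= 0" using le by linarith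
  have "real c1 * real c2 <= 2 * real c3" using le by (simp flip: of_nat_mult)
  hence "ln (real c1 * real c2) <= ln (2 * real c3)" using False c3 by (subst ln_le_cancel_iff) auto
  hence "ln (real c1) + ln (real c2) <= ln 2 + ln (real c3)" using False c3 by (simp add: ln_mult)
  hence "(ln (real c1) + ln (real c2)) / m <= (ln 2 + ln (real c3)) / m" using m by (simp add: divide_right_mono)
  thus ?thesis using False c3 m by (simp add: log_nat_def m_def[symmetric] add_divide_distrib)
 qed
qed

lemma rate_le_add:
 assumes V: "finite V'" "V' ~= {}" and le: "c3 <= c1 * c2"
 shows "log_nat c3 / ereal (real (card V')) <= log_nat c1 / ereal (real (card V')) + log_nat c2 / ereal (real (card V'))"
proof -
 define m where "m = real (card V')"
 have m: "0 < m" using V by (simp add: m_def card_gt_0_iff)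
 show ?thesis
 proof (cases "c3 = 0")
  case True
  thus ?thesis using m by (auto simp: log_nat_def m_def[symmetric])
 next
  case False
  hence "c1 * c2 ~= 0" using le by linarith
  hence c: "c1 ~= 0" "c2 ~= 0" by auto
  have "real c3 <= real c1 * real c2" using le by (simp flip: of_nat_mult)
  hence "ln (real c3) <= ln (real c1 * real c2)" using False c by (subst ln_le_cancel_iff) auto
  hence "ln (real c3) <= ln (real c1) + ln (real c2)" using c by (simp add: ln_mult)
  hence "ln (real c3) / m <= (ln (real c1) + ln (real c2)) / m" using m by (simp add: divide_right_mono)
  thus ?thesis using False c m by (simp add: log_nat_def m_def[symmetric] add_divide_distrib)
 qed
qed

context coind_product
begin

lemma faGam: "finite_action Gam VW st" unfolding finite_action_def
proof (intro conjI allI ballI VW)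
 fix n i assume "i : carrier Gam"
 hence "bij_betw (sg n (fst i)) (V n) (V n)" "bij_betw (ta n (snd i)) (W n) (W n)"
  using finite_actionD(3)[OF fa] finite_actionD(3)[OF faH] by (auto simp: DirProd_def)
 thus "bij_betw (st n i) (VW n) (VW n)" by (auto simp: prod_approx_def prod_sets_def case_prod_beta intro: bij_betw_map_prod)
qed

lemma ln2_card: "(%n. ln 2 / real (card (VW n))) \<longlonglongrightarrow> 0"
proof (rule real_tendsto_sandwich[of "%_. 0" _ _ "%n. ln 2 / real (card (W n))"])
 have "filterlim (%n. real (card (W n))) at_top sequentially"
  unfolding filterlim_at_top using sofic_card_unbounded[OF grpH so inf] by blast
 thus "(%n. ln 2 / real (card (W n))) \<longlonglongrightarrow> 0" by (intro tendsto_divide_0[OF tendsto_const] filterlim_at_top_imp_at_infinity)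
 show "EV n. ln 2 / real (card (VW n)) <= ln 2 / real (card (W n))"
 proof (rule always_eventually, rule allI)
  fix n
  have "0 < card (V n)" "0 < card (W n)" using finite_actionD(5)[OF fa] finite_actionD(5)[OF faH] by auto
  hence "real (card (W n)) <= real (card (VW n))" by (simp add: prod_sets_def card_cartesian_product)
  thus "ln 2 / real (card (VW n)) <= ln 2 / real (card (W n))"
   using \<open>0 < card (W n)\<close> by (intro divide_left_mono) auto
 qed
qed auto

text \<open>Tests may be chosen separately for the two factors. An empty set of models for one factor makes the
product entropy \<open>-\<infinity>\<close>, matching the convention for sums.\<close>

theorem entropy_product:
 assumes eq: "loc_entropy limsup Gam VW st S' e I2 = loc_entropy liminf Gam VW st S' e I2"
 shows "loc_entropy limsup Gam VW st SC dC I12 =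
  entropy_add (loc_entropy limsup Gam VW st S d I1) (loc_entropy limsup Gam VW st S' e I2)"
proof (rule antisym)
 have VWf: "!!n. finite (VW n) & VW n ~= {}" using VW by auto
 let ?A = "test_inf limsup Gam VW st S d I1" and ?B = "test_inf limsup Gam VW st S' e I2"
 let ?B' = "test_inf liminf Gam VW st S' e I2" and ?C = "test_inf limsup Gam VW st SC dC I12"
 have upper: "?C (4 * dl) <= entropy_add (?A dl) (?B dl)" if dl: "0 < dl" for dl
 proof -
  have main: "?C (4 * dl) <= limsup (rate d VW dl (Z1 F1 ep1)) + limsup (rate e VW dl (Z2 F2 ep2))
    & (limsup (rate d VW dl (Z1 F1 ep1)) < 0 | limsup (rate e VW dl (Z2 F2 ep2)) < 0 --> ?C (4 * dl) = -\<infinity>)"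
   if t: "(F1, ep1) : loc_tests D S d" "(F2, ep2) : loc_tests D S' e" for F1 ep1 F2 ep2
  proof -
   obtain F ep where F: "(F, ep) : loc_tests D SC dC"
    "ALL n. cov (4 * dl) (Z12 F ep n) (hm dC (VW n))
     <= cov dl (Z1 F1 ep1 n) (hm d (VW n)) * cov dl (Z2 F2 ep2 n) (hm e (VW n))" by (rule product_upper[OF dl t])
   have C: "?C (4 * dl) <= limsup (rate dC VW (4 * dl) (Z12 F ep))" using F(1) by (intro test_inf_le) (simp add: carrier_Gam)
   have "rate dC VW (4 * dl) (Z12 F ep) n <= rate d VW dl (Z1 F1 ep1) n + rate e VW dl (Z2 F2 ep2) n" for n
    unfolding rate_def by (rule rate_le_add[OF VW F(2)[THEN spec]])
   hence "limsup (rate dC VW (4 * dl) (Z12 F ep)) <= limsup (%n. rate d VW dl (Z1 F1 ep1) n + rate e VW dl (Z2 F2 ep2) n)"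
    by (intro Limsup_mono always_eventually allI)
   also have "... <= limsup (rate d VW dl (Z1 F1 ep1)) + limsup (rate e VW dl (Z2 F2 ep2))" by (rule ereal_limsup_add_mono)
   finally have 1: "?C (4 * dl) <= limsup (rate d VW dl (Z1 F1 ep1)) + limsup (rate e VW dl (Z2 F2 ep2))"
    using C by (rule order_trans[rotated])
   have "?C (4 * dl) = -\<infinity>" if "limsup (rate d VW dl (Z1 F1 ep1)) < 0 | limsup (rate e VW dl (Z2 F2 ep2)) < 0"
   proof -
    have "EV n. cov dl (Z1 F1 ep1 n) (hm d (VW n)) * cov dl (Z2 F2 ep2 n) (hm e (VW n)) = 0" using that
    proof
     assume "limsup (rate d VW dl (Z1 F1 ep1)) < 0"
     from limsup_rate_minf[OF VWf this] show ?thesis by (rule eventually_mono) simp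
    next
     assume "limsup (rate e VW dl (Z2 F2 ep2)) < 0"
     from limsup_rate_minf[OF VWf this] show ?thesis by (rule eventually_mono) simp
    qed
    hence "EV n. rate dC VW (4 * dl) (Z12 F ep) n <= -\<infinity>"
    proof (rule eventually_mono)
     fix n assume "cov dl (Z1 F1 ep1 n) (hm d (VW n)) * cov dl (Z2 F2 ep2 n) (hm e (VW n)) = 0"
     hence "cov (4 * dl) (Z12 F ep n) (hm dC (VW n)) = 0" using F(2)[THEN spec, of n] by linarith
     thus "rate dC VW (4 * dl) (Z12 F ep) n <= -\<infinity>" using rate_minf[of VW n dC "4 * dl" "Z12 F ep"] VW by simp
    qed
    hence "limsup (rate dC VW (4 * dl) (Z12 F ep)) <= -\<infinity>" by (rule Limsup_bounded)
    thus ?thesis using C by (simp add: order_trans)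
   qed
   thus ?thesis using 1 by blast
  qed
  have triv: "({}, 1) : loc_tests D S d" "({}, 1) : loc_tests D S' e" by (auto simp: loc_tests_def)
  show ?thesis
  proof (cases "?A dl < 0 | ?B dl < 0")
   case True
   hence "?C (4 * dl) = -\<infinity>"
   proof
    assume "?A dl < 0"
    then obtain F1 ep1 where "(F1, ep1) : loc_tests D S d" "limsup (rate d VW dl (Z1 F1 ep1)) < 0"
     by (rule test_inf_less) (auto simp: carrier_Gam)
    thus ?thesis using main[OF _ triv(2)] by blast
   next
    assume "?B dl < 0"
    then obtain F2 ep2 where "(F2, ep2) : loc_tests D S' e" "limsup (rate e VW dl (Z2 F2 ep2)) < 0"
     by (rule test_inf_less) (auto simp: carrier_Gam)
    thus ?thesis using main[OF triv(1)] by blast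
   qed
   thus ?thesis by simp
  next
   case False
   hence AB: "0 <= ?A dl" "0 <= ?B dl" by auto
   have "?C (4 * dl) <= ?A dl + ?B dl"
   proof (cases "?A dl = \<infinity> | ?B dl = \<infinity>")
    case True
    thus ?thesis by auto
   next
    case fin: False
    show ?thesis
    proof (rule ereal_le_epsilon2)
     fix ep :: real assume ep: "0 < ep"
     have "?A dl < ?A dl + ereal (ep / 2)" using fin AB ep by (cases "?A dl") auto
     then obtain F1 ep1 where 1: "(F1, ep1) : loc_tests D S d" "limsup (rate d VW dl (Z1 F1 ep1)) < ?A dl + ereal (ep / 2)"
      by (rule test_inf_less) (auto simp: carrier_Gam)
     have "?B dl < ?B dl + ereal (ep / 2)" using fin AB ep by (cases "?B dl") auto
     then obtain F2 ep2 where 2: "(F2, ep2) : loc_tests D S' e" "limsup (rate e VW dl (Z2 F2 ep2)) < ?B dl + ereal (ep / 2)"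
      by (rule test_inf_less) (auto simp: carrier_Gam)
     have "?C (4 * dl) <= limsup (rate d VW dl (Z1 F1 ep1)) + limsup (rate e VW dl (Z2 F2 ep2))"
      using main[OF 1(1) 2(1)] by blast
     also have "... <= (?A dl + ereal (ep / 2)) + (?B dl + ereal (ep / 2))" using 1(2) 2(2) by (intro add_mono) auto
     also have "... = ?A dl + ?B dl + ereal ep" using fin AB by (cases "?A dl"; cases "?B dl") auto
     finally show "?C (4 * dl) <= ?A dl + ?B dl + ereal ep" .
    qed
   qed
   thus ?thesis using AB by (auto simp: entropy_add_def)
  qed
 qed
 show "loc_entropy limsup Gam VW st SC dC I12 <=
  entropy_add (loc_entropy limsup Gam VW st S d I1) (loc_entropy limsup Gam VW st S' e I2)" unfolding loc_entropy_alt
 proof (rule SUP_least)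
  fix dl :: real assume "dl : {0<..}"
  hence dl: "0 < dl / 4" by simp
  have "?C dl <= entropy_add (?A (dl / 4)) (?B (dl / 4))" using upper[OF dl] by simp
  also have "... <= entropy_add (SUP dl\<in>{0<..}. ?A dl) (SUP dl\<in>{0<..}. ?B dl)"
   using dl by (intro entropy_add_mono SUP_upper) auto
  finally show "?C dl <= entropy_add (SUP dl\<in>{0<..}. ?A dl) (SUP dl\<in>{0<..}. ?B dl)" .
 qed
 have lower: "?A dl + ?B' dl <= ?C (dl / 2)" if dl: "0 < dl" and ninf: "?A dl ~= -\<infinity>" "?B' dl ~= -\<infinity>" for dl
 proof (rule test_inf_greatest)
  fix F ep assume "(F, ep) : loc_tests (carrier Gam) SC dC"
  hence F: "(F, ep) : loc_tests D SC dC" by (simp add: carrier_Gam)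
  obtain F1 ep1 F2 ep2 where t: "(F1, ep1) : loc_tests D S d" "(F2, ep2) : loc_tests D S' e"
   and ev: "EV n. cov dl (Z1 F1 ep1 n) (hm d (VW n)) * cov dl (Z2 F2 ep2 n) (hm e (VW n))
    <= 2 * cov (dl / 2) (Z12 F ep n) (hm dC (VW n))" by (rule product_lower[OF dl F])
  have a: "?A dl <= limsup (rate d VW dl (Z1 F1 ep1))" using t by (intro test_inf_le) (simp add: carrier_Gam)
  have b: "?B' dl <= liminf (rate e VW dl (Z2 F2 ep2))" using t by (intro test_inf_le) (simp add: carrier_Gam)
  have "EV n. rate d VW dl (Z1 F1 ep1) n + rate e VW dl (Z2 F2 ep2) n
    <= rate dC VW (dl / 2) (Z12 F ep) n + ereal (ln 2 / real (card (VW n)))"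
   using ev unfolding rate_def by (rule eventually_mono) (rule rate_add_le[OF VW])
  hence "limsup (rate d VW dl (Z1 F1 ep1)) + liminf (rate e VW dl (Z2 F2 ep2)) <= limsup (rate dC VW (dl / 2) (Z12 F ep))"
   by (rule limsup_liminf_le[OF _ ln2_card]) (use a b ninf in auto)
  thus "?A dl + ?B' dl <= limsup (rate dC VW (dl / 2) (Z12 F ep))" using add_mono[OF a b] by (rule order_trans[rotated])
 qed
 show "entropy_add (loc_entropy limsup Gam VW st S d I1) (loc_entropy limsup Gam VW st S' e I2) <=
  loc_entropy limsup Gam VW st SC dC I12" unfolding eq unfolding loc_entropy_alt
 proof (rule SUP_add_restrict)
  fix s t :: real assume st: "0 < s" "0 < t" "?A s ~= -\<infinity>" "?B' t ~= -\<infinity>"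
  define dl where "dl = min s t"
  have dl: "0 < dl" using st by (simp add: dl_def)
  have A: "?A s <= ?A dl" using st by (intro test_inf_antimono[OF tb faGam tail_mono_limsup dl]) (simp add: dl_def)
  have B: "?B' t <= ?B' dl" using st by (intro test_inf_antimono[OF tb' faGam tail_mono_liminf dl]) (simp add: dl_def)
  have "?A s + ?B' t <= ?A dl + ?B' dl" by (rule add_mono[OF A B])
  also have "... <= ?C (dl / 2)" using A B st by (intro lower[OF dl]) auto
  also have "... <= (SUP dl\<in>{0<..}. ?C dl)" using dl by (intro SUP_upper) auto
  finally show "?A s + ?B' t <= (SUP dl\<in>{0<..}. ?C dl)" .
 qed
qed

end

section \<open>Entropy of a power\<close>

definition power_dist :: "nat => ('a => 'a => real) => (nat => 'a) => (nat => 'a) => real" where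
 "power_dist k d a b = (SUM i<k. d (a i) (b i))"

lemma tbm_power:
 assumes tb: "tbm S d"
 shows "tbm ({..<k} ~> S) (power_dist k d)" unfolding tbm_def
proof (intro conjI allI impI)
 show "Metric_space ({..<k} ~> S) (power_dist k d)"
 proof
  fix a b c
  show "0 <= power_dist k d a b" by (simp add: power_dist_def sum_nonneg tbm_nonneg[OF tb])
  show "power_dist k d a b = power_dist k d b a" unfolding power_dist_def by (intro sum.cong refl tbm_sym[OF tb])
  assume a: "a : {..<k} ~> S" and b: "b : {..<k} ~> S"
  have "power_dist k d a b = 0 \<longleftrightarrow> (ALL i:{..<k}. d (a i) (b i) = 0)"
   unfolding power_dist_def by (rule sum_nonneg_eq_0_iff) (simp_all add: tbm_nonneg[OF tb])
  also have "... \<longleftrightarrow> (ALL i:{..<k}. a i = b i)"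
   using a b Metric_space.zero[OF tbm_metric[OF tb]] by (intro ball_cong refl) (auto simp: PiE_iff)
  also have "... \<longleftrightarrow> a = b" using PiE_ext[OF a b] by blast
  finally show "(power_dist k d a b = 0) = (a = b)" .
  assume c: "c : {..<k} ~> S"
  show "power_dist k d a c <= power_dist k d a b + power_dist k d b c" unfolding power_dist_def sum.distrib[symmetric]
   using a b c by (intro sum_mono tbm_tri[OF tb]) (auto simp: PiE_iff)
 qed
next
 fix r :: real assume r: "0 < r"
 hence r': "0 < r / (real k + 1)" by (simp add: add_nonneg_pos)
 obtain Q where Q: "finite Q" "Q <= {..<k} ~> S"
  "!!a. a : {..<k} ~> S ==> EX q:Q. ALL i:{..<k}. d (a i) (q i) < r / (real k + 1)"
  by (rule path_net[OF tb finite_lessThan[of k] subset_refl r']) auto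
 have "EX q:Q. power_dist k d a q < r" if a: "a : {..<k} ~> S" for a
 proof -
  obtain q where q: "q : Q" "ALL i:{..<k}. d (a i) (q i) < r / (real k + 1)" using Q(3)[OF a] by (rule bexE)
  have "power_dist k d a q <= (SUM i<k. r / (real k + 1))"
   unfolding power_dist_def using q(2) by (intro sum_mono) (simp add: less_imp_le)
  also have "... < r" using r by (simp add: divide_simps add_nonneg_pos)
  finally show ?thesis using q(1) by (intro bexI)
 qed
 thus "\<exists>K\<subseteq>{..<k} ~> S. finite K & (ALL x:{..<k} ~> S. EX y:K. power_dist k d x y < r)"
  using Q(1,2) by (intro exI[of _ Q] conjI ballI)
qed

lemma merging_power:
 "merging (%a b. b(k := a)) (%c. c k) (%c. restrict c {..<k}) S d ({..<k} ~> S) (power_dist k d)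
   ({..<Suc k} ~> S) (power_dist (Suc k) d)" unfolding merging_def
proof (intro conjI ballI)
 fix a b assume a: "a : S" and b: "b : {..<k} ~> S"
 show "b(k := a) : {..<Suc k} ~> S" unfolding lessThan_Suc by (rule PiE_fun_upd[OF a b])
 show "(b(k := a)) k = a" by simp
 show "restrict (b(k := a)) {..<k} = b" using PiE_restrict[OF b] by (simp add: restrict_upd)
next
 fix c assume c: "c : {..<Suc k} ~> S"
 show "c k : S" using PiE_mem[OF c, of k] by simp
 show "restrict c {..<k} : {..<k} ~> S" by (intro restrict_PiE_iff[THEN iffD2] ballI PiE_mem[OF c]) simp
 show "(restrict c {..<k})(k := c k) = c"
 proof
  fix i
  consider "i = k" | "i < k" | "~ i < Suc k" by linarith
  thus "((restrict c {..<k})(k := c k)) i = c i" using PiE_arb[OF c, of i] by cases auto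
 qed
 fix c'
 show "power_dist (Suc k) d c c' = d (c k) (c' k) + power_dist k d (restrict c {..<k}) (restrict c' {..<k})"
  by (simp add: power_dist_def)
qed

lemma rate_le_power:
 assumes V: "finite V'" "V' ~= {}" and le: "c' <= c ^ k" and k: "1 <= k"
 shows "log_nat c' / ereal (real (card V')) <= ereal (real k) * (log_nat c / ereal (real (card V')))"
proof -
 define m where "m = real (card V')"
 have m: "0 < m" using V by (simp add: m_def card_gt_0_iff)
 show ?thesis
 proof (cases "c' = 0")
  case True
  thus ?thesis using m by (auto simp: log_nat_def m_def[symmetric])
 next
  case False
  hence c: "0 < c" using le k by (cases "c = 0") (auto simp: power_0_left split: if_splits)
  have "ln (real c') <= ln (real c ^ k)" using False c le by (subst ln_le_cancel_iff) (auto simp flip: of_nat_power)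
  also have "... = real k * ln (real c)" using c by (simp add: ln_realpow)
  finally have "ln (real c') / m <= real k * (ln (real c) / m)" using m by (simp add: divide_right_mono)
  thus ?thesis using False c m by (simp add: log_nat_def m_def[symmetric])
 qed
qed

lemma power_le_rate:
 assumes V: "finite V'" "V' ~= {}" and le: "c ^ k <= 2 ^ k * c'" and k: "1 <= k"
 shows "ereal (real k) * (log_nat c / ereal (real (card V')))
   <= log_nat c' / ereal (real (card V')) + ereal (real k * (ln 2 / real (card V')))"
proof -
 define m where "m = real (card V')"
 have m: "0 < m" using V by (simp add: m_def card_gt_0_iff)
 show ?thesis
 proof (cases "c = 0")
  case True
  thus ?thesis using m k by (auto simp: log_nat_def m_def[symmetric])
 next
  case False
  hence c': "0 < c'" using le by (cases "c' = 0") auto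
  have "real (c ^ k) <= real (2 ^ k * c')" using le by (rule of_nat_mono)
  hence "ln (real c ^ k) <= ln (2 ^ k * real c')" using False c' by (subst ln_le_cancel_iff) auto
  hence "real k * ln (real c) <= real k * ln 2 + ln (real c')" using False c' by (simp add: ln_realpow ln_mult)
  hence "real k * ln (real c) / m <= (real k * ln 2 + ln (real c')) / m" using m by (simp add: divide_right_mono)
  thus ?thesis using False c' m by (simp add: log_nat_def m_def[symmetric] add_divide_distrib)
 qed
qed

definition power_path ::
  "('g, 'm) monoid_scheme => ('h, 'n) monoid_scheme => ('g => 'x => 'x) => ('x => 'a) => nat =>
    (nat => 'h => 'x) => 'g \<times> 'h => nat => 'a" where
 "power_path G H T af k x = (\<lambda>p\<in>carrier G \<times> carrier H. \<lambda>i\<in>{..<k}. coind_path G H T af (x i) p)"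

locale coind_power =
 fixes G :: "('g, 'm) monoid_scheme" and H :: "('h, 'n) monoid_scheme"
  and M :: "'x measure" and T :: "'g => 'x => 'x" and af :: "'x => 'a" and S :: "'a set" and d
  and V :: "nat => 'v set" and W :: "nat => 'w set" and sg :: "nat => 'g => 'v => 'v"
  and ta :: "nat => 'h => 'w => 'w"
 assumes grpG: "group G" and grpH: "group H" and pm: "pmp G M T" and tb: "tbm S d"
  and obs: "observable M S d af" and inf: "infinite (carrier H)" and fa: "finite_action G V sg"
  and so: "sofic_approximation H W ta"
begin

abbreviation "D \<equiv> carrier G \<times> carrier H"
abbreviation "MH \<equiv> coind_measure H M"
abbreviation "cp \<equiv> coind_path G H T af"
abbreviation "pp \<equiv> power_path G H T af"
abbreviation "Gam \<equiv> G \<times>\<times> H"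
abbreviation "VW \<equiv> prod_sets V W"
abbreviation "st \<equiv> prod_approx sg ta"
abbreviation "Sk k \<equiv> {..<k} ~> S"
abbreviation "I1 \<equiv> (%f. \<integral>y. f (cp y) \<partial>MH)"
abbreviation "Ik k \<equiv> (%f. \<integral>x. f (pp k x) \<partial>power_measure MH k)"
abbreviation "Z1 F ep n \<equiv> loc_models Gam (st n) (VW n) S I1 F ep"
abbreviation "Zk k F ep n \<equiv> loc_models Gam (st n) (VW n) (Sk k) (Ik k) F ep"
abbreviation "cov1 dl F ep n \<equiv> cov dl (Z1 F ep n) (hm d (VW n))"
abbreviation "covk k dl F ep n \<equiv> cov dl (Zk k F ep n) (hm (power_dist k d) (VW n))"

lemma merge_power: "coind_merge G H M T af S d (Sk k) (power_dist k d) (Sk (Suc k)) (power_dist (Suc k) d)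
  (%a b. b(k := a)) (%c. c k) (%c. restrict c {..<k})"
 by (intro coind_merge.intro grpG grpH pm tb obs tbm_power merging_power)

lemma prob_MH: "prob_space MH" unfolding coind_measure_def by (rule prob_space_PiM) (rule pmpD(1)[OF pm])

lemma prob_power: "prob_space (power_measure MH k)" unfolding power_measure_def by (rule prob_space_PiM) (rule prob_MH)

lemma path_map_cp: "path_map MH D S d cp" by (rule coind_merge.path_map_cp[OF merge_power])

lemma path_map_pp: "path_map (power_measure MH k) D (Sk k) (power_dist k d) (pp k)" unfolding path_map_def
proof (intro conjI ballI)
 fix x assume "x : space (power_measure MH k)"
 hence "cp (x i) : D ~> S" if "i < k" for i
  using that path_map_cp by (auto simp: path_map_def power_measure_def space_PiM PiE_iff)
 thus "pp k x : D ~> Sk k" unfolding power_path_def by (intro restrict_PiE_iff[THEN iffD2] ballI) (auto simp: PiE_iff)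
next
 fix p c assume p: "p : D" and c: "c : Sk k"
 have "(%x. d (cp (x i) p) (c i)) : borel_measurable (power_measure MH k)" if i: "i < k" for i
 proof -
  have "(%y. d (cp y p) (c i)) : borel_measurable MH" using path_map_cp p c i by (auto simp: path_map_def PiE_iff)
  thus ?thesis unfolding power_measure_def using i by (intro measurable_PiM_component_rev) auto
 qed
 hence "(%x. SUM i<k. d (cp (x i) p) (c i)) : borel_measurable (power_measure MH k)" by (intro borel_measurable_sum) auto
 thus "(%x. power_dist k d (pp k x p) c) : borel_measurable (power_measure MH k)"
  using p by (simp add: power_dist_def power_path_def)
qed

lemma Ik_Suc:
 assumes f: "f : loc D (Sk (Suc k)) (power_dist (Suc k) d)"
 shows "Ik (Suc k) f = (\<integral>x. (\<integral>y. f (merge_path D (%a b. b(k := a)) (cp y) (pp k x)) \<partial>MH) \<partial>power_measure MH k)"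
proof -
 interpret MH: prob_space MH by (rule prob_MH)
 interpret P: product_sigma_finite "%_ :: nat. MH" by unfold_locales
 have "integrable (Pi\<^sub>M (insert k {..<k}) (%_. MH)) (%x. f (pp (Suc k) x))"
  using path_map_loc_integrable[OF prob_power tbm_power[OF tb] path_map_pp f] by (simp add: power_measure_def lessThan_Suc)
 from P.product_integral_insert[OF _ _ this]
 have "Ik (Suc k) f = (\<integral>x. (\<integral>y. f (pp (Suc k) (x(k := y))) \<partial>MH) \<partial>power_measure MH k)"
  by (simp add: power_measure_def lessThan_Suc)
 moreover have "pp (Suc k) (x(k := y)) = merge_path D (%a b. b(k := a)) (cp y) (pp k x)" for x y
  by (auto simp: power_path_def merge_path_def fun_eq_iff less_Suc_eq)
 ultimately show ?thesis by simp
qed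

lemma product_power: "coind_product G H M T af S d (Sk k) (power_dist k d) (Sk (Suc k)) (power_dist (Suc k) d)
  (%a b. b(k := a)) (%c. c k) (%c. restrict c {..<k}) V W sg ta (Ik k) (Ik (Suc k))"
proof (intro coind_product.intro merge_power coind_product_axioms.intro inf fa so)
 interpret MH: prob_space MH by (rule prob_MH)
 interpret P: product_prob_space "%_ :: nat. MH" "{..<Suc k}" by unfold_locales
 show "Ik (Suc k) f = Ik k (coind_merge.Th G H M T af (%a b. b(k := a)) f)"
  if f: "f : loc D (Sk (Suc k)) (power_dist (Suc k) d)" for f unfolding Ik_Suc[OF f] coind_merge.Th_def[OF merge_power] ..
 show "Ik (Suc k) (%c. f (\<lambda>i\<in>D. c i k)) = I1 f" if f: "f : loc D S d" for f
 proof -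
  have "(\<lambda>i\<in>D. pp (Suc k) x i k) = cp (x k)" for x by (auto simp: power_path_def coind_path_def fun_eq_iff)
  hence "Ik (Suc k) (%c. f (\<lambda>i\<in>D. c i k)) = (\<integral>x. f (cp (x k)) \<partial>Pi\<^sub>M {..<Suc k} (%_. MH))"
   by (simp add: power_measure_def)
  also have "... = (\<integral>y. f (cp y) \<partial>distr (Pi\<^sub>M {..<Suc k} (%_. MH)) MH (%x. x k))"
   by (intro integral_distr[symmetric] path_map_loc_measurable[OF tb path_map_cp f] measurable_component_singleton) simp
  also have "distr (Pi\<^sub>M {..<Suc k} (%_. MH)) MH (%x. x k) = MH" by (rule P.PiM_component) simp
  finally show ?thesis .
 qed
 show "Ik (Suc k) (%c. f (\<lambda>i\<in>D. restrict (c i) {..<k})) = Ik k f" if f: "f : loc D (Sk k) (power_dist k d)" for f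
 proof -
  have "(%c. f (\<lambda>i\<in>D. restrict (c i) {..<k})) : loc D (Sk (Suc k)) (power_dist (Suc k) d)"
  proof (rule loc_compose[OF f])
   fix p q assume p: "p : Sk (Suc k)"
   show "restrict p {..<k} : Sk k" by (intro restrict_PiE_iff[THEN iffD2] ballI PiE_mem[OF p]) simp
   show "power_dist k d (restrict p {..<k}) (restrict q {..<k}) <= power_dist (Suc k) d p q"
    using tbm_nonneg[OF tb, of "p k" "q k"] by (simp add: power_dist_def)
  qed
  from Ik_Suc[OF this]
  have "Ik (Suc k) (%c. f (\<lambda>i\<in>D. restrict (c i) {..<k})) =
   (\<integral>x. (\<integral>y. f (\<lambda>i\<in>D. restrict (merge_path D (%a b. b(k := a)) (cp y) (pp k x) i) {..<k}) \<partial>MH) \<partial>power_measure MH k)" .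
  moreover have "(\<lambda>i\<in>D. restrict (merge_path D (%a b. b(k := a)) (cp y) (pp k x) i) {..<k}) = pp k x" for x y
   by (auto simp: power_path_def merge_path_def fun_eq_iff)
  ultimately show ?thesis by (simp add: MH.prob_space)
 qed
qed

lemma VW: "finite (VW n)" "VW n ~= {}" using coind_product.VW[OF product_power] by auto

lemma faGam: "finite_action Gam VW st" by (rule coind_product.faGam[OF product_power])

lemma cov_empty_power:
 assumes "0 < dl" shows "covk 0 dl F ep n <= 1" and "0 < ep ==> 1 <= covk 0 dl F ep n"
proof -
 interpret P: prob_space "power_measure MH 0" by (rule prob_power)
 define c where "c = (\<lambda>v\<in>VW n. (%_. undefined) :: nat => 'a)"
 have sub: "Zk 0 F ep n <= {c}" by (auto simp: loc_models_def c_def PiE_iff extensional_def fun_eq_iff)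
 have fin: "finite (Zk 0 F ep n)" using sub by (rule finite_subset) simp
 have zero: "hm (power_dist 0 d) (VW n) z z = 0" for z by (simp add: hamming_metric_def power_dist_def)
 have "covk 0 dl F ep n <= card (Zk 0 F ep n)"
 proof (rule cov_le_card[OF subset_refl fin], rule ballI)
  fix z assume z: "z : Zk 0 F ep n"
  show "EX y:Zk 0 F ep n. hm (power_dist 0 d) (VW n) z y < dl" by (rule bexI[OF _ z]) (simp only: zero assms)
 qed
 also have "... <= card {c}" using sub by (intro card_mono) auto
 finally show "covk 0 dl F ep n <= 1" by simp
 assume ep: "0 < ep"
 have cZ: "c : Zk 0 F ep n"
 proof -
  have "pullback_name Gam (st n) c v = pp 0 x" if "v : VW n" for v x
  proof -
   have "st n g v : VW n" if "g : carrier Gam" for g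
    using finite_actionD(4)[OF faGam that, of n] \<open>v : VW n\<close> by blast
   thus ?thesis by (auto simp: pullback_name_def power_path_def c_def fun_eq_iff DirProd_def)
  qed
  note pb = this
  have avg: "emp_avg Gam (st n) (VW n) c f = f (pp 0 x)" for f x
  proof -
   have "(SUM v:VW n. f (pullback_name Gam (st n) c v)) = (SUM v:VW n. f (pp 0 x))"
    by (intro sum.cong refl arg_cong[where f = f] pb)
   thus ?thesis using VW[of n] by (simp add: emp_avg_def card_gt_0_iff)
  qed
  have eq: "emp_avg Gam (st n) (VW n) c f = Ik 0 f" for f
  proof -
   have "Ik 0 f = (\<integral>x. emp_avg Gam (st n) (VW n) c f \<partial>power_measure MH 0)"
    by (intro Bochner_Integration.integral_cong refl avg[symmetric])
   thus ?thesis by (simp add: P.prob_space)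
  qed
  have cV: "c : VW n ~> Sk 0"
   unfolding c_def restrict_PiE_iff by (rule ballI, rule PiE_I) (simp_all only: lessThan_0 empty_iff)
  show ?thesis unfolding loc_models_def by (intro CollectI conjI ballI cV) (simp only: eq diff_self abs_zero ep)
 qed
 have ZV: "Zk 0 F ep n <= VW n ~> Sk 0" unfolding loc_models_def by blast
 obtain Q where Q: "Q <= Zk 0 F ep n" "finite Q" "card Q = covk 0 dl F ep n"
  "ALL z:Zk 0 F ep n. EX y:Q. hm (power_dist 0 d) (VW n) z y < dl" by (rule cov_attained[OF tbm_power[OF tb] VW assms ZV])
 obtain y where "y : Q" using bspec[OF Q(4) cZ] by (rule bexE)
 hence "0 < card Q" using Q(2) by (intro card_gt_0_iff[THEN iffD2] conjI) blast+
 thus "1 <= covk 0 dl F ep n" unfolding Q(3) by linarith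
qed

lemma power_upper:
 assumes dl: "0 < dl" and F1: "(F1, ep1) : loc_tests D S d"
 shows "EX F ep. (F, ep) : loc_tests D (Sk k) (power_dist k d) & (ALL n. covk k (4 ^ k * dl) F ep n <= cov1 dl F1 ep1 n ^ k)"
proof (induction k)
 case 0
 show ?case using cov_empty_power(1)[OF dl] by (intro exI[of _ "{}"] exI[of _ 1]) (auto simp: loc_tests_def)
next
 case (Suc k)
 then obtain F2 ep2 where F2: "(F2, ep2) : loc_tests D (Sk k) (power_dist k d)"
  and le: "ALL n. covk k (4 ^ k * dl) F2 ep2 n <= cov1 dl F1 ep1 n ^ k" by (elim exE conjE)
 have dlk: "0 < 4 ^ k * dl" using dl by simp
 obtain F ep where F: "(F, ep) : loc_tests D (Sk (Suc k)) (power_dist (Suc k) d)"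
  "ALL n. covk (Suc k) (4 * (4 ^ k * dl)) F ep n <= cov1 (4 ^ k * dl) F1 ep1 n * covk k (4 ^ k * dl) F2 ep2 n"
  by (rule coind_product.product_upper[OF product_power dlk F1 F2])
 have "covk (Suc k) (4 ^ Suc k * dl) F ep n <= cov1 dl F1 ep1 n ^ Suc k" for n
 proof -
  have "dl <= 4 ^ k * dl" using dl by (simp add: mult_le_cancel_right1)
  hence "cov1 (4 ^ k * dl) F1 ep1 n <= cov1 dl F1 ep1 n" by (intro cov_antimono[OF tb VW dl]) (auto simp: loc_models_def)
  from mult_mono[OF this le[THEN spec, of n]] show ?thesis using F(2)[THEN spec, of n] by (simp add: mult.assoc)
 qed
 with F(1) show ?case by (intro exI[of _ F] exI[of _ ep] conjI allI)
qed

text \<open>Radii grow by a factor 4 in each step: 2 is lost in the separation of a product and 2 in passing to a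
common refinement of two tests.\<close>

lemma power_lower:
 assumes "0 < dl" and "(F, ep) : loc_tests D (Sk k) (power_dist k d)"
 shows "EX F1 ep1. (F1, ep1) : loc_tests D S d &
   (EV n. cov1 (4 ^ k * dl) F1 ep1 n ^ k <= 2 ^ k * covk k dl F ep n)" using assms
proof (induction k arbitrary: dl F ep)
 case 0
 hence "1 <= covk 0 dl F ep n" for n by (intro cov_empty_power(2)) (auto simp: loc_tests_def)
 thus ?case by (intro exI[of _ "{}"] exI[of _ 1]) (auto simp: loc_tests_def)
next
 case (Suc k)
 have dl2: "0 < 2 * dl" using Suc.prems by simp
 obtain F1 ep1 F2 ep2 where t: "(F1, ep1) : loc_tests D S d" "(F2, ep2) : loc_tests D (Sk k) (power_dist k d)"
  and ev: "EV n. cov1 (2 * dl) F1 ep1 n * covk k (2 * dl) F2 ep2 n <= 2 * covk (Suc k) (2 * dl / 2) F ep n"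
  by (rule coind_product.product_lower[OF product_power dl2 Suc.prems(2)])
 obtain F1' ep1' where t': "(F1', ep1') : loc_tests D S d"
  and ev': "EV n. cov1 (4 ^ k * (2 * dl)) F1' ep1' n ^ k <= 2 ^ k * covk k (2 * dl) F2 ep2 n"
  using Suc.IH[OF dl2 t(2)] by (elim exE conjE)
 define U where "U = F1 Un F1'"
 define et where "et = min ep1 ep1'"
 have tU: "(U, et) : loc_tests D S d" using t t' by (auto simp: loc_tests_def U_def et_def)
 have sub: "Z1 U et n <= Z1 F1 ep1 n" "Z1 U et n <= Z1 F1' ep1' n" for n by (auto simp: loc_models_def U_def et_def)
 have pos: "0 < 4 ^ k * (2 * dl)" "2 * dl <= 4 ^ k * (2 * dl)" using Suc.prems by (auto simp: mult_le_cancel_right1)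
 have Z: "Z1 F' ep' n <= VW n ~> S" for F' ep' n by (auto simp: loc_models_def)
 have c4: "4 ^ Suc k * dl = 2 * (4 ^ k * (2 * dl))" by simp
 have c1: "cov1 (4 ^ Suc k * dl) U et n <= cov1 (2 * dl) F1 ep1 n" for n
  unfolding c4 by (rule order_trans[OF cov_subset[OF tb VW pos(1) sub(1) Z] cov_antimono[OF tb VW dl2 pos(2) Z]])
 have c2: "cov1 (4 ^ Suc k * dl) U et n <= cov1 (4 ^ k * (2 * dl)) F1' ep1' n" for n
  unfolding c4 by (rule cov_subset[OF tb VW pos(1) sub(2) Z])
 have "EV n. cov1 (4 ^ Suc k * dl) U et n ^ Suc k <= 2 ^ Suc k * covk (Suc k) dl F ep n" using ev ev'
 proof eventually_elim
  case (elim n)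
  have "cov1 (4 ^ Suc k * dl) U et n ^ Suc k <= cov1 (2 * dl) F1 ep1 n * cov1 (4 ^ k * (2 * dl)) F1' ep1' n ^ k"
   unfolding power_Suc[of "cov1 (4 ^ Suc k * dl) U et n"] by (intro mult_mono power_mono c1 c2) auto
  also have "... <= cov1 (2 * dl) F1 ep1 n * (2 ^ k * covk k (2 * dl) F2 ep2 n)" by (rule mult_left_mono[OF elim(2)]) simp
  also have "... = 2 ^ k * (cov1 (2 * dl) F1 ep1 n * covk k (2 * dl) F2 ep2 n)" by (simp only: ac_simps)
  also have "... <= 2 ^ k * (2 * covk (Suc k) (2 * dl / 2) F ep n)" by (rule mult_left_mono[OF elim(1)]) simp
  finally show ?case by simp
 qed
 with tU show ?case by (intro exI[of _ U] exI[of _ et] conjI)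
qed

theorem entropy_power:
 assumes k: "1 <= k"
 shows "loc_entropy limsup Gam VW st (Sk k) (power_dist k d) (Ik k) =
  ereal (real k) * loc_entropy limsup Gam VW st S d I1"
proof (rule antisym)
 let ?A = "test_inf limsup Gam VW st S d I1" and ?C = "test_inf limsup Gam VW st (Sk k) (power_dist k d) (Ik k)"
 have kp: "0 < ereal (real k)" "ereal (real k) ~= \<infinity>" using k by auto
 have cG: "carrier Gam = D" by (simp add: DirProd_def)
 have upper: "?C (4 ^ k * dl) <= ereal (real k) * ?A dl" if dl: "0 < dl" for dl
  unfolding ereal_divide_le_pos[OF kp, symmetric]
 proof (rule test_inf_greatest)
  fix F1 ep1 assume "(F1, ep1) : loc_tests (carrier Gam) S d"
  hence t: "(F1, ep1) : loc_tests D S d" by (simp add: cG)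
  obtain F ep where F: "(F, ep) : loc_tests D (Sk k) (power_dist k d)"
   "ALL n. covk k (4 ^ k * dl) F ep n <= cov1 dl F1 ep1 n ^ k" using power_upper[OF dl t, of k] by (elim exE conjE)
  have "?C (4 ^ k * dl) <= limsup (rate (power_dist k d) VW (4 ^ k * dl) (Zk k F ep))"
   using F(1) by (intro test_inf_le) (simp add: cG)
  also have "... <= limsup (%n. ereal (real k) * rate d VW dl (Z1 F1 ep1) n)"
   unfolding rate_def by (intro Limsup_mono always_eventually allI rate_le_power VW k F(2)[THEN spec])
  also have "... = ereal (real k) * limsup (rate d VW dl (Z1 F1 ep1))" by (rule Limsup_ereal_mult_left) auto
  finally show "?C (4 ^ k * dl) / ereal (real k) <= limsup (rate d VW dl (Z1 F1 ep1))" unfolding ereal_divide_le_pos[OF kp] .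
 qed
 show "loc_entropy limsup Gam VW st (Sk k) (power_dist k d) (Ik k) <= ereal (real k) * loc_entropy limsup Gam VW st S d I1"
  unfolding loc_entropy_alt
 proof (rule SUP_least)
  fix dl :: real assume "dl : {0<..}"
  hence dl: "0 < dl / 4 ^ k" by simp
  have "?C dl <= ereal (real k) * ?A (dl / 4 ^ k)" using upper[OF dl] by simp
  also have "... <= ereal (real k) * (SUP dl\<in>{0<..}. ?A dl)" using dl by (intro ereal_mult_left_mono SUP_upper) auto
  finally show "?C dl <= ereal (real k) * (SUP dl\<in>{0<..}. ?A dl)" .
 qed
 have lower: "ereal (real k) * ?A (4 ^ k * dl) <= ?C dl" if dl: "0 < dl" for dl
 proof (rule test_inf_greatest)
  fix F ep assume "(F, ep) : loc_tests (carrier Gam) (Sk k) (power_dist k d)"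
  hence F: "(F, ep) : loc_tests D (Sk k) (power_dist k d)" by (simp add: cG)
  obtain F1 ep1 where t: "(F1, ep1) : loc_tests D S d"
   and ev: "EV n. cov1 (4 ^ k * dl) F1 ep1 n ^ k <= 2 ^ k * covk k dl F ep n" using power_lower[OF dl F] by (elim exE conjE)
  let ?z = "%n. real k * (ln 2 / real (card (VW n)))"
  have "?A (4 ^ k * dl) <= limsup (rate d VW (4 ^ k * dl) (Z1 F1 ep1))" using t by (intro test_inf_le) (simp add: cG)
  hence "ereal (real k) * ?A (4 ^ k * dl) <= ereal (real k) * limsup (rate d VW (4 ^ k * dl) (Z1 F1 ep1))"
   by (intro ereal_mult_left_mono) auto
  also have "... = limsup (%n. ereal (real k) * rate d VW (4 ^ k * dl) (Z1 F1 ep1) n)"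
   by (rule Limsup_ereal_mult_left[symmetric]) auto
  also have "... <= limsup (%n. rate (power_dist k d) VW dl (Zk k F ep) n + ereal (?z n))"
   unfolding rate_def using ev by (intro Limsup_mono) (rule eventually_mono, assumption, rule power_le_rate[OF VW _ k])
  also have "... <= limsup (rate (power_dist k d) VW dl (Zk k F ep)) + limsup (%n. ereal (?z n))"
   by (rule ereal_limsup_add_mono)
  also have "limsup (%n. ereal (?z n)) = 0"
  proof (rule lim_imp_Limsup)
   have "?z \<longlonglongrightarrow> real k * 0" by (intro tendsto_mult_left coind_product.ln2_card[OF product_power])
   thus "(%n. ereal (?z n)) \<longlonglongrightarrow> 0" unfolding zero_ereal_def by (intro tendsto_ereal) simp
  qed simp
  finally show "ereal (real k) * ?A (4 ^ k * dl) <= limsup (rate (power_dist k d) VW dl (Zk k F ep))" by simp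
 qed
 have "loc_entropy limsup Gam VW st S d I1 <= loc_entropy limsup Gam VW st (Sk k) (power_dist k d) (Ik k) / ereal (real k)"
  unfolding loc_entropy_alt
 proof (rule SUP_least)
  fix dl :: real assume "dl : {0<..}"
  hence dl: "0 < dl / 4 ^ k" by simp
  have "ereal (real k) * ?A dl <= ?C (dl / 4 ^ k)" using lower[OF dl] by simp
  also have "... <= (SUP dl\<in>{0<..}. ?C dl)" using dl by (intro SUP_upper) auto
  finally show "?A dl <= (SUP dl\<in>{0<..}. ?C dl) / ereal (real k)" by (simp only: ereal_le_divide_pos[OF kp])
 qed
 thus "ereal (real k) * loc_entropy limsup Gam VW st S d I1 <= loc_entropy limsup Gam VW st (Sk k) (power_dist k d) (Ik k)"
  by (simp only: ereal_le_divide_pos[OF kp])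
qed

end

section \<open>Countable bases of standard spaces\<close>

definition topology_base :: "'x topology => 'x set set => bool" where
 "topology_base X \<B> \<longleftrightarrow> (ALL V:\<B>. openin X V) &
   (ALL U x. openin X U & x : U --> (EX V:\<B>. x : V & V <= U))"

lemma topology_base_Union: "topology_base X \<B> ==> openin X U ==> U = \<Union>{V : \<B>. V <= U}"
 unfolding topology_base_def by blast

lemma topology_base_cover:
 assumes base: "topology_base Z \<A>"
 shows "topspace Z <= \<Union>\<A>"
proof
  fix x assume "x : topspace Z"
  hence "EX V:\<A>. x : V & V <= topspace Z"
   using base[unfolded topology_base_def, THEN conjunct2, rule_format, of "topspace Z" x] by simp
  thus "x : \<Union>\<A>" by blast
qed

lemma sigma_sets_open_base:
 assumes "topology_base X \<B>" "countable \<B>"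
 shows "sigma_sets (topspace X) {U. openin X U} = sigma_sets (topspace X) \<B>"
proof (rule sigma_sets_eqI)
 fix U assume "U : {U. openin X U}"
 hence U: "U = \<Union>{V : \<B>. V <= U}" using topology_base_Union[OF assms(1)] by simp
 have "countable {V : \<B>. V <= U}" using assms(2) by (rule countable_subset[rotated]) blast
 hence "\<Union>{V : \<B>. V <= U} : sigma_sets (topspace X) \<B>" by (rule sigma_sets_UNION) auto
 thus "U : sigma_sets (topspace X) \<B>" using U by simp
next
 fix V assume "V : \<B>"
 thus "V : sigma_sets (topspace X) {U. openin X U}" using assms(1) by (auto simp: topology_base_def)
qed

lemma generator_into_space:
 assumes "sets M = sigma_sets (space M) \<B>" shows "\<B> <= Pow (space M)"
proof
 fix V assume "V : \<B>"
 hence "V : sets M" unfolding assms by (rule sigma_sets.Basic)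
 thus "V : Pow (space M)" using sets.sets_into_space by blast
qed

text \<open>A countable base describes the Borel sets and separability together, and it passes to countable products.\<close>

lemma standard_space_base:
 "standard_space M \<longleftrightarrow> (EX X \<B>. topspace X = space M & completely_metrizable_space X &
   countable \<B> & topology_base X \<B> & sets M = sigma_sets (space M) \<B>)"
proof
 assume "standard_space M"
 then obtain X where X: "topspace X = space M" "completely_metrizable_space X" "separable_space X"
  "sets M = sigma_sets (space M) {U. openin X U}" unfolding standard_space_def by (elim exE conjE)
 obtain M' d where d: "Metric_space M' d" "X = Metric_space.mtopology M' d"
  using X(2) unfolding completely_metrizable_space_def by blast
 interpret Metric_space M' d by (rule d(1))
 obtain C where C: "countable C" "C <= topspace X" "X closure_of C = topspace X"
  using X(3) unfolding separable_space_def by blast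
 define \<B> where "\<B> = (%(c, n). mball c (1 / (real n + 1))) ` (C \<times> (UNIV :: nat set))"
 have B: "topology_base X \<B>" unfolding topology_base_def
 proof (intro conjI ballI allI impI)
  show "openin X V" if "V : \<B>" for V using that by (auto simp: \<B>_def d(2))
  fix U x assume U: "openin X U & x : U"
  then obtain r where r: "0 < r" "mball x r <= U" and x: "x : M'" unfolding d(2) openin_mtopology by blast
  obtain n where n: "1 / (real n + 1) < r / 2"
   using reals_Archimedean[of "r / 2"] r(1) by (auto simp: inverse_eq_divide add.commute)
  have "x : mtopology closure_of C" using C(3) x by (simp add: d(2))
  moreover have "0 < 1 / (real n + 1)" by (simp add: add_nonneg_pos)
  ultimately obtain c where c: "c : C" "c : mball x (1 / (real n + 1))" unfolding metric_closure_of by blast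
  have "mball c (1 / (real n + 1)) <= mball x r"
  proof
   fix y assume y: "y : mball c (1 / (real n + 1))"
   hence "d x y <= d x c + d c y" using c x by (intro triangle) auto
   thus "y : mball x r" using y c n x by auto
  qed
  moreover have "x : mball c (1 / (real n + 1))" using c commute by auto
  ultimately show "EX V:\<B>. x : V & V <= U"
   using r c(1) by (intro bexI[of _ "mball c (1 / (real n + 1))"]) (auto simp: \<B>_def)
 qed
 have "countable \<B>" using C(1) by (simp add: \<B>_def)
 thus "EX X \<B>. topspace X = space M & completely_metrizable_space X &
   countable \<B> & topology_base X \<B> & sets M = sigma_sets (space M) \<B>"
  using X B sigma_sets_open_base[OF B] by (intro exI[of _ X] exI[of _ \<B>]) simp
next
 assume "EX X \<B>. topspace X = space M & completely_metrizable_space X &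
   countable \<B> & topology_base X \<B> & sets M = sigma_sets (space M) \<B>"
 then obtain X \<B> where X: "topspace X = space M" "completely_metrizable_space X"
   "countable \<B>" "topology_base X \<B>" "sets M = sigma_sets (space M) \<B>" by (elim exE conjE)
 have "second_countable X" unfolding second_countable_def using X(3,4) by (auto simp: topology_base_def)
 hence "separable_space X" by (rule second_countable_imp_separable_space)
 thus "standard_space M" unfolding standard_space_def using X sigma_sets_open_base[OF X(4,3)] by (intro exI[of _ X]) simp
qed

lemma sets_PiM_base:
 assumes I: "countable I" "I ~= {}" and X: "topspace X = space M" and \<B>: "countable \<B>" "topology_base X \<B>"
  and M: "sets M = sigma_sets (space M) \<B>"
 defines "\<C> \<equiv> (%(F, f). PiE I (%i. if i : F then f i else space M)) ` (SIGMA F:{F. finite F & F <= I}. F ~> \<B>)"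
 shows "countable \<C>" "topology_base (product_topology (%_. X) I) \<C>"
  "sets (PiM I (%_. M)) = sigma_sets (space (PiM I (%_. M))) \<C>"
proof -
 have Bs: "V : sets M" if "V : \<B>" for V unfolding M using that by blast
 have XM: "openin X (space M)" using openin_topspace[of X] by (simp add: X)
 show "countable \<C>" unfolding \<C>_def
  by (intro countable_image countable_SIGMA countable_Collect_finite_subset I countable_PiE \<B>) auto
 show "topology_base (product_topology (%_. X) I) \<C>" unfolding topology_base_def
 proof (intro conjI ballI allI impI)
  fix V assume "V : \<C>"
  then obtain F f where Ff: "finite F" "F <= I" "f : F ~> \<B>" "V = PiE I (%i. if i : F then f i else space M)"
   unfolding \<C>_def by auto
  have "openin X (if i : F then f i else space M)" for i using Ff(3) \<B>(2) XM by (auto simp: topology_base_def PiE_iff)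
  moreover have "finite {i : I. (if i : F then f i else space M) ~= topspace X}"
   by (rule finite_subset[OF _ Ff(1)]) (auto simp: X)
  ultimately show "openin (product_topology (%_. X) I) V" unfolding Ff(4) by (subst openin_PiE_gen) auto
 next
  fix U x assume U: "openin (product_topology (%_. X) I) U & x : U"
  then obtain O' where O': "finite {i : I. O' i ~= topspace X}" "ALL i:I. openin X (O' i)" "x : PiE I O'" "PiE I O' <= U"
   unfolding openin_product_topology_alt by blast
  define F where "F = {i : I. O' i ~= topspace X}"
  have "ALL i:F. EX V. V : \<B> & x i : V & V <= O' i"
  proof
   fix i assume "i : F"
   hence i: "i : I" by (simp add: F_def)
   have "openin X (O' i) & x i : O' i" using O'(2,3) i by (auto simp: PiE_iff)
   thus "EX V. V : \<B> & x i : V & V <= O' i" using \<B>(2) unfolding topology_base_def by blast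
  qed
  then obtain f where f: "ALL i:F. f i : \<B> & x i : f i & f i <= O' i" by (rule bchoice[THEN exE])
  let ?V = "PiE I (%i. if i : F then restrict f F i else space M)"
  have FI: "finite F" "F <= I" using O'(1) by (auto simp: F_def)
  have fB: "restrict f F : F ~> \<B>" using f by (intro restrict_PiE_iff[THEN iffD2]) blast
  have "?V : \<C>" unfolding \<C>_def by (rule image_eqI[of _ _ "(F, restrict f F)"]) (use FI fB in simp_all)
  moreover have "x : ?V"
  proof -
   have "x i : (if i : F then restrict f F i else space M)" if i: "i : I" for i
   proof (cases "i : F")
    case True thus ?thesis using f by simp
   next
    case False
    hence "O' i = space M" using i by (simp add: F_def X)
    thus ?thesis using PiE_mem[OF O'(3) i] False by simp
   qed
   thus ?thesis using O'(3) by (intro PiE_I) (auto simp: PiE_iff extensional_def)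
  qed
  moreover have "?V <= PiE I O'"
  proof (rule PiE_mono)
   fix i assume i: "i : I"
   show "(if i : F then restrict f F i else space M) <= O' i"
   proof (cases "i : F")
    case True thus ?thesis using f by simp
   next
    case False
    thus ?thesis using i by (simp add: F_def X)
   qed
  qed
  ultimately show "EX V:\<C>. x : V & V <= U" using O'(4) by (intro bexI[of _ ?V]) auto
 qed
 let ?\<Omega> = "I ~> space M"
 have cyl: "{f : ?\<Omega>. f i : A} : sigma_sets ?\<Omega> \<C>" if i: "i : I" and A: "A : sets M" for i A
 proof -
  have "A : sigma_sets (space M) \<B>" using A M by simp
  thus ?thesis
  proof induction
   case (Basic a)
   have "{f : ?\<Omega>. f i : a} = PiE I (%j. if j : {i} then restrict (%_. a) {i} j else space M)"
   proof (rule antisym; rule subsetI)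
    fix x assume "x : {f : ?\<Omega>. f i : a}"
    hence x: "x : ?\<Omega>" "x i : a" by auto
    show "x : PiE I (%j. if j : {i} then restrict (%_. a) {i} j else space M)"
     by (rule PiE_I) (use x PiE_mem[OF x(1)] PiE_arb[OF x(1)] in auto)
   next
    fix x assume x: "x : PiE I (%j. if j : {i} then restrict (%_. a) {i} j else space M)"
    have "x j : space M" if "j : I" for j
     using PiE_mem[OF x that] sets.sets_into_space[OF Bs[OF Basic]] by (auto split: if_splits)
    moreover have "x i : a" using PiE_mem[OF x i] by simp
    ultimately show "x : {f : ?\<Omega>. f i : a}" using PiE_arb[OF x] by (intro CollectI conjI PiE_I) auto
   qed
   also have "... : \<C>" unfolding \<C>_def using i Basic by (intro image_eqI[of _ _ "({i}, restrict (%_. a) {i})"]) auto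
   finally show ?case by blast
  next
   case Empty
   thus ?case by (simp add: sigma_sets.Empty)
  next
   case (Compl a)
   have "{f : ?\<Omega>. f i : space M - a} = ?\<Omega> - {f : ?\<Omega>. f i : a}" using i by auto
   thus ?case using Compl sigma_sets.Compl by simp
  next
   case (Union a)
   have "{f : ?\<Omega>. f i : \<Union> (range a)} = (UN n. {f : ?\<Omega>. f i : a n})" by auto
   thus ?case using Union sigma_sets.Union[of "%n. {f : ?\<Omega>. f i : a n}"] by simp
  qed
 qed
 show "sets (PiM I (%_. M)) = sigma_sets (space (PiM I (%_. M))) \<C>"
 proof (rule antisym)
  have "\<C> <= sets (PiM I (%_. M))"
  proof
   fix V assume "V : \<C>"
   then obtain F f where Ff: "f : F ~> \<B>" "V = PiE I (%i. if i : F then f i else space M)" unfolding \<C>_def by auto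
   show "V : sets (PiM I (%_. M))"
    unfolding Ff(2) using Ff(1) by (intro sets_PiM_I_countable I) (auto intro: Bs simp: PiE_iff)
  qed
  thus "sigma_sets (space (PiM I (%_. M))) \<C> <= sets (PiM I (%_. M))" by (rule sets.sigma_sets_subset)
  have "sets (PiM I (%_. M)) = sigma_sets ?\<Omega> {{f : ?\<Omega>. f i : A} | i A. i : I & A : sets M}"
   by (simp add: sets_PiM_single)
  also have "... <= sigma_sets ?\<Omega> \<C>" by (rule sigma_sets_mono) (auto intro: cyl)
  finally show "sets (PiM I (%_. M)) <= sigma_sets (space (PiM I (%_. M))) \<C>" by (simp add: space_PiM)
 qed
qed

lemma standard_space_PiM:
 assumes "standard_space M" "countable I" "I ~= {}"
 shows "standard_space (PiM I (%_. M))"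
proof -
 obtain X \<B> where X: "topspace X = space M" "completely_metrizable_space X"
   "countable \<B>" "topology_base X \<B>" "sets M = sigma_sets (space M) \<B>"
  using assms(1) unfolding standard_space_base by (elim exE conjE)
 note b = sets_PiM_base[OF assms(2,3) X(1,3,4,5)]
 have "completely_metrizable_space (product_topology (%_. X) I)"
  using X(2) assms(2) by (auto simp: completely_metrizable_space_product_topology intro: countable_subset[of _ I])
 thus ?thesis unfolding standard_space_base using b X(1)
  by (intro exI[of _ "product_topology (%_. X) I"] exI conjI b) (auto simp: space_PiM)
qed

lemma standard_space_pair:
 assumes "standard_space M" "standard_space N"
 shows "standard_space (M \<Otimes>\<^sub>M N)"
proof -
 obtain X \<B> where X: "topspace X = space M" "completely_metrizable_space X"
   "countable \<B>" "topology_base X \<B>" "sets M = sigma_sets (space M) \<B>"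
  using assms(1) unfolding standard_space_base by (elim exE conjE)
 obtain Y \<C> where Y: "topspace Y = space N" "completely_metrizable_space Y"
   "countable \<C>" "topology_base Y \<C>" "sets N = sigma_sets (space N) \<C>"
  using assms(2) unfolding standard_space_base by (elim exE conjE)
 define \<D> where "\<D> = (%(U, V). U \<times> V) ` (\<B> \<times> \<C>)"
 have base: "topology_base (prod_topology X Y) \<D>" unfolding topology_base_def
 proof (intro conjI ballI allI impI)
  fix V assume "V : \<D>"
  thus "openin (prod_topology X Y) V" using X(4) Y(4) by (auto simp: \<D>_def topology_base_def openin_prod_Times_iff)
 next
  fix W p assume "openin (prod_topology X Y) W & p : W"
  then obtain U V where UV: "openin X U" "openin Y V" "fst p : U" "snd p : V" "U \<times> V <= W"
   unfolding openin_prod_topology_alt by (metis prod.collapse)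
  obtain U' where U': "U' : \<B>" "fst p : U'" "U' <= U" using X(4) UV unfolding topology_base_def by blast
  obtain V' where V': "V' : \<C>" "snd p : V'" "V' <= V" using Y(4) UV unfolding topology_base_def by blast
  show "EX V:\<D>. p : V & V <= W"
  proof (rule bexI[of _ "U' \<times> V'"])
   show "p : U' \<times> V' & U' \<times> V' <= W" using U'(2,3) V'(2,3) UV(5) by (auto simp: mem_Times_iff)
   show "U' \<times> V' : \<D>" using U'(1) V'(1) by (auto simp: \<D>_def)
  qed
 qed
 have sub: "\<B> <= Pow (space M)" "\<C> <= Pow (space N)"
  by (rule generator_into_space[OF X(5)], rule generator_into_space[OF Y(5)])
 have U: "\<Union>\<B> = space M" "\<Union>\<C> = space N"
 proof -
  show "\<Union>\<B> = space M" using Union_mono[OF sub(1)] topology_base_cover[OF X(4)] unfolding X(1) by (intro antisym) simp_all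
  show "\<Union>\<C> = space N" using Union_mono[OF sub(2)] topology_base_cover[OF Y(4)] unfolding Y(1) by (intro antisym) simp_all
 qed
 have "sets (M \<Otimes>\<^sub>M N) = sets (sigma (space M \<times> space N) {a \<times> b | a b. a : \<B> & b : \<C>})"
  by (rule sets_pair_eq[OF sub(1) X(5,3) subset_refl U(1) sub(2) Y(5,3) subset_refl U(2)])
 moreover have "{a \<times> b | a b. a : \<B> & b : \<C>} = \<D>" by (auto simp: \<D>_def)
 moreover have "\<D> <= Pow (space M \<times> space N)" using sub by (auto simp: \<D>_def)
 ultimately have "sets (M \<Otimes>\<^sub>M N) = sigma_sets (space (M \<Otimes>\<^sub>M N)) \<D>" by (simp add: space_pair_measure)
 moreover have "countable \<D>" using X(3) Y(3) by (simp add: \<D>_def)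
 moreover have "completely_metrizable_space (prod_topology X Y)"
  using X(2) Y(2) by (simp add: completely_metrizable_space_prod_topology)
 ultimately show ?thesis unfolding standard_space_base using base X(1) Y(1)
  by (intro exI[of _ "prod_topology X Y"] exI[of _ \<D>]) (simp add: space_pair_measure)
qed

section \<open>Covering a standard space by disjoint compact sets\<close>

context
 fixes M :: "'x measure" and d :: "'x => 'x => real"
 assumes pr: "prob_space M" and met: "Metric_space (space M) d" and mc: "Metric_space.mcomplete (space M) d"
  and sep: "separable_space (Metric_space.mtopology (space M) d)"
  and Bor: "sets M = sigma_sets (space M) {U. openin (Metric_space.mtopology (space M) d) U}"
begin

interpretation prob_space M by (rule pr)
interpretation D: Metric_space "space M" d by (rule met)

lemma open_measurable: "openin D.mtopology U ==> U : sets M" unfolding Bor by (rule sigma_sets.Basic) simp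

lemma closed_measurable:
 assumes "closedin D.mtopology U" shows "U : sets M"
proof -
 have "U <= space M" "openin D.mtopology (space M - U)" using assms by (auto simp: closedin_def)
 hence "space M - (space M - U) : sets M" by (intro sets.compl_sets open_measurable)
 thus ?thesis using \<open>U <= space M\<close> by (simp add: double_diff)
qed

lemma compact_closed: "compactin D.mtopology K ==> closedin D.mtopology K"
 by (rule compactin_imp_closedin[OF D.Hausdorff_space_mtopology])

text \<open>Ulam's tightness: intersect finite unions of balls of radius \<open>1 / (k + 1)\<close> of almost full measure.\<close>

lemma compact_approx:
 assumes ep: "0 < ep"
 shows "EX L. compactin D.mtopology L & measure M (space M - L) <= ep"
proof -
 obtain C where C: "countable C" "C <= space M" "D.mtopology closure_of C = space M"
  using sep unfolding separable_space_def D.topspace_mtopology by (elim exE conjE)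
 have "C ~= {}" using C(3) not_empty by auto
 define c where "c = from_nat_into C"
 have rc: "range c = C" unfolding c_def by (rule range_from_nat_into[OF \<open>C ~= {}\<close> C(1)])
 have cM: "c i : space M" for i using rc C(2) by auto
 define B where "B k N = (UN i:{..N}. D.mcball (c i) (1 / (real k + 1)))" for k N :: nat
 have r: "0 < 1 / (real k + 1)" for k by (simp add: add_nonneg_pos)
 have Bcl: "closedin D.mtopology (B k N)" for k N unfolding B_def by (rule closedin_Union) auto
 note Bm = closed_measurable[OF Bcl]
 have cover: "(UN N. B k N) = space M" for k
 proof
  show "(UN N. B k N) <= space M" using sets.sets_into_space[OF Bm] by blast
  show "space M <= (UN N. B k N)"
  proof
   fix x assume x: "x : space M"
   hence "x : D.mtopology closure_of C" using C(3) by simp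
   then obtain y where y: "y : C" "y : D.mball x (1 / (real k + 1))" unfolding D.metric_closure_of using r[of k] by blast
   then obtain i where "y = c i" using rc by auto
   hence "x : D.mcball (c i) (1 / (real k + 1))" using y(2) x D.commute[of x "c i"] by auto
   hence "x : B k i" unfolding B_def by blast
   thus "x : (UN N. B k N)" by blast
  qed
 qed
 have "ALL k. EX N. measure M (space M - B k N) < ep * (1 / 2) ^ Suc k"
 proof
  fix k
  have "incseq (B k)"
  proof (rule incseq_SucI)
   fix N show "B k N <= B k (Suc N)" unfolding B_def atMost_Suc by blast
  qed
  hence "(%N. prob (B k N)) \<longlonglongrightarrow> prob (UN N. B k N)" using Bm by (intro finite_Lim_measure_incseq) auto
  hence "(%N. prob (B k N)) \<longlonglongrightarrow> 1" by (simp add: cover prob_space)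
  hence "EV N. 1 - ep * (1 / 2) ^ Suc k < prob (B k N)" by (rule order_tendstoD) (use ep in simp)
  then obtain N where "1 - ep * (1 / 2) ^ Suc k < prob (B k N)" by (auto simp: eventually_sequentially)
  hence "measure M (space M - B k N) < ep * (1 / 2) ^ Suc k" using prob_compl[OF Bm, of k N] by simp
  thus "EX N. measure M (space M - B k N) < ep * (1 / 2) ^ Suc k" ..
 qed
 then obtain N where N: "ALL k. measure M (space M - B k (N k)) < ep * (1 / 2) ^ Suc k" by (rule choice[THEN exE])
 define L where "L = (INT k. B k (N k))"
 have cl: "closedin D.mtopology L" unfolding L_def by (rule closedin_INT) (auto simp: Bcl)
 have "D.mtotally_bounded L" unfolding D.mtotally_bounded_def
 proof (intro allI impI)
  fix s :: real assume "0 < s"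
  then obtain k where k: "1 / (real k + 1) < s / 2"
   using reals_Archimedean[of "s / 2"] by (auto simp: inverse_eq_divide add.commute)
  define J where "J = {i : {..N k}. L Int D.mcball (c i) (1 / (real k + 1)) ~= {}}"
  have "ALL i:J. EX y. y : L Int D.mcball (c i) (1 / (real k + 1))" unfolding J_def by blast
  then obtain y where y: "ALL i:J. y i : L Int D.mcball (c i) (1 / (real k + 1))" by (rule bchoice[THEN exE])
  have "L <= (UN x:y ` J. D.mball x s)"
  proof
   fix x assume x: "x : L"
   hence "x : B k (N k)" by (simp add: L_def)
   then obtain i where i: "i <= N k" "x : D.mcball (c i) (1 / (real k + 1))" by (auto simp: B_def)
   hence iJ: "i : J" using x unfolding J_def by blast
   hence yi: "y i : D.mcball (c i) (1 / (real k + 1))" using y by blast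
   have "d (y i) x <= d (y i) (c i) + d (c i) x" using yi i(2) by (intro D.triangle) auto
   also have "... < s" using yi i(2) k D.commute[of "y i" "c i"] by auto
   finally have "x : D.mball (y i) s" using yi i(2) by auto
   thus "x : (UN x:y ` J. D.mball x s)" using iJ by blast
  qed
  moreover have "finite (y ` J)" by (simp add: J_def)
  moreover have "y ` J <= L" using y by blast
  ultimately show "EX K. finite K & K <= L & L <= (UN x:K. D.mball x s)" by (intro exI[of _ "y ` J"] conjI)
 qed
 hence "compactin D.mtopology (D.mtopology closure_of L)"
  by (rule D.mtotally_bounded_eq_compact_closure_of[OF mc, THEN iffD1, THEN conjunct2])
 hence cpt: "compactin D.mtopology L" using cl by (simp add: closure_of_closedin)
 have sm: "summable (%k. ep * (1 / 2) ^ Suc k)" using power_half_series sums_mult sums_summable by blast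
 have smm: "summable (%k. measure M (space M - B k (N k)))"
  by (rule summable_comparison_test[OF _ sm]) (use N in \<open>auto intro!: exI[of _ 0] less_imp_le\<close>)
 have "space M - L = (UN k. space M - B k (N k))" by (auto simp: L_def)
 hence "measure M (space M - L) <= (\<Sum>k. measure M (space M - B k (N k)))"
  using Bm smm by (simp only:) (intro finite_measure_subadditive_countably, auto)
 also have "... <= (\<Sum>k. ep * (1 / 2) ^ Suc k)" using N by (intro suminf_le smm sm) (simp add: less_imp_le)
 also have "... = ep * 1" by (rule sums_unique[symmetric, OF sums_mult[OF power_half_series]])
 finally show ?thesis using cpt by auto
qed

lemma compact_avoid:
 assumes C: "closedin D.mtopology C" and ep: "0 < ep"
 shows "EX K. compactin D.mtopology K & K Int C = {} & measure M (space M - C - K) <= ep"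
proof -
 have ep2: "0 < ep / 2" using ep by simp
 define F where "F j = space M - (UN y:C. D.mball y (1 / (real j + 1)))" for j :: nat
 have CM: "C <= space M" using C by (simp add: closedin_def)
 have Fcl: "closedin D.mtopology (F j)" for j
  unfolding F_def closedin_def by (auto simp: double_diff UN_least D.mball_subset_mspace)
 note Fm = closed_measurable[OF Fcl]
 have Cm: "space M - C : sets M" using closed_measurable[OF C] by auto
 have U: "(UN j. F j) = space M - C"
 proof (intro antisym subsetI)
  fix x assume "x : (UN j. F j)"
  then obtain j where j: "x : space M" "x ~: (UN y:C. D.mball y (1 / (real j + 1)))" by (auto simp: F_def)
  have "x : D.mball x (1 / (real j + 1))" using j(1) by (simp add: add_nonneg_pos)
  thus "x : space M - C" using j by blast
 next
  fix x assume x: "x : space M - C"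
  have "ALL x. x : space M - C --> (EX r>0. disjnt C (D.mball x r))" using C unfolding D.closedin_metric by (rule conjunct2)
  then obtain r where r: "0 < r" "disjnt C (D.mball x r)" using x by blast
  then obtain j where j: "1 / (real j + 1) < r" using reals_Archimedean[of r] by (auto simp: inverse_eq_divide add.commute)
  have "x ~: D.mball y (1 / (real j + 1))" if y: "y : C" for y
  proof
   assume "x : D.mball y (1 / (real j + 1))"
   hence "y : D.mball x r" using j D.commute[of x y] by auto
   thus False using r(2) y by (auto simp: disjnt_def)
  qed
  hence "x : F j" using x by (simp add: F_def)
  thus "x : (UN j. F j)" by blast
 qed
 have "incseq F"
 proof (rule incseq_SucI)
  fix j
  have "1 / (real (Suc j) + 1) <= 1 / (real j + 1)" by (intro divide_left_mono) (auto simp: add_nonneg_pos)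
  hence "D.mball y (1 / (real (Suc j) + 1)) <= D.mball y (1 / (real j + 1))" for y by (rule D.mball_subset_concentric)
  thus "F j <= F (Suc j)" unfolding F_def by blast
 qed
 hence "(%j. prob (F j)) \<longlonglongrightarrow> prob (UN j. F j)" using Fm by (intro finite_Lim_measure_incseq) auto
 hence "EV j. prob (space M - C) - ep / 2 < prob (F j)" unfolding U by (rule order_tendstoD) (use ep in simp)
 then obtain j where j: "prob (space M - C) - ep / 2 < prob (F j)" by (auto simp: eventually_sequentially)
 obtain L where L: "compactin D.mtopology L" "measure M (space M - L) <= ep / 2" using compact_approx[OF ep2] by blast
 have Lm: "L : sets M" by (rule closed_measurable[OF compact_closed[OF L(1)]])
 have FC: "F j <= space M - C" using U by blast
 have "prob (space M - C - (F j Int L)) <= prob ((space M - C - F j) Un (space M - L))"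
  using Cm Fm Lm by (intro finite_measure_mono) auto
 also have "... <= prob (space M - C - F j) + prob (space M - L)" using Cm Fm Lm by (intro measure_Un_le) auto
 also have "prob (space M - C - F j) = prob (space M - C) - prob (F j)" by (rule finite_measure_Diff[OF Cm Fm FC])
 finally have "prob (space M - C - (F j Int L)) <= ep" using j L(2) by simp
 moreover have "compactin D.mtopology (F j Int L)" by (rule closed_Int_compactin[OF Fcl L(1)])
 ultimately show ?thesis using FC by (intro exI[of _ "F j Int L"]) blast
qed

text \<open>Each new compact set is taken in the complement of the previous ones, which is open, so that the union has full
measure. The set with index 0 is a single point, kept as the limit point of a compactification.\<close>

lemma disjoint_compacts:
 "EX K p. p : space M & K 0 = {p} & (ALL n :: nat. compactin D.mtopology (K n)) &
   (ALL m n. m ~= n --> K m Int K n = {}) & (AE x in M. EX n. x : K n)"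
proof -
 obtain p where p: "p : space M" using not_empty by blast
 define kq where "kq C n = (SOME K. compactin D.mtopology K & K Int C = {} & measure M (space M - C - K) <= 1 / (real n + 1))" for C n
 have kq: "compactin D.mtopology (kq C n) & kq C n Int C = {} & measure M (space M - C - kq C n) <= 1 / (real n + 1)"
  if "closedin D.mtopology C" for C n
  unfolding kq_def by (rule someI_ex, rule compact_avoid[OF that]) (simp add: add_nonneg_pos)
 define U where "U = rec_nat {p} (%n A. A Un kq A n)"
 have U0: "U 0 = {p}" and US: "U (Suc n) = U n Un kq (U n) n" for n by (simp_all add: U_def)
 have cp: "compactin D.mtopology {p}" using p by (simp add: finite_imp_compactin)
 have Ucl: "closedin D.mtopology (U n)" for n
 proof (induction n)
  case 0 show ?case unfolding U0 by (rule compact_closed[OF cp])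
 next
  case (Suc n)
  show ?case unfolding US by (intro closedin_Un Suc compact_closed[OF conjunct1[OF kq[OF Suc]]])
 qed
 define K where "K n = (case n of 0 => {p} | Suc m => kq (U m) m)" for n
 have K0: "K 0 = {p}" and KS: "K (Suc m) = kq (U m) m" for m by (simp_all add: K_def)
 have cK: "compactin D.mtopology (K n)" for n using kq[OF Ucl] cp by (cases n) (simp_all add: K0 KS)
 have KU: "K m <= U n" if "m <= n" for m n using that
 proof (induction n)
  case 0 thus ?case by (simp add: K0 U0)
 next
  case (Suc n)
  thus ?case by (cases "m = Suc n") (auto simp: US KS)
 qed
 have lt: "K m Int K n = {}" if mn: "m < n" for m n
 proof -
  obtain l where l: "n = Suc l" using mn by (cases n) auto
  hence "K m <= U l" using mn by (intro KU) simp
  moreover have "K n Int U l = {}" using kq[OF Ucl, of l l] by (simp add: l KS)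
  ultimately show ?thesis by blast
 qed
 have disj: "K m Int K n = {}" if "m ~= n" for m n using lt[of m n] lt[of n m] that by (cases "m < n") auto
 have Km: "K n : sets M" for n by (rule closed_measurable[OF compact_closed[OF cK]])
 let ?N = "space M - (UN n. K n)"
 have Nm: "?N : sets M" using Km by auto
 have le: "prob ?N <= 1 / (real n + 1)" for n
 proof -
  have "U m <= (UN n. K n)" for m
  proof (induction m)
   case 0 thus ?case using K0 by (auto simp: U0)
  next
   case (Suc m)
   have "kq (U m) m <= (UN n. K n)" using KS[of m] by blast
   thus ?case using Suc by (simp add: US)
  qed
  hence "?N <= space M - U n - kq (U n) n" using KS[of n] by blast
  moreover have "space M - U n - kq (U n) n : sets M" using closed_measurable[OF Ucl[of n]] Km[of "Suc n"] by (auto simp: KS)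
  ultimately have "prob ?N <= prob (space M - U n - kq (U n) n)" by (intro finite_measure_mono)
  also have "... <= 1 / (real n + 1)" using kq[OF Ucl] by blast
  finally show ?thesis .
 qed
 have "prob ?N <= 0"
 proof (rule field_le_epsilon)
  fix e :: real assume "0 < e"
  then obtain n where "1 / (real n + 1) < e" using reals_Archimedean[of e] by (auto simp: inverse_eq_divide add.commute)
  thus "prob ?N <= 0 + e" using le[of n] by simp
 qed
 hence "?N : null_sets M" using Nm by (intro null_setsI) (simp_all add: emeasure_eq_measure measure_le_0_iff)
 hence "AE x in M. EX n. x : K n" by (rule AE_I') auto
 thus ?thesis using p K0 cK disj by (intro exI[of _ K] exI[of _ p] conjI allI impI)
qed

end

lemma tbm_countable_dense:
 assumes tb: "tbm S d"
 obtains C where "countable C" "C <= S" "ALL x:S. ALL r>0. EX y:C. d x y < r"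
proof -
 have "ALL n. EX K. K <= S & finite K & (ALL x:S. EX y:K. d x y < 1 / (real n + 1))"
 proof
  fix n :: nat
  have "0 < 1 / (real n + 1)" by (simp add: add_nonneg_pos)
  thus "EX K. K <= S & finite K & (ALL x:S. EX y:K. d x y < 1 / (real n + 1))" using tb unfolding tbm_def by blast
 qed
 then obtain K where K: "ALL n. K n <= S & finite (K n) & (ALL x:S. EX y:K n. d x y < 1 / (real n + 1))"
  by (rule choice[THEN exE])
 have "EX y:(UN n. K n). d x y < r" if x: "x : S" and r: "0 < r" for x r
 proof -
  obtain n where n: "1 / (real n + 1) < r" using reals_Archimedean[OF r] by (auto simp: inverse_eq_divide add.commute)
  obtain y where "y : K n" "d x y < 1 / (real n + 1)" using K[THEN spec, of n] x by blast
  thus ?thesis using n by (intro bexI[of _ y]) auto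
 qed
 moreover have "countable (UN n. K n)" using K by (auto intro: countable_finite)
 moreover have "(UN n. K n) <= S" using K by blast
 ultimately show ?thesis by (intro that[of "UN n. K n"]) blast+
qed

section \<open>Compact alphabets\<close>

text \<open>The piece with index \<open>n\<close> has diameter at most \<open>1 / n\<close>; for \<open>n = 0\<close> division by zero gives
the weight 0 of the point at infinity.\<close>

definition wedge_dist :: "('x => nat) => ('x => 'x => real) => 'x => 'x => real" where
 "wedge_dist idx d x y = (if idx x = idx y then min 1 (d x y) / real (idx x)
   else max (1 / real (idx x)) (1 / real (idx y)))"

lemma wedge_metric:
 assumes met: "Metric_space X d" and A: "A <= X" and p: "!!x. x : A ==> idx x = 0 ==> x = p"
 shows "Metric_space A (wedge_dist idx d)"
proof
 interpret D: Metric_space X d by (rule met)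
 fix x y z
 show "0 <= wedge_dist idx d x y" by (simp add: wedge_dist_def max_def)
 show "wedge_dist idx d x y = wedge_dist idx d y x" by (simp add: wedge_dist_def D.commute[of x y] max.commute)
 assume x: "x : A" and y: "y : A"
 show "(wedge_dist idx d x y = 0) = (x = y)"
 proof (cases "idx x = idx y")
  case True
  show ?thesis
  proof (cases "idx x = 0")
   case True
   have "x = y" using p[OF x True] p[OF y] True \<open>idx x = idx y\<close> by simp
   thus ?thesis using True by (simp add: wedge_dist_def)
  next
   case False
   have "d x y = 0 \<longleftrightarrow> x = y" using x y A by (intro D.zero) auto
   hence "min 1 (d x y) = 0 \<longleftrightarrow> x = y" by (cases "x = y") (auto simp: min_def)
   thus ?thesis using False True by (simp add: wedge_dist_def)
  qed
 next
  case False
  hence "0 < idx x | 0 < idx y" by linarith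
  hence "0 < max (1 / real (idx x)) (1 / real (idx y))" by (auto simp: less_max_iff_disj)
  thus ?thesis using False by (auto simp: wedge_dist_def)
 qed
 assume z: "z : A"
 have half: "min 1 (d x z) / real n <= 1 / real n" for n and x z :: 'a by (intro divide_right_mono) auto
 have w: "0 <= 1 / real n" for n by simp
 have max_tri: "a <= max a b + max b c" "c <= max a b + max b c" if "0 <= a" "0 <= b" "0 <= c" for a b c :: real
  using that by (auto simp: max_def)
 show "wedge_dist idx d x z <= wedge_dist idx d x y + wedge_dist idx d y z"
 proof (cases "idx x = idx z")
  case xz: True
  show ?thesis
  proof (cases "idx y = idx x")
   case True
   have "d x z <= d x y + d y z" using x y z A by (intro D.triangle) auto
   hence "min 1 (d x z) <= min 1 (d x y) + min 1 (d y z)" using D.nonneg[of x y] D.nonneg[of y z] by linarith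
   hence "min 1 (d x z) / real (idx x) <= (min 1 (d x y) + min 1 (d y z)) / real (idx x)" by (intro divide_right_mono) auto
   thus ?thesis using True xz by (simp add: wedge_dist_def add_divide_distrib)
  next
   case False
   have "min 1 (d x z) / real (idx z) <= 1 / real (idx z)" by (rule half)
   also have "... <= max (1 / real (idx x)) (1 / real (idx y)) + max (1 / real (idx y)) (1 / real (idx z))"
    by (rule add_increasing[OF max.coboundedI1[OF w] max.cobounded2])
   finally show ?thesis using xz False by (simp add: wedge_dist_def)
  qed
 next
  case xz: False
  have n: "0 <= min 1 (d x y) / real (idx x)" "0 <= min 1 (d y z) / real (idx y)" by simp_all
  show ?thesis using xz n w[of "idx x"] w[of "idx y"] w[of "idx z"] by (cases "idx x = idx y"; cases "idx y = idx z")
    (auto simp: wedge_dist_def intro!: max_tri)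
 qed
qed

text \<open>Disjoint compact pieces of full measure, shrunk so that they converge to one point, form a compact metric
space with the same Borel sets. Points outside are sent to that point.\<close>

lemma compact_alphabet:
 assumes std: "standard_space M" and pr: "prob_space M"
 obtains A rh \<iota> where "standard_space A" "alphabet A rh" "\<iota> : measurable M A" "(%x. x) : measurable A M"
  "AE x in M. \<iota> x = x"
proof -
 interpret prob_space M by (rule pr)
 obtain X where X: "topspace X = space M" "completely_metrizable_space X" "separable_space X"
  "sets M = sigma_sets (space M) {U. openin X U}" using std unfolding standard_space_def by (elim exE conjE)
 obtain M' d where d': "Metric_space M' d" "Metric_space.mcomplete M' d" "X = Metric_space.mtopology M' d"
  using X(2) unfolding completely_metrizable_space_def by blast
 have M': "M' = space M" using X(1) Metric_space.topspace_mtopology[OF d'(1)] d'(3) by simp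
 interpret D: Metric_space "space M" d using d'(1) M' by simp
 have Xd: "X = D.mtopology" using d'(3) M' by simp
 note ctx = pr D.Metric_space_axioms d'(2)[unfolded M'] X(3)[unfolded Xd] X(4)[unfolded Xd]
 obtain K p where p: "p : space M" and K0: "K 0 = {p}" and cK: "!!n :: nat. compactin D.mtopology (K n)"
  and disj: "!!m n. m ~= n ==> K m Int K n = {}" and ae: "AE x in M. EX n. x : K n" using disjoint_compacts[OF ctx] by blast
 define A0 where "A0 = (UN n. K n)"
 define idx where "idx x = (THE n. x : K n)" for x
 have idx: "idx x = n" if "x : K n" for x n unfolding idx_def
 proof (rule the_equality[where a = n])
  show "x : K n" by (rule that)
  show "m = n" if "x : K m" for m using disj[of m n] \<open>x : K n\<close> that by blast
 qed
 have Ksub: "K n <= space M" for n using compactin_subset_topspace[OF cK[of n]] by simp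
 have A0M: "A0 <= space M" using Ksub by (auto simp: A0_def)
 have KA: "K n <= A0" for n by (auto simp: A0_def)
 have inK: "x : K (idx x)" if "x : A0" for x using that idx by (auto simp: A0_def)
 have pA: "p : A0" using K0 KA[of 0] by simp
 define rh where "rh = wedge_dist idx d"
 have met: "Metric_space A0 rh" unfolding rh_def
 proof (rule wedge_metric[OF D.Metric_space_axioms A0M])
  fix x assume "x : A0" "idx x = 0"
  thus "x = p" using inK[of x] K0 by simp
 qed
 interpret R: Metric_space A0 rh by (rule met)
 have rhK: "rh x y = min 1 (d x y) / real n" if "x : K n" "y : K n" for x y n
  using that by (simp add: rh_def wedge_dist_def idx)
 have cpt: "compact_space R.mtopology" unfolding R.compact_space_sequentially
 proof (intro allI impI)
  fix s :: "nat => 'a" assume s: "range s <= A0"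
  show "EX l r. l : A0 & strict_mono r & limitin R.mtopology (s \<circ> r) l sequentially"
  proof (cases "EX n. infinite {k. s k : K n}")
   case True
   then obtain n where n: "infinite {k. s k : K n}" by blast
   define e where "e = enumerate {k. s k : K n}"
   have e: "strict_mono e" "!!i. s (e i) : K n"
    using strict_mono_enumerate[OF n] enumerate_in_set[OF n] by (auto simp: e_def)
   have "range (s \<circ> e) <= K n" using e(2) by auto
   then obtain l r where l: "l : K n" "strict_mono r" "limitin D.mtopology ((s \<circ> e) \<circ> r) l sequentially"
    using cK[of n] unfolding D.compactin_sequentially by blast
   have "limitin R.mtopology (s \<circ> (e \<circ> r)) l sequentially" unfolding R.limit_metric_sequentially
   proof (intro conjI allI impI)
    show "l : A0" using l(1) KA by blast
    fix ep :: real assume "0 < ep"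
    then obtain N where N: "ALL k>=N. d (s (e (r k))) l < ep" using l(3) unfolding D.limit_metric_sequentially by fastforce
    have "s (e (r k)) : A0 & rh (s (e (r k))) l < ep" if "N <= k" for k
    proof
     show "s (e (r k)) : A0" using e(2) KA by blast
     let ?a = "d (s (e (r k))) l"
     have "rh (s (e (r k))) l = min 1 ?a / real n" by (rule rhK[OF e(2) l(1)])
     also have "... <= min 1 ?a"
     proof (cases "n = 0")
      case False
      hence "min 1 ?a / real n <= min 1 ?a / 1" by (intro divide_left_mono) auto
      thus ?thesis by simp
     qed simp
     also have "... < ep" using N that by auto
     finally show "rh (s (e (r k))) l < ep" .
    qed
    thus "EX N. ALL k>=N. (s \<circ> (e \<circ> r)) k : A0 & rh ((s \<circ> (e \<circ> r)) k) l < ep" by auto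
   qed
   thus ?thesis using l e KA by (intro exI[of _ l] exI[of _ "e \<circ> r"] conjI strict_mono_o) auto
  next
   case False
   have "limitin R.mtopology s p sequentially" unfolding R.limit_metric_sequentially
   proof (intro conjI allI impI pA)
    fix ep :: real assume "0 < ep"
    then obtain m where m: "1 / (real m + 1) < ep"
     using reals_Archimedean[of ep] by (auto simp: inverse_eq_divide add.commute)
    have "finite (UN n:{..m}. {k. s k : K n})" using False by simp
    from finite_nat_bounded[OF this] obtain N where N: "(UN n:{..m}. {k. s k : K n}) <= {..<N}" ..
    have "s k : A0 & rh (s k) p < ep" if "N <= k" for k
    proof
     show sk: "s k : A0" using s by auto
     have "~ idx (s k) <= m"
     proof
      assume "idx (s k) <= m"
      hence "k : (UN n:{..m}. {k. s k : K n})" using inK[OF sk] by (intro UN_I[of "idx (s k)"]) simp_all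
      thus False using subsetD[OF N] that by fastforce
     qed
     hence m': "real m + 1 <= real (idx (s k))" by linarith
     have "idx p = 0" using idx[of p 0] K0 by simp
     hence "rh (s k) p = 1 / real (idx (s k))" using m' by (auto simp: rh_def wedge_dist_def)
     also have "... <= 1 / (real m + 1)" using m' by (intro divide_left_mono) (auto simp: add_nonneg_pos)
     finally show "rh (s k) p < ep" using m by simp
    qed
    thus "EX N. ALL k>=N. s k : A0 & rh (s k) p < ep" by blast
   qed
   thus ?thesis using pA by (intro exI[of _ p] exI[of _ id]) (auto simp: strict_mono_def)
  qed
 qed
 have Kcl: "closedin D.mtopology (K n)" for n by (rule compact_closed[OF ctx cK])
 have Km: "K n : sets M" for n by (rule closed_measurable[OF ctx Kcl])
 have A0m: "A0 : sets M" using Km by (auto simp: A0_def)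
 have openR: "openin R.mtopology (V Int K n)" if V: "openin D.mtopology V" and n: "n ~= 0" for V n
  unfolding R.openin_mtopology
 proof (intro conjI allI impI)
  show "V Int K n <= A0" using KA by blast
  fix x assume x: "x : V Int K n"
  then obtain r where r: "0 < r" "D.mball x r <= V" using V unfolding D.openin_mtopology by blast
  have n': "0 < real n" using n by simp
  have "R.mball x (min r 1 / real n) <= V Int K n"
  proof
   fix y assume "y : R.mball x (min r 1 / real n)"
   hence y: "y : A0" "rh x y < min r 1 / real n" by auto
   have ix: "idx x = n" using x idx by blast
   have "idx y = n"
   proof (rule ccontr)
    assume "idx y ~= n"
    hence "1 / real n <= rh x y" by (auto simp: rh_def wedge_dist_def ix)
    moreover have "min r 1 / real n <= 1 / real n" using n' by (intro divide_right_mono) auto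
    ultimately show False using y(2) by linarith
   qed
   hence yK: "y : K n" using inK[OF y(1)] by simp
   have "min 1 (d x y) / real n < min r 1 / real n" using y(2) rhK[of x n y] x yK by simp
   hence "min 1 (d x y) < min r 1" using n' by (simp add: divide_less_cancel)
   hence "d x y < r" by (auto simp: min_def split: if_splits)
   moreover have "x : space M" "y : space M" using x yK Ksub[of n] by auto
   ultimately have "y : D.mball x r" by simp
   thus "y : V Int K n" using subsetD[OF r(2)] yK by blast
  qed
  thus "EX r>0. R.mball x r <= V Int K n" using r(1) n' by (intro exI[of _ "min r 1 / real n"]) auto
 qed
 have measR: "U : sets M" if U: "openin R.mtopology U" for U
 proof -
  have "U Int K n : sets M" for n
  proof (cases "n = 0")
   case True
   hence "U Int K n = {} | U Int K n = K 0" using K0 by auto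
   thus ?thesis using Km[of 0] by auto
  next
   case False
   hence n': "0 < real n" by simp
   define V where "V = \<Union>{D.mball x r | x r. D.mball x r Int K n <= U}"
   have "openin D.mtopology V" unfolding V_def by (intro openin_Union) auto
   moreover have "U Int K n = V Int K n"
   proof
    show "V Int K n <= U Int K n" unfolding V_def by blast
    show "U Int K n <= V Int K n"
    proof
     fix x assume x: "x : U Int K n"
     then obtain r where r: "0 < r" "R.mball x r <= U" using U unfolding R.openin_mtopology by blast
     have rn: "0 < r * real n" using r(1) n' by simp
     have "D.mball x (r * real n) Int K n <= U"
     proof
      fix y assume y: "y : D.mball x (r * real n) Int K n"
      have "rh x y = min 1 (d x y) / real n" using x y by (intro rhK) auto
      also have "... <= d x y / real n" using n' by (intro divide_right_mono) auto
      also have "... < r" using y n' by (simp add: divide_less_eq)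
      finally have "y : R.mball x r" using x y KA by auto
      thus "y : U" using r(2) by blast
     qed
     hence "D.mball x (r * real n) <= V" unfolding V_def by blast
     moreover have "x : space M" using x Ksub[of n] by blast
     hence "x : D.mball x (r * real n)" using rn by simp
     ultimately show "x : V Int K n" using x by blast
    qed
   qed
   ultimately show ?thesis using open_measurable[OF ctx] Km[of n] by auto
  qed
  hence "(UN n. U Int K n) : sets M" by (intro sets.countable_UN image_subsetI)
  moreover have "U <= (UN n. K n)" using openin_subset[OF U] unfolding R.topspace_mtopology by (simp add: A0_def)
  hence "U = (UN n. U Int K n)" by auto
  ultimately show ?thesis by simp
 qed
 define A where "A = restrict_space M A0"
 have spA: "space A = A0" using A0M by (auto simp: A_def space_restrict_space)
 have "sets A = sigma_sets A0 ((Int) A0 ` {U. openin D.mtopology U})" unfolding A_def sets_restrict_space ctx(5)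
  by (rule sigma_sets_Int) (use A0m A0M ctx(5) in auto)
 also have "... = sigma_sets A0 {U. openin R.mtopology U}"
 proof (rule sigma_sets_eqI)
  fix B assume "B : (Int) A0 ` {U. openin D.mtopology U}"
  then obtain V where V: "B = A0 Int V" "openin D.mtopology V" by auto
  have pos: "V' Int K n : sigma_sets A0 {U. openin R.mtopology U}" if "openin D.mtopology V'" "n ~= 0" for V' n
   by (rule sigma_sets.Basic) (simp add: openR that)
  have rest: "K n : sigma_sets A0 {U. openin R.mtopology U}" if "n ~= 0" for n
   using pos[OF openin_topspace that] Ksub[of n] by (simp add: Int_absorb1)
  have "(UN n. K (Suc n)) : sigma_sets A0 {U. openin R.mtopology U}" by (rule sigma_sets.Union) (simp add: rest)
  hence "A0 - (UN n. K (Suc n)) : sigma_sets A0 {U. openin R.mtopology U}" by (rule sigma_sets.Compl)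
  moreover have "A0 - (UN n. K (Suc n)) = K 0"
  proof
   show "K 0 <= A0 - (UN n. K (Suc n))" using KA[of 0] disj[of 0] by blast
   show "A0 - (UN n. K (Suc n)) <= K 0"
   proof
    fix x assume x: "x : A0 - (UN n. K (Suc n))"
    thus "x : K 0" using inK[of x] by (cases "idx x") auto
   qed
  qed
  ultimately have zero: "K 0 : sigma_sets A0 {U. openin R.mtopology U}" by simp
  have "V Int K n : sigma_sets A0 {U. openin R.mtopology U}" for n
  proof (cases "n = 0")
   case True
   have "V Int K 0 = {} | V Int K 0 = K 0" using K0 by auto
   thus ?thesis using zero True sigma_sets.Empty by auto
  qed (rule pos[OF V(2)])
  hence "(UN n. V Int K n) : sigma_sets A0 {U. openin R.mtopology U}" by (rule sigma_sets.Union)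
  moreover have "B = (UN n. V Int K n)" by (auto simp: V(1) A0_def)
  ultimately show "B : sigma_sets A0 {U. openin R.mtopology U}" by simp
 next
  fix U assume "U : {U. openin R.mtopology U}"
  hence U: "openin R.mtopology U" by simp
  have "U : (Int) A0 ` sets M" using measR[OF U] U unfolding R.openin_mtopology by (intro image_eqI[of _ _ U]) auto
  also have "... = sigma_sets A0 ((Int) A0 ` {U. openin D.mtopology U})"
   unfolding ctx(5) by (rule sigma_sets_Int) (use A0m A0M ctx(5) in auto)
  finally show "U : sigma_sets A0 ((Int) A0 ` {U. openin D.mtopology U})" .
 qed
 finally have setsA: "sets A = sigma_sets A0 {U. openin R.mtopology U}" .
 have al: "alphabet A rh" using met cpt setsA by (simp add: alphabet_def spA)
 have "separable_space R.mtopology"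
 proof -
  obtain C where C: "countable C" "C <= A0" "ALL x:A0. ALL r>0. EX y:C. rh x y < r"
   using tbm_countable_dense[OF alphabet_tbm[OF al]] unfolding spA by blast
  have "R.mtopology closure_of C = A0" unfolding R.metric_closure_of using C by (auto 4 3 simp: subset_iff)
  thus ?thesis unfolding separable_space_def using C by (intro exI[of _ C]) simp
 qed
 hence st: "standard_space A" unfolding standard_space_def
  using R.completely_metrizable_space_mtopology[OF R.compact_space_imp_mcomplete[OF cpt]] setsA
  by (intro exI[of _ R.mtopology]) (simp add: spA)
 define \<iota> where "\<iota> x = (if x : A0 then x else p)" for x
 have "(%x. if x : A0 then x else p) : measurable M M" using A0m p by (intro measurable_If_set) auto
 hence \<iota>: "\<iota> : measurable M A" unfolding A_def \<iota>_def using pA by (intro measurable_restrict_space2) auto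
 have id: "(%x. x) : measurable A M" unfolding A_def by (intro measurable_restrict_space1) simp
 have "AE x in M. \<iota> x = x" using ae by (rule AE_mp) (auto simp: \<iota>_def A0_def)
 with st al \<iota> id show ?thesis by (rule that)
qed

section \<open>Metric models and generating observables\<close>

text \<open>Equality almost everywhere passes to the image measure because it is tested by countably many distances.\<close>

lemma AE_eq_of_distances:
 assumes al: "alphabet A rh" and f: "f : measurable N A" and h: "h : measurable N A"
  and K: "k : measurable M N" and ae: "AE x in M. f (k x) = h (k x)"
 shows "AE y in distr M N k. f y = h y"
proof -
 note tb = alphabet_tbm[OF al]
 obtain C where C: "countable C" "C <= space A" "ALL x:space A. ALL r>0. EX y:C. rh x y < r"
  by (rule tbm_countable_dense[OF tb])
 have "AE y in distr M N k. rh (f y) c = rh (h y) c" if c: "c : C" for c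
 proof -
  have cA: "c : space A" using C(2) c by blast
  have [measurable]: "(%y. rh (f y) c) : borel_measurable N" "(%y. rh (h y) c) : borel_measurable N"
   using measurable_compose[OF f alphabet_dist_measurable[OF al cA]] measurable_compose[OF h alphabet_dist_measurable[OF al cA]] by auto
  have "{y : space N. rh (f y) c = rh (h y) c} : sets N" by measurable
  from AE_distr_iff[OF K this] show ?thesis using ae by auto
 qed
 hence "AE y in distr M N k. ALL c:C. rh (f y) c = rh (h y) c" using C(1) by (simp add: AE_ball_countable)
 thus ?thesis
 proof (rule AE_mp, intro AE_I2 impI)
  fix y assume "y : space (distr M N k)" and eq: "ALL c:C. rh (f y) c = rh (h y) c"
  hence y: "f y : space A" "h y : space A" using measurable_space[OF f] measurable_space[OF h] by auto
  have "rh (f y) (h y) <= 0"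
  proof (rule field_le_epsilon)
   fix r :: real assume "0 < r"
   hence "0 < r / 2" by simp
   then obtain c where c: "c : C" "rh (h y) c < r / 2" using C(3) y(2) by blast
   have "rh (f y) (h y) <= rh (f y) c + rh c (h y)" using y C(2) c(1) by (intro tbm_tri[OF tb]) auto
   also have "... = rh (h y) c + rh (h y) c" using eq c(1) tbm_sym[OF tb, of c "h y"] by simp
   finally show "rh (f y) (h y) <= 0 + r" using c(2) by simp
  qed
  hence "rh (f y) (h y) = 0" using tbm_nonneg[OF tb, of "f y" "h y"] by simp
  thus "f y = h y" using Metric_space.zero[OF tbm_metric[OF tb] y] by simp
 qed
qed

theorem metric_model_exists:
 assumes grp: "group Gm" and cnt: "countable (carrier Gm)" and sys: "gsystem Gm M T"
 shows "EX P. is_metric_model Gm M T P"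
proof -
 interpret group Gm by (rule grp)
 note pm = gsystem_pmp[OF sys]
 interpret prob_space M by (rule pmpD(1)[OF pm])
 have std: "standard_space M" using sys by (simp add: gsystem_def)
 obtain A rh \<iota> where A: "standard_space A" "alphabet A rh" "\<iota> : measurable M A" "(%x. x) : measurable A M"
  "AE x in M. \<iota> x = x" by (rule compact_alphabet[OF std prob_space_axioms])
 define P where "P = path_space Gm A"
 define ph where "ph = orb Gm T \<iota>"
 define ps :: "('a => 'c) => 'c" where "ps p = p \<one>\<^bsub>Gm\<^esub>" for p
 define mu where "mu = distr M P ph"
 have phP: "ph : measurable M P" unfolding ph_def orb_def[abs_def] P_def path_space_def
  by (intro measurable_restrict measurable_compose[OF pmpD(2)[OF pm] A(3)])
 have comp: "(%p. p g) : measurable P A" if "g : carrier Gm" for g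
  unfolding P_def path_space_def by (rule measurable_component_singleton[OF that])
 have psP: "ps : measurable P M" unfolding ps_def[abs_def] using measurable_compose[OF comp[OF one_closed] A(4)] .
 have smu: "sets mu = sets P" "space mu = space P" by (simp_all add: mu_def)
 have phmu: "ph : measurable M mu" and psmu: "ps : measurable mu M"
  using phP psP smu by (simp_all cong: measurable_cong_sets)
 have psph: "ps (ph x) = \<iota> x" if "x : space M" for x using pmpD(4)[OF pm that] by (simp add: ps_def ph_def orb_def)
 have sh: "shift Gm g : measurable P P" if "g : carrier Gm" for g
  unfolding shift_def[abs_def] using comp that unfolding P_def path_space_def by (intro measurable_restrict) auto
 have eqv: "ph (T g x) = shift Gm g (ph x)" if "g : carrier Gm" "x : space M" for g x
  using that pmpD(5)[OF pm] by (auto simp: ph_def orb_def shift_def)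
 have inv: "distr mu mu (shift Gm g) = mu" if g: "g : carrier Gm" for g
 proof -
  have "distr mu mu (shift Gm g) = distr mu P (shift Gm g)" using smu by (intro distr_cong) auto
  also have "... = distr M P (shift Gm g \<circ> ph)" unfolding mu_def by (rule distr_distr[OF sh[OF g] phP])
  also have "... = distr M P (ph \<circ> T g)" using eqv g by (intro distr_cong) auto
  also have "... = distr (distr M M (T g)) P ph" by (rule distr_distr[symmetric, OF phP pmpD(2)[OF pm g]])
  also have "... = mu" by (simp add: pmpD(3)[OF pm g] mu_def)
  finally show ?thesis .
 qed
 have "prob_space mu" unfolding mu_def by (rule prob_space_distr[OF phP])
 hence mp: "metric_process Gm A rh mu" using A(1,2) inv smu by (simp add: metric_process_def alphabet_def P_def)
 have ae: "AE x in M. ps (ph x) = x" using A(5) by (rule AE_mp) (simp add: psph)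
 have "AE y in mu. ph (ps y) g = y g" if g: "g : carrier Gm" for g unfolding mu_def
 proof (rule AE_eq_of_distances[OF A(2) _ comp[OF g] phP])
  show "(%y. ph (ps y) g) : measurable P A" by (rule measurable_compose[OF psP measurable_compose[OF phP comp[OF g]]])
  show "AE x in M. ph (ps (ph x)) g = ph x g" using ae by (rule AE_mp) simp
 qed
 hence "AE y in mu. ALL g:carrier Gm. ph (ps y) g = y g" using cnt by (simp add: AE_ball_countable)
 hence ae': "AE y in mu. ph (ps y) = y"
 proof (rule AE_mp, intro AE_I2 impI)
  fix y assume y: "y : space mu" and eq: "ALL g:carrier Gm. ph (ps y) g = y g"
  have "y : carrier Gm ~> space A" using y smu by (simp add: P_def path_space_def space_PiM)
  thus "ph (ps y) = y" using eq by (intro ext) (auto simp: ph_def orb_def PiE_iff extensional_def)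
 qed
 have d1: "distr M mu ph = mu"
 proof -
  have "distr M mu ph = distr M P ph" using smu by (intro distr_cong) auto
  thus ?thesis by (simp add: mu_def)
 qed
 have d2: "distr mu M ps = M"
 proof -
  have "distr mu M ps = distr M M (ps \<circ> ph)" unfolding mu_def by (rule distr_distr[OF psP phP])
  also have "... = distr M M (%x. x)"
  proof (rule measure_eqI)
   fix B assume "B : sets (distr M M (ps \<circ> ph))"
   hence B: "B : sets M" by simp
   have m: "ps \<circ> ph : measurable M M" by (rule measurable_comp[OF phP psP])
   have "emeasure M ((ps \<circ> ph) -` B Int space M) = emeasure M ((%x. x) -` B Int space M)"
    using ae measurable_sets[OF m B] B by (intro emeasure_eq_AE) (auto elim!: AE_mp)
   thus "emeasure (distr M M (ps \<circ> ph)) B = emeasure (distr M M (%x. x)) B" using m B by (simp add: emeasure_distr)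
  qed simp
  finally show ?thesis by (simp add: distr_id)
 qed
 have "isomorphic_systems Gm M T mu (shift Gm)" unfolding isomorphic_systems_def
  by (intro bexI[of _ ph] bexI[of _ ps] conjI ballI d1 d2 ae ae' phmu psmu) (auto intro: AE_I2 eqv)
 thus ?thesis using mp by (intro exI[of _ "(A, rh, mu)"]) (simp add: is_metric_model_def)
qed

lemma system_entropy_observable:
 assumes grp: "group Gm" and cnt: "countable (carrier Gm)" and sys: "gsystem Gm M T"
  and aa: "almost_action Gm V sg" and tb: "tbm S d" and obs: "observable M S d af"
  and gen: "generating Gm M T S d af"
 shows "sofic_entropy Gm V sg M T = loc_entropy limsup Gm V sg S d (obs_int Gm M T af)"
  and "lower_sofic_entropy Gm V sg M T = loc_entropy liminf Gm V sg S d (obs_int Gm M T af)"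
proof -
 note pm = gsystem_pmp[OF sys]
 have fa: "finite_action Gm V sg" using aa by (simp add: almost_action_def)
 obtain A e mu where mod: "metric_model Gm M T = (A, e, mu)" by (cases "metric_model Gm M T")
 have mm: "is_metric_model Gm M T (A, e, mu)"
  unfolding mod[symmetric] metric_model_def by (rule someI_ex[OF metric_model_exists[OF grp cnt sys]])
 hence "metric_process Gm A e mu" by (simp add: is_metric_model_def)
 note al = metric_process_alphabet[OF this]
 obtain bt where bt: "observable M (space A) e bt" "generating Gm M T (space A) e bt"
  "!!f. f : loc (carrier Gm) (space A) e ==> (\<integral>p. f p \<partial>mu) = obs_int Gm M T bt f"
  using metric_model_observable[OF grp cnt pm mm] by blast
 have eq: "process_entropy_wrt L Gm V sg A e mu = loc_entropy L Gm V sg S d (obs_int Gm M T af)" if L: "tail_mono L" for L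
 proof -
  have "process_entropy_wrt L Gm V sg A e mu = loc_entropy L Gm V sg (space A) e (%f. \<integral>p. f p \<partial>mu)"
   by (rule process_entropy_eq_loc[OF al L fa])
  also have "... = loc_entropy L Gm V sg (space A) e (obs_int Gm M T bt)" by (rule loc_entropy_cong[OF bt(3)])
  also have "... = loc_entropy L Gm V sg S d (obs_int Gm M T af)"
   by (rule entropy_generating_eq[OF grp pm aa alphabet_tbm[OF al(1)] tb bt(1) obs bt(2) gen L])
  finally show ?thesis .
 qed
 show "sofic_entropy Gm V sg M T = loc_entropy limsup Gm V sg S d (obs_int Gm M T af)"
  using eq[OF tail_mono_limsup] by (simp add: sofic_entropy_def mod process_entropy_def)
 show "lower_sofic_entropy Gm V sg M T = loc_entropy liminf Gm V sg S d (obs_int Gm M T af)"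
  using eq[OF tail_mono_liminf] by (simp add: lower_sofic_entropy_def mod lower_process_entropy_def)
qed

lemma generating_observable_exists:
 assumes grp: "group Gm" and cnt: "countable (carrier Gm)" and sys: "gsystem Gm M T"
 obtains S :: "'x set" and d and af :: "'x => 'x"
 where "tbm S d" "observable M S d af" "generating Gm M T S d af"
proof -
 obtain P where P: "is_metric_model Gm M T P" using metric_model_exists[OF assms] by blast
 obtain A e mu where APe: "P = (A, e, mu)" by (cases P)
 hence mm: "is_metric_model Gm M T (A, e, mu)" using P by simp
 hence "metric_process Gm A e mu" by (simp add: is_metric_model_def)
 note al = metric_process_alphabet[OF this]
 obtain bt where bt: "observable M (space A) e bt" "generating Gm M T (space A) e bt"
  using metric_model_observable[OF grp cnt gsystem_pmp[OF sys] mm] by blast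
 show ?thesis by (rule that[OF alphabet_tbm[OF al(1)] bt])
qed

section \<open>Co-induced systems, products and powers\<close>

text \<open>Both the diagonal action of \<open>G\<close> and the translation by \<open>H\<close> have this form.\<close>

lemma distr_PiM_twist:
 assumes M: "prob_space M" and f: "f : measurable M M" "distr M M f = M"
  and pv: "pv ` I <= I" "inj_on pv I"
 shows "(%x. \<lambda>i\<in>I. f (x (pv i))) : measurable (PiM I (%_. M)) (PiM I (%_. M))"
  and "distr (PiM I (%_. M)) (PiM I (%_. M)) (%x. \<lambda>i\<in>I. f (x (pv i))) = PiM I (%_. M)"
proof -
 interpret prob_space M by (rule M)
 interpret P: product_prob_space "%_. M" I by unfold_locales
 let ?P = "PiM I (%_. M)" and ?t = "%x. \<lambda>i\<in>I. f (x (pv i))"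
 show t: "?t : measurable ?P ?P"
  using pv(1) by (intro measurable_restrict measurable_compose[OF _ f(1)] measurable_component_singleton) auto
 have em: "emeasure M (f -` A Int space M) = emeasure M A" if "A : sets M" for A
  using emeasure_distr[OF f(1) that] f(2) by simp
 show "distr ?P ?P ?t = ?P"
 proof (rule measure_eqI_PiM_infinite)
  fix A J assume J: "finite J" "J <= I" and A: "!!i. i : J ==> A i : sets M"
  define B where "B j = f -` A (the_inv_into I pv j) Int space M" for j
  have B: "B (pv i) = f -` A i Int space M" if "i : J" for i
   using J(2) that by (simp add: B_def the_inv_into_f_f[OF pv(2)] subset_iff)
  have Bm: "B j : sets M" if "j : pv ` J" for j using that B A measurable_sets[OF f(1)] by auto
  have emb: "prod_emb I (%_. M) J (Pi\<^sub>E J A) = {x : space ?P. ALL i:J. x i : A i}"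
   using J(2) by (auto simp: prod_emb_def space_PiM PiE_iff extensional_def)
  have Em: "{x : space ?P. ALL i:J. x i : A i} : sets ?P" unfolding emb[symmetric] using J A by (intro sets_PiM_I) auto
  have "emeasure (distr ?P ?P ?t) {x : space ?P. ALL i:J. x i : A i} = emeasure ?P (?t -` {x : space ?P. ALL i:J. x i : A i} Int space ?P)"
   by (rule emeasure_distr[OF t Em])
  also have "?t -` {x : space ?P. ALL i:J. x i : A i} Int space ?P = {x : space ?P. ALL j:pv ` J. x j : B j}"
  proof (rule antisym; rule subsetI)
   fix x assume "x : ?t -` {x : space ?P. ALL i:J. x i : A i} Int space ?P"
   hence x: "x : space ?P" and xA: "ALL i:J. ?t x i : A i" by auto
   have "x (pv i) : B (pv i)" if i: "i : J" for i
   proof -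
    have "x (pv i) : space M" using x pv(1) i J(2) by (auto simp: space_PiM PiE_iff)
    moreover have "f (x (pv i)) : A i" using bspec[OF xA i] i J(2) by (auto simp: restrict_def split: if_splits)
    ultimately show ?thesis by (simp add: B[OF i])
   qed
   thus "x : {x : space ?P. ALL j:pv ` J. x j : B j}" using x by simp
  next
   fix x assume "x : {x : space ?P. ALL j:pv ` J. x j : B j}"
   hence x: "x : space ?P" and xB: "!!i. i : J ==> x (pv i) : B (pv i)" by auto
   have "?t x i : A i" if i: "i : J" for i using xB[OF i] B[OF i] subsetD[OF J(2) i] by simp
   moreover have "?t x : space ?P" by (rule measurable_space[OF t x])
   ultimately show "x : ?t -` {x : space ?P. ALL i:J. x i : A i} Int space ?P" using x by simp
  qed
  also have "emeasure ?P {x : space ?P. ALL j:pv ` J. x j : B j} = (PROD j:pv ` J. emeasure M (B j))"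
   using J pv(1) Bm by (intro P.emeasure_PiM_Collect) auto
  also have "... = (PROD i:J. emeasure M (B (pv i)))" by (rule prod.reindex_cong[OF inj_on_subset[OF pv(2) J(2)]]) auto
  also have "... = (PROD i:J. emeasure M (A i))" by (intro prod.cong refl) (simp add: B em A)
  also have "... = emeasure ?P {x : space ?P. ALL i:J. x i : A i}" using J A by (intro P.emeasure_PiM_Collect[symmetric])
  finally show "emeasure (distr ?P ?P ?t) (prod_emb I (%_. M) J (Pi\<^sub>E J A)) = emeasure ?P (prod_emb I (%_. M) J (Pi\<^sub>E J A))"
   unfolding emb .
 next
  show "finite_measure (distr ?P ?P ?t)" using P.prob_space_distr[OF t] by (rule prob_space.finite_measure)
 qed simp_all
qed

lemma gsystem_coind:
 assumes grpG: "group G" and grpH: "group H" and cH: "countable (carrier H)" and sys: "gsystem G M T"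
 shows "gsystem (G \<times>\<times> H) (coind_measure H M) (coind_action H T)"
proof -
 interpret G: group G by (rule grpG)
 interpret H: group H by (rule grpH)
 note pm = gsystem_pmp[OF sys]
 note pr = pmpD(1)[OF pm]
 have std: "standard_space M" using sys by (simp add: gsystem_def)
 let ?MH = "coind_measure H M"
 have sp: "space ?MH = carrier H ~> space M" by (simp add: coind_measure_def space_PiM)
 have act: "coind_action H T p = (%x. \<lambda>k\<in>carrier H. T (fst p) (x (k \<otimes>\<^bsub>H\<^esub> snd p)))" for p
  by (simp add: coind_action_def case_prod_beta)
 have one: "coind_action H T (\<one>\<^bsub>G\<^esub>, \<one>\<^bsub>H\<^esub>) x = x" if "x : space ?MH" for x
  using that pmpD(4)[OF pm] by (intro ext) (auto simp: act sp PiE_iff extensional_def)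
 have mult: "coind_action H T (g \<otimes>\<^bsub>G\<^esub> g', h \<otimes>\<^bsub>H\<^esub> h') x = coind_action H T (g, h) (coind_action H T (g', h') x)"
  if "g : carrier G" "g' : carrier G" "h : carrier H" "h' : carrier H" "x : space ?MH" for g g' h h' x
  using that pmpD(5)[OF pm] by (intro ext) (auto simp: act sp PiE_iff H.m_assoc)
 have pres: "coind_action H T p : measurable ?MH ?MH & distr ?MH ?MH (coind_action H T p) = ?MH"
  if p: "p : carrier (G \<times>\<times> H)" for p
 proof -
  have g: "fst p : carrier G" and h: "snd p : carrier H" using p by auto
  have 1: "(%k. k \<otimes>\<^bsub>H\<^esub> snd p) ` carrier H <= carrier H" using h by auto
  have 2: "inj_on (%k. k \<otimes>\<^bsub>H\<^esub> snd p) (carrier H)" using h by (auto intro: inj_onI)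
  show ?thesis unfolding act coind_measure_def
   using distr_PiM_twist[OF pr pmpD(2)[OF pm g] pmpD(3)[OF pm g] 1 2] by (intro conjI)
 qed
 have "standard_space ?MH" unfolding coind_measure_def by (rule standard_space_PiM[OF std cH H.carrier_not_empty])
 moreover have "prob_space ?MH" unfolding coind_measure_def by (rule prob_space_PiM) (rule pr)
 ultimately show ?thesis unfolding gsystem_def using pres one mult by (auto simp: mult_DirProd')
qed

lemma gsystem_prod:
 assumes M: "gsystem Gm M T" and N: "gsystem Gm N S"
 shows "gsystem Gm (M \<Otimes>\<^sub>M N) (prod_action T S)"
proof -
 note pm = gsystem_pmp[OF M] and pn = gsystem_pmp[OF N]
 interpret M: prob_space M by (rule pmpD(1)[OF pm])
 interpret N: prob_space N by (rule pmpD(1)[OF pn])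
 interpret P: pair_prob_space M N by unfold_locales
 have act: "prod_action T S g = (%(x, y). (T g x, S g y))" for g by (auto simp: prod_action_def)
 have pres: "prod_action T S g : measurable (M \<Otimes>\<^sub>M N) (M \<Otimes>\<^sub>M N) &
   distr (M \<Otimes>\<^sub>M N) (M \<Otimes>\<^sub>M N) (prod_action T S g) = M \<Otimes>\<^sub>M N" if g: "g : carrier Gm" for g
 proof
  note [measurable] = pmpD(2)[OF pm g] pmpD(2)[OF pn g]
  show "prod_action T S g : measurable (M \<Otimes>\<^sub>M N) (M \<Otimes>\<^sub>M N)" unfolding act by measurable
  have "sigma_finite_measure (distr N N (S g))" unfolding pmpD(3)[OF pn g] by unfold_locales
  from pair_measure_distr[OF pmpD(2)[OF pm g] pmpD(2)[OF pn g] this]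
  show "distr (M \<Otimes>\<^sub>M N) (M \<Otimes>\<^sub>M N) (prod_action T S g) = M \<Otimes>\<^sub>M N"
   unfolding act by (simp add: pmpD(3)[OF pm g] pmpD(3)[OF pn g])
 qed
 have "standard_space (M \<Otimes>\<^sub>M N)" using M N by (intro standard_space_pair) (auto simp: gsystem_def)
 thus ?thesis unfolding gsystem_def using pres pmpD(4,5)[OF pm] pmpD(4,5)[OF pn] P.prob_space_axioms
  by (auto simp: space_pair_measure act)
qed

lemma gsystem_power:
 assumes M: "gsystem Gm M T" and k: "1 <= k"
 shows "gsystem Gm (power_measure M k) (power_action T k)"
proof -
 note pm = gsystem_pmp[OF M]
 note pr = pmpD(1)[OF pm]
 have sp: "space (power_measure M k) = {..<k} ~> space M" by (simp add: power_measure_def space_PiM)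
 have act: "power_action T k g = (%x. \<lambda>i\<in>{..<k}. T g (x i))" for g by (simp add: power_action_def fun_eq_iff)
 have one: "(\<lambda>i\<in>{..<k}. T \<one>\<^bsub>Gm\<^esub> (x i)) = x" if "x : {..<k} ~> space M" for x
  using that pmpD(4)[OF pm] by (intro ext) (auto simp: PiE_iff extensional_def)
 have mult: "(\<lambda>i\<in>{..<k}. T (g \<otimes>\<^bsub>Gm\<^esub> h) (x i)) = (\<lambda>i\<in>{..<k}. T g ((\<lambda>i\<in>{..<k}. T h (x i)) i))"
  if "x : {..<k} ~> space M" "g : carrier Gm" "h : carrier Gm" for x g h
  using that pmpD(5)[OF pm] by (intro restrict_ext) (auto simp: PiE_iff)
 have "standard_space (power_measure M k)" unfolding power_measure_def using M k
  by (intro standard_space_PiM) (auto simp: gsystem_def lessThan_empty_iff)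
 moreover have "prob_space (power_measure M k)" unfolding power_measure_def by (rule prob_space_PiM) (rule pr)
 moreover have "power_action T k g : measurable (power_measure M k) (power_measure M k) &
   distr (power_measure M k) (power_measure M k) (power_action T k g) = power_measure M k" if g: "g : carrier Gm" for g
  unfolding power_measure_def act using distr_PiM_twist[OF pr pmpD(2)[OF pm g] pmpD(3)[OF pm g], of "%i. i" "{..<k}"] by simp
 ultimately show ?thesis unfolding gsystem_def act sp using one mult by blast
qed

lemma almost_action_prod:
 assumes G: "almost_action G V sg" and H: "almost_action H W ta"
 shows "almost_action (G \<times>\<times> H) (prod_sets V W) (prod_approx sg ta)"
proof -
 have fa: "finite_action G V sg" and fb: "finite_action H W ta" using G H by (auto simp: almost_action_def)
 have "finite_action (G \<times>\<times> H) (prod_sets V W) (prod_approx sg ta)" unfolding finite_action_def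
 proof (intro conjI allI ballI)
  fix n
  show "finite (prod_sets V W n)" "prod_sets V W n ~= {}"
   using finite_actionD(1,2)[OF fa] finite_actionD(1,2)[OF fb] by (auto simp: prod_sets_def)
  fix p assume "p : carrier (G \<times>\<times> H)"
  hence "bij_betw (sg n (fst p)) (V n) (V n)" "bij_betw (ta n (snd p)) (W n) (W n)"
   using finite_actionD(3)[OF fa] finite_actionD(3)[OF fb] by auto
  thus "bij_betw (prod_approx sg ta n p) (prod_sets V W n) (prod_sets V W n)"
   by (auto simp: prod_approx_def prod_sets_def case_prod_beta intro: bij_betw_map_prod)
 qed
 moreover have "(%n. real (card {v : prod_sets V W n. prod_approx sg ta n p (prod_approx sg ta n q v)
    = prod_approx sg ta n (p \<otimes>\<^bsub>G \<times>\<times> H\<^esub> q) v}) / real (card (prod_sets V W n))) \<longlonglongrightarrow> 1"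
  if p: "p : carrier (G \<times>\<times> H)" and q: "q : carrier (G \<times>\<times> H)" for p q
 proof -
  let ?A = "%n. {v : V n. sg n (fst p) (sg n (fst q) v) = sg n (fst p \<otimes>\<^bsub>G\<^esub> fst q) v}"
  let ?B = "%n. {w : W n. ta n (snd p) (ta n (snd q) w) = ta n (snd p \<otimes>\<^bsub>H\<^esub> snd q) w}"
  have "(%n. real (card (?A n)) / real (card (V n))) \<longlonglongrightarrow> 1" "(%n. real (card (?B n)) / real (card (W n))) \<longlonglongrightarrow> 1"
   using G H p q by (auto simp: almost_action_def)
  from tendsto_mult[OF this]
  have "(%n. real (card (?A n \<times> ?B n)) / real (card (V n \<times> W n))) \<longlonglongrightarrow> 1"
   by (simp add: card_cartesian_product)
  moreover have "{v : prod_sets V W n. prod_approx sg ta n p (prod_approx sg ta n q v)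
    = prod_approx sg ta n (p \<otimes>\<^bsub>G \<times>\<times> H\<^esub> q) v} = ?A n \<times> ?B n" for n
   by (auto simp: prod_sets_def prod_approx_def case_prod_beta mult_DirProd')
  ultimately show ?thesis by (simp add: prod_sets_def)
 qed
 ultimately show ?thesis by (simp add: almost_action_def)
qed

section \<open>Generating observables for products\<close>

text \<open>Approximability passes from a factor \<open>q\<close> to the system above it.\<close>

lemma approximable_factor:
 assumes tb: "tbm S d" and P: "path_map M D S d P" and q: "q : measurable N M" "distr N M q = M"
  and ap: "approximable M D S d P (indicator B)" and B: "B : sets M"
  and lift: "!!f. f : loc D S d ==> EX f':loc D' S' d'. ALL y:space N. f' (P' y) = f (P (q y))"
 shows "approximable N D' S' d' P' (indicator (q -` B Int space N))" unfolding approximable_def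
proof (intro allI impI)
 fix ep :: real assume "0 < ep"
 then obtain f where f: "f : loc D S d" "(\<integral>x. \<bar>indicator B x - f (P x)\<bar> \<partial>M) < ep"
  using ap unfolding approximable_def by blast
 obtain f' where f': "f' : loc D' S' d'" "ALL y:space N. f' (P' y) = f (P (q y))" using lift[OF f(1)] by blast
 have [measurable]: "(%x. f (P x)) : borel_measurable M" "B : sets M" by (rule path_map_loc_measurable[OF tb P f(1)], rule B)
 have "(\<integral>x. \<bar>indicator B x - f (P x)\<bar> \<partial>M) = (\<integral>x. \<bar>indicator B x - f (P x)\<bar> \<partial>distr N M q)"
  by (simp add: q(2))
 also have "... = (\<integral>y. \<bar>indicator B (q y) - f (P (q y))\<bar> \<partial>N)"
  by (rule integral_distr[OF q(1)]) measurable
 also have "... = (\<integral>y. \<bar>indicator (q -` B Int space N) y - f' (P' y)\<bar> \<partial>N)"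
  using f'(2) by (intro Bochner_Integration.integral_cong refl) (simp add: indicator_def)
 finally show "EX f:loc D' S' d'. (\<integral>x. \<bar>indicator (q -` B Int space N) x - f (P' x)\<bar> \<partial>N) < ep"
  using f(2) f'(1) by (intro bexI[of _ f']) simp_all
qed

lemma observable_factor:
 assumes "observable M S d af" "q : measurable N M"
 shows "observable N S d (%y. af (q y))" using assms measurable_space[OF assms(2)] unfolding observable_def
 by (auto intro: measurable_compose[OF assms(2)])

lemma generatingI:
 assumes "tbm S d" "pmp Gm M T" "observable M S d af" and G: "sets M <= sigma_sets (space M) \<G>" "\<G> <= sets M"
  and ap: "!!B. B : \<G> ==> approximable M (carrier Gm) S d (orb Gm T af) (indicator B)"
 shows "generating Gm M T S d af" unfolding generating_def
proof
 fix B assume "B : sets M"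
 hence B: "B : sigma_sets (space M) \<G>" using G(1) by blast
 show "approximable M (carrier Gm) S d (orb Gm T af) (indicator B)"
  by (rule conjunct2[OF approximable_sigma_sets[OF pmpD(1)[OF assms(2)] assms(1) orb_path_map[OF assms(2,3)] _ B]])
    (use G(2) ap in blast)
qed

lemma PiM_component_distr:
 assumes "prob_space M" "i : I"
 shows "distr (PiM I (%_. M)) M (%x. x i) = M"
proof -
 interpret prob_space M by fact
 interpret P: product_prob_space "%_. M" I by unfold_locales
 show ?thesis by (rule P.PiM_component[OF assms(2)])
qed

lemma distr_pair_snd:
 assumes "prob_space M" "prob_space N"
 shows "distr (M \<Otimes>\<^sub>M N) N snd = N"
proof (rule measure_eqI)
 interpret M: prob_space M by fact
 interpret N: prob_space N by fact
 fix A assume "A : sets (distr (M \<Otimes>\<^sub>M N) N snd)"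
 hence A: "A : sets N" by simp
 have "snd -` A Int space (M \<Otimes>\<^sub>M N) = space M \<times> A"
  using sets.sets_into_space[OF A] by (auto simp: space_pair_measure)
 thus "emeasure (distr (M \<Otimes>\<^sub>M N) N snd) A = emeasure N A"
  using A by (simp add: emeasure_distr N.emeasure_pair_measure_Times M.emeasure_space_1)
qed simp

lemma orb_coind:
 assumes "group G" "group H" "pmp G M T" "y : space (coind_measure H M)"
 shows "orb (G \<times>\<times> H) (coind_action H T) (%y. af (y \<one>\<^bsub>H\<^esub>)) y = coind_path G H T af y"
proof -
 interpret H: group H by fact
 show ?thesis unfolding orb_def coind_path_def carrier_DirProd by (intro restrict_ext) (auto simp: coind_action_def)
qed

text \<open>The events depending on one coordinate \<open>k\<close> generate. They are approximable because the column over
\<open>k\<close> in the orbit is the \<open>G\<close>-orbit of the coordinate \<open>k\<close>.\<close>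

lemma generating_coind:
 assumes grpG: "group G" and grpH: "group H" and cH: "countable (carrier H)" and sys: "gsystem G M T"
  and tb: "tbm S d" and obs: "observable M S d af" and gen: "generating G M T S d af"
 shows "observable (coind_measure H M) S d (%y. af (y \<one>\<^bsub>H\<^esub>))"
  and "generating (G \<times>\<times> H) (coind_measure H M) (coind_action H T) S d (%y. af (y \<one>\<^bsub>H\<^esub>))"
proof -
 interpret H: group H by (rule grpH)
 note pm = gsystem_pmp[OF sys]
 note pmH = gsystem_pmp[OF gsystem_coind[OF grpG grpH cH sys]]
 let ?MH = "coind_measure H M" and ?bt = "%y. af (y \<one>\<^bsub>H\<^esub>)"
 have comp: "(%y. y k) : measurable ?MH M" "distr ?MH M (%y. y k) = M" if "k : carrier H" for k
  unfolding coind_measure_def using that by (rule measurable_component_singleton, intro PiM_component_distr pmpD(1)[OF pm])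
 show obsH: "observable ?MH S d ?bt" by (rule observable_factor[OF obs comp(1)[OF H.one_closed]])
 let ?\<Omega> = "carrier H ~> space M"
 let ?G = "{{f : ?\<Omega>. f i : A} | i A. i : carrier H & A : sets M}"
 have sp: "space ?MH = ?\<Omega>" by (simp add: coind_measure_def space_PiM)
 show "generating (G \<times>\<times> H) ?MH (coind_action H T) S d ?bt"
 proof (rule generatingI[OF tb pmH obsH])
  show "sets ?MH <= sigma_sets (space ?MH) ?G" unfolding sp unfolding coind_measure_def sets_PiM_single by simp
  have vim: "{f : ?\<Omega>. f i : A} = (%y. y i) -` A Int space ?MH" for i A by (auto simp: sp)
  show "?G <= sets ?MH" unfolding vim by (auto intro: measurable_sets[OF comp(1)])
  fix B assume "B : ?G"
  then obtain k A where k: "k : carrier H" and A: "A : sets M" and B: "B = (%y. y k) -` A Int space ?MH"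
   unfolding vim by blast
  show "approximable ?MH (carrier (G \<times>\<times> H)) S d (orb (G \<times>\<times> H) (coind_action H T) ?bt) (indicator B)"
   unfolding B
  proof (rule approximable_factor[OF tb orb_path_map[OF pm obs] comp[OF k] _ A])
   show "approximable M (carrier G) S d (orb G T af) (indicator A)" using gen A by (simp add: generating_def)
   fix f assume f: "f : loc (carrier G) S d"
   then obtain E C where l: "lip_on (carrier G) S d E C f" by (auto simp: loc_def)
   define f' where "f' a = f (\<lambda>g\<in>carrier G. a (g, k))" for a
   have E: "finite E" "E <= carrier G" "0 <= C" using l by (auto simp: lip_on_def)
   have "lip_on (carrier G \<times> carrier H) S d ((%g. (g, k)) ` E) C f'" unfolding lip_on_def
   proof (intro conjI ballI)
    show "finite ((%g. (g, k)) ` E)" "(%g. (g, k)) ` E <= carrier G \<times> carrier H" "0 <= C" using E k by auto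
    fix a b assume a: "a : carrier G \<times> carrier H ~> S" and b: "b : carrier G \<times> carrier H ~> S"
    have in': "(\<lambda>g\<in>carrier G. a' (g, k)) : carrier G ~> S" if "a' : carrier G \<times> carrier H ~> S" for a'
     by (intro restrict_PiE_iff[THEN iffD2] ballI PiE_mem[OF that]) (simp add: k)
    have "\<bar>f' a - f' b\<bar> <= C * (SUM g:E. d ((\<lambda>g\<in>carrier G. a (g, k)) g) ((\<lambda>g\<in>carrier G. b (g, k)) g))"
     unfolding f'_def by (rule lip_onD[OF l in'[OF a] in'[OF b]])
    also have "(SUM g:E. d ((\<lambda>g\<in>carrier G. a (g, k)) g) ((\<lambda>g\<in>carrier G. b (g, k)) g)) = (SUM g:E. d (a (g, k)) (b (g, k)))"
     using E(2) by (intro sum.cong refl) (auto simp: subset_iff)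
    also have "... = (SUM i:(%g. (g, k)) ` E. d (a i) (b i))"
     by (rule sum.reindex_cong[symmetric, where l = "%g. (g, k)"]) (auto intro: inj_onI)
    finally show "\<bar>f' a - f' b\<bar> <= C * (SUM i:(%g. (g, k)) ` E. d (a i) (b i))" .
   qed
   hence "f' : loc (carrier (G \<times>\<times> H)) S d" unfolding carrier_DirProd by (rule locI)
   moreover have "f' (orb (G \<times>\<times> H) (coind_action H T) ?bt y) = f (orb G T af (y k))" if y: "y : space ?MH" for y
    unfolding f'_def orb_coind[OF grpG grpH pm y]
    using k by (intro arg_cong[where f = f]) (auto simp: coind_path_def orb_def)
   ultimately show "EX f':loc (carrier (G \<times>\<times> H)) S d. ALL y:space ?MH. f' (orb (G \<times>\<times> H) (coind_action H T) ?bt y) = f (orb G T af (y k))"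
    by blast
  qed
 qed
qed

lemma generating_prod:
 assumes M: "gsystem Gm M T" and N: "gsystem Gm N R" and tb: "tbm S d" "tbm S' e"
  and obs: "observable M S d af" "observable N S' e bt"
  and gen: "generating Gm M T S d af" "generating Gm N R S' e bt"
 defines "\<gamma> \<equiv> %p. (af (fst p), bt (snd p))"
 shows "observable (M \<Otimes>\<^sub>M N) (S \<times> S') (pair_dist d e) \<gamma>"
  and "generating Gm (M \<Otimes>\<^sub>M N) (prod_action T R) (S \<times> S') (pair_dist d e) \<gamma>"
proof -
 note pm = gsystem_pmp[OF M] and pn = gsystem_pmp[OF N]
 interpret M: prob_space M by (rule pmpD(1)[OF pm])
 interpret N: prob_space N by (rule pmpD(1)[OF pn])
 interpret P: pair_prob_space M N by unfold_locales
 let ?P = "M \<Otimes>\<^sub>M N"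
 note pp = gsystem_pmp[OF gsystem_prod[OF M N]]
 have f: "fst : measurable ?P M" "distr ?P M fst = M" and s: "snd : measurable ?P N" "distr ?P N snd = N"
  by (auto simp: N.distr_pair_fst distr_pair_snd[OF M.prob_space_axioms N.prob_space_axioms])
 show ob: "observable ?P (S \<times> S') (pair_dist d e) \<gamma>"
  unfolding \<gamma>_def by (intro observable_pair observable_factor[OF obs(1) f(1)] observable_factor[OF obs(2) s(1)])
 let ?G = "{fst -` A Int space ?P | A. A : sets M} Un {snd -` B Int space ?P | B. B : sets N}"
 have G: "?G <= sets ?P" using measurable_sets[OF f(1)] measurable_sets[OF s(1)] by blast
 have orbP: "orb Gm (prod_action T R) \<gamma> p = pair_path (carrier Gm) (orb Gm T af (fst p)) (orb Gm R bt (snd p))" for p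
  unfolding orb_def pair_path_def by (intro restrict_ext) (simp add: \<gamma>_def prod_action_def)
 show "generating Gm ?P (prod_action T R) (S \<times> S') (pair_dist d e) \<gamma>"
 proof (rule generatingI[OF tbm_pair[OF tb] pp ob _ G])
  have Gp: "?G <= Pow (space ?P)" by blast
  have mem: "U : sets (sigma (space ?P) ?G)" if "U : ?G" for U
   unfolding sets_measure_of[OF Gp] by (rule sigma_sets.Basic[OF that])
  have "sets ?P <= sets (sigma (space ?P) ?G)"
  proof (rule sets_pair_in_sets)
   fix a b assume a: "a : sets M" and b: "b : sets N"
   have "(fst -` a Int space ?P) Int (snd -` b Int space ?P) : sets (sigma (space ?P) ?G)"
    by (rule sets.Int; rule mem) (use a b in blast)+
   moreover have "(fst -` a Int space ?P) Int (snd -` b Int space ?P) = a \<times> b"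
    using sets.sets_into_space[OF a] sets.sets_into_space[OF b] by (auto simp: space_pair_measure)
   ultimately show "a \<times> b : sets (sigma (space ?P) ?G)" by simp
  qed
  thus "sets ?P <= sigma_sets (space ?P) ?G" unfolding sets_measure_of[OF Gp] .
  fix B assume "B : ?G"
  thus "approximable ?P (carrier Gm) (S \<times> S') (pair_dist d e) (orb Gm (prod_action T R) \<gamma>) (indicator B)"
  proof
   assume "B : {fst -` A Int space ?P | A. A : sets M}"
   then obtain A where A: "A : sets M" and B: "B = fst -` A Int space ?P" by blast
   show ?thesis unfolding B
   proof (rule approximable_factor[OF tb(1) orb_path_map[OF pm obs(1)] f _ A])
    show "approximable M (carrier Gm) S d (orb Gm T af) (indicator A)" using gen(1) A by (simp add: generating_def)
    fix h assume "h : loc (carrier Gm) S d"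
    hence "(%a. h (\<lambda>i\<in>carrier Gm. fst (a i))) : loc (carrier Gm) (S \<times> S') (pair_dist d e)"
     by (rule loc_compose) (auto simp: pair_dist_def tbm_nonneg[OF tb(2)])
    moreover have "(\<lambda>i\<in>carrier Gm. fst (orb Gm (prod_action T R) \<gamma> p i)) = orb Gm T af (fst p)" for p
     unfolding orbP by (auto simp: pair_path_def orb_def)
    ultimately show "EX f':loc (carrier Gm) (S \<times> S') (pair_dist d e). ALL y:space ?P. f' (orb Gm (prod_action T R) \<gamma> y) = h (orb Gm T af (fst y))"
     by (intro bexI[of _ "%a. h (\<lambda>i\<in>carrier Gm. fst (a i))"]) simp_all
   qed
  next
   assume "B : {snd -` A Int space ?P | A. A : sets N}"
   then obtain A where A: "A : sets N" and B: "B = snd -` A Int space ?P" by blast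
   show ?thesis unfolding B
   proof (rule approximable_factor[OF tb(2) orb_path_map[OF pn obs(2)] s _ A])
    show "approximable N (carrier Gm) S' e (orb Gm R bt) (indicator A)" using gen(2) A by (simp add: generating_def)
    fix h assume "h : loc (carrier Gm) S' e"
    hence "(%a. h (\<lambda>i\<in>carrier Gm. snd (a i))) : loc (carrier Gm) (S \<times> S') (pair_dist d e)"
     by (rule loc_compose) (auto simp: pair_dist_def tbm_nonneg[OF tb(1)])
    moreover have "(\<lambda>i\<in>carrier Gm. snd (orb Gm (prod_action T R) \<gamma> p i)) = orb Gm R bt (snd p)" for p
     unfolding orbP by (auto simp: pair_path_def orb_def)
    ultimately show "EX f':loc (carrier Gm) (S \<times> S') (pair_dist d e). ALL y:space ?P. f' (orb Gm (prod_action T R) \<gamma> y) = h (orb Gm R bt (snd y))"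
     by (intro bexI[of _ "%a. h (\<lambda>i\<in>carrier Gm. snd (a i))"]) simp_all
   qed
  qed
 qed
qed

lemma generating_power:
 assumes M: "gsystem Gm M T" and k: "1 <= k" and tb: "tbm S d" and obs: "observable M S d af"
  and gen: "generating Gm M T S d af"
 defines "\<gamma> \<equiv> %x. \<lambda>i\<in>{..<k}. af (x i)"
 shows "observable (power_measure M k) ({..<k} ~> S) (power_dist k d) \<gamma>"
  and "generating Gm (power_measure M k) (power_action T k) ({..<k} ~> S) (power_dist k d) \<gamma>"
proof -
 note pm = gsystem_pmp[OF M]
 let ?P = "power_measure M k"
 note pp = gsystem_pmp[OF gsystem_power[OF M k]]
 have comp: "(%y. y i) : measurable ?P M" "distr ?P M (%y. y i) = M" if "i : {..<k}" for i
  unfolding power_measure_def using that by (rule measurable_component_singleton, intro PiM_component_distr pmpD(1)[OF pm])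
 show ob: "observable ?P ({..<k} ~> S) (power_dist k d) \<gamma>" unfolding observable_def
 proof (intro conjI ballI)
  fix x assume x: "x : space ?P"
  show "\<gamma> x : {..<k} ~> S" unfolding \<gamma>_def
  proof (intro restrict_PiE_iff[THEN iffD2] ballI)
   fix i assume "i : {..<k}"
   thus "af (x i) : S" using measurable_space[OF comp(1) x] obs by (simp add: observable_def)
  qed
 next
  fix c assume c: "c : {..<k} ~> S"
  have "(%x. d (af (x i)) (c i)) : borel_measurable ?P" if i: "i : {..<k}" for i
   using observable_factor[OF obs comp(1)[OF i]] PiE_mem[OF c i] by (simp add: observable_def)
  hence "(%x. SUM i<k. d (af (x i)) (c i)) : borel_measurable ?P" by (rule borel_measurable_sum)
  thus "(%x. power_dist k d (\<gamma> x) c) : borel_measurable ?P" by (simp add: power_dist_def \<gamma>_def)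
 qed
 let ?\<Omega> = "{..<k} ~> space M"
 let ?G = "{{f : ?\<Omega>. f i : A} | i A. i : {..<k} & A : sets M}"
 have sp: "space ?P = ?\<Omega>" by (simp add: power_measure_def space_PiM)
 show "generating Gm ?P (power_action T k) ({..<k} ~> S) (power_dist k d) \<gamma>"
 proof (rule generatingI[OF tbm_power[OF tb] pp ob])
  show "sets ?P <= sigma_sets (space ?P) ?G" unfolding sp unfolding power_measure_def sets_PiM_single by simp
  have vim: "{f : ?\<Omega>. f i : A} = (%y. y i) -` A Int space ?P" for i A by (auto simp: sp)
  show "?G <= sets ?P" unfolding vim by (auto intro: measurable_sets[OF comp(1)])
  fix B assume "B : ?G"
  then obtain i A where i: "i : {..<k}" and A: "A : sets M" and B: "B = (%y. y i) -` A Int space ?P" unfolding vim by blast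
  show "approximable ?P (carrier Gm) ({..<k} ~> S) (power_dist k d) (orb Gm (power_action T k) \<gamma>) (indicator B)"
   unfolding B
  proof (rule approximable_factor[OF tb orb_path_map[OF pm obs] comp[OF i] _ A])
   show "approximable M (carrier Gm) S d (orb Gm T af) (indicator A)" using gen A by (simp add: generating_def)
   fix h assume h: "h : loc (carrier Gm) S d"
   have "(%a. h (\<lambda>g\<in>carrier Gm. a g i)) : loc (carrier Gm) ({..<k} ~> S) (power_dist k d)"
   proof (rule loc_compose[OF h])
    fix p q :: "nat => _" assume p: "p : {..<k} ~> S"
    show "p i : S" by (rule PiE_mem[OF p i])
    show "d (p i) (q i) <= power_dist k d p q"
     unfolding power_dist_def by (rule member_le_sum[OF i]) (simp_all add: tbm_nonneg[OF tb])
   qed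
   moreover have "(\<lambda>g\<in>carrier Gm. orb Gm (power_action T k) \<gamma> x g i) = orb Gm T af (x i)" for x
    unfolding orb_def using i by (intro restrict_ext) (simp add: \<gamma>_def power_action_def)
   ultimately show "EX f':loc (carrier Gm) ({..<k} ~> S) (power_dist k d). ALL y:space ?P. f' (orb Gm (power_action T k) \<gamma> y) = h (orb Gm T af (y i))"
    by (intro bexI[of _ "%a. h (\<lambda>g\<in>carrier Gm. a g i)"]) simp_all
  qed
 qed
qed

section \<open>The entropy formulas\<close>

lemma merging_pair: "merging Pair fst snd S d S' e (S \<times> S') (pair_dist d e)" by (auto simp: merging_def pair_dist_def)

lemma obs_int_coind:
 assumes "group G" "group H" "pmp G M T"
 shows "obs_int (G \<times>\<times> H) (coind_measure H M) (coind_action H T) (%y. af (y \<one>\<^bsub>H\<^esub>)) =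
  (%f. \<integral>y. f (coind_path G H T af y) \<partial>coind_measure H M)" unfolding obs_int_def
 by (intro ext Bochner_Integration.integral_cong refl) (simp add: orb_coind[OF assms])

text \<open>Fubini's theorem over the co-induced coordinate.\<close>

lemma coind_product_system:
 assumes grpG: "group G" and grpH: "group H" and cH: "countable (carrier H)" and sys: "gsystem G M T"
  and sysN: "gsystem (G \<times>\<times> H) N R" and tb: "tbm S d" "tbm S' e"
  and obs: "observable M S d af" "observable N S' e \<gamma>"
  and inf: "infinite (carrier H)" and fa: "finite_action G V sg" and so: "sofic_approximation H W ta"
 shows "coind_product G H M T af S d S' e (S \<times> S') (pair_dist d e) Pair fst snd V W sg ta
   (obs_int (G \<times>\<times> H) N R \<gamma>)
   (obs_int (G \<times>\<times> H) (coind_measure H M \<Otimes>\<^sub>M N) (prod_action (coind_action H T) R)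
    (%p. (af (fst p \<one>\<^bsub>H\<^esub>), \<gamma> (snd p))))"
proof -
 interpret H: group H by (rule grpH)
 note pm = gsystem_pmp[OF sys] and pn = gsystem_pmp[OF sysN]
 note sysH = gsystem_coind[OF grpG grpH cH sys]
 note pmH = gsystem_pmp[OF sysH] and pp = gsystem_pmp[OF gsystem_prod[OF sysH sysN]]
 let ?MH = "coind_measure H M" and ?Gm = "G \<times>\<times> H" and ?D = "carrier G \<times> carrier H"
 let ?A = "prod_action (coind_action H T) R" and ?dl = "%p. (af (fst p \<one>\<^bsub>H\<^esub>), \<gamma> (snd p))"
 let ?cp = "coind_path G H T af"
 interpret MH: prob_space ?MH by (rule pmpD(1)[OF pmH])
 interpret N: prob_space N by (rule pmpD(1)[OF pn])
 interpret P: pair_prob_space ?MH N by unfold_locales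
 have cm: "coind_merge G H M T af S d S' e (S \<times> S') (pair_dist d e) Pair fst snd"
  by (intro coind_merge.intro grpG grpH pm tb tbm_pair obs(1) merging_pair)
 have "observable ?MH S d (%y. af (y \<one>\<^bsub>H\<^esub>))"
  unfolding coind_measure_def by (rule observable_factor[OF obs(1)]) (rule measurable_component_singleton, simp)
 hence ob: "observable (?MH \<Otimes>\<^sub>M N) (S \<times> S') (pair_dist d e) ?dl"
  by (intro observable_pair observable_factor[OF obs(2) measurable_snd]
    observable_factor[OF _ measurable_fst, where af = "%y. af (y \<one>\<^bsub>H\<^esub>)"])
 have orb: "orb ?Gm ?A ?dl p = merge_path ?D Pair (?cp (fst p)) (orb ?Gm R \<gamma> (snd p))"
  if p: "p : space (?MH \<Otimes>\<^sub>M N)" for p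
 proof -
  have "orb ?Gm (coind_action H T) (%y. af (y \<one>\<^bsub>H\<^esub>)) (fst p) = ?cp (fst p)"
   using p by (intro orb_coind[OF grpG grpH pm]) (auto simp: space_pair_measure)
  moreover have "orb ?Gm ?A ?dl p = merge_path ?D Pair (orb ?Gm (coind_action H T) (%y. af (y \<one>\<^bsub>H\<^esub>)) (fst p)) (orb ?Gm R \<gamma> (snd p))"
   unfolding orb_def merge_path_def carrier_DirProd by (intro restrict_ext) (simp add: prod_action_def)
  ultimately show ?thesis by simp
 qed
 have cp_meas: "(%y. f (?cp y)) : borel_measurable ?MH" if "f : loc ?D S d" for f
  by (rule path_map_loc_measurable[OF tb(1) coind_merge.path_map_cp[OF cm] that])
 have orb_meas: "(%z. f (orb ?Gm R \<gamma> z)) : borel_measurable N" if "f : loc ?D S' e" for f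
  using path_map_loc_measurable[OF tb(2) orb_path_map[OF pn obs(2)]] that by simp
 show ?thesis
 proof (intro coind_product.intro cm coind_product_axioms.intro inf fa so)
  fix f assume f: "f : loc ?D (S \<times> S') (pair_dist d e)"
  have "integrable (?MH \<Otimes>\<^sub>M N) (%p. f (orb ?Gm ?A ?dl p))"
   using obs_int_loc_integrable[OF tbm_pair[OF tb] pp ob] f by simp
  hence "integrable (?MH \<Otimes>\<^sub>M N) (%p. f (merge_path ?D Pair (?cp (fst p)) (orb ?Gm R \<gamma> (snd p))))"
   by (rule Bochner_Integration.integrable_cong[THEN iffD1, OF refl, rotated]) (simp add: orb)
  hence int: "integrable (?MH \<Otimes>\<^sub>M N) (case_prod (%y z. f (merge_path ?D Pair (?cp y) (orb ?Gm R \<gamma> z))))"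
   by (simp add: case_prod_beta')
  have "obs_int ?Gm (?MH \<Otimes>\<^sub>M N) ?A ?dl f = integral\<^sup>L (?MH \<Otimes>\<^sub>M N) (case_prod (%y z. f (merge_path ?D Pair (?cp y) (orb ?Gm R \<gamma> z))))"
   unfolding obs_int_def by (intro Bochner_Integration.integral_cong refl) (simp add: orb case_prod_beta)
  also have "... = (\<integral>z. (\<integral>y. f (merge_path ?D Pair (?cp y) (orb ?Gm R \<gamma> z)) \<partial>?MH) \<partial>N)"
   by (rule P.integral_snd[OF int, symmetric])
  finally show "obs_int ?Gm (?MH \<Otimes>\<^sub>M N) ?A ?dl f = obs_int ?Gm N R \<gamma> (coind_merge.Th G H M T af Pair f)"
   by (simp add: obs_int_def coind_merge.Th_def[OF cm])
 next
  fix f assume f: "f : loc ?D S d"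
  have "obs_int ?Gm (?MH \<Otimes>\<^sub>M N) ?A ?dl (%c. f (\<lambda>i\<in>?D. fst (c i))) = (\<integral>p. f (?cp (fst p)) \<partial>(?MH \<Otimes>\<^sub>M N))"
   unfolding obs_int_def
  proof (intro Bochner_Integration.integral_cong refl arg_cong[where f = f])
   fix p assume p: "p : space (?MH \<Otimes>\<^sub>M N)"
   show "(\<lambda>i\<in>?D. fst (orb ?Gm ?A ?dl p i)) = ?cp (fst p)"
    unfolding orb[OF p] by (auto simp: merge_path_def coind_path_def fun_eq_iff)
  qed
  also have "... = (\<integral>y. f (?cp y) \<partial>distr (?MH \<Otimes>\<^sub>M N) ?MH fst)"
   by (rule integral_distr[symmetric, OF measurable_fst cp_meas[OF f]])
  finally show "obs_int ?Gm (?MH \<Otimes>\<^sub>M N) ?A ?dl (%c. f (\<lambda>i\<in>?D. fst (c i))) = (\<integral>y. f (?cp y) \<partial>?MH)"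
   by (simp add: N.distr_pair_fst)
 next
  fix f assume f: "f : loc ?D S' e"
  have "obs_int ?Gm (?MH \<Otimes>\<^sub>M N) ?A ?dl (%c. f (\<lambda>i\<in>?D. snd (c i))) = (\<integral>p. f (orb ?Gm R \<gamma> (snd p)) \<partial>(?MH \<Otimes>\<^sub>M N))"
   unfolding obs_int_def
  proof (intro Bochner_Integration.integral_cong refl arg_cong[where f = f])
   fix p assume p: "p : space (?MH \<Otimes>\<^sub>M N)"
   show "(\<lambda>i\<in>?D. snd (orb ?Gm ?A ?dl p i)) = orb ?Gm R \<gamma> (snd p)"
    unfolding orb[OF p] by (auto simp: merge_path_def orb_def fun_eq_iff)
  qed
  also have "... = (\<integral>z. f (orb ?Gm R \<gamma> z) \<partial>distr (?MH \<Otimes>\<^sub>M N) N snd)"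
   by (rule integral_distr[symmetric, OF measurable_snd orb_meas[OF f]])
  finally show "obs_int ?Gm (?MH \<Otimes>\<^sub>M N) ?A ?dl (%c. f (\<lambda>i\<in>?D. snd (c i))) = obs_int ?Gm N R \<gamma> f"
   by (simp add: distr_pair_snd[OF MH.prob_space_axioms N.prob_space_axioms] obs_int_def)
 qed
qed

theorem mainTheorem8:
  fixes G :: "('g, 'm) monoid_scheme" and H :: "('h, 'n) monoid_scheme"
    and V :: "nat \<Rightarrow> 'v set" and \<sigma> :: "nat \<Rightarrow> 'g \<Rightarrow> 'v \<Rightarrow> 'v"
    and W :: "nat \<Rightarrow> 'w set" and \<tau> :: "nat \<Rightarrow> 'h \<Rightarrow> 'w \<Rightarrow> 'w"
    and M :: "'x measure" and T :: "'g \<Rightarrow> 'x \<Rightarrow> 'x"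
  assumes "group G" and "countable (carrier G)"
    and "group H" and "countable (carrier H)"
    and "sofic_approximation G V \<sigma>"
    and "sofic_approximation H W \<tau>"
    and "gsystem G M T"
    and "infinite (carrier H)"
  shows
    "(\<forall>(N :: 'y measure) S.
        gsystem (G \<times>\<times> H) N S \<longrightarrow>
        sofic_entropy (G \<times>\<times> H) (prod_sets V W) (prod_approx \<sigma> \<tau>) N S =
          lower_sofic_entropy (G \<times>\<times> H) (prod_sets V W) (prod_approx \<sigma> \<tau>) N S \<longrightarrow>
        sofic_entropy (G \<times>\<times> H) (prod_sets V W) (prod_approx \<sigma> \<tau>)
            (coind_measure H M \<Otimes>\<^sub>M N) (prod_action (coind_action H T) S) =
          entropy_add
            (sofic_entropy (G \<times>\<times> H) (prod_sets V W) (prod_approx \<sigma> \<tau>)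
               (coind_measure H M) (coind_action H T))
            (sofic_entropy (G \<times>\<times> H) (prod_sets V W) (prod_approx \<sigma> \<tau>) N S)) \<and>
     ((\<exists>\<P>. finite_generating_partition G M T \<P>) \<longrightarrow>
        (\<forall>k\<ge>1.
          sofic_entropy (G \<times>\<times> H) (prod_sets V W) (prod_approx \<sigma> \<tau>)
              (power_measure (coind_measure H M) k) (power_action (coind_action H T) k) =
            ereal (real k) *
            sofic_entropy (G \<times>\<times> H) (prod_sets V W) (prod_approx \<sigma> \<tau>)
              (coind_measure H M) (coind_action H T)))"
proof -
 note grpG = assms(1) and cG = assms(2) and grpH = assms(3) and cH = assms(4) and soG = assms(5)
  and soH = assms(6) and sys = assms(7) and inf = assms(8)
 let ?\<Gamma> = "G \<times>\<times> H" and ?V = "prod_sets V W" and ?\<sigma> = "prod_approx \<sigma> \<tau>"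
 let ?MH = "coind_measure H M" and ?TH = "coind_action H T"
 note aaG = sofic_almost_action[OF soG] and aaH = sofic_almost_action[OF soH]
 have fa: "finite_action G V \<sigma>" using aaG by (simp add: almost_action_def)
 have grp: "group ?\<Gamma>" by (rule DirProd_group[OF grpG grpH])
 have cnt: "countable (carrier ?\<Gamma>)" using cG cH by simp
 note aa = almost_action_prod[OF aaG aaH]
 note pm = gsystem_pmp[OF sys]
 note sysH = gsystem_coind[OF grpG grpH cH sys]
 obtain A :: "'x set" and d and \<alpha> :: "'x \<Rightarrow> 'x"
  where \<alpha>: "tbm A d" "observable M A d \<alpha>" "generating G M T A d \<alpha>"
  by (rule generating_observable_exists[OF grpG cG sys])
 note \<beta> = generating_coind[OF grpG grpH cH sys \<alpha>]
 have hH: "sofic_entropy ?\<Gamma> ?V ?\<sigma> ?MH ?TH =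
   loc_entropy limsup ?\<Gamma> ?V ?\<sigma> A d (\<lambda>f. \<integral>y. f (coind_path G H T \<alpha> y) \<partial>?MH)"
  unfolding obs_int_coind[OF grpG grpH pm, symmetric]
  by (rule system_entropy_observable(1)[OF grp cnt sysH aa \<alpha>(1) \<beta>])
 show ?thesis
 proof (intro conjI allI impI)
  fix N :: "'y measure" and S
  assume sysN: "gsystem ?\<Gamma> N S" and reg: "sofic_entropy ?\<Gamma> ?V ?\<sigma> N S = lower_sofic_entropy ?\<Gamma> ?V ?\<sigma> N S"
  obtain B :: "'y set" and e and \<gamma> :: "'y \<Rightarrow> 'y"
   where \<gamma>: "tbm B e" "observable N B e \<gamma>" "generating ?\<Gamma> N S B e \<gamma>"
   by (rule generating_observable_exists[OF grp cnt sysN])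
  note hN = system_entropy_observable[OF grp cnt sysN aa \<gamma>]
  note \<delta> = generating_prod[OF sysH sysN \<alpha>(1) \<gamma>(1) \<beta>(1) \<gamma>(2) \<beta>(2) \<gamma>(3)]
  have "sofic_entropy ?\<Gamma> ?V ?\<sigma> (?MH \<Otimes>\<^sub>M N) (prod_action ?TH S) =
   loc_entropy limsup ?\<Gamma> ?V ?\<sigma> (A \<times> B) (pair_dist d e)
    (obs_int ?\<Gamma> (?MH \<Otimes>\<^sub>M N) (prod_action ?TH S) (\<lambda>p. (\<alpha> (fst p \<one>\<^bsub>H\<^esub>), \<gamma> (snd p))))"
   by (rule system_entropy_observable(1)[OF grp cnt gsystem_prod[OF sysH sysN] aa tbm_pair[OF \<alpha>(1) \<gamma>(1)] \<delta>])
  also have "\<dots> = entropy_add (loc_entropy limsup ?\<Gamma> ?V ?\<sigma> A d (\<lambda>f. \<integral>y. f (coind_path G H T \<alpha> y) \<partial>?MH))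
    (loc_entropy limsup ?\<Gamma> ?V ?\<sigma> B e (obs_int ?\<Gamma> N S \<gamma>))"
   by (rule coind_product.entropy_product[OF
      coind_product_system[OF grpG grpH cH sys sysN \<alpha>(1) \<gamma>(1) \<alpha>(2) \<gamma>(2) inf fa soH]])
     (use reg hN in simp)
  finally show "sofic_entropy ?\<Gamma> ?V ?\<sigma> (?MH \<Otimes>\<^sub>M N) (prod_action ?TH S) =
    entropy_add (sofic_entropy ?\<Gamma> ?V ?\<sigma> ?MH ?TH) (sofic_entropy ?\<Gamma> ?V ?\<sigma> N S)"
   by (simp only: hH hN(1))
 next
  fix k :: nat assume k: "1 \<le> k"
  note \<gamma> = generating_power[OF sysH k \<alpha>(1) \<beta>]
  let ?P = "power_measure ?MH k"
  have path: "orb ?\<Gamma> (power_action ?TH k) (\<lambda>x. \<lambda>i\<in>{..<k}. \<alpha> (x i \<one>\<^bsub>H\<^esub>)) x = power_path G H T \<alpha> k x"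
   if x: "x \<in> space ?P" for x
  proof -
   have "\<alpha> (power_action ?TH k p x i \<one>\<^bsub>H\<^esub>) = coind_path G H T \<alpha> (x i) p"
    if p: "p \<in> carrier ?\<Gamma>" and i: "i \<in> {..<k}" for p i
   proof -
    have "x i \<in> space ?MH" using x i by (auto simp: power_measure_def space_PiM)
    from fun_cong[OF orb_coind[OF grpG grpH pm this, of \<alpha>], of p]
    show ?thesis using p i by (simp add: orb_def power_action_def)
   qed
   thus ?thesis unfolding orb_def power_path_def carrier_DirProd[symmetric] by (intro restrict_ext)
  qed
  have "obs_int ?\<Gamma> ?P (power_action ?TH k) (\<lambda>x. \<lambda>i\<in>{..<k}. \<alpha> (x i \<one>\<^bsub>H\<^esub>)) = (\<lambda>f. \<integral>x. f (power_path G H T \<alpha> k x) \<partial>?P)"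
   unfolding obs_int_def by (intro ext Bochner_Integration.integral_cong refl) (simp add: path)
  hence "sofic_entropy ?\<Gamma> ?V ?\<sigma> ?P (power_action ?TH k) =
    loc_entropy limsup ?\<Gamma> ?V ?\<sigma> ({..<k} \<rightarrow>\<^sub>E A) (power_dist k d) (\<lambda>f. \<integral>x. f (power_path G H T \<alpha> k x) \<partial>?P)"
   using system_entropy_observable(1)[OF grp cnt gsystem_power[OF sysH k] aa tbm_power[OF \<alpha>(1)] \<gamma>] by simp
  also have "\<dots> = ereal (real k) * loc_entropy limsup ?\<Gamma> ?V ?\<sigma> A d (\<lambda>f. \<integral>y. f (coind_path G H T \<alpha> y) \<partial>?MH)"
   by (rule coind_power.entropy_power[OF coind_power.intro[OF grpG grpH pm \<alpha>(1,2) inf fa soH] k])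
  finally show "sofic_entropy ?\<Gamma> ?V ?\<sigma> ?P (power_action ?TH k) = ereal (real k) * sofic_entropy ?\<Gamma> ?V ?\<sigma> ?MH ?TH"
   by (simp only: hH)
 qed
qed

end
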